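(* Let $\mathcal{B}=\{B_t\}_{t\in G}$ be a Fell bundle over a discrete group $G$. (1) If $C^*_\lambda(\mathcal{B})$ is RFD, then $\mathcal{B}$ is RFD. (2) Assume $\mathcal{B}$ is separable. If $\mathcal{B}$ and $C^*_\lambda(G)$ are RFD, then so is $C^*_\lambda(\mathcal{B})$.
   Context: All groups are discrete with neutral element $e$; $C^*_\lambda(G)$ is the reduced group C*-algebra. $M_d$ is the algebra of complex $d\times d$ matrices. A Fell bundle over $G$ is a collection of Banach spaces $\mathcal{B}=\{B_t\}_{t\in G}$ whose disjoint union $B=\bigsqcup_t B_t$ (total space) has a multiplication and an involution such that for all $s,t\in G$, $a,b\in B$: $B_sB_t\subseteq B_{st}$; multiplication is bilinear $B_s\times B_t\to B_{st}$ and associative; $B_t^*\subseteq B_{t^{-1}}$; involution is conjugate-linear $B_t\to B_{t^{-1}}$; $(ab)^*=b^*a^*$; $a^{**}=a$; $\|ab\|\le\|a\|\|b\|$; $\|a^*\|=\|a\|$; $\|a^*a\|=\|a\|^2$; $a^*a\ge0$ in the C*-algebra $B_e$. It is separable if $G$ is countable and each $B_t$ is separable. $C_c(\mathcal{B})$ is the $*$-algebra of finitely supported sections ($x(t)\in B_t$) with $(xy)(s)=\sum_t x(t)y(t^{-1}s)$, $x^*(s)=x(s^{-1})^*$. $\ell_2(\mathcal{B})$ is the Hilbert $B_e$-module obtained by completing $C_c(\mathcal{B})$ with $(\xi\cdot b)(s)=\xi(s)b$, $\langle\xi,\eta\rangle=\sum_t\xi(t)^*\eta(t)$. For $b\in B_s$,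 $\lambda_s(b)$ is the adjointable operator $(\lambda_s(b)\xi)(t)=b\,\xi(s^{-1}t)$ on $\ell_2(\mathcal{B})$. $C^*_\lambda(\mathcal{B})$ is the completion of $C_c(\mathcal{B})$ in the norm $\|x\|_\lambda=\|\sum_t\lambda_t(x(t))\|$. A representation $\pi:\mathcal{B}\to C$ in a $*$-algebra $C$ is a family of linear maps $\pi_t:B_t\to C$ with $\pi_s(a)\pi_t(b)=\pi_{st}(ab)$ and $\pi_s(a)^*=\pi_{s^{-1}}(a^* )$ for $a\in B_s$, $b\in B_t$. A C*-algebra $A$ is RFD (residually finite-dimensional) if for every $\varepsilon>0$ and finite $\Omega\subseteq A$ there are $d\in\mathbb{N}$ and a $*$-homomorphism $\varphi:A\to M_d$ with $\|\varphi(a)\|\ge\|a\|-\varepsilon$ for all $a\in\Omega$. A Fell bundle $\mathcal{B}$ is RFD if for every $\varepsilon>0$ and finite $\Omega\subseteq B$ there are $d\in\mathbb{N}$ and a representation $\pi:\mathcal{B}\to M_d$ with $\|\pi_t(b)\|\ge\|b\|-\varepsilon$ for all $t\in G$ and $b\in\Omega\cap B_t$. *)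

theory Defs
  imports
    "HOL-Analysis.Infinite_Sum"
    "HOL-Algebra.FiniteProduct"
    "HOL-Library.Countable_Set"
    "Jordan_Normal_Form.Schur_Decomposition"
begin

text \<open>
  Groups are types of class \<open>group_add\<close>; this class is not assumed to be commutative, but its
  notation is additive: \<open>s + t\<close>, \<open>- t\<close> and \<open>0\<close> stand for $st$, $t^{-1}$ and $e$.
\<close>

section \<open>Normed spaces and star algebras on carrier sets\<close>

record 'a nspace =
  pts :: "'a set"
  vzero :: 'a
  vadd :: "'a \<Rightarrow> 'a \<Rightarrow> 'a"
  vscale :: "complex \<Rightarrow> 'a \<Rightarrow> 'a"
  vnorm :: "'a \<Rightarrow> real"

record 'a staralg = "'a nspace" +
  amult :: "'a \<Rightarrow> 'a \<Rightarrow> 'a"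
  astar :: "'a \<Rightarrow> 'a"

definition additive_monoid :: "('a, 'm) nspace_scheme \<Rightarrow> 'a monoid" where
  "additive_monoid V = \<lparr>carrier = pts V, monoid.mult = vadd V, one = vzero V\<rparr>"

definition vdiff :: "('a, 'm) nspace_scheme \<Rightarrow> 'a \<Rightarrow> 'a \<Rightarrow> 'a" where
  "vdiff V x y = vadd V x (vscale V (-1) y)"

definition vector_space_on :: "('a, 'm) nspace_scheme \<Rightarrow> bool" where
  "vector_space_on V \<longleftrightarrow>
     comm_group (additive_monoid V) \<and>
     (\<forall>c. \<forall>x\<in>pts V. vscale V c x \<in> pts V) \<and>
     (\<forall>c. \<forall>x\<in>pts V. \<forall>y\<in>pts V. vscale V c (vadd V x y) = vadd V (vscale V c x) (vscale V c y)) \<and>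
     (\<forall>c d. \<forall>x\<in>pts V. vscale V (c + d) x = vadd V (vscale V c x) (vscale V d x)) \<and>
     (\<forall>c d. \<forall>x\<in>pts V. vscale V (c * d) x = vscale V c (vscale V d x)) \<and>
     (\<forall>x\<in>pts V. vscale V 1 x = x)"

definition cauchy_seqs :: "('a, 'm) nspace_scheme \<Rightarrow> (nat \<Rightarrow> 'a) set" where
  "cauchy_seqs V = {X. (\<forall>n. X n \<in> pts V) \<and>
     (\<forall>e>0. \<exists>N. \<forall>m\<ge>N. \<forall>n\<ge>N. vnorm V (vdiff V (X m) (X n)) < e)}"

definition banach_on :: "('a, 'm) nspace_scheme \<Rightarrow> bool" where
  "banach_on V \<longleftrightarrow>
     vector_space_on V \<and>
     (\<forall>x\<in>pts V. 0 \<le> vnorm V x) \<and>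
     (\<forall>x\<in>pts V. vnorm V x = 0 \<longleftrightarrow> x = vzero V) \<and>
     (\<forall>c. \<forall>x\<in>pts V. vnorm V (vscale V c x) = cmod c * vnorm V x) \<and>
     (\<forall>x\<in>pts V. \<forall>y\<in>pts V. vnorm V (vadd V x y) \<le> vnorm V x + vnorm V y) \<and>
     (\<forall>X\<in>cauchy_seqs V. \<exists>x\<in>pts V. (\<lambda>n. vnorm V (vdiff V (X n) x)) \<longlonglongrightarrow> 0)"

definition separable_on :: "('a, 'm) nspace_scheme \<Rightarrow> bool" where
  "separable_on V \<longleftrightarrow>
     (\<exists>D\<subseteq>pts V. countable D \<and> (\<forall>x\<in>pts V. \<forall>e>0. \<exists>y\<in>D. vnorm V (vdiff V x y) < e))"

definition linear_on :: "('a, 'm) nspace_scheme \<Rightarrow> ('b, 'n) nspace_scheme \<Rightarrow> ('a \<Rightarrow> 'b) \<Rightarrow> bool" where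
  "linear_on V W f \<longleftrightarrow>
     (\<forall>x\<in>pts V. f x \<in> pts W) \<and>
     (\<forall>x\<in>pts V. \<forall>y\<in>pts V. f (vadd V x y) = vadd W (f x) (f y)) \<and>
     (\<forall>c. \<forall>x\<in>pts V. f (vscale V c x) = vscale W c (f x))"

definition conj_linear_on :: "('a, 'm) nspace_scheme \<Rightarrow> ('b, 'n) nspace_scheme \<Rightarrow> ('a \<Rightarrow> 'b) \<Rightarrow> bool" where
  "conj_linear_on V W f \<longleftrightarrow>
     (\<forall>x\<in>pts V. f x \<in> pts W) \<and>
     (\<forall>x\<in>pts V. \<forall>y\<in>pts V. f (vadd V x y) = vadd W (f x) (f y)) \<and>
     (\<forall>c. \<forall>x\<in>pts V. f (vscale V c x) = vscale W (cnj c) (f x))"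

text \<open>
  The sum in \<open>V\<close> of a family with only finitely many non-zero terms.
\<close>

definition fsum :: "('a, 'm) nspace_scheme \<Rightarrow> ('i \<Rightarrow> 'a) \<Rightarrow> 'a" where
  "fsum V f = finprod (additive_monoid V) f {i. f i \<noteq> vzero V}"

definition opnorm :: "('a, 'm) nspace_scheme \<Rightarrow> ('a \<Rightarrow> 'a) \<Rightarrow> real" where
  "opnorm V T = Sup {vnorm V (T x) | x. x \<in> pts V \<and> vnorm V x \<le> 1}"

definition star_hom :: "('a, 'm) staralg_scheme \<Rightarrow> ('b, 'n) staralg_scheme \<Rightarrow> ('a \<Rightarrow> 'b) \<Rightarrow> bool" where
  "star_hom A C \<phi> \<longleftrightarrow>
     linear_on A C \<phi> \<and>
     (\<forall>x\<in>pts A. \<forall>y\<in>pts A. \<phi> (amult A x y) = amult C (\<phi> x) (\<phi> y)) \<and>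
     (\<forall>x\<in>pts A. \<phi> (astar A x) = astar C (\<phi> x))"


section \<open>Completion of a (semi)normed space\<close>

text \<open>
  Elements of the completion are classes of Cauchy sequences modulo null sequences; the operations
  are computed on representatives.
\<close>

definition cauchy_rel :: "('a, 'm) nspace_scheme \<Rightarrow> ((nat \<Rightarrow> 'a) \<times> (nat \<Rightarrow> 'a)) set" where
  "cauchy_rel V = {(X, Y). X \<in> cauchy_seqs V \<and> Y \<in> cauchy_seqs V \<and>
     (\<lambda>n. vnorm V (vdiff V (X n) (Y n))) \<longlonglongrightarrow> 0}"

definition cauchy_class :: "('a, 'm) nspace_scheme \<Rightarrow> (nat \<Rightarrow> 'a) \<Rightarrow> (nat \<Rightarrow> 'a) set" where
  "cauchy_class V X = cauchy_rel V `` {X}"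

definition cauchy_rep :: "(nat \<Rightarrow> 'a) set \<Rightarrow> nat \<Rightarrow> 'a" where
  "cauchy_rep P = (SOME X. X \<in> P)"

definition completion :: "('a, 'm) nspace_scheme \<Rightarrow> (nat \<Rightarrow> 'a) set nspace" where
  "completion V = \<lparr>
     pts = cauchy_seqs V // cauchy_rel V,
     vzero = cauchy_class V (\<lambda>n. vzero V),
     vadd = (\<lambda>P Q. cauchy_class V (\<lambda>n. vadd V (cauchy_rep P n) (cauchy_rep Q n))),
     vscale = (\<lambda>c P. cauchy_class V (\<lambda>n. vscale V c (cauchy_rep P n))),
     vnorm = (\<lambda>P. lim (\<lambda>n. vnorm V (cauchy_rep P n)))\<rparr>"

definition alg_completion :: "('a, 'm) staralg_scheme \<Rightarrow> (nat \<Rightarrow> 'a) set staralg" where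
  "alg_completion A = \<lparr>
     pts = pts (completion A),
     vzero = vzero (completion A),
     vadd = vadd (completion A),
     vscale = vscale (completion A),
     vnorm = vnorm (completion A),
     amult = (\<lambda>P Q. cauchy_class A (\<lambda>n. amult A (cauchy_rep P n) (cauchy_rep Q n))),
     astar = (\<lambda>P. cauchy_class A (\<lambda>n. astar A (cauchy_rep P n)))\<rparr>"


section \<open>Matrix algebras and residual finite-dimensionality\<close>

definition hilbert_vec :: "nat \<Rightarrow> complex Matrix.vec nspace" where
  "hilbert_vec d = \<lparr>
     pts = carrier_vec d,
     vzero = 0\<^sub>v d,
     vadd = (\<lambda>v w. v + w),
     vscale = (\<lambda>c v. c \<cdot>\<^sub>v v),
     vnorm = (\<lambda>v. sqrt (Re (v \<bullet>c v)))\<rparr>"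

definition mat_alg :: "nat \<Rightarrow> complex Matrix.mat staralg" where
  "mat_alg d = \<lparr>
     pts = carrier_mat d d,
     vzero = 0\<^sub>m d d,
     vadd = (\<lambda>A B. A + B),
     vscale = (\<lambda>c A. c \<cdot>\<^sub>m A),
     vnorm = (\<lambda>A. opnorm (hilbert_vec d) (\<lambda>v. A *\<^sub>v v)),
     amult = (\<lambda>A B. A * B),
     astar = mat_adjoint\<rparr>"

definition rfd :: "('a, 'm) staralg_scheme \<Rightarrow> bool" where
  "rfd A \<longleftrightarrow>
     (\<forall>\<epsilon>>0. \<forall>\<Omega>. finite \<Omega> \<and> \<Omega> \<subseteq> pts A \<longrightarrow>
        (\<exists>d \<phi>. star_hom A (mat_alg d) \<phi> \<and>
           (\<forall>a\<in>\<Omega>. vnorm (mat_alg d) (\<phi> a) \<ge> vnorm A a - \<epsilon>)))"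


section \<open>The reduced group C*-algebra\<close>

definition ell2 :: "('g \<Rightarrow> complex) nspace" where
  "ell2 = \<lparr>
     pts = {\<xi>. (\<lambda>t. (cmod (\<xi> t))\<^sup>2) summable_on UNIV},
     vzero = (\<lambda>t. 0),
     vadd = (\<lambda>\<xi> \<eta> t. \<xi> t + \<eta> t),
     vscale = (\<lambda>c \<xi> t. c * \<xi> t),
     vnorm = (\<lambda>\<xi>. sqrt (\<Sum>\<^sub>\<infinity>t. (cmod (\<xi> t))\<^sup>2))\<rparr>"

definition group_regular :: "'g::group_add \<Rightarrow> ('g \<Rightarrow> complex) \<Rightarrow> 'g \<Rightarrow> complex" where
  "group_regular s \<xi> = (\<lambda>t. \<xi> (- s + t))"

definition group_alg :: "('g::group_add \<Rightarrow> complex) staralg" where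
  "group_alg = \<lparr>
     pts = {x. finite {t. x t \<noteq> 0}},
     vzero = (\<lambda>t. 0),
     vadd = (\<lambda>x y t. x t + y t),
     vscale = (\<lambda>c x t. c * x t),
     vnorm = (\<lambda>x. opnorm ell2 (\<lambda>\<xi> r. \<Sum>t | x t \<noteq> 0. x t * group_regular t \<xi> r)),
     amult = (\<lambda>x y s. \<Sum>t | x t \<noteq> 0. x t * y (- t + s)),
     astar = (\<lambda>x s. cnj (x (- s)))\<rparr>"

definition reduced_group_cstar :: "'g::group_add itself \<Rightarrow> (nat \<Rightarrow> 'g \<Rightarrow> complex) set staralg" where
  "reduced_group_cstar _ = alg_completion group_alg"


section \<open>Fell bundles\<close>

text \<open>
  The fibres are pairwise disjoint subsets of \<open>'b\<close>, so that the multiplication and the involution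
  can be operations on the total space, the union of the fibres.
\<close>

record ('g, 'b) bundle_data =
  fib :: "'g \<Rightarrow> 'b nspace"
  bmult :: "'b \<Rightarrow> 'b \<Rightarrow> 'b"
  bstar :: "'b \<Rightarrow> 'b"

definition total :: "('g, 'b) bundle_data \<Rightarrow> 'b set" where
  "total B = (\<Union>t. pts (fib B t))"

text \<open>
  Positivity in the C*-algebra \<open>B\<^sub>e\<close>: the positive elements of a C*-algebra are those of the form
  $c^*c$ with $c$ in the algebra.
\<close>

definition unit_fibre_positive :: "('g::group_add, 'b) bundle_data \<Rightarrow> 'b \<Rightarrow> bool" where
  "unit_fibre_positive B x \<longleftrightarrow> (\<exists>c\<in>pts (fib B 0). x = bmult B (bstar B c) c)"

definition fell_bundle :: "('g::group_add, 'b) bundle_data \<Rightarrow> bool" where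
  "fell_bundle B \<longleftrightarrow>
     (\<forall>t. banach_on (fib B t)) \<and>
     (\<forall>s t. s \<noteq> t \<longrightarrow> pts (fib B s) \<inter> pts (fib B t) = {}) \<and>
     (\<forall>s t. \<forall>b\<in>pts (fib B t). linear_on (fib B s) (fib B (s + t)) (\<lambda>a. bmult B a b)) \<and>
     (\<forall>s t. \<forall>a\<in>pts (fib B s). linear_on (fib B t) (fib B (s + t)) (\<lambda>b. bmult B a b)) \<and>
     (\<forall>a\<in>total B. \<forall>b\<in>total B. \<forall>c\<in>total B. bmult B (bmult B a b) c = bmult B a (bmult B b c)) \<and>
     (\<forall>t. conj_linear_on (fib B t) (fib B (- t)) (bstar B)) \<and>
     (\<forall>a\<in>total B. \<forall>b\<in>total B. bstar B (bmult B a b) = bmult B (bstar B b) (bstar B a)) \<and>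
     (\<forall>a\<in>total B. bstar B (bstar B a) = a) \<and>
     (\<forall>s t. \<forall>a\<in>pts (fib B s). \<forall>b\<in>pts (fib B t).
        vnorm (fib B (s + t)) (bmult B a b) \<le> vnorm (fib B s) a * vnorm (fib B t) b) \<and>
     (\<forall>t. \<forall>a\<in>pts (fib B t). vnorm (fib B (- t)) (bstar B a) = vnorm (fib B t) a) \<and>
     (\<forall>t. \<forall>a\<in>pts (fib B t). vnorm (fib B 0) (bmult B (bstar B a) a) = (vnorm (fib B t) a)\<^sup>2) \<and>
     (\<forall>a\<in>total B. unit_fibre_positive B (bmult B (bstar B a) a))"

definition separable_bundle :: "('g, 'b) bundle_data \<Rightarrow> bool" where
  "separable_bundle B \<longleftrightarrow> countable (UNIV :: 'g set) \<and> (\<forall>t. separable_on (fib B t))"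

definition representation ::
  "('g::group_add, 'b) bundle_data \<Rightarrow> ('c, 'm) staralg_scheme \<Rightarrow> ('g \<Rightarrow> 'b \<Rightarrow> 'c) \<Rightarrow> bool" where
  "representation B C \<pi> \<longleftrightarrow>
     (\<forall>t. linear_on (fib B t) C (\<pi> t)) \<and>
     (\<forall>s t. \<forall>a\<in>pts (fib B s). \<forall>b\<in>pts (fib B t).
        amult C (\<pi> s a) (\<pi> t b) = \<pi> (s + t) (bmult B a b)) \<and>
     (\<forall>s. \<forall>a\<in>pts (fib B s). astar C (\<pi> s a) = \<pi> (- s) (bstar B a))"

definition rfd_bundle :: "('g::group_add, 'b) bundle_data \<Rightarrow> bool" where
  "rfd_bundle B \<longleftrightarrow>
     (\<forall>\<epsilon>>0. \<forall>\<Omega>. finite \<Omega> \<and> \<Omega> \<subseteq> total B \<longrightarrow>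
        (\<exists>d \<pi>. representation B (mat_alg d) \<pi> \<and>
           (\<forall>t. \<forall>b\<in>\<Omega> \<inter> pts (fib B t).
              vnorm (mat_alg d) (\<pi> t b) \<ge> vnorm (fib B t) b - \<epsilon>)))"


section \<open>The reduced C*-algebra of a Fell bundle\<close>

definition finite_sections :: "('g, 'b) bundle_data \<Rightarrow> ('g \<Rightarrow> 'b) set" where
  "finite_sections B = {x. (\<forall>t. x t \<in> pts (fib B t)) \<and> finite {t. x t \<noteq> vzero (fib B t)}}"

definition section_inner :: "('g::group_add, 'b) bundle_data \<Rightarrow> ('g \<Rightarrow> 'b) \<Rightarrow> ('g \<Rightarrow> 'b) \<Rightarrow> 'b" where
  "section_inner B \<xi> \<eta> = fsum (fib B 0) (\<lambda>t. bmult B (bstar B (\<xi> t)) (\<eta> t))"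

definition section_module :: "('g::group_add, 'b) bundle_data \<Rightarrow> ('g \<Rightarrow> 'b) nspace" where
  "section_module B = \<lparr>
     pts = finite_sections B,
     vzero = (\<lambda>t. vzero (fib B t)),
     vadd = (\<lambda>\<xi> \<eta> t. vadd (fib B t) (\<xi> t) (\<eta> t)),
     vscale = (\<lambda>c \<xi> t. vscale (fib B t) c (\<xi> t)),
     vnorm = (\<lambda>\<xi>. sqrt (vnorm (fib B 0) (section_inner B \<xi> \<xi>)))\<rparr>"

text \<open>
  Only the Banach space underlying the Hilbert module is recorded: the operator norm on
  adjointable operators does not involve the right action of \<open>B\<^sub>e\<close>.
\<close>

definition bundle_ell2 :: "('g::group_add, 'b) bundle_data \<Rightarrow> (nat \<Rightarrow> 'g \<Rightarrow> 'b) set nspace" where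
  "bundle_ell2 B = completion (section_module B)"

text \<open>
  On a class of Cauchy sequences of finitely supported sections, \<open>left_regular B s b\<close> acts
  termwise, that is, it is the continuous extension of the operator on sections.
\<close>

definition left_regular ::
  "('g::group_add, 'b) bundle_data \<Rightarrow> 'g \<Rightarrow> 'b \<Rightarrow> (nat \<Rightarrow> 'g \<Rightarrow> 'b) set \<Rightarrow> (nat \<Rightarrow> 'g \<Rightarrow> 'b) set" where
  "left_regular B s b P =
     cauchy_class (section_module B) (\<lambda>n t. bmult B b (cauchy_rep P n (- s + t)))"

definition section_alg :: "('g::group_add, 'b) bundle_data \<Rightarrow> ('g \<Rightarrow> 'b) staralg" where
  "section_alg B = \<lparr>
     pts = finite_sections B,
     vzero = (\<lambda>t. vzero (fib B t)),
     vadd = (\<lambda>x y t. vadd (fib B t) (x t) (y t)),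
     vscale = (\<lambda>c x t. vscale (fib B t) c (x t)),
     vnorm = (\<lambda>x. opnorm (bundle_ell2 B)
                 (\<lambda>P. fsum (bundle_ell2 B) (\<lambda>t. left_regular B t (x t) P))),
     amult = (\<lambda>x y s. fsum (fib B s) (\<lambda>t. bmult B (x t) (y (- t + s)))),
     astar = (\<lambda>x s. bstar B (x (- s)))\<rparr>"

definition reduced_cstar :: "('g::group_add, 'b) bundle_data \<Rightarrow> (nat \<Rightarrow> 'g \<Rightarrow> 'b) set staralg" where
  "reduced_cstar B = alg_completion (section_alg B)"

end

theory Submission
  imports Defs "HOL-Library.Poly_Mapping" "HOL-Analysis.L2_Norm"
begin

text \<open>
  For (1), restrict a finite-dimensional representation of the reduced algebra to the sections
  supported at one point.

  For (2), a representation \<open>\<pi>\<close> of the bundle in \<open>M\<^sub>d\<close> and a representation \<open>\<rho>\<close> of the reduced group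
  algebra in \<open>M\<^sub>k\<close> yield the representation \<open>\<pi> \<otimes> \<rho>\<close> of the sections in \<open>M\<^sub>d\<^sub>k\<close>, and these
  suffice to recover the reduced norm: for self-adjoint \<open>h\<close> the norms of the unit fibre values of
  \<open>h\<close> raised to the powers \<open>2\<^sup>k\<close> grow at the rate given by the norm of \<open>h\<close>. Choose \<open>\<pi>\<close> almost
  isometric at the unit fibre value of one such power. Passing to a higher power makes the factor
  \<open>d\<^sup>2\<close>, which is lost in the comparison of a matrix with its entries, negligible; then choose \<open>\<rho>\<close>
  almost isometric on the matrix entries of \<open>\<pi>\<close> applied to that higher power. That \<open>\<pi> \<otimes> \<rho>\<close> is
  contractive also comes from such growth rates, so that no minimal tensor products are needed.
\<close>

section \<open>Positivity in a unital star algebra with a C*-seminorm\<close>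

text \<open>The Fell bundle axioms provide positive elements only in the form \<open>c^* c\<close>,
  whereas Cauchy-Schwarz for the module of sections has to add and compare them. Hence the
  Kelley-Vaught theorem, derived here from norms alone: a self-adjoint \<open>h\<close> is positive
  when \<open>N (t - h) \<le> t\<close> for some \<open>t\<close>, and square roots are approximated
  by an iteration for \<open>1 - sqrt (1 - x)\<close>, so that neither spectra nor limits enter.

  Growth rates work because the powers of a self-adjoint element obey
  \<open>a_k^2 \<le> c a_(k+1)\<close>: in an upper bound \<open>K L^(2^k)\<close> the factor
  \<open>K\<close> counts only through its \<open>2^k\<close>-th root. An estimate may lose any
  constant that does not depend on the power, such as a number of matrix entries.

  A finite-dimensional representation is not assumed continuous, so a first bound must come from
  algebra. In a complete algebra \<open>y = 1 - sqrt (1 - z^* z)\<close> exists even without a unit,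
  and the identity \<open>z^* z + y y = y + y\<close> forces the image of \<open>z\<close> to have
  norm at most 1. This bounds \<open>\<pi>\<close> on the unit fibre and \<open>\<rho>\<close> on
  the reduced group algebra.\<close>

primrec sqrt_majorant :: "nat \<Rightarrow> real" where
  "sqrt_majorant 0 = 0"
| "sqrt_majorant (Suc n) = (1 + (sqrt_majorant n)\<^sup>2) / 2"

text \<open>The sequence is the case \<open>x = 1\<close> of the iteration
  \<open>y' = (x + y^2) / 2\<close>, whose fixed point is \<open>1 - sqrt (1 - x)\<close>. It will
  majorise the norms of the iterates for every \<open>x\<close> of norm at most 1, and the norms of
  their differences.\<close>

lemma sqrt_majorant_bounds: "0 \<le> sqrt_majorant n \<and> sqrt_majorant n \<le> 1"
proof (induction n)
  case (Suc n)
  then have "(sqrt_majorant n)\<^sup>2 \<le> 1" by (simp add: power_le_one)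
  then show ?case by simp
qed simp

lemma sqrt_majorant_mono: "sqrt_majorant n \<le> sqrt_majorant (Suc n)"
proof -
  have "0 \<le> (sqrt_majorant n - 1)\<^sup>2" by simp
  then show ?thesis by (simp add: power2_diff)
qed

lemma sqrt_majorant_convergent: "convergent sqrt_majorant"
proof (rule Bseq_mono_convergent)
  show "Bseq sqrt_majorant" using sqrt_majorant_bounds by (intro BseqI'[of _ 1]) simp
qed (use sqrt_majorant_mono in \<open>blast intro: lift_Suc_mono_le\<close>)

text \<open>The step size is what matters later: the error of an approximate square root is a
  multiple of the difference of two consecutive iterates.\<close>

lemma sqrt_majorant_step_small:
  assumes "0 < e"
  obtains n where "sqrt_majorant (Suc n) - sqrt_majorant n < e"
proof -
  obtain L where L: "sqrt_majorant \<longlonglongrightarrow> L" using sqrt_majorant_convergent convergent_def by blast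
  have "(\<lambda>n. sqrt_majorant (Suc n) - sqrt_majorant n) \<longlonglongrightarrow> L - L"
    by (intro tendsto_diff LIMSEQ_Suc L)
  then have "eventually (\<lambda>n. sqrt_majorant (Suc n) - sqrt_majorant n < e) sequentially"
    using assms by (intro order_tendstoD(2)) auto
  then show ?thesis using that by (meson eventually_at_top_linorder order_refl)
qed

text \<open>A seminorm, because the free star algebra to which this applies has nonzero elements
  that act as zero. The type class supplies real scalars only; the central element \<open>J\<close>
  takes the place of the imaginary unit.\<close>

locale cstar_seminorm =
  fixes st :: "'r::real_algebra_1 \<Rightarrow> 'r" and N :: "'r \<Rightarrow> real" and J :: 'r
  assumes st_add: "st (x + y) = st x + st y"
    and st_scaleR: "st (r *\<^sub>R x) = r *\<^sub>R st x"
    and st_mult: "st (x * y) = st y * st x"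
    and st_st [simp]: "st (st x) = x"
    and J_comm: "J * x = x * J"
    and J_J: "J * J = - 1"
    and st_J: "st J = - J"
    and N_nonneg: "0 \<le> N x"
    and N_add: "N (x + y) \<le> N x + N y"
    and N_scaleR: "N (r *\<^sub>R x) = \<bar>r\<bar> * N x"
    and N_mult: "N (x * y) \<le> N x * N y"
    and N_one: "N 1 \<le> 1"
    and N_J: "N J \<le> 1"
    and N_cstar: "(N x)\<^sup>2 \<le> N (st x * x)"
begin

lemma st_minus [simp]: "st (- x) = - st x"
  using st_scaleR[of "-1" x] by simp

lemma st_diff: "st (x - y) = st x - st y"
  using st_add[of x "- y"] by simp

lemma st_zero [simp]: "st 0 = 0"
  using st_scaleR[of 0 0] by simp

lemma st_one [simp]: "st 1 = 1"
  by (metis mult.right_neutral st_mult st_st)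

lemma st_power: "st (x ^ n) = st x ^ n"
  by (induction n) (simp_all add: st_mult power_commutes)

lemma N_minus [simp]: "N (- x) = N x"
  using N_scaleR[of "-1" x] by simp

lemma N_zero [simp]: "N 0 = 0"
  using N_scaleR[of 0 0] by simp

lemma N_diff: "N (x - y) \<le> N x + N y"
  using N_add[of x "- y"] by simp

lemma N_real: "0 \<le> r \<Longrightarrow> N (r *\<^sub>R 1) \<le> r"
  using N_one by (simp add: N_scaleR mult_left_le)

lemma N_st_le: "N x \<le> N (st x)"
proof (cases "N x = 0")
  case False
  have "N x * N x \<le> N (st x) * N x"
    using N_cstar[of x] N_mult[of "st x" x] by (simp add: power2_eq_square)
  then show ?thesis using False N_nonneg[of x] by simp
qed (simp add: N_nonneg)

lemma N_st [simp]: "N (st x) = N x"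
  using N_st_le[of x] N_st_le[of "st x"] by simp

lemma N_cstar_eq: "N (st x * x) = (N x)\<^sup>2"
  using N_cstar[of x] N_mult[of "st x" x] by (simp add: power2_eq_square)

text \<open>For exponents \<open>2^k\<close> the C*-identity gives equality. An exponent in between
  inherits the inequality, since a strict loss at \<open>m\<close> would persist up to the next such
  power.\<close>

lemma N_power_sa:
  assumes "st u = u" "0 < m"
  shows "(N u) ^ m \<le> N (u ^ m)"
proof -
  have two: "N (u ^ (2 ^ k)) = N u ^ (2 ^ k)" for k
  proof (induction k)
    case (Suc k)
    have "N (u ^ (2 ^ Suc k)) = N (st (u ^ (2 ^ k)) * u ^ (2 ^ k))"
      using assms by (simp add: st_power mult_2 power_add)
    then show ?case
      by (simp add: N_cstar_eq Suc flip: power_mult) (simp add: mult.commute)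
  qed simp
  have le: "N (u ^ Suc m) \<le> N (u ^ m) * N u" for m
    using N_mult[of "u ^ m" u] by (simp add: power_commutes)
  have down: "N (u ^ (m + j)) \<le> N (u ^ m) * N u ^ j" for j
  proof (induction j)
    case (Suc j)
    show ?case
      using le[of "m + j"] mult_right_mono[OF Suc N_nonneg[of u]] by (simp add: mult_ac)
  qed simp
  show ?thesis
  proof (cases "N u = 0")
    case True
    then show ?thesis using assms(2) by (simp add: N_nonneg zero_power)
  next
    case False
    \<comment> \<open>Any power of two above \<open>m\<close> would do; \<open>down\<close> compares
      it with \<open>m\<close>.\<close>
    have "m \<le> 2 ^ m" by (simp add: less_imp_le)
    then obtain j where j: "2 ^ m = m + j" using le_Suc_ex by blast
    have "N u ^ m * N u ^ j \<le> N (u ^ m) * N u ^ j"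
      using down[of j] two[of m] by (simp add: j power_add)
    moreover have "0 < N u ^ j" using False N_nonneg[of u] by simp
    ultimately show ?thesis by simp
  qed
qed

text \<open>In a C*-algebra the inequality says that the spectrum of \<open>h\<close> lies in the
  interval from \<open>0\<close> to \<open>2 t\<close>. In this form positivity is visibly stable
  under sums and under nonnegative multiples.\<close>

definition pos :: "'r \<Rightarrow> bool" where
  "pos h \<longleftrightarrow> st h = h \<and> (\<exists>t. N (t *\<^sub>R 1 - h) \<le> t)"

lemma pos_add: "pos h \<Longrightarrow> pos k \<Longrightarrow> pos (h + k)"
proof -
  assume "pos h" "pos k"
  then obtain s t where st: "st h = h" "st k = k" "N (s *\<^sub>R 1 - h) \<le> s" "N (t *\<^sub>R 1 - k) \<le> t"
    unfolding pos_def by blast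
  have "(s + t) *\<^sub>R 1 - (h + k) = (s *\<^sub>R 1 - h) + (t *\<^sub>R 1 - k)" by (simp add: algebra_simps)
  then have "N ((s + t) *\<^sub>R 1 - (h + k)) \<le> s + t"
    using N_add[of "s *\<^sub>R 1 - h" "t *\<^sub>R 1 - k"] st(3,4) by (simp only:)
  then show ?thesis using st by (auto simp: pos_def st_add)
qed

lemma pos_scaleR:
  assumes "pos h" "0 \<le> r"
  shows "pos (r *\<^sub>R h)"
proof -
  obtain t where t: "st h = h" "N (t *\<^sub>R 1 - h) \<le> t" using assms unfolding pos_def by blast
  have "(r * t) *\<^sub>R 1 - r *\<^sub>R h = r *\<^sub>R (t *\<^sub>R 1 - h)" by (simp add: algebra_simps)
  then have "N ((r * t) *\<^sub>R 1 - r *\<^sub>R h) \<le> r * t"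
    using t assms by (simp add: N_scaleR mult_left_mono)
  then show ?thesis using t by (auto simp: pos_def st_scaleR)
qed

lemma pos_zero: "pos 0"
  by (auto simp: pos_def intro!: exI[of _ 0])

lemma pos_one: "pos 1"
  by (auto simp: pos_def intro!: exI[of _ 1])

lemma pos_sum: "(\<And>i. i \<in> I \<Longrightarrow> pos (f i)) \<Longrightarrow> pos (sum f I)"
  by (induction I rule: infinite_finite_induct) (auto intro: pos_add pos_zero)

lemma pos_norm_minus: "st h = h \<Longrightarrow> pos (N h *\<^sub>R 1 - h)"
  unfolding pos_def by (intro conjI exI[of _ "N h"]) (simp_all add: st_diff st_scaleR)

text \<open>Iteration towards the solution \<open>1 - sqrt (1 - x)\<close> of
  \<open>y = (x + y^2) / 2\<close>. Every iterate is a real polynomial in \<open>x\<close>, hence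
  commutes with whatever commutes with \<open>x\<close>.\<close>

primrec sqrt_iter :: "'r \<Rightarrow> nat \<Rightarrow> 'r" where
  "sqrt_iter x 0 = 0"
| "sqrt_iter x (Suc n) = (1/2) *\<^sub>R (x + sqrt_iter x n * sqrt_iter x n)"

lemma sqrt_iter_commute: "z * x = x * z \<Longrightarrow> z * sqrt_iter x n = sqrt_iter x n * z"
proof (induction n)
  case (Suc n)
  let ?s = "sqrt_iter x n"
  have c: "z * ?s = ?s * z" by (rule Suc.IH[OF Suc.prems])
  have "z * (?s * ?s) = z * ?s * ?s" by (rule mult.assoc[symmetric])
  also have "\<dots> = ?s * z * ?s" unfolding c ..
  also have "\<dots> = ?s * (z * ?s)" by (rule mult.assoc)
  also have "\<dots> = ?s * (?s * z)" unfolding c ..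
  also have "\<dots> = ?s * ?s * z" by (rule mult.assoc[symmetric])
  finally have "z * (x + ?s * ?s) = (x + ?s * ?s) * z"
    by (simp only: distrib_left distrib_right Suc.prems)
  then show ?case by (simp only: sqrt_iter.simps mult_scaleR_left mult_scaleR_right)
next
  case 0
  show ?case by (simp only: sqrt_iter.simps mult_zero_left mult_zero_right)
qed

lemma sqrt_iter_st: "st x = x \<Longrightarrow> st (sqrt_iter x n) = sqrt_iter x n"
  by (induction n) (simp_all add: st_scaleR st_add st_mult)

lemma sqrt_iter_N: "N x \<le> 1 \<Longrightarrow> N (sqrt_iter x n) \<le> sqrt_majorant n"
proof (induction n)
  case (Suc n)
  have "N (x + sqrt_iter x n * sqrt_iter x n) \<le> 1 + sqrt_majorant n * sqrt_majorant n"
    using N_add[of x "sqrt_iter x n * sqrt_iter x n"] N_mult[of "sqrt_iter x n" "sqrt_iter x n"]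
      mult_mono[OF Suc(1) Suc(1)] sqrt_majorant_bounds[of n] N_nonneg Suc by fastforce
  then show ?case by (simp add: N_scaleR power2_eq_square)
qed simp

text \<open>Consecutive differences are half a difference of squares,
  \<open>(y_(n+1) - y_n) (y_(n+1) + y_n) / 2\<close>, because the iterates commute. The scalar
  sequence obeys the same recursion with equality, so majorisation propagates.\<close>

lemma sqrt_iter_N_step:
  assumes "N x \<le> 1"
  shows "N (sqrt_iter x (Suc n) - sqrt_iter x n) \<le> sqrt_majorant (Suc n) - sqrt_majorant n"
proof (induction n)
  case 0
  then show ?case using assms by (simp add: N_scaleR)
next
  case (Suc n)
  let ?y = "sqrt_iter x" and ?t = sqrt_majorant
  have c: "?y n * ?y (Suc n) = ?y (Suc n) * ?y n"
    by (rule sqrt_iter_commute, rule sqrt_iter_commute[symmetric]) simp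
  have "?y (Suc (Suc n)) - ?y (Suc n) = (1/2) *\<^sub>R ((?y (Suc n) - ?y n) * (?y (Suc n) + ?y n))"
  proof -
    have "?y (Suc (Suc n)) - ?y (Suc n)
        = (1/2) *\<^sub>R (x + ?y (Suc n) * ?y (Suc n)) - (1/2) *\<^sub>R (x + ?y n * ?y n)"
      by (simp only: sqrt_iter.simps(2)[of x "Suc n"] sqrt_iter.simps(2)[of x n])
    also have "\<dots> = (1/2) *\<^sub>R ((?y (Suc n) - ?y n) * (?y (Suc n) + ?y n))"
      using c by (simp add: algebra_simps del: sqrt_iter.simps)
    finally show ?thesis .
  qed
  then have "N (?y (Suc (Suc n)) - ?y (Suc n)) = 1/2 * N ((?y (Suc n) - ?y n) * (?y (Suc n) + ?y n))"
    by (simp only: N_scaleR)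
  also have "\<dots> \<le> 1/2 * ((?t (Suc n) - ?t n) * (?t (Suc n) + ?t n))"
  proof -
    have "N (?y (Suc n) + ?y n) \<le> ?t (Suc n) + ?t n"
      using N_add[of "?y (Suc n)" "?y n"] sqrt_iter_N[OF assms, of n] sqrt_iter_N[OF assms, of "Suc n"]
      by linarith
    then have "N (?y (Suc n) - ?y n) * N (?y (Suc n) + ?y n) \<le> (?t (Suc n) - ?t n) * (?t (Suc n) + ?t n)"
      using Suc N_nonneg sqrt_majorant_mono[of n] by (intro mult_mono) auto
    then show ?thesis using N_mult[of "?y (Suc n) - ?y n" "?y (Suc n) + ?y n"] by linarith
  qed
  also have "\<dots> = ?t (Suc (Suc n)) - ?t (Suc n)"
  proof -
    have "?t (Suc (Suc n)) - ?t (Suc n) = (1 + (?t (Suc n))\<^sup>2) / 2 - (1 + (?t n)\<^sup>2) / 2"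
      by (simp only: sqrt_majorant.simps(2)[of "Suc n"] sqrt_majorant.simps(2)[of n])
    then show ?thesis by (simp add: field_simps power2_eq_square del: sqrt_majorant.simps)
  qed
  finally show ?case .
qed

text \<open>Write \<open>h = t (1 - x)\<close> with \<open>N x \<le> 1\<close> and take
  \<open>k = sqrt t (1 - y_n)\<close>. Then \<open>k k - h = 2 t (y_(n+1) - y_n)\<close>, so a small
  step means a small error. No limit is taken, as the algebra may be incomplete. The commutation
  clause holds because \<open>k\<close> is a polynomial in \<open>h\<close>.\<close>

lemma approx_sqrt:
  assumes h: "st h = h" and t: "N (t *\<^sub>R 1 - h) \<le> t" and e: "0 < e"
  obtains k where "pos k" "\<And>z. z * h = h * z \<Longrightarrow> z * k = k * z" "N (k * k - h) \<le> e"
proof (cases "t = 0")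
  case True
  \<comment> \<open>The scaling in the other case divides by \<open>t\<close>; here
    \<open>N h\<close> vanishes and the root is \<open>0\<close>.\<close>
  then have "N (0 * 0 - h) \<le> e" using t e by simp
  then show ?thesis using that[of 0] by (simp add: pos_zero)
next
  case False
  then have t0: "0 < t" using t N_nonneg[of "t *\<^sub>R 1 - h"] by linarith
  define x where "x = (1/t) *\<^sub>R (t *\<^sub>R 1 - h)"
  have Nx: "N x \<le> 1" using t t0 unfolding x_def by (simp only: N_scaleR) (simp add: field_simps)
  have sx: "st x = x" using h by (simp add: x_def st_scaleR st_diff)
  obtain n where n: "sqrt_majorant (Suc n) - sqrt_majorant n < e / (2 * t)"
    using sqrt_majorant_step_small[of "e / (2 * t)"] e t0 by auto
  let ?y = "sqrt_iter x"
  define k where "k = sqrt t *\<^sub>R (1 - ?y n)"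
  show ?thesis
  proof
    have "N (sqrt t *\<^sub>R 1 - k) = sqrt t * N (?y n)"
      using t0 by (simp add: k_def algebra_simps N_scaleR)
    also have "\<dots> \<le> sqrt t"
      using sqrt_iter_N[OF Nx, of n] sqrt_majorant_bounds[of n] t0 by (simp add: mult_left_le)
    finally show "pos k"
      using sx unfolding pos_def by (intro conjI exI[of _ "sqrt t"]) (simp_all add: k_def st_scaleR st_diff sqrt_iter_st)
    show "z * k = k * z" if "z * h = h * z" for z
    proof -
      have "z * x = x * z" using that by (simp add: x_def algebra_simps)
      from sqrt_iter_commute[OF this, of n] show ?thesis
        by (simp add: k_def left_diff_distrib right_diff_distrib)
    qed
    have hx: "h = t *\<^sub>R (1 - x)" using t0 by (simp add: x_def algebra_simps)
    have "k * k - h = (sqrt t * sqrt t) *\<^sub>R ((1 - ?y n) * (1 - ?y n)) - h"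
      by (simp add: k_def)
    also have "\<dots> = t *\<^sub>R ((1 - ?y n) * (1 - ?y n) - (1 - x))"
      using t0 unfolding hx scaleR_diff_right by simp
    also have "(1 - ?y n) * (1 - ?y n) - (1 - x) = (x + ?y n * ?y n) - 2 *\<^sub>R ?y n"
      by (simp add: left_diff_distrib right_diff_distrib scaleR_2)
    also have "\<dots> = 2 *\<^sub>R (?y (Suc n) - ?y n)"
      by (simp add: scaleR_diff_right)
    finally have "k * k - h = (2 * t) *\<^sub>R (?y (Suc n) - ?y n)"
      by (simp only: scaleR_scaleR mult.commute)
    then have "N (k * k - h) = 2 * t * N (?y (Suc n) - ?y n)"
      using t0 by (simp add: N_scaleR)
    also have "\<dots> \<le> 2 * t * (e / (2 * t))"
      using sqrt_iter_N_step[OF Nx, of n] n t0 by (intro mult_left_mono) auto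
    also have "2 * t * (e / (2 * t)) = e" using t0 by simp
    finally show "N (k * k - h) \<le> e" .
  qed
qed

lemma pos_approx_sqrt:
  assumes "pos h" "0 < e"
  obtains k where "pos k" "\<And>z. z * h = h * z \<Longrightarrow> z * k = k * z" "N (k * k - h) \<le> e"
proof -
  obtain t where "st h = h" "N (t *\<^sub>R 1 - h) \<le> t" using assms unfolding pos_def by blast
  from approx_sqrt[OF this assms(2)] that show ?thesis by blast
qed

section \<open>Order properties of positive elements\<close>

lemma pos_sa: "pos h \<Longrightarrow> st h = h"
  by (simp add: pos_def)

lemma J_left_commute: "x * (J * y) = J * (x * y)"
  by (simp only: J_comm[of x, symmetric] mult.assoc[symmetric])

lemma J_mult_J: "J * x * (J * y) = - (x * y)"
proof -
  have "J * x * (J * y) = J * (x * (J * y))" by (rule mult.assoc)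
  also have "\<dots> = J * J * (x * y)" unfolding J_left_commute[of x] by (rule mult.assoc[symmetric])
  finally show ?thesis by (simp add: J_J)
qed

text \<open>The element \<open>u = m + J k\<close> is normal with
  \<open>st u * u = m m + k k\<close>, and \<open>m\<close> is its real part, so
  \<open>N m \<le> N u\<close>.\<close>

lemma N_sum_squares_ge:
  assumes "st m = m" "st k = k" "m * k = k * m" "N (m * m + k * k) \<le> s"
  shows "(N m)\<^sup>2 \<le> s"
proof -
  define u where "u = m + J * k"
  have su: "st u = m - J * k" using assms by (simp add: u_def st_add st_mult st_J J_comm)
  have "(m - J * k) * (m + J * k) = m * m + m * (J * k) - J * k * m - J * k * (J * k)"
    by (simp add: algebra_simps)
  also have "J * k * m = m * (J * k)"
    unfolding J_left_commute[of m] assms(3) by (rule mult.assoc)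
  finally have "st u * u = m * m + k * k"
    unfolding su unfolding u_def by (simp add: J_mult_J)
  then have "(N u)\<^sup>2 \<le> s" using assms(4) N_cstar_eq[of u] by simp
  moreover have "u + st u = 2 *\<^sub>R m"
    unfolding su unfolding u_def scaleR_2 by simp
  then have "N (u + st u) = 2 * N m" by (simp add: N_scaleR)
  then have "N m \<le> N u" using N_add[of u "st u"] by simp
  ultimately show ?thesis using N_nonneg[of m] by (meson order_trans power_mono)
qed

text \<open>An approximate root \<open>m\<close> of \<open>1 - k k\<close> commutes with
  \<open>k\<close>, and \<open>m m + k k\<close> is close to \<open>1\<close>; the bound on a sum of
  commuting squares then controls \<open>N m\<close>, hence \<open>N (1 - k k)\<close>.\<close>

lemma N_one_minus_square:
  assumes "st k = k" "N k \<le> 1"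
  shows "N (1 - k * k) \<le> 1"
proof (rule field_le_epsilon)
  fix e :: real assume e: "0 < e"
  have "N (k * k) \<le> 1" using N_mult[of k k] assms(2) N_nonneg[of k] by (meson mult_le_one order_trans)
  then have kk: "N (1 *\<^sub>R 1 - (1 - k * k)) \<le> 1" by simp
  have skk: "st (1 - k * k) = 1 - k * k" using assms by (simp add: st_diff st_mult)
  have e2: "0 < e / 2" using e by simp
  obtain m where m: "pos m" "\<And>z. z * (1 - k * k) = (1 - k * k) * z \<Longrightarrow> z * m = m * z"
    "N (m * m - (1 - k * k)) \<le> e / 2"
    by (rule approx_sqrt[OF skk kk e2]) blast
  have "k * m = m * k" by (rule m(2)) (simp add: algebra_simps)
  moreover have "N (m * m + k * k) \<le> 1 + e / 2"
  proof -
    have "m * m + k * k = (m * m - (1 - k * k)) + 1" by simp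
    then show ?thesis using N_add[of "m * m - (1 - k * k)" 1] m(3) N_one by (metis add_mono add.commute order_trans)
  qed
  ultimately have "(N m)\<^sup>2 \<le> 1 + e / 2"
    using N_sum_squares_ge[of m k] m(1) assms(1) by (simp add: pos_def)
  moreover have "1 - k * k = m * m - (m * m - (1 - k * k))" by simp
  then have "N (1 - k * k) \<le> N (m * m) + N (m * m - (1 - k * k))" by (metis N_diff)
  ultimately show "N (1 - k * k) \<le> 1 + e" using m(3) N_mult[of m m] by (simp add: power2_eq_square)
qed

lemma N_square_upper:
  assumes "st k = k" "(N k)\<^sup>2 \<le> t"
  shows "N (t *\<^sub>R 1 - k * k) \<le> t"
proof (cases "t = 0")
  case True
  then have "N (k * k) \<le> 0" using N_mult[of k k] assms(2) by (simp add: power2_eq_square)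
  then show ?thesis using True by simp
next
  case False
  then have t: "0 < t" using assms(2) by (smt (verit) zero_le_power2)
  let ?k = "(1 / sqrt t) *\<^sub>R k"
  have "N ?k = N k / sqrt t" using t by (simp add: N_scaleR)
  also have "\<dots> \<le> 1" using assms t by (simp add: real_le_rsqrt)
  finally have "N (1 - ?k * ?k) \<le> 1" using assms by (intro N_one_minus_square) (simp_all add: st_scaleR)
  moreover have "t *\<^sub>R 1 - k * k = t *\<^sub>R (1 - ?k * ?k)" using t by (simp add: algebra_simps)
  ultimately show ?thesis using t by (simp add: N_scaleR mult_left_le)
qed

lemma pos_square: "st k = k \<Longrightarrow> pos (k * k)"
  using N_square_upper[of k "(N k)\<^sup>2"] by (auto simp: pos_def st_mult)

text \<open>Besides closedness this shows that the \<open>t\<close> in \<open>pos\<close> may be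
  taken to be \<open>N h\<close>: near \<open>h\<close> there is a square \<open>q q\<close>, and a
  square satisfies the inequality for every \<open>t \<ge> (N q)^2\<close>.\<close>

lemma pos_closed:
  assumes "st h = h" "\<And>e. 0 < e \<Longrightarrow> \<exists>k. pos k \<and> N (k - h) \<le> e"
  shows "N (N h *\<^sub>R 1 - h) \<le> N h"
proof (rule field_le_epsilon)
  fix e :: real assume e: "0 < e"
  \<comment> \<open>Two errors \<open>e / 8\<close> put \<open>q q\<close> within
    \<open>e / 4\<close> of \<open>h\<close>; below, three errors \<open>e / 4\<close>
    accumulate.\<close>
  obtain k where k: "pos k" "N (k - h) \<le> e / 8" using assms(2)[of "e/8"] e by auto
  have e8: "0 < e / 8" using e by simp
  obtain q where q: "pos q" "N (q * q - k) \<le> e / 8" by (rule pos_approx_sqrt[OF k(1) e8]) blast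
  have *: "N (q * q - h) \<le> e / 4"
    using N_add[of "q * q - k" "k - h"] k q by simp
  have "(N q)\<^sup>2 = N (q * q)" using N_cstar_eq[of q] q by (simp add: pos_sa)
  also have "\<dots> \<le> N h + e / 4" using N_add[of "q * q - h" h] * by simp
  finally have "N ((N h + e / 4) *\<^sub>R 1 - q * q) \<le> N h + e / 4"
    by (intro N_square_upper pos_sa q)
  moreover have "N h *\<^sub>R 1 - h = ((N h + e / 4) *\<^sub>R 1 - q * q) + ((q * q - h) - (e / 4) *\<^sub>R 1)"
    by (simp add: algebra_simps)
  then have "N (N h *\<^sub>R 1 - h) \<le> N ((N h + e / 4) *\<^sub>R 1 - q * q) + N ((q * q - h) - (e / 4) *\<^sub>R 1)"
    by (metis N_add)
  moreover have "N ((q * q - h) - (e / 4) *\<^sub>R 1) \<le> e / 4 + e / 4"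
    using N_diff[of "q * q - h" "(e / 4) *\<^sub>R 1"] * N_real[of "e/4"] e by linarith
  ultimately show "N (N h *\<^sub>R 1 - h) \<le> N h + e" using e by linarith
qed

lemma pos_limit:
  assumes "st h = h" "\<And>e. 0 < e \<Longrightarrow> \<exists>k. pos k \<and> N (k - h) \<le> e"
  shows "pos h"
  using pos_closed[OF assms] assms(1) unfolding pos_def by blast

text \<open>Approximate roots of \<open>h\<close> and of \<open>s - h\<close> commute, and the sum
  of their squares is close to \<open>s\<close>, so each of the two squares has norm at most about
  \<open>s\<close>.\<close>

lemma pos_le_N:
  assumes "pos h" "pos (s *\<^sub>R 1 - h)" and s: "0 \<le> s"
  shows "N h \<le> s"
proof (rule field_le_epsilon)
  fix e :: real assume e: "0 < e"
  have e4: "0 < e / 4" using e by simp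
  obtain m where m: "pos m" "\<And>z. z * h = h * z \<Longrightarrow> z * m = m * z" "N (m * m - h) \<le> e / 4"
    by (rule pos_approx_sqrt[OF assms(1) e4]) blast
  obtain k where k: "pos k" "\<And>z. z * (s *\<^sub>R 1 - h) = (s *\<^sub>R 1 - h) * z \<Longrightarrow> z * k = k * z"
    "N (k * k - (s *\<^sub>R 1 - h)) \<le> e / 4"
    by (rule pos_approx_sqrt[OF assms(2) e4]) blast
  have mh: "m * h = h * m" by (rule m(2)[OF refl, symmetric])
  have mk: "m * k = k * m" by (rule k(2)) (simp add: mh algebra_simps)
  have "m * m + k * k = s *\<^sub>R 1 + (m * m - h) + (k * k - (s *\<^sub>R 1 - h))" by simp
  then have "N (m * m + k * k) \<le> s + e / 4 + e / 4"
    using N_add[of "s *\<^sub>R 1 + (m * m - h)" "k * k - (s *\<^sub>R 1 - h)"] N_add[of "s *\<^sub>R 1" "m * m - h"]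
      m(3) k(3) N_real[OF s] by simp
  then have "(N m)\<^sup>2 \<le> s + e / 4 + e / 4"
    by (rule N_sum_squares_ge[OF pos_sa[OF m(1)] pos_sa[OF k(1)] mk])
  moreover have "N h \<le> N (m * m) + N (m * m - h)" using N_diff[of "m * m" "m * m - h"] by simp
  ultimately show "N h \<le> s + e" using m(3) N_mult[of m m] e by (simp add: power2_eq_square)
qed

lemma pos_mono:
  assumes "pos h" "pos (k - h)"
  shows "N h \<le> N k"
proof -
  have "st k = k" using assms st_add[of h "k - h"] by (simp add: pos_sa)
  then have "pos ((N k *\<^sub>R 1 - k) + (k - h))" by (intro pos_add assms pos_norm_minus)
  then show ?thesis using assms(1) by (intro pos_le_N) (simp_all add: N_nonneg)
qed

text \<open>Approximate roots \<open>m\<close> of \<open>h\<close> and \<open>q\<close> of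
  \<open>k\<close> commute with each other, which makes \<open>h k\<close> a limit of the squares
  \<open>(m q)^2\<close>.\<close>

lemma pos_commuting_mult:
  assumes "pos h" "pos k" "h * k = k * h"
  shows "pos (h * k)"
proof (rule pos_limit)
  show "st (h * k) = h * k" using assms by (simp add: st_mult pos_sa)
  fix e :: real assume e: "0 < e"
  \<comment> \<open>The error of the product will be at most \<open>d (N k + 1) + N h d\<close>. The
    minimum with \<open>1\<close> serves to bound \<open>N (q q)\<close> by
    \<open>N k + 1\<close>.\<close>
  define d where "d = min 1 (e / (N h + N k + 2))"
  have pp: "0 < N h + N k + 2" using N_nonneg[of h] N_nonneg[of k] by linarith
  have d: "0 < d" "d \<le> 1" using e pp by (auto simp: d_def)
  have "d \<le> e / (N h + N k + 2)" by (simp add: d_def)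
  then have de: "d * (N h + N k + 2) \<le> e" using pp by (simp add: pos_le_divide_eq)
  obtain m where m: "pos m" "\<And>z. z * h = h * z \<Longrightarrow> z * m = m * z" "N (m * m - h) \<le> d"
    by (rule pos_approx_sqrt[OF assms(1) d(1)]) blast
  obtain q where q: "pos q" "\<And>z. z * k = k * z \<Longrightarrow> z * q = q * z" "N (q * q - k) \<le> d"
    by (rule pos_approx_sqrt[OF assms(2) d(1)]) blast
  have mk: "m * k = k * m" by (rule m(2)[OF assms(3)[symmetric], symmetric])
  have mq: "m * q = q * m" by (rule q(2)[OF mk])
  have "(m * q) * (m * q) = m * (q * m) * q" by (simp only: mult.assoc)
  then have eq: "(m * q) * (m * q) = (m * m) * (q * q)" by (simp only: mq[symmetric] mult.assoc)
  have "st (m * q) = m * q" using pos_sa[OF m(1)] pos_sa[OF q(1)] mq by (simp add: st_mult)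
  then have p: "pos ((m * m) * (q * q))" using pos_square[of "m * q"] eq by simp
  have "(m * m) * (q * q) - h * k = (m * m - h) * (q * q) + h * (q * q - k)" by (simp add: algebra_simps)
  then have "N ((m * m) * (q * q) - h * k) \<le> N ((m * m - h) * (q * q)) + N (h * (q * q - k))"
    by (metis N_add)
  also have "\<dots> \<le> N (m * m - h) * N (q * q) + N h * N (q * q - k)" by (intro add_mono N_mult)
  also have "\<dots> \<le> d * (N k + 1) + N h * d"
    using m(3) q(3) d N_nonneg N_add[of "q * q - k" k] by (intro add_mono mult_mono) auto
  also have "\<dots> \<le> e" using d de by (simp add: algebra_simps)
  finally show "\<exists>p. pos p \<and> N (p - h * k) \<le> e" using p by blast
qed

section \<open>Polynomial estimates for the Kelley-Vaught theorem\<close>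

lemma pos_power: "pos h \<Longrightarrow> pos (h ^ n)"
  by (induction n) (auto simp: pos_one power_commutes intro: pos_commuting_mult)

text \<open>The scalar inequality \<open>n x (1 - x)^n \<le> 1\<close>. In the application
  \<open>x\<close> is \<open>c * st c\<close>, whose sign is precisely the question; the proof gets
  round it since each \<open>x (1 - x)^j - x (1 - x)^n\<close> carries a factor \<open>x x\<close>,
  multiplied by powers of the positive element \<open>1 - x\<close>.\<close>

lemma pos_peak_bound:
  assumes "st x = x" "N x \<le> 1" "0 < n"
  shows "pos (1 - real n *\<^sub>R (x * (1 - x) ^ n))"
proof -
  have u: "pos (1 - x)" using assms by (auto simp: pos_def st_diff intro!: exI[of _ 1])
  have geo: "x * (\<Sum>i<k. (1 - x) ^ i) = 1 - (1 - x) ^ k" for k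
    by (induction k) (simp_all add: algebra_simps)
  have xu: "x * (1 - x) ^ m = (1 - x) ^ m * x" for m
    by (rule power_commuting_commutes[symmetric]) (simp add: algebra_simps)
  have smaller: "pos (x * (1 - x) ^ j - x * (1 - x) ^ n)" if "j < n" for j
  proof -
    have "(1 - x) ^ j * (1 - (1 - x) ^ (n - j)) = (1 - x) ^ j - (1 - x) ^ n"
      using that by (simp add: algebra_simps flip: power_add)
    then have "x * (1 - x) ^ j - x * (1 - x) ^ n = x * ((1 - x) ^ j * (x * (\<Sum>i<n - j. (1 - x) ^ i)))"
      by (simp add: geo right_diff_distrib)
    also have "\<dots> = (\<Sum>i<n - j. (x * x) * (1 - x) ^ (j + i))"
      unfolding sum_distrib_left
    proof (rule sum.cong[OF refl])
      fix i
      have "x * ((1 - x) ^ j * (x * (1 - x) ^ i)) = x * ((1 - x) ^ j * x) * (1 - x) ^ i"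
        by (simp only: mult.assoc)
      then show "x * ((1 - x) ^ j * (x * (1 - x) ^ i)) = x * x * (1 - x) ^ (j + i)"
        by (simp only: xu[symmetric] power_add mult.assoc)
    qed
    also have "pos \<dots>"
    proof (rule pos_sum, rule pos_commuting_mult)
      fix i show "x * x * (1 - x) ^ (j + i) = (1 - x) ^ (j + i) * (x * x)"
        by (simp only: mult.assoc xu) (simp only: mult.assoc[symmetric] xu)
    qed (intro pos_power u pos_square assms(1))+
    finally show ?thesis .
  qed
  have "(\<Sum>j<n. x * (1 - x) ^ j - x * (1 - x) ^ n) = 1 - (1 - x) ^ n - real n *\<^sub>R (x * (1 - x) ^ n)"
    by (simp add: sum_subtractf geo scaleR_conv_of_real flip: sum_distrib_left)
  then have "1 - real n *\<^sub>R (x * (1 - x) ^ n) = (1 - x) ^ n + (\<Sum>j<n. x * (1 - x) ^ j - x * (1 - x) ^ n)"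
    by simp
  also have "pos \<dots>" using smaller by (intro pos_add pos_power u pos_sum) auto
  finally show ?thesis .
qed

text \<open>With \<open>a\<close> the real part of \<open>y\<close> and \<open>b\<close> the
  imaginary part up to sign, the sum equals \<open>2 (a a + b b)\<close>.\<close>

lemma pos_sum_star: "pos (st y * y + y * st y)"
proof -
  define a b where "a = (1/2) *\<^sub>R (y + st y)" and "b = (1/2) *\<^sub>R (J * (y - st y))"
  have sa: "st a = a" by (simp add: a_def st_scaleR st_add)
  have sb: "st b = b" by (simp add: b_def st_scaleR st_mult st_diff st_J J_comm algebra_simps)
  have bb: "b * b = - ((1/4) *\<^sub>R ((y - st y) * (y - st y)))"
    unfolding b_def by (simp add: J_mult_J)
  have "st y * y + y * st y = 2 *\<^sub>R (a * a + b * b)"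
  proof -
    have "2 *\<^sub>R (a * a + b * b) = (1/2) *\<^sub>R ((y + st y) * (y + st y) - (y - st y) * (y - st y))"
      unfolding bb a_def mult_scaleR_left mult_scaleR_right
      by (simp add: scaleR_diff_right)
    also have "(y + st y) * (y + st y) - (y - st y) * (y - st y) = 2 *\<^sub>R (st y * y + y * st y)"
      unfolding scaleR_2 by (simp add: algebra_simps)
    finally show ?thesis by simp
  qed
  then show ?thesis using pos_scaleR[OF pos_add[OF pos_square[OF sa] pos_square[OF sb]], of 2] by simp
qed

text \<open>Put \<open>h = st c * c\<close>, \<open>k = c * st c\<close> and
  \<open>f x = x (1 - x)^(2 n)\<close>. Since \<open>c (1 - h) = (1 - k) c\<close>, the single
  element \<open>y = c (1 - h)^n\<close> has \<open>st y * y = f h\<close> and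
  \<open>y * st y = f k\<close>, which lets positivity pass between the two sides.\<close>

lemma pos_transform_swap:
  "(1 - st c * c) ^ n * (st c * c) * (1 - st c * c) ^ n = st (c * (1 - st c * c) ^ n) * (c * (1 - st c * c) ^ n)"
  "(c * st c) * (1 - c * st c) ^ (n + n) = (c * (1 - st c * c) ^ n) * st (c * (1 - st c * c) ^ n)"
proof -
  let ?u = "1 - st c * c" and ?v = "1 - c * st c"
  have su: "st (?u ^ n) = ?u ^ n" by (simp add: st_power st_diff st_mult)
  have cu: "c * ?u ^ m = ?v ^ m * c" for m
  proof (induction m)
    case (Suc m)
    have c: "c * ?u = ?v * c" by (simp add: algebra_simps)
    have "c * ?u ^ Suc m = c * ?u * ?u ^ m" by (simp only: power_Suc mult.assoc)
    also have "\<dots> = ?v * (c * ?u ^ m)" unfolding c by (rule mult.assoc)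
    also have "\<dots> = ?v ^ Suc m * c" unfolding Suc.IH by (simp only: power_Suc mult.assoc)
    finally show ?case .
  qed (simp only: power_0 mult_1_left mult_1_right)
  show "?u ^ n * (st c * c) * ?u ^ n = st (c * ?u ^ n) * (c * ?u ^ n)"
    unfolding st_mult su by (simp only: mult.assoc)
  have "(c * ?u ^ n) * st (c * ?u ^ n) = c * ?u ^ (n + n) * st c"
    unfolding st_mult su power_add by (simp only: mult.assoc)
  also have "\<dots> = ?v ^ (n + n) * (c * st c)" unfolding cu by (rule mult.assoc)
  also have "\<dots> = (c * st c) * ?v ^ (n + n)"
    by (rule power_commuting_commutes) (simp add: algebra_simps)
  finally show "(c * st c) * ?v ^ (n + n) = (c * ?u ^ n) * st (c * ?u ^ n)" by (rule sym)
qed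

text \<open>
  The Kelley--Vaught theorem. With \<open>h = c\<^sup>*c\<close> and \<open>k = cc\<^sup>*\<close>, the polynomial
  \<open>f(x) = x(1-x)\<^sup>2\<^sup>n\<close> satisfies \<open>f(h) + f(k) \<ge> 0\<close> and \<open>f(k) \<le> 1/2n\<close>, which bounds
  \<open>f(h)\<close> from below; a negative spectral value of \<open>h\<close> would make it exponentially negative.
\<close>

lemma pos_star_mult_normalized:
  assumes "N c \<le> 1"
  shows "pos (st c * c)"
proof -
  let ?h = "st c * c" and ?k = "c * st c"
  have c1: "(N c)\<^sup>2 \<le> 1" using assms N_nonneg[of c] by (simp add: power_le_one)
  have sh: "st ?h = ?h" and sk: "st ?k = ?k" by (simp_all add: st_mult)
  have Nh: "N ?h \<le> 1" using c1 N_cstar_eq[of c] by simp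
  have Nk: "N ?k \<le> 1" using c1 N_cstar_eq[of "st c"] by simp
  define u where "u = 1 - ?h"
  have pu: "pos u" using Nh sh by (auto simp: pos_def u_def st_diff intro!: exI[of _ 1])
  have su: "st u = u" by (rule pos_sa[OF pu])
  have bound: "N u ^ (2 * n) * (N u - 1) \<le> 1 / real (2 * n)" if n: "0 < n" for n
  proof -
    define y where "y = c * u ^ n"
    have uh: "u * ?h = ?h * u" by (simp add: u_def algebra_simps)
    have yy: "st y * y = u ^ (2 * n) * ?h"
    proof -
      have "st y * y = u ^ n * (?h * u ^ n)"
        unfolding y_def u_def pos_transform_swap(1)[symmetric] by (simp only: mult.assoc)
      also have "?h * u ^ n = u ^ n * ?h" by (rule power_commuting_commutes[OF uh, symmetric])
      finally show ?thesis by (simp add: mult_2 power_add mult.assoc)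
    qed
    have "pos (1 - real (2 * n) *\<^sub>R (?k * (1 - ?k) ^ (2 * n)))"
      using n by (intro pos_peak_bound sk Nk) simp
    moreover have "?k * (1 - ?k) ^ (2 * n) = y * st y"
      unfolding y_def u_def mult_2 by (rule pos_transform_swap(2))
    ultimately have "pos (1 - real (2 * n) *\<^sub>R (y * st y))" by simp
    then have "pos ((1 / real (2 * n)) *\<^sub>R (1 - real (2 * n) *\<^sub>R (y * st y)))"
      by (rule pos_scaleR) simp
    then have "pos ((1 / real (2 * n)) *\<^sub>R 1 - y * st y)"
      using n by (simp add: scaleR_diff_right)
    from pos_add[OF pos_sum_star[of y] this]
    have "pos (u ^ (2 * n) * ?h + (1 / real (2 * n)) *\<^sub>R 1)" by (simp add: yy)
    \<comment> \<open>In terms of \<open>u = 1 - h\<close> one has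
      \<open>f h = u^(2 n) - u^(2 n + 1)\<close>. The inequality thereby compares two positive
      elements, and \<open>pos_mono\<close> turns it into an inequality of norms.\<close>
    then have "pos ((u ^ (2 * n) + (1 / real (2 * n)) *\<^sub>R 1) - u ^ Suc (2 * n))"
    proof -
      have h: "?h = 1 - u" by (simp add: u_def)
      have "u ^ (2 * n) * ?h = u ^ (2 * n) - u ^ Suc (2 * n)"
        unfolding h right_diff_distrib mult_1_right power_Suc2 ..
      then have "u ^ (2 * n) * ?h + (1 / real (2 * n)) *\<^sub>R 1
          = (u ^ (2 * n) + (1 / real (2 * n)) *\<^sub>R 1) - u ^ Suc (2 * n)"
        by (simp only: diff_add_eq)
      then show ?thesis using \<open>pos (u ^ (2 * n) * ?h + (1 / real (2 * n)) *\<^sub>R 1)\<close> by (simp only:)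
    qed
    with pos_power[OF pu] have "N (u ^ Suc (2 * n)) \<le> N (u ^ (2 * n) + (1 / real (2 * n)) *\<^sub>R 1)"
      by (rule pos_mono)
    also have "\<dots> \<le> N u ^ (2 * n) + 1 / real (2 * n)"
    proof -
      have "N (u ^ m) \<le> N u ^ m" if "0 < m" for m
        using that
      proof (induction m)
        case (Suc m)
        show ?case
        proof (cases m)
          case (Suc j)
          with Suc.IH have "N (u ^ m) \<le> N u ^ m" by simp
          then have "N u * N (u ^ m) \<le> N u * N u ^ m" by (rule mult_left_mono) (rule N_nonneg)
          then show ?thesis using N_mult[of u "u ^ m"] by simp
        qed simp
      qed simp
      then have "N (u ^ (2 * n)) \<le> N u ^ (2 * n)" using n by simp
      moreover have "N ((1 / real (2 * n)) *\<^sub>R 1) \<le> 1 / real (2 * n)" by (rule N_real) simp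
      ultimately show ?thesis using N_add[of "u ^ (2 * n)" "(1 / real (2 * n)) *\<^sub>R 1"] by linarith
    qed
    finally have "N (u ^ Suc (2 * n)) \<le> N u ^ (2 * n) + 1 / real (2 * n)" .
    then have "N u ^ Suc (2 * n) \<le> N u ^ (2 * n) + 1 / real (2 * n)"
      using N_power_sa[OF su, of "Suc (2 * n)"] by linarith
    then show ?thesis by (simp add: algebra_simps)
  qed
  have "N u \<le> 1"
  proof (rule ccontr)
    assume "\<not> N u \<le> 1"
    then have M: "1 < N u" by simp
    \<comment> \<open>From such an \<open>n\<close> on, \<open>1 / (2 n)\<close> is below
      \<open>N u - 1\<close>, whereas \<open>bound\<close> and \<open>N u^(2 n) \<ge> 1\<close>
      demand the opposite.\<close>
    obtain n :: nat where n: "1 / (N u - 1) < real n" using reals_Archimedean2 by blast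
    have "0 < 1 / (N u - 1)" using M by simp
    then have "0 < real n" using n by (rule less_trans)
    then have n0: "0 < n" by simp
    have "1 * (N u - 1) \<le> N u ^ (2 * n) * (N u - 1)" using M by (intro mult_right_mono) (simp_all add: one_le_power)
    then have "N u - 1 \<le> 1 / real (2 * n)" using bound[OF n0] by (simp only: mult_1_left)
    moreover have "0 < real (2 * n)" using n0 by simp
    ultimately have "(N u - 1) * real (2 * n) \<le> 1" by (simp only: pos_le_divide_eq)
    moreover have "1 < real n * (N u - 1)" using n M by (simp add: pos_divide_less_eq)
    moreover have "(N u - 1) * real (2 * n) = 2 * (real n * (N u - 1))" by simp
    ultimately show False by linarith
  qed
  then show ?thesis unfolding pos_def using sh by (auto simp: u_def intro!: exI[of _ 1])
qed

theorem pos_star_mult: "pos (st c * c)"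
proof (cases "N c \<le> 1")
  case True then show ?thesis by (rule pos_star_mult_normalized)
next
  case False
  then have "pos (st ((1 / N c) *\<^sub>R c) * ((1 / N c) *\<^sub>R c))"
    by (intro pos_star_mult_normalized) (simp add: N_scaleR)
  then have "pos ((N c)\<^sup>2 *\<^sub>R (st ((1 / N c) *\<^sub>R c) * ((1 / N c) *\<^sub>R c)))"
    by (rule pos_scaleR) simp
  then show ?thesis using False by (simp add: st_scaleR power2_eq_square)
qed

end

section \<open>Vector spaces on carrier sets\<close>

lemma additive_monoid_simps [simp]:
  "carrier (additive_monoid V) = pts V"
  "monoid.mult (additive_monoid V) = vadd V"
  "one (additive_monoid V) = vzero V"
  by (simp_all add: additive_monoid_def)

abbreviation vsum :: "('a, 'm) nspace_scheme \<Rightarrow> ('i \<Rightarrow> 'a) \<Rightarrow> 'i set \<Rightarrow> 'a" where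
  "vsum V f I \<equiv> finprod (additive_monoid V) f I"

text \<open>Kept apart from \<open>vspace\<close> because finite sums are also formed in the
  completion of the module, where only the monoid laws are established.\<close>

locale vmonoid =
  fixes V :: "('a, 'm) nspace_scheme"
  assumes comm_monoid: "comm_monoid (additive_monoid V)"
begin

sublocale add: comm_monoid "additive_monoid V"
  rewrites "carrier (additive_monoid V) = pts V"
    and "monoid.mult (additive_monoid V) = vadd V"
    and "one (additive_monoid V) = vzero V"
  using comm_monoid by simp_all

text \<open>The range of \<open>fsum\<close> is the exact support and varies with the family;
  families are compared over a common finite superset.\<close>

lemma fsum_eq_vsum:
  assumes "finite I" "\<And>i. i \<in> I \<Longrightarrow> f i \<in> pts V" "\<And>i. i \<notin> I \<Longrightarrow> f i = vzero V"
  shows "fsum V f = vsum V f I"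
  unfolding fsum_def using assms
  by (intro add.finprod_mono_neutral_cong_left) auto

lemma fsum_closed:
  assumes "\<And>i. f i \<in> pts V"
  shows "fsum V f \<in> pts V"
  unfolding fsum_def using assms by (intro add.finprod_closed) auto

lemma fsum_zero:
  assumes "\<And>j. f j = vzero V"
  shows "fsum V f = vzero V"
  using fsum_eq_vsum[of "{}" f] assms by auto

lemma fsum_add:
  assumes "finite {i. f i \<noteq> vzero V}" "finite {i. g i \<noteq> vzero V}" "\<And>i. f i \<in> pts V" "\<And>i. g i \<in> pts V"
  shows "fsum V (\<lambda>i. vadd V (f i) (g i)) = vadd V (fsum V f) (fsum V g)"
proof -
  let ?I = "{i. f i \<noteq> vzero V} \<union> {i. g i \<noteq> vzero V}"
  have "fsum V (\<lambda>i. vadd V (f i) (g i)) = vsum V (\<lambda>i. vadd V (f i) (g i)) ?I"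
    using assms by (intro fsum_eq_vsum) auto
  also have "\<dots> = vadd V (vsum V f ?I) (vsum V g ?I)"
    using assms by (intro add.finprod_multf) auto
  also have "\<dots> = vadd V (fsum V f) (fsum V g)"
    using assms by (intro arg_cong2[of _ _ _ _ "vadd V"] fsum_eq_vsum[symmetric]) auto
  finally show ?thesis .
qed

end

lemma vsum_hom:
  assumes "vmonoid V" "vmonoid W" "\<And>i. i \<in> I \<Longrightarrow> f i \<in> pts V" "h (vzero V) = vzero W"
    "\<And>x. x \<in> pts V \<Longrightarrow> h x \<in> pts W"
    "\<And>x y. x \<in> pts V \<Longrightarrow> y \<in> pts V \<Longrightarrow> h (vadd V x y) = vadd W (h x) (h y)"
  shows "h (vsum V f I) = vsum W (\<lambda>i. h (f i)) I"
proof -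
  interpret V: vmonoid V by fact
  interpret W: vmonoid W by fact
  show ?thesis using assms(3)
  proof (induction I rule: infinite_finite_induct)
    case (insert x F)
    have "vsum V f F \<in> pts V" using insert by (intro V.add.finprod_closed) auto
    then show ?case using insert assms by (simp add: Pi_iff)
  qed (simp_all add: assms)
qed

lemma fsum_hom:
  assumes "vmonoid V" "vmonoid W" "finite {i. f i \<noteq> vzero V}" "\<And>i. f i \<in> pts V" "h (vzero V) = vzero W"
    "\<And>x. x \<in> pts V \<Longrightarrow> h x \<in> pts W"
    "\<And>x y. x \<in> pts V \<Longrightarrow> y \<in> pts V \<Longrightarrow> h (vadd V x y) = vadd W (h x) (h y)"
  shows "h (fsum V f) = fsum W (\<lambda>i. h (f i))"
proof -
  have "h (fsum V f) = vsum W (\<lambda>i. h (f i)) {i. f i \<noteq> vzero V}"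
    unfolding fsum_def using assms by (intro vsum_hom) auto
  also have "\<dots> = fsum W (\<lambda>i. h (f i))"
    using assms by (intro vmonoid.fsum_eq_vsum[symmetric]) auto
  finally show ?thesis .
qed

locale vspace =
  fixes V :: "('a, 'm) nspace_scheme"
  assumes vector_space: "vector_space_on V"
begin

sublocale vmonoid V
  using vector_space comm_group.axioms(1) by (auto simp: vector_space_on_def vmonoid_def)

lemma zero_closed [simp]: "vzero V \<in> pts V"
  and add_closed [simp]: "x \<in> pts V \<Longrightarrow> y \<in> pts V \<Longrightarrow> vadd V x y \<in> pts V"
  using add.one_closed add.m_closed by auto

lemma scale_closed [simp]: "x \<in> pts V \<Longrightarrow> vscale V c x \<in> pts V"
  and scale_add: "x \<in> pts V \<Longrightarrow> y \<in> pts V \<Longrightarrow> vscale V c (vadd V x y) = vadd V (vscale V c x) (vscale V c y)"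
  and add_scale: "x \<in> pts V \<Longrightarrow> vscale V (c + d) x = vadd V (vscale V c x) (vscale V d x)"
  and scale_mult: "x \<in> pts V \<Longrightarrow> vscale V (c * d) x = vscale V c (vscale V d x)"
  and scale_one [simp]: "x \<in> pts V \<Longrightarrow> vscale V 1 x = x"
  using vector_space by (auto simp: vector_space_on_def)

lemma add_cancel:
  assumes "x \<in> pts V" "y \<in> pts V" "z \<in> pts V" "vadd V x y = vadd V x z"
  shows "y = z"
proof -
  have "Group.group (additive_monoid V)"
    using vector_space comm_group.axioms(2) by (auto simp: vector_space_on_def)
  then obtain i where i: "i \<in> pts V" "vadd V i x = vzero V"
    using group.l_inv_ex[of "additive_monoid V" x] assms(1) by auto
  have "y = vadd V (vadd V i x) y" using i assms by (simp add: add.l_one)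
  also have "\<dots> = vadd V i (vadd V x y)" by (intro add.m_assoc i assms)
  also have "\<dots> = vadd V i (vadd V x z)" using assms(4) by (simp only:)
  also have "\<dots> = vadd V (vadd V i x) z" by (intro add.m_assoc[symmetric] i assms)
  also have "\<dots> = z" using i assms by (simp add: add.l_one)
  finally show ?thesis .
qed

lemma scale_zero [simp]: "x \<in> pts V \<Longrightarrow> vscale V 0 x = vzero V"
  using add_cancel[of x "vscale V 0 x" "vzero V"] add_scale[of x 1 0] by (simp add: add.r_one)

lemma scale_vzero [simp]: "vscale V c (vzero V) = vzero V"
  using scale_mult[of "vzero V" c 0] scale_zero[of "vzero V"] zero_closed by (simp only: mult_zero_right)

lemma add_zero [simp]: "x \<in> pts V \<Longrightarrow> vadd V x (vzero V) = x" "x \<in> pts V \<Longrightarrow> vadd V (vzero V) x = x"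
  by (simp_all add: add.r_one add.l_one)

lemma diff_closed [simp]: "x \<in> pts V \<Longrightarrow> y \<in> pts V \<Longrightarrow> vdiff V x y \<in> pts V"
  by (simp add: vdiff_def)

lemma add_neg [simp]: "x \<in> pts V \<Longrightarrow> vadd V x (vscale V (-1) x) = vzero V"
  using add_scale[of x 1 "-1"] by simp

lemma diff_self [simp]: "x \<in> pts V \<Longrightarrow> vdiff V x x = vzero V"
  by (simp add: vdiff_def)

lemma diff_zero [simp]: "x \<in> pts V \<Longrightarrow> vdiff V x (vzero V) = x"
  by (simp add: vdiff_def)

lemma diff_commute: "x \<in> pts V \<Longrightarrow> y \<in> pts V \<Longrightarrow> vdiff V y x = vscale V (-1) (vdiff V x y)"
  by (simp add: vdiff_def scale_add add.m_comm flip: scale_mult)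

lemma diff_add_diff:
  assumes "x \<in> pts V" "y \<in> pts V" "z \<in> pts V"
  shows "vadd V (vdiff V x y) (vdiff V y z) = vdiff V x z"
proof -
  have "vadd V (vdiff V x y) (vdiff V y z) = vadd V x (vadd V (vadd V y (vscale V (-1) y)) (vscale V (-1) z))"
    using assms by (simp add: vdiff_def add.m_ac del: add_neg)
  then show ?thesis using assms by (simp add: vdiff_def)
qed

lemma add_diff: "x \<in> pts V \<Longrightarrow> y \<in> pts V \<Longrightarrow> vadd V (vdiff V x y) y = x"
  using diff_add_diff[of x y "vzero V"] by simp

lemma diff_eq_zeroD: "x \<in> pts V \<Longrightarrow> y \<in> pts V \<Longrightarrow> vdiff V x y = vzero V \<Longrightarrow> x = y"
  using add_diff[of x y] by simp

lemma diff_add_add: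
  assumes "x \<in> pts V" "y \<in> pts V" "x' \<in> pts V" "y' \<in> pts V"
  shows "vdiff V (vadd V x y) (vadd V x' y') = vadd V (vdiff V x x') (vdiff V y y')"
  using assms by (simp add: vdiff_def scale_add add.m_ac)

lemma diff_scale: "x \<in> pts V \<Longrightarrow> y \<in> pts V \<Longrightarrow> vdiff V (vscale V c x) (vscale V c y) = vscale V c (vdiff V x y)"
  by (simp add: vdiff_def scale_add flip: scale_mult)

end

lemma linear_on_zero:
  assumes "vspace V" "vspace W" "linear_on V W h"
  shows "h (vzero V) = vzero W"
proof -
  interpret V: vspace V by fact
  interpret W: vspace W by fact
  have "h (vscale V 0 (vzero V)) = vscale W 0 (h (vzero V))" "h (vzero V) \<in> pts W"
    using assms(3) V.zero_closed unfolding linear_on_def by blast+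
  then show ?thesis by simp
qed

lemma conj_linear_on_zero:
  assumes "vspace V" "vspace W" "conj_linear_on V W h"
  shows "h (vzero V) = vzero W"
proof -
  interpret V: vspace V by fact
  interpret W: vspace W by fact
  have "h (vscale V 0 (vzero V)) = vscale W (cnj 0) (h (vzero V))" "h (vzero V) \<in> pts W"
    using assms(3) V.zero_closed unfolding conj_linear_on_def by blast+
  then show ?thesis by simp
qed

lemma linear_on_diff:
  assumes "vspace V" "linear_on V W h" "x \<in> pts V" "y \<in> pts V"
  shows "h (vdiff V x y) = vdiff W (h x) (h y)"
proof -
  interpret V: vspace V by fact
  show ?thesis using assms by (auto simp: linear_on_def vdiff_def)
qed

locale seminormed = vspace +
  assumes norm_nonneg [simp]: "x \<in> pts V \<Longrightarrow> 0 \<le> vnorm V x"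
    and norm_scale: "x \<in> pts V \<Longrightarrow> vnorm V (vscale V c x) = cmod c * vnorm V x"
    and norm_triangle: "x \<in> pts V \<Longrightarrow> y \<in> pts V \<Longrightarrow> vnorm V (vadd V x y) \<le> vnorm V x + vnorm V y"
begin

lemma norm_zero [simp]: "vnorm V (vzero V) = 0"
  using norm_scale[of "vzero V" 0] by simp

lemma norm_diff_commute: "x \<in> pts V \<Longrightarrow> y \<in> pts V \<Longrightarrow> vnorm V (vdiff V x y) = vnorm V (vdiff V y x)"
  using diff_commute[of x y] by (simp add: norm_scale)

lemma norm_diff_triangle:
  "x \<in> pts V \<Longrightarrow> y \<in> pts V \<Longrightarrow> z \<in> pts V \<Longrightarrow> vnorm V (vdiff V x z) \<le> vnorm V (vdiff V x y) + vnorm V (vdiff V y z)"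
  using norm_triangle[of "vdiff V x y" "vdiff V y z"] by (simp add: diff_add_diff)

lemma norm_le_add_diff: "x \<in> pts V \<Longrightarrow> y \<in> pts V \<Longrightarrow> vnorm V x \<le> vnorm V (vdiff V x y) + vnorm V y"
  using norm_triangle[of "vdiff V x y" y] by (simp add: add_diff)

lemma abs_norm_diff: "x \<in> pts V \<Longrightarrow> y \<in> pts V \<Longrightarrow> \<bar>vnorm V x - vnorm V y\<bar> \<le> vnorm V (vdiff V x y)"
  using norm_le_add_diff[of x y] norm_le_add_diff[of y x] norm_diff_commute[of x y] by linarith

end

section \<open>The completion of a seminormed space\<close>

context seminormed
begin

lemma cauchy_seqsI:
  assumes "\<And>n. X n \<in> pts V"
    "\<And>e. 0 < e \<Longrightarrow> \<exists>N. \<forall>m\<ge>N. \<forall>n\<ge>N. vnorm V (vdiff V (X m) (X n)) < e"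
  shows "X \<in> cauchy_seqs V"
  using assms by (auto simp: cauchy_seqs_def)

lemma cauchy_seqsD: "X \<in> cauchy_seqs V \<Longrightarrow> X n \<in> pts V"
  by (simp add: cauchy_seqs_def)

lemma cauchy_const [simp]: "x \<in> pts V \<Longrightarrow> (\<lambda>n. x) \<in> cauchy_seqs V"
  by (auto intro: cauchy_seqsI)

lemma cauchy_norm_Cauchy:
  assumes "X \<in> cauchy_seqs V"
  shows "Cauchy (\<lambda>n. vnorm V (X n))"
proof (rule CauchyI)
  fix e :: real assume "0 < e"
  then obtain N where "\<forall>m\<ge>N. \<forall>n\<ge>N. vnorm V (vdiff V (X m) (X n)) < e"
    using assms by (auto simp: cauchy_seqs_def)
  then show "\<exists>M. \<forall>m\<ge>M. \<forall>n\<ge>M. norm (vnorm V (X m) - vnorm V (X n)) < e"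
  proof (intro exI[of _ N] allI impI)
    fix m n assume "N \<le> m" "N \<le> n"
    with \<open>\<forall>m\<ge>N. \<forall>n\<ge>N. vnorm V (vdiff V (X m) (X n)) < e\<close>
    have "vnorm V (vdiff V (X m) (X n)) < e" by blast
    then show "norm (vnorm V (X m) - vnorm V (X n)) < e"
      using abs_norm_diff[OF cauchy_seqsD[OF assms, of m] cauchy_seqsD[OF assms, of n]] by simp
  qed
qed

lemma cauchy_norm_tendsto:
  "X \<in> cauchy_seqs V \<Longrightarrow> (\<lambda>n. vnorm V (X n)) \<longlonglongrightarrow> lim (\<lambda>n. vnorm V (X n))"
  using cauchy_norm_Cauchy[of X] by (simp add: Cauchy_convergent_iff convergent_LIMSEQ_iff)

lemma cauchy_norm_bounded:
  assumes "X \<in> cauchy_seqs V"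
  obtains C where "0 < C" "\<And>n. vnorm V (X n) \<le> C"
proof -
  obtain C where "0 < C" "\<And>n. norm (vnorm V (X n)) \<le> C"
    using Cauchy_Bseq[OF cauchy_norm_Cauchy[OF assms]] by (auto elim: BseqE)
  then show ?thesis using that by (metis abs_le_D1 real_norm_def)
qed

lemma cauchy_rel_iff:
  "(X, Y) \<in> cauchy_rel V \<longleftrightarrow> X \<in> cauchy_seqs V \<and> Y \<in> cauchy_seqs V \<and> (\<lambda>n. vnorm V (vdiff V (X n) (Y n))) \<longlonglongrightarrow> 0"
  by (auto simp: cauchy_rel_def)

lemma cauchy_rel_equiv: "equiv (cauchy_seqs V) (cauchy_rel V)"
proof (rule equivI)
  show "cauchy_rel V \<subseteq> cauchy_seqs V \<times> cauchy_seqs V" by (auto simp: cauchy_rel_def)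
  show "refl_on (cauchy_seqs V) (cauchy_rel V)"
    by (auto simp: refl_on_def cauchy_rel_iff cauchy_seqsD)
  show "sym (cauchy_rel V)"
  proof (rule symI)
    fix X Y assume XY: "(X, Y) \<in> cauchy_rel V"
    then have "vnorm V (vdiff V (X n) (Y n)) = vnorm V (vdiff V (Y n) (X n))" for n
      by (intro norm_diff_commute cauchy_seqsD) (auto simp: cauchy_rel_iff)
    then show "(Y, X) \<in> cauchy_rel V" using XY by (simp add: cauchy_rel_iff)
  qed
  show "trans (cauchy_rel V)"
  proof (rule transI)
    fix X Y Z assume *: "(X, Y) \<in> cauchy_rel V" "(Y, Z) \<in> cauchy_rel V"
    have "(\<lambda>n. vnorm V (vdiff V (X n) (Z n))) \<longlonglongrightarrow> 0"
    proof (rule tendsto_sandwich[OF _ _ tendsto_const])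
      show "(\<lambda>n. vnorm V (vdiff V (X n) (Y n)) + vnorm V (vdiff V (Y n) (Z n))) \<longlonglongrightarrow> 0"
        using tendsto_add[of _ 0 sequentially _ 0] * by (auto simp: cauchy_rel_iff)
      show "\<forall>\<^sub>F n in sequentially. vnorm V (vdiff V (X n) (Z n)) \<le> vnorm V (vdiff V (X n) (Y n)) + vnorm V (vdiff V (Y n) (Z n))"
        using * by (intro always_eventually allI norm_diff_triangle cauchy_seqsD) (auto simp: cauchy_rel_iff)
      show "\<forall>\<^sub>F n in sequentially. 0 \<le> vnorm V (vdiff V (X n) (Z n))"
        using * by (intro always_eventually allI norm_nonneg diff_closed cauchy_seqsD) (auto simp: cauchy_rel_iff)
    qed
    then show "(X, Z) \<in> cauchy_rel V" using * by (auto simp: cauchy_rel_iff)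
  qed
qed

lemma cauchy_class_eq_iff:
  "X \<in> cauchy_seqs V \<Longrightarrow> Y \<in> cauchy_seqs V \<Longrightarrow> cauchy_class V X = cauchy_class V Y \<longleftrightarrow> (X, Y) \<in> cauchy_rel V"
  unfolding cauchy_class_def by (rule eq_equiv_class_iff[OF cauchy_rel_equiv])

lemma cauchy_class_closed [simp]: "X \<in> cauchy_seqs V \<Longrightarrow> cauchy_class V X \<in> pts (completion V)"
  by (auto simp: completion_def cauchy_class_def quotientI)

lemma completion_cases:
  assumes "P \<in> pts (completion V)"
  obtains X where "X \<in> cauchy_seqs V" "P = cauchy_class V X"
  using assms by (auto simp: completion_def cauchy_class_def elim: quotientE)

lemma cauchy_rep_class:
  assumes "X \<in> cauchy_seqs V"
  shows "(X, cauchy_rep (cauchy_class V X)) \<in> cauchy_rel V"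
proof -
  have "X \<in> cauchy_class V X"
    unfolding cauchy_class_def using cauchy_rel_equiv assms by (rule equiv_class_self)
  then have "cauchy_rep (cauchy_class V X) \<in> cauchy_class V X" unfolding cauchy_rep_def
    by (rule someI[of "\<lambda>Y. Y \<in> cauchy_class V X"])
  then show ?thesis by (simp add: cauchy_class_def)
qed

lemma cauchy_rep_seq: "P \<in> pts (completion V) \<Longrightarrow> cauchy_rep P \<in> cauchy_seqs V"
  by (metis completion_cases cauchy_rel_iff cauchy_rep_class)

lemma class_cauchy_rep: "P \<in> pts (completion V) \<Longrightarrow> cauchy_class V (cauchy_rep P) = P"
  by (metis completion_cases cauchy_rel_iff cauchy_rep_class cauchy_class_eq_iff)

end

lemma tendsto_zero_le:
  fixes f g :: "nat \<Rightarrow> real"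
  assumes "g \<longlonglongrightarrow> 0" "\<And>n. 0 \<le> f n" "\<And>n. f n \<le> g n"
  shows "f \<longlonglongrightarrow> 0"
  by (rule tendsto_sandwich[OF _ _ tendsto_const assms(1)]) (simp_all add: assms)

text \<open>A Lipschitz map passes to classes of Cauchy sequences. Scalar multiplication,
  involution, convolution by a point section and contractive homomorphisms all extend to completions
  in this way.\<close>

lemma bounded_map_cauchy:
  assumes V: "seminormed V" and W: "seminormed W"
    and h: "\<And>x. x \<in> pts V \<Longrightarrow> h x \<in> pts W"
    and C: "\<And>x y. x \<in> pts V \<Longrightarrow> y \<in> pts V \<Longrightarrow> vnorm W (vdiff W (h x) (h y)) \<le> C * vnorm V (vdiff V x y)"
  shows "X \<in> cauchy_seqs V \<Longrightarrow> (\<lambda>n. h (X n)) \<in> cauchy_seqs W"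
    and "(X, Y) \<in> cauchy_rel V \<Longrightarrow> ((\<lambda>n. h (X n)), (\<lambda>n. h (Y n))) \<in> cauchy_rel W"
proof -
  interpret V: seminormed V by fact
  interpret W: seminormed W by fact
  \<comment> \<open>A strictly positive constant, since \<open>e\<close> is divided by it.\<close>
  let ?C = "\<bar>C\<bar> + 1"
  have C': "vnorm W (vdiff W (h x) (h y)) \<le> ?C * vnorm V (vdiff V x y)" if "x \<in> pts V" "y \<in> pts V" for x y
  proof -
    have "C * vnorm V (vdiff V x y) \<le> ?C * vnorm V (vdiff V x y)"
      using that by (intro mult_right_mono) auto
    then show ?thesis using C[OF that] by linarith
  qed
  have cs: "(\<lambda>n. h (X n)) \<in> cauchy_seqs W" if X: "X \<in> cauchy_seqs V" for X
  proof (rule W.cauchy_seqsI)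
    fix e :: real assume "0 < e"
    then have "0 < e / ?C" by simp
    then obtain N where N: "\<forall>m\<ge>N. \<forall>n\<ge>N. vnorm V (vdiff V (X m) (X n)) < e / ?C"
      using X by (auto simp: cauchy_seqs_def)
    have "vnorm W (vdiff W (h (X m)) (h (X n))) < e" if "m \<ge> N" "n \<ge> N" for m n
    proof -
      have "?C * vnorm V (vdiff V (X m) (X n)) < e"
        using N that by (simp add: pos_less_divide_eq mult.commute)
      then show ?thesis using C'[OF V.cauchy_seqsD[OF X] V.cauchy_seqsD[OF X], of m n] by linarith
    qed
    then show "\<exists>N. \<forall>m\<ge>N. \<forall>n\<ge>N. vnorm W (vdiff W (h (X m)) (h (X n))) < e" by blast
  qed (use h V.cauchy_seqsD[OF X] in auto)
  then show "X \<in> cauchy_seqs V \<Longrightarrow> (\<lambda>n. h (X n)) \<in> cauchy_seqs W" .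
  assume XY: "(X, Y) \<in> cauchy_rel V"
  then have X: "\<And>n. X n \<in> pts V" and Y: "\<And>n. Y n \<in> pts V"
    by (auto simp: V.cauchy_rel_iff V.cauchy_seqsD)
  have "(\<lambda>n. ?C * vnorm V (vdiff V (X n) (Y n))) \<longlonglongrightarrow> 0"
    using XY tendsto_mult_right_zero by (auto simp: V.cauchy_rel_iff)
  then have "(\<lambda>n. vnorm W (vdiff W (h (X n)) (h (Y n)))) \<longlonglongrightarrow> 0"
    by (rule tendsto_zero_le) (use C' X Y h in auto)
  then show "((\<lambda>n. h (X n)), (\<lambda>n. h (Y n))) \<in> cauchy_rel W"
    using XY cs by (auto simp: V.cauchy_rel_iff W.cauchy_rel_iff)
qed

context seminormed
begin

lemma cauchy_add:
  assumes "X \<in> cauchy_seqs V" "Y \<in> cauchy_seqs V"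
  shows "(\<lambda>n. vadd V (X n) (Y n)) \<in> cauchy_seqs V"
proof (rule cauchy_seqsI)
  fix e :: real assume "0 < e"
  then have "0 < e / 2" by simp
  obtain M where M: "\<forall>m\<ge>M. \<forall>n\<ge>M. vnorm V (vdiff V (X m) (X n)) < e / 2"
    using assms(1) \<open>0 < e / 2\<close> unfolding cauchy_seqs_def by blast
  obtain N where N: "\<forall>m\<ge>N. \<forall>n\<ge>N. vnorm V (vdiff V (Y m) (Y n)) < e / 2"
    using assms(2) \<open>0 < e / 2\<close> unfolding cauchy_seqs_def by blast
  have "vnorm V (vdiff V (vadd V (X m) (Y m)) (vadd V (X n) (Y n))) < e" if "m \<ge> max M N" "n \<ge> max M N" for m n
  proof -
    have "vnorm V (vdiff V (vadd V (X m) (Y m)) (vadd V (X n) (Y n)))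
        \<le> vnorm V (vdiff V (X m) (X n)) + vnorm V (vdiff V (Y m) (Y n))"
      using assms by (simp add: diff_add_add cauchy_seqsD norm_triangle)
    moreover have "vnorm V (vdiff V (X m) (X n)) < e / 2" "vnorm V (vdiff V (Y m) (Y n)) < e / 2"
      using M N that by (meson max.boundedE)+
    ultimately show ?thesis by linarith
  qed
  then show "\<exists>N. \<forall>m\<ge>N. \<forall>n\<ge>N. vnorm V (vdiff V (vadd V (X m) (Y m)) (vadd V (X n) (Y n))) < e" by blast
qed (use assms in \<open>simp add: cauchy_seqsD\<close>)

lemma cauchy_rel_add:
  assumes "(X, X') \<in> cauchy_rel V" "(Y, Y') \<in> cauchy_rel V"
  shows "((\<lambda>n. vadd V (X n) (Y n)), (\<lambda>n. vadd V (X' n) (Y' n))) \<in> cauchy_rel V"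
proof -
  have seqs: "X \<in> cauchy_seqs V" "X' \<in> cauchy_seqs V" "Y \<in> cauchy_seqs V" "Y' \<in> cauchy_seqs V"
    using assms by (auto simp: cauchy_rel_iff)
  note [simp] = seqs[THEN cauchy_seqsD]
  have "(\<lambda>n. vnorm V (vdiff V (X n) (X' n)) + vnorm V (vdiff V (Y n) (Y' n))) \<longlonglongrightarrow> 0"
    using tendsto_add[of _ 0 sequentially _ 0] assms by (auto simp: cauchy_rel_iff)
  then have "(\<lambda>n. vnorm V (vdiff V (vadd V (X n) (Y n)) (vadd V (X' n) (Y' n)))) \<longlonglongrightarrow> 0"
    by (rule tendsto_zero_le) (simp_all add: diff_add_add norm_triangle)
  then show ?thesis using seqs by (simp add: cauchy_rel_iff cauchy_add)
qed

lemma cauchy_scale: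
  "X \<in> cauchy_seqs V \<Longrightarrow> (\<lambda>n. vscale V c (X n)) \<in> cauchy_seqs V"
  "(X, Y) \<in> cauchy_rel V \<Longrightarrow> ((\<lambda>n. vscale V c (X n)), (\<lambda>n. vscale V c (Y n))) \<in> cauchy_rel V"
  by (rule bounded_map_cauchy[OF seminormed_axioms seminormed_axioms, of _ "cmod c"];
      simp add: diff_scale norm_scale)+

text \<open>The operations of the completion act on representatives picked by choice; here the
  picked ones are exchanged for given ones, at the cost of a null sequence.\<close>

lemma completion_add:
  assumes "X \<in> cauchy_seqs V" "Y \<in> cauchy_seqs V"
  shows "vadd (completion V) (cauchy_class V X) (cauchy_class V Y) = cauchy_class V (\<lambda>n. vadd V (X n) (Y n))"
proof -
  have "((\<lambda>n. vadd V (X n) (Y n)), (\<lambda>n. vadd V (cauchy_rep (cauchy_class V X) n) (cauchy_rep (cauchy_class V Y) n))) \<in> cauchy_rel V"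
    by (intro cauchy_rel_add cauchy_rep_class assms)
  then show ?thesis
    by (subst cauchy_class_eq_iff[THEN iffD2, of "\<lambda>n. vadd V (X n) (Y n)"]) (auto simp: cauchy_rel_iff completion_def)
qed

lemma completion_scale:
  assumes "X \<in> cauchy_seqs V"
  shows "vscale (completion V) c (cauchy_class V X) = cauchy_class V (\<lambda>n. vscale V c (X n))"
proof -
  have "((\<lambda>n. vscale V c (X n)), (\<lambda>n. vscale V c (cauchy_rep (cauchy_class V X) n))) \<in> cauchy_rel V"
    by (intro cauchy_scale cauchy_rep_class assms)
  then show ?thesis
    by (subst cauchy_class_eq_iff[THEN iffD2, of "\<lambda>n. vscale V c (X n)"]) (auto simp: cauchy_rel_iff completion_def)
qed

lemma completion_zero: "vzero (completion V) = cauchy_class V (\<lambda>n. vzero V)"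
  by (simp add: completion_def)

lemma cauchy_rel_norm_lim:
  assumes "(X, Y) \<in> cauchy_rel V"
  shows "(\<lambda>n. vnorm V (Y n)) \<longlonglongrightarrow> lim (\<lambda>n. vnorm V (X n))"
proof -
  have seqs: "X \<in> cauchy_seqs V" "Y \<in> cauchy_seqs V" using assms by (auto simp: cauchy_rel_iff)
  have "(\<lambda>n. \<bar>vnorm V (X n) - vnorm V (Y n)\<bar>) \<longlonglongrightarrow> 0"
  proof (rule tendsto_zero_le)
    show "(\<lambda>n. vnorm V (vdiff V (X n) (Y n))) \<longlonglongrightarrow> 0" using assms by (simp add: cauchy_rel_iff)
  qed (use seqs abs_norm_diff in \<open>auto simp: cauchy_seqsD\<close>)
  then have "(\<lambda>n. vnorm V (X n) - vnorm V (Y n)) \<longlonglongrightarrow> 0" by (simp add: tendsto_rabs_zero_iff)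
  from tendsto_diff[OF cauchy_norm_tendsto[OF seqs(1)] this] show ?thesis by simp
qed

lemma completion_norm:
  assumes "X \<in> cauchy_seqs V"
  shows "vnorm (completion V) (cauchy_class V X) = lim (\<lambda>n. vnorm V (X n))"
proof -
  have "lim (\<lambda>n. vnorm V (cauchy_rep (cauchy_class V X) n)) = lim (\<lambda>n. vnorm V (X n))"
    by (rule limI[OF cauchy_rel_norm_lim[OF cauchy_rep_class[OF assms]]])
  then show ?thesis by (simp add: completion_def)
qed

lemma completion_norm_const [simp]:
  "x \<in> pts V \<Longrightarrow> vnorm (completion V) (cauchy_class V (\<lambda>n. x)) = vnorm V x"
  by (simp add: completion_norm)

text \<open>This much structure gives a meaning to the finite sum of left regular operators applied
  to a class.\<close>

lemma completion_vmonoid: "vmonoid (completion V)"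
proof (rule vmonoid.intro, rule comm_monoidI, unfold additive_monoid_simps)
  fix P Q assume P: "P \<in> pts (completion V)" and Q: "Q \<in> pts (completion V)"
  obtain X where X: "X \<in> cauchy_seqs V" "P = cauchy_class V X" using P by (rule completion_cases)
  obtain Y where Y: "Y \<in> cauchy_seqs V" "Q = cauchy_class V Y" using Q by (rule completion_cases)
  show "vadd (completion V) P Q \<in> pts (completion V)"
    using X Y by (simp add: completion_add cauchy_add)
  have "vadd V (X n) (Y n) = vadd V (Y n) (X n)" for n
    using X Y by (intro add.m_comm) (auto simp: cauchy_seqsD)
  then show "vadd (completion V) P Q = vadd (completion V) Q P"
    using X Y by (simp add: completion_add)
  fix R assume R: "R \<in> pts (completion V)"
  obtain Z where Z: "Z \<in> cauchy_seqs V" "R = cauchy_class V Z" using R by (rule completion_cases)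
  show "vadd (completion V) (vadd (completion V) P Q) R = vadd (completion V) P (vadd (completion V) Q R)"
    using X Y Z by (simp add: completion_add cauchy_add cauchy_seqsD add.m_assoc)
next
  show "vzero (completion V) \<in> pts (completion V)" by (simp add: completion_zero)
next
  fix P assume P: "P \<in> pts (completion V)"
  obtain X where "X \<in> cauchy_seqs V" "P = cauchy_class V X" using P by (rule completion_cases)
  then show "vadd (completion V) (vzero (completion V)) P = P"
    by (simp add: completion_zero completion_add cauchy_seqsD)
qed

text \<open>Both claims run through one induction because the inductive step of the second uses the
  first.\<close>

lemma cauchy_vsum:
  assumes "\<And>i. i \<in> I \<Longrightarrow> X i \<in> cauchy_seqs V"
  shows "(\<lambda>n. vsum V (\<lambda>i. X i n) I) \<in> cauchy_seqs V \<and>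
    vsum (completion V) (\<lambda>i. cauchy_class V (X i)) I = cauchy_class V (\<lambda>n. vsum V (\<lambda>i. X i n) I)"
  using assms
proof (induction I rule: infinite_finite_induct)
  case (insert i I)
  interpret C: vmonoid "completion V" by (rule completion_vmonoid)
  have "vsum V (\<lambda>i. X i n) (insert i I) = vadd V (X i n) (vsum V (\<lambda>i. X i n) I)" for n
    using insert by (intro add.finprod_insert) (auto simp: cauchy_seqsD)
  moreover have "vsum (completion V) (\<lambda>i. cauchy_class V (X i)) (insert i I)
      = vadd (completion V) (cauchy_class V (X i)) (vsum (completion V) (\<lambda>i. cauchy_class V (X i)) I)"
    using insert by (intro C.add.finprod_insert) auto
  ultimately show ?case using insert by (simp add: cauchy_add completion_add)
next
  case empty
  interpret C: vmonoid "completion V" by (rule completion_vmonoid)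
  show ?case by (simp flip: completion_zero)
next
  case (infinite I)
  interpret C: vmonoid "completion V" by (rule completion_vmonoid)
  show ?case using infinite by (simp flip: completion_zero)
qed

end

section \<open>The free star algebra\<close>

text \<open>A copy of lists with concatenation as addition. Finitely supported functions on it,
  under the convolution product, are the polynomials in noncommuting variables.\<close>

datatype 'b word = Word (letters: "'b list")

instantiation word :: (type) monoid_add
begin

definition zero_word :: "'a word" where "0 = Word []"
definition plus_word :: "'a word \<Rightarrow> 'a word \<Rightarrow> 'a word" where "v + w = Word (letters v @ letters w)"

instance by standard (simp_all add: zero_word_def plus_word_def)

end

lemma poly_mapping_induct [case_names single sum]:
  fixes p :: "'a \<Rightarrow>\<^sub>0 'b::comm_monoid_add"
  assumes "\<And>k v. P (Poly_Mapping.single k v)" "\<And>p q. P p \<Longrightarrow> P q \<Longrightarrow> P (p + q)"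
  shows "P p"
proof -
  have "P (\<Sum>k\<in>K. Poly_Mapping.single k (Poly_Mapping.lookup p k))" for K
  proof (induction K rule: infinite_finite_induct)
    case (insert k K)
    then show ?case using assms by simp
  qed (use assms(1)[of undefined 0] in simp_all)
  moreover have "p = (\<Sum>k\<in>Poly_Mapping.keys p. Poly_Mapping.single k (Poly_Mapping.lookup p k))"
    by (rule poly_mapping_eqI) (simp add: lookup_sum lookup_single when_def in_keys_iff)
  ultimately show ?thesis by metis
qed

instantiation poly_mapping :: (monoid_add, real_algebra_1) real_algebra_1
begin

text \<open>Real scalars act through constant polynomials, which are central. The resulting class
  instance is what makes the type eligible for \<open>cstar_seminorm\<close>.\<close>

definition scaleR_poly_mapping :: "real \<Rightarrow> ('a \<Rightarrow>\<^sub>0 'b) \<Rightarrow> ('a \<Rightarrow>\<^sub>0 'b)" where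
  "r *\<^sub>R p = Poly_Mapping.single 0 (of_real r) * p"

lemma real_single_commute:
  "p * Poly_Mapping.single 0 (of_real r) = Poly_Mapping.single 0 (of_real r) * (p :: 'a \<Rightarrow>\<^sub>0 'b)"
proof (induction p rule: poly_mapping_induct)
  case (single k v)
  show ?case by (simp add: mult_single of_real_def)
qed (simp add: distrib_left distrib_right)

instance
proof
  fix r s :: real and p q :: "'a \<Rightarrow>\<^sub>0 'b"
  show "r *\<^sub>R (p + q) = r *\<^sub>R p + r *\<^sub>R q" by (simp add: scaleR_poly_mapping_def distrib_left)
  show "(r + s) *\<^sub>R p = r *\<^sub>R p + s *\<^sub>R p" by (simp add: scaleR_poly_mapping_def single_add distrib_right)
  show "r *\<^sub>R s *\<^sub>R p = (r * s) *\<^sub>R p"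
    by (simp add: scaleR_poly_mapping_def mult_single flip: mult.assoc)
  show "1 *\<^sub>R p = p" by (simp add: scaleR_poly_mapping_def single_one)
  show "r *\<^sub>R p * q = r *\<^sub>R (p * q)" by (simp add: scaleR_poly_mapping_def mult.assoc)
  show "p * r *\<^sub>R q = r *\<^sub>R (p * q)"
    unfolding scaleR_poly_mapping_def mult.assoc[symmetric] by (simp only: real_single_commute)
qed

end

text \<open>The antimultiplicative, conjugate-linear extension of the map \<open>s\<close> on
  letters.\<close>

definition free_star :: "('b \<Rightarrow> 'b) \<Rightarrow> ('b word \<Rightarrow>\<^sub>0 complex) \<Rightarrow> ('b word \<Rightarrow>\<^sub>0 complex)" where
  "free_star s p = (\<Sum>w\<in>Poly_Mapping.keys p.
     Poly_Mapping.single (Word (rev (map s (letters w)))) (cnj (Poly_Mapping.lookup p w)))"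

lemma free_star_eq_sum:
  assumes "finite K" "Poly_Mapping.keys p \<subseteq> K"
  shows "free_star s p = (\<Sum>w\<in>K. Poly_Mapping.single (Word (rev (map s (letters w)))) (cnj (Poly_Mapping.lookup p w)))"
  unfolding free_star_def using assms by (intro sum.mono_neutral_left) (auto simp: in_keys_iff)

lemma free_star_add: "free_star s (p + q) = free_star s p + free_star s q"
proof -
  let ?K = "Poly_Mapping.keys p \<union> Poly_Mapping.keys q"
  have "Poly_Mapping.keys (p + q) \<subseteq> ?K" by (rule keys_add)
  then show ?thesis
    by (simp add: free_star_eq_sum[of ?K] lookup_add single_add sum.distrib)
qed

lemma free_star_single:
  "free_star s (Poly_Mapping.single w c) = Poly_Mapping.single (Word (rev (map s (letters w)))) (cnj c)"
  by (simp add: free_star_eq_sum[of "{w}"])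

lemma free_star_mult: "free_star s (p * q) = free_star s q * free_star s p"
proof (induction p rule: poly_mapping_induct)
  case (single v c)
  show ?case
  proof (induction q rule: poly_mapping_induct)
    case (single w d)
    show ?case by (simp add: free_star_single mult_single plus_word_def mult.commute)
  qed (simp add: free_star_add distrib_left distrib_right)
qed (simp add: free_star_add distrib_left distrib_right)

lemma free_star_star:
  assumes "\<And>x. s (s x) = x"
  shows "free_star s (free_star s p) = p"
proof (induction p rule: poly_mapping_induct)
  case (single v c)
  show ?case using assms by (simp add: free_star_single rev_map map_idI)
qed (simp add: free_star_add)

lemma free_star_scaleR: "free_star s (r *\<^sub>R p) = r *\<^sub>R free_star s p"
proof -
  have "free_star s (r *\<^sub>R p) = free_star s p * Poly_Mapping.single 0 (of_real r)"
    unfolding scaleR_poly_mapping_def free_star_mult by (simp add: free_star_single zero_word_def)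
  then show ?thesis by (simp only: real_single_commute scaleR_poly_mapping_def)
qed

section \<open>The unit fibre of a Fell bundle\<close>

locale fell =
  fixes B :: "('g::group_add, 'b) bundle_data"
  assumes fell_bundle: "fell_bundle B"
begin

abbreviation nm :: "'g \<Rightarrow> 'b \<Rightarrow> real" where "nm t \<equiv> vnorm (fib B t)"

lemma banach: "banach_on (fib B t)"
  using fell_bundle by (simp add: fell_bundle_def)

sublocale fib: seminormed "fib B t" for t
  using banach by unfold_locales (simp_all add: banach_on_def)

lemma mult_left_linear: "b \<in> pts (fib B t) \<Longrightarrow> linear_on (fib B s) (fib B (s + t)) (\<lambda>a. bmult B a b)"
  and mult_right_linear: "a \<in> pts (fib B s) \<Longrightarrow> linear_on (fib B t) (fib B (s + t)) (\<lambda>b. bmult B a b)"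
  and star_conj_linear: "conj_linear_on (fib B t) (fib B (- t)) (bstar B)"
  and norm_mult: "a \<in> pts (fib B s) \<Longrightarrow> b \<in> pts (fib B t) \<Longrightarrow> nm (s + t) (bmult B a b) \<le> nm s a * nm t b"
  and norm_star [simp]: "a \<in> pts (fib B t) \<Longrightarrow> nm (- t) (bstar B a) = nm t a"
  and norm_star_mult: "a \<in> pts (fib B t) \<Longrightarrow> nm 0 (bmult B (bstar B a) a) = (nm t a)\<^sup>2"
  using fell_bundle unfolding fell_bundle_def by auto

lemma totalI: "a \<in> pts (fib B t) \<Longrightarrow> a \<in> total B"
  by (auto simp: total_def)

lemma mult_assoc:
  "a \<in> pts (fib B s) \<Longrightarrow> b \<in> pts (fib B t) \<Longrightarrow> c \<in> pts (fib B r) \<Longrightarrow> bmult B (bmult B a b) c = bmult B a (bmult B b c)"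
  and star_mult: "a \<in> pts (fib B s) \<Longrightarrow> b \<in> pts (fib B t) \<Longrightarrow> bstar B (bmult B a b) = bmult B (bstar B b) (bstar B a)"
  and star_star [simp]: "a \<in> pts (fib B s) \<Longrightarrow> bstar B (bstar B a) = a"
  and star_mult_positive: "a \<in> pts (fib B s) \<Longrightarrow> unit_fibre_positive B (bmult B (bstar B a) a)"
  using totalI[of a s] totalI[of b t] totalI[of c r] fell_bundle unfolding fell_bundle_def by simp_all

lemma mult_closed: "a \<in> pts (fib B s) \<Longrightarrow> b \<in> pts (fib B t) \<Longrightarrow> bmult B a b \<in> pts (fib B (s + t))"
  using mult_left_linear unfolding linear_on_def by blast

lemma mult_closed': "a \<in> pts (fib B s) \<Longrightarrow> b \<in> pts (fib B t) \<Longrightarrow> s + t = r \<Longrightarrow> bmult B a b \<in> pts (fib B r)"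
  using mult_closed by blast

lemma star_closed: "a \<in> pts (fib B t) \<Longrightarrow> bstar B a \<in> pts (fib B (- t))"
  using star_conj_linear unfolding conj_linear_on_def by blast

lemma star_closed': "a \<in> pts (fib B t) \<Longrightarrow> - t = r \<Longrightarrow> bstar B a \<in> pts (fib B r)"
  using star_closed by blast

lemma unit_mult_closed: "a \<in> pts (fib B 0) \<Longrightarrow> b \<in> pts (fib B t) \<Longrightarrow> bmult B a b \<in> pts (fib B t)"
  "b \<in> pts (fib B t) \<Longrightarrow> a \<in> pts (fib B 0) \<Longrightarrow> bmult B b a \<in> pts (fib B t)"
  using mult_closed[of a 0 b t] mult_closed[of b t a 0] by simp_all

lemma star_mult_closed: "a \<in> pts (fib B t) \<Longrightarrow> b \<in> pts (fib B t) \<Longrightarrow> bmult B (bstar B a) b \<in> pts (fib B 0)"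
  using mult_closed[OF star_closed] by fastforce

lemma unit_star_closed: "a \<in> pts (fib B 0) \<Longrightarrow> bstar B a \<in> pts (fib B 0)"
  using star_closed[of a 0] by simp

lemma mult_add_left:
  assumes "a \<in> pts (fib B s)" "a' \<in> pts (fib B s)" "b \<in> pts (fib B t)" "s + t = r"
  shows "bmult B (vadd (fib B s) a a') b = vadd (fib B r) (bmult B a b) (bmult B a' b)"
  using mult_left_linear[OF assms(3), of s] assms unfolding linear_on_def by blast

lemma mult_add_right:
  assumes "a \<in> pts (fib B s)" "b \<in> pts (fib B t)" "b' \<in> pts (fib B t)" "s + t = r"
  shows "bmult B a (vadd (fib B t) b b') = vadd (fib B r) (bmult B a b) (bmult B a b')"
  using mult_right_linear[OF assms(1), of t] assms unfolding linear_on_def by blast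

lemma mult_scale_left:
  assumes "a \<in> pts (fib B s)" "b \<in> pts (fib B t)" "s + t = r"
  shows "bmult B (vscale (fib B s) c a) b = vscale (fib B r) c (bmult B a b)"
  using mult_left_linear[OF assms(2), of s] assms unfolding linear_on_def by blast

lemma mult_scale_right:
  assumes "a \<in> pts (fib B s)" "b \<in> pts (fib B t)" "s + t = r"
  shows "bmult B a (vscale (fib B t) c b) = vscale (fib B r) c (bmult B a b)"
  using mult_right_linear[OF assms(1), of t] assms unfolding linear_on_def by blast

lemma mult_diff_right:
  assumes "a \<in> pts (fib B s)" "b \<in> pts (fib B t)" "b' \<in> pts (fib B t)" "s + t = r"
  shows "bmult B a (vdiff (fib B t) b b') = vdiff (fib B r) (bmult B a b) (bmult B a b')"
  using linear_on_diff[OF fib.vspace_axioms mult_right_linear[OF assms(1)] assms(2,3)] assms(4) by simp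

lemma mult_zero_left: "b \<in> pts (fib B t) \<Longrightarrow> s + t = r \<Longrightarrow> bmult B (vzero (fib B s)) b = vzero (fib B r)"
  using linear_on_zero[OF fib.vspace_axioms fib.vspace_axioms mult_left_linear] by blast

lemma mult_zero_right: "a \<in> pts (fib B s) \<Longrightarrow> s + t = r \<Longrightarrow> bmult B a (vzero (fib B t)) = vzero (fib B r)"
  using linear_on_zero[OF fib.vspace_axioms fib.vspace_axioms mult_right_linear] by blast

lemma star_zero: "- t = r \<Longrightarrow> bstar B (vzero (fib B t)) = vzero (fib B r)"
  using conj_linear_on_zero[OF fib.vspace_axioms fib.vspace_axioms star_conj_linear] by blast

lemma star_add:
  "a \<in> pts (fib B t) \<Longrightarrow> b \<in> pts (fib B t) \<Longrightarrow> - t = r \<Longrightarrow>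
    bstar B (vadd (fib B t) a b) = vadd (fib B r) (bstar B a) (bstar B b)"
  using star_conj_linear[of t] unfolding conj_linear_on_def by blast

lemma star_scale:
  "a \<in> pts (fib B t) \<Longrightarrow> - t = r \<Longrightarrow> bstar B (vscale (fib B t) c a) = vscale (fib B r) (cnj c) (bstar B a)"
  using star_conj_linear[of t] unfolding conj_linear_on_def by blast

text \<open>
  The unit fibre is neither unital nor a type. Acting on the bundle by the unital free star algebra
  over the alphabet \<open>'b\<close> makes the type class results above applicable.
\<close>

definition letter_val :: "'b \<Rightarrow> 'b" where
  "letter_val a = (if a \<in> pts (fib B 0) then a else vzero (fib B 0))"

text \<open>Every element of the type is a letter. Those outside the unit fibre act as zero and are
  fixed by the star, so that the star is an involution of the whole alphabet and still matches the
  involution of the bundle on values.\<close>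

definition letter_star :: "'b \<Rightarrow> 'b" where
  "letter_star a = (if a \<in> pts (fib B 0) then bstar B a else a)"

abbreviation fstar :: "('b word \<Rightarrow>\<^sub>0 complex) \<Rightarrow> ('b word \<Rightarrow>\<^sub>0 complex)" where
  "fstar \<equiv> free_star letter_star"

lemma letter_val_closed [simp]: "letter_val a \<in> pts (fib B 0)"
  by (simp add: letter_val_def)

lemma letter_star_star: "letter_star (letter_star a) = a"
  by (simp add: letter_star_def unit_star_closed)

lemma letter_val_star: "letter_val (letter_star a) = bstar B (letter_val a)"
  by (simp add: letter_val_def letter_star_def unit_star_closed star_zero)

definition word_act :: "'b word \<Rightarrow> 'b \<Rightarrow> 'b" where
  "word_act w u = foldr (\<lambda>a. bmult B (letter_val a)) (letters w) u"

text \<open>The free algebra acts on every fibre, not just on the unit fibre: the regular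
  representation requires compressions of \<open>p\<close> by elements of arbitrary degree.\<close>

definition act :: "'g \<Rightarrow> ('b word \<Rightarrow>\<^sub>0 complex) \<Rightarrow> 'b \<Rightarrow> 'b" where
  "act t p u = vsum (fib B t) (\<lambda>w. vscale (fib B t) (Poly_Mapping.lookup p w) (word_act w u)) (Poly_Mapping.keys p)"

lemma word_act_Cons: "word_act (Word (a # as)) u = bmult B (letter_val a) (word_act (Word as) u)"
  by (simp add: word_act_def)

lemma word_act_Nil [simp]: "word_act (Word []) u = u"
  by (simp add: word_act_def)

lemma word_act_plus: "word_act (v + w) u = word_act v (word_act w u)"
  by (simp add: word_act_def plus_word_def)

lemma word_act_closed [simp]: "u \<in> pts (fib B t) \<Longrightarrow> word_act (Word as) u \<in> pts (fib B t)"
  by (induction as) (simp_all add: word_act_Cons unit_mult_closed)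

lemma word_act_closed' [simp]: "u \<in> pts (fib B t) \<Longrightarrow> word_act w u \<in> pts (fib B t)"
  by (cases w) simp

lemma word_act_add:
  "u \<in> pts (fib B t) \<Longrightarrow> v \<in> pts (fib B t) \<Longrightarrow>
    word_act (Word as) (vadd (fib B t) u v) = vadd (fib B t) (word_act (Word as) u) (word_act (Word as) v)"
  by (induction as) (simp_all add: word_act_Cons mult_add_right[where s = 0 and t = t and r = t])

lemma word_act_scale:
  "u \<in> pts (fib B t) \<Longrightarrow> word_act (Word as) (vscale (fib B t) c u) = vscale (fib B t) c (word_act (Word as) u)"
  by (induction as) (simp_all add: word_act_Cons mult_scale_right[where s = 0 and t = t and r = t])

lemma word_act_mult:
  "u \<in> pts (fib B s) \<Longrightarrow> v \<in> pts (fib B t) \<Longrightarrow> word_act (Word as) (bmult B u v) = bmult B (word_act (Word as) u) v"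
  by (induction as) (simp_all add: word_act_Cons mult_assoc[where s = 0 and t = s and r = t])

lemma word_act_append: "word_act (Word (as @ bs)) u = word_act (Word as) (word_act (Word bs) u)"
  by (simp add: word_act_def)

lemma word_act_star:
  assumes "v \<in> pts (fib B t)"
  shows "u \<in> pts (fib B s) \<Longrightarrow>
    bmult B (bstar B (word_act (Word as) u)) v = bmult B (bstar B u) (word_act (Word (rev (map letter_star as))) v)"
  using assms
\<comment> \<open>Each letter taken off the left factor is absorbed into \<open>v\<close>, hence the
  generalisation.\<close>
proof (induction as arbitrary: v)
  case (Cons a as)
  let ?w = "word_act (Word as) u" and ?a = "letter_val a"
  have w: "?w \<in> pts (fib B s)" using Cons by simp
  have "bmult B (bstar B (word_act (Word (a # as)) u)) v = bmult B (bmult B (bstar B ?w) (bstar B ?a)) v"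
    using star_mult[OF letter_val_closed w] by (simp only: word_act_Cons)
  also have "\<dots> = bmult B (bstar B ?w) (bmult B (bstar B ?a) v)"
    using w by (intro mult_assoc[of _ "-s" _ 0 _ t] star_closed unit_star_closed Cons) simp_all
  also have "\<dots> = bmult B (bstar B u) (word_act (Word (rev (map letter_star as))) (bmult B (bstar B ?a) v))"
    using Cons by (intro Cons.IH) (simp_all add: unit_mult_closed unit_star_closed)
  also have "word_act (Word (rev (map letter_star as))) (bmult B (bstar B ?a) v)
      = word_act (Word (rev (map letter_star (a # as)))) v"
    by (simp add: word_act_append word_act_Cons letter_val_star)
  finally show ?case .
qed simp

lemma act_eq_vsum:
  assumes "u \<in> pts (fib B t)" "finite K" "Poly_Mapping.keys p \<subseteq> K"
  shows "act t p u = vsum (fib B t) (\<lambda>w. vscale (fib B t) (Poly_Mapping.lookup p w) (word_act w u)) K"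
  unfolding act_def using assms
  by (intro fib.add.finprod_mono_neutral_cong_left) (auto simp: in_keys_iff)

lemma act_closed [simp]: "u \<in> pts (fib B t) \<Longrightarrow> act t p u \<in> pts (fib B t)"
  unfolding act_def by (intro fib.add.finprod_closed) auto

lemma act_plus:
  assumes "u \<in> pts (fib B t)"
  shows "act t (p + q) u = vadd (fib B t) (act t p u) (act t q u)"
proof -
  let ?K = "Poly_Mapping.keys p \<union> Poly_Mapping.keys q"
  have "Poly_Mapping.keys (p + q) \<subseteq> ?K" by (rule keys_add)
  then have "act t (p + q) u = vsum (fib B t) (\<lambda>w. vadd (fib B t) (vscale (fib B t) (Poly_Mapping.lookup p w) (word_act w u))
      (vscale (fib B t) (Poly_Mapping.lookup q w) (word_act w u))) ?K"
    using assms by (subst act_eq_vsum[of u t ?K]) (auto simp: lookup_add fib.add_scale)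
  also have "\<dots> = vadd (fib B t) (vsum (fib B t) (\<lambda>w. vscale (fib B t) (Poly_Mapping.lookup p w) (word_act w u)) ?K)
     (vsum (fib B t) (\<lambda>w. vscale (fib B t) (Poly_Mapping.lookup q w) (word_act w u)) ?K)"
    using assms by (intro fib.add.finprod_multf) auto
  also have "\<dots> = vadd (fib B t) (act t p u) (act t q u)"
    using assms by (subst (1 2) act_eq_vsum[of u t ?K]) auto
  finally show ?thesis .
qed

lemma act_single:
  "u \<in> pts (fib B t) \<Longrightarrow> act t (Poly_Mapping.single w c) u = vscale (fib B t) c (word_act w u)"
  by (subst act_eq_vsum[of u t "{w}"]) auto

lemma act_add:
  assumes "u \<in> pts (fib B t)" "v \<in> pts (fib B t)"
  shows "act t p (vadd (fib B t) u v) = vadd (fib B t) (act t p u) (act t p v)"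
proof (induction p rule: poly_mapping_induct)
  case (single w c)
  show ?case using assms by (cases w) (simp add: act_single word_act_add fib.scale_add)
next
  case (sum p q)
  then show ?case using assms by (simp add: act_plus fib.add.m_ac)
qed

lemma act_scale:
  assumes "u \<in> pts (fib B t)"
  shows "act t p (vscale (fib B t) c u) = vscale (fib B t) c (act t p u)"
proof (induction p rule: poly_mapping_induct)
  case (single w d)
  show ?case using assms
    by (cases w) (simp add: act_single word_act_scale mult.commute flip: fib.scale_mult)
next
  case (sum p q)
  then show ?case using assms by (simp add: act_plus fib.scale_add)
qed

lemma act_times:
  assumes "u \<in> pts (fib B t)"
  shows "act t (p * q) u = act t p (act t q u)"
proof (induction p rule: poly_mapping_induct)
  case (single v c)
  show ?case
  proof (induction q rule: poly_mapping_induct)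
    case (single w d)
    show ?case using assms
      by (cases v) (simp add: act_single mult_single word_act_plus word_act_scale fib.scale_mult)
  next
    case (sum p q)
    then show ?case using assms by (simp add: distrib_left act_plus act_add)
  qed
next
  case (sum p p')
  then show ?case using assms by (simp add: distrib_right act_plus)
qed

lemma act_one: "u \<in> pts (fib B t) \<Longrightarrow> act t 1 u = u"
  by (simp add: act_single zero_word_def flip: single_one)

lemma act_scalar: "u \<in> pts (fib B t) \<Longrightarrow> act t (Poly_Mapping.single 0 c) u = vscale (fib B t) c u"
  by (simp add: act_single zero_word_def)

lemma act_scaleR: "u \<in> pts (fib B t) \<Longrightarrow> act t (r *\<^sub>R p) u = vscale (fib B t) (of_real r) (act t p u)"
  by (simp add: scaleR_poly_mapping_def act_times act_scalar)

lemma act_minus: "u \<in> pts (fib B t) \<Longrightarrow> act t (- p) u = vscale (fib B t) (-1) (act t p u)"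
  using act_scaleR[of u t "-1" p] by simp

lemma act_diff: "u \<in> pts (fib B t) \<Longrightarrow> act t (p - q) u = vdiff (fib B t) (act t p u) (act t q u)"
  using act_plus[of u t p "- q"] by (simp add: act_minus vdiff_def)

lemma act_mult:
  assumes "u \<in> pts (fib B s)" "v \<in> pts (fib B t)" "s + t = r"
  shows "act r p (bmult B u v) = bmult B (act s p u) v"
proof (induction p rule: poly_mapping_induct)
  case (single w c)
  show ?case using assms mult_closed'[OF assms]
    by (cases w) (simp add: act_single word_act_mult mult_scale_left)
next
  case (sum p q)
  then show ?case using assms mult_closed'[OF assms] by (simp add: act_plus mult_add_left)
qed

lemma act_star:
  assumes "u \<in> pts (fib B s)" "v \<in> pts (fib B t)"
  shows "bmult B (bstar B (act s p u)) v = bmult B (bstar B u) (act t (fstar p) v)"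
proof (induction p rule: poly_mapping_induct)
  case (single w c)
  obtain as where w: "w = Word as" by (cases w)
  have "bmult B (bstar B (act s (Poly_Mapping.single w c) u)) v
      = vscale (fib B (- s + t)) (cnj c) (bmult B (bstar B (word_act w u)) v)"
    using assms by (simp add: act_single star_scale[of _ s] mult_scale_left[OF star_closed])
  also have "\<dots> = vscale (fib B (- s + t)) (cnj c) (bmult B (bstar B u) (word_act (Word (rev (map letter_star as))) v))"
    using assms by (simp add: w word_act_star)
  also have "\<dots> = bmult B (bstar B u) (act t (fstar (Poly_Mapping.single w c)) v)"
    using assms by (simp add: w act_single free_star_single mult_scale_right[OF star_closed])
  finally show ?case .
next
  case (sum p q)
  have "bmult B (bstar B (act s (p + q) u)) v
      = vadd (fib B (- s + t)) (bmult B (bstar B (act s p u)) v) (bmult B (bstar B (act s q u)) v)"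
    using assms by (simp add: act_plus star_add[of _ s] mult_add_left[of _ "- s"] star_closed)
  also have "\<dots> = bmult B (bstar B u) (act t (fstar (p + q)) v)"
    using assms by (simp add: sum free_star_add act_plus mult_add_right[of _ "-s"] star_closed)
  finally show ?case .
qed

text \<open>Some bound is enough: it makes the supremum in \<open>mnorm\<close> meaningful. The
  sharp constant on an arbitrary fibre follows in \<open>norm_act_fibre\<close>.\<close>

lemma act_bounded: "\<exists>C\<ge>0. \<forall>u\<in>pts (fib B t). nm t (act t p u) \<le> C * nm t u"
proof (induction p rule: poly_mapping_induct)
  case (single w c)
  have "\<exists>C\<ge>0. \<forall>u\<in>pts (fib B t). nm t (word_act (Word as) u) \<le> C * nm t u" for as
  proof (induction as)
    case (Cons a as)
    then obtain C where C: "0 \<le> C" "\<And>u. u \<in> pts (fib B t) \<Longrightarrow> nm t (word_act (Word as) u) \<le> C * nm t u" by blast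
    have "nm t (word_act (Word (a # as)) u) \<le> (nm 0 (letter_val a) * C) * nm t u" if u: "u \<in> pts (fib B t)" for u
    proof -
      have "nm t (word_act (Word (a # as)) u) \<le> nm 0 (letter_val a) * nm t (word_act (Word as) u)"
        using norm_mult[of "letter_val a" 0 "word_act (Word as) u" t] u by (simp add: word_act_Cons)
      also have "\<dots> \<le> nm 0 (letter_val a) * (C * nm t u)" using C(2)[OF u] by (intro mult_left_mono) simp_all
      finally show ?thesis by (simp add: mult.assoc)
    qed
    then show ?case using C(1) by (intro exI[of _ "nm 0 (letter_val a) * C"]) simp
  qed (auto intro: exI[of _ 1])
  then obtain C where C: "0 \<le> C" "\<And>u. u \<in> pts (fib B t) \<Longrightarrow> nm t (word_act w u) \<le> C * nm t u"
    by (metis word.exhaust)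
  have "nm t (act t (Poly_Mapping.single w c) u) \<le> (cmod c * C) * nm t u" if "u \<in> pts (fib B t)" for u
    using mult_left_mono[OF C(2)[OF that], of "cmod c"] that by (simp add: act_single fib.norm_scale mult.assoc)
  then show ?case using C(1) by (intro exI[of _ "cmod c * C"]) simp
next
  case (sum p q)
  then obtain C D where C: "0 \<le> C" "\<And>u. u \<in> pts (fib B t) \<Longrightarrow> nm t (act t p u) \<le> C * nm t u"
    and D: "0 \<le> D" "\<And>u. u \<in> pts (fib B t) \<Longrightarrow> nm t (act t q u) \<le> D * nm t u" by blast
  have "nm t (act t (p + q) u) \<le> (C + D) * nm t u" if u: "u \<in> pts (fib B t)" for u
    using fib.norm_triangle[OF act_closed[OF u] act_closed[OF u], of p q] C(2)[OF u] D(2)[OF u]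
    by (simp add: act_plus u distrib_right)
  then show ?case using C(1) D(1) by (intro exI[of _ "C + D"]) simp
qed

end

section \<open>The operator seminorm of the free algebra and positivity in the unit fibre\<close>

context fell
begin

text \<open>The operator norm on the unit fibre as a Banach space. Nonempty words act as left
  multiplications by elements of the fibre, so modulo the kernel of the action the polynomials are
  the unit fibre with scalars adjoined.\<close>

definition mnorm :: "('b word \<Rightarrow>\<^sub>0 complex) \<Rightarrow> real" where
  "mnorm p = Sup {nm 0 (act 0 p u) | u. u \<in> pts (fib B 0) \<and> nm 0 u \<le> 1}"

lemma mnorm_bdd: "bdd_above {nm 0 (act 0 p u) | u. u \<in> pts (fib B 0) \<and> nm 0 u \<le> 1}"
proof -
  obtain C where C: "0 \<le> C" "\<And>u. u \<in> pts (fib B 0) \<Longrightarrow> nm 0 (act 0 p u) \<le> C * nm 0 u"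
    using act_bounded by blast
  show ?thesis
  proof (rule bdd_aboveI[of _ C])
    fix x assume "x \<in> {nm 0 (act 0 p u) | u. u \<in> pts (fib B 0) \<and> nm 0 u \<le> 1}"
    then obtain u where u: "u \<in> pts (fib B 0)" "nm 0 u \<le> 1" "x = nm 0 (act 0 p u)" by blast
    then show "x \<le> C" using C(2)[OF u(1)] mult_left_le[OF u(2) C(1)] by simp
  qed
qed

lemma norm_act:
  assumes u: "u \<in> pts (fib B 0)"
  shows "nm 0 (act 0 p u) \<le> mnorm p * nm 0 u"
proof (cases "nm 0 u = 0")
  case True
  obtain C where "nm 0 (act 0 p u) \<le> C * nm 0 u" using act_bounded u by blast
  then show ?thesis using True by simp
next
  case False
  then have pos: "0 < nm 0 u" using u by (simp add: less_le)
  let ?v = "vscale (fib B 0) (of_real (1 / nm 0 u)) u"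
  have "nm 0 ?v = 1" using u pos by (simp add: fib.norm_scale norm_divide)
  then have "nm 0 (act 0 p ?v) \<le> mnorm p"
    unfolding mnorm_def using u by (intro cSup_upper[OF _ mnorm_bdd]) auto
  moreover have "nm 0 (act 0 p ?v) = nm 0 (act 0 p u) / nm 0 u"
    using u pos by (simp add: act_scale fib.norm_scale norm_divide)
  ultimately show ?thesis using pos by (simp add: pos_divide_le_eq)
qed

lemma mnorm_le:
  assumes "0 \<le> C" "\<And>u. u \<in> pts (fib B 0) \<Longrightarrow> nm 0 (act 0 p u) \<le> C * nm 0 u"
  shows "mnorm p \<le> C"
  unfolding mnorm_def
proof (rule cSup_least)
  show "{nm 0 (act 0 p u) | u. u \<in> pts (fib B 0) \<and> nm 0 u \<le> 1} \<noteq> {}"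
    using fib.zero_closed[of 0] by force
next
  fix x assume "x \<in> {nm 0 (act 0 p u) | u. u \<in> pts (fib B 0) \<and> nm 0 u \<le> 1}"
  then obtain u where u: "u \<in> pts (fib B 0)" "nm 0 u \<le> 1" "x = nm 0 (act 0 p u)" by blast
  then show "x \<le> C" using assms(2)[OF u(1)] mult_left_le[OF u(2) assms(1)] by simp
qed

lemma mnorm_nonneg: "0 \<le> mnorm p"
proof -
  have "nm 0 (act 0 p (vzero (fib B 0))) \<le> mnorm p"
    unfolding mnorm_def by (intro cSup_upper[OF _ mnorm_bdd]) (auto intro: exI[of _ "vzero (fib B 0)"])
  moreover have "0 \<le> nm 0 (act 0 p (vzero (fib B 0)))" by simp
  ultimately show ?thesis by linarith
qed

lemma mnorm_scaleR_le: "mnorm (r *\<^sub>R p) \<le> \<bar>r\<bar> * mnorm p"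
proof (rule mnorm_le)
  show "0 \<le> \<bar>r\<bar> * mnorm p" using mnorm_nonneg by simp
  fix u assume u: "u \<in> pts (fib B 0)"
  show "nm 0 (act 0 (r *\<^sub>R p) u) \<le> \<bar>r\<bar> * mnorm p * nm 0 u"
    using mult_left_mono[OF norm_act[OF u, of p] abs_ge_zero[of r]] u by (simp add: act_scaleR fib.norm_scale mult.assoc)
qed

lemma norm_mult_star:
  assumes "a \<in> pts (fib B t)"
  shows "nm 0 (bmult B a (bstar B a)) = (nm t a)\<^sup>2"
  using norm_star_mult[OF star_closed[OF assms]] assms by simp

sublocale free: cstar_seminorm fstar mnorm "Poly_Mapping.single 0 \<i>"
proof
  fix p q :: "'b word \<Rightarrow>\<^sub>0 complex" and r :: real
  show "fstar (p + q) = fstar p + fstar q" by (rule free_star_add)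
  show "fstar (r *\<^sub>R p) = r *\<^sub>R fstar p" by (rule free_star_scaleR)
  show "fstar (p * q) = fstar q * fstar p" by (rule free_star_mult)
  show "fstar (fstar p) = p" by (rule free_star_star) (rule letter_star_star)
  show "Poly_Mapping.single 0 \<i> * p = p * Poly_Mapping.single 0 \<i>"
    by (induction p rule: poly_mapping_induct) (simp_all add: mult_single mult.commute distrib_left distrib_right)
  show "Poly_Mapping.single 0 \<i> * Poly_Mapping.single 0 \<i> = - (1 :: 'b word \<Rightarrow>\<^sub>0 complex)"
    by (simp add: mult_single single_uminus flip: single_one)
  show "fstar (Poly_Mapping.single 0 \<i>) = - Poly_Mapping.single 0 \<i>"
    by (simp add: free_star_single zero_word_def single_uminus)
  show "0 \<le> mnorm p" by (rule mnorm_nonneg)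
  show "mnorm (p + q) \<le> mnorm p + mnorm q"
  proof (rule mnorm_le)
    fix u assume u: "u \<in> pts (fib B 0)"
    show "nm 0 (act 0 (p + q) u) \<le> (mnorm p + mnorm q) * nm 0 u"
      using fib.norm_triangle[OF act_closed[OF u] act_closed[OF u], of p q] norm_act[OF u, of p] norm_act[OF u, of q]
      by (simp add: act_plus[OF u] distrib_right)
  qed (simp add: mnorm_nonneg)
  show "mnorm (r *\<^sub>R p) = \<bar>r\<bar> * mnorm p"
  proof (cases "r = 0")
    case True
    then show ?thesis using mnorm_scaleR_le[of 0 p] mnorm_nonneg[of "0 *\<^sub>R p"] by simp
  next
    case False
    have "\<bar>r\<bar> * mnorm p = \<bar>r\<bar> * mnorm ((1 / r) *\<^sub>R (r *\<^sub>R p))" using False by simp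
    also have "\<dots> \<le> \<bar>r\<bar> * (\<bar>1 / r\<bar> * mnorm (r *\<^sub>R p))" by (intro mult_left_mono mnorm_scaleR_le) simp
    also have "\<dots> = mnorm (r *\<^sub>R p)" using False by (simp add: abs_divide)
    finally show ?thesis using mnorm_scaleR_le[of r p] by linarith
  qed
  show "mnorm (p * q) \<le> mnorm p * mnorm q"
  proof (rule mnorm_le)
    fix u assume u: "u \<in> pts (fib B 0)"
    have "nm 0 (act 0 (p * q) u) \<le> mnorm p * nm 0 (act 0 q u)"
      using norm_act[of "act 0 q u" p] u by (simp add: act_times)
    also have "\<dots> \<le> mnorm p * (mnorm q * nm 0 u)" by (intro mult_left_mono norm_act u mnorm_nonneg)
    finally show "nm 0 (act 0 (p * q) u) \<le> mnorm p * mnorm q * nm 0 u" by (simp add: mult.assoc)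
  qed (simp add: mnorm_nonneg)
  show "mnorm 1 \<le> 1" by (rule mnorm_le) (simp_all add: act_one)
  show "mnorm (Poly_Mapping.single 0 \<i>) \<le> 1" by (rule mnorm_le) (simp_all add: act_scalar fib.norm_scale)
  \<comment> \<open>Moving \<open>p\<close> across the star gives
    \<open>(p u)^* (p u) = u^* (p^* p u)\<close>, so the C*-identity of the bundle for
    \<open>p u\<close> yields the inequality for \<open>p\<close>.\<close>
  show "(mnorm p)\<^sup>2 \<le> mnorm (fstar p * p)"
  proof -
    have "mnorm p \<le> sqrt (mnorm (fstar p * p))"
    proof (rule mnorm_le)
      fix u assume u: "u \<in> pts (fib B 0)"
      have "(nm 0 (act 0 p u))\<^sup>2 = nm 0 (bmult B (bstar B (act 0 p u)) (act 0 p u))"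
        using norm_star_mult[OF act_closed[OF u], of p] by simp
      also have "\<dots> = nm 0 (bmult B (bstar B u) (act 0 (fstar p * p) u))"
        using u by (simp add: act_star[where s = 0 and t = 0] act_times)
      also have "\<dots> \<le> nm 0 u * nm 0 (act 0 (fstar p * p) u)"
        using norm_mult[of "bstar B u" "0" "act 0 (fstar p * p) u" 0] norm_star[OF u] u
        by (simp add: unit_star_closed)
      also have "\<dots> \<le> nm 0 u * (mnorm (fstar p * p) * nm 0 u)"
        using u by (intro mult_left_mono norm_act) simp_all
      finally have "(nm 0 (act 0 p u))\<^sup>2 \<le> (sqrt (mnorm (fstar p * p)) * nm 0 u)\<^sup>2"
        using mnorm_nonneg by (simp add: power_mult_distrib power2_eq_square mult_ac)
      then show "nm 0 (act 0 p u) \<le> sqrt (mnorm (fstar p * p)) * nm 0 u"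
        by (rule power2_le_imp_le) (use u mnorm_nonneg in simp)
    qed (simp add: mnorm_nonneg)
    then have "(mnorm p)\<^sup>2 \<le> (sqrt (mnorm (fstar p * p)))\<^sup>2" by (rule power_mono) (rule mnorm_nonneg)
    then show ?thesis using mnorm_nonneg by simp
  qed
qed

lemma mnorm_eq_zero:
  assumes "\<And>u. u \<in> pts (fib B 0) \<Longrightarrow> act 0 p u = act 0 q u"
  shows "mnorm (p - q) = 0"
proof -
  have "mnorm (p - q) \<le> 0" by (rule mnorm_le) (simp_all add: act_diff assms)
  then show ?thesis using mnorm_nonneg[of "p - q"] by linarith
qed

definition letter :: "'b \<Rightarrow> ('b word \<Rightarrow>\<^sub>0 complex)" where
  "letter a = Poly_Mapping.single (Word [a]) 1"

lemma act_letter: "a \<in> pts (fib B 0) \<Longrightarrow> u \<in> pts (fib B t) \<Longrightarrow> act t (letter a) u = bmult B a u"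
  by (simp add: letter_def act_single word_act_Cons letter_val_def unit_mult_closed)

lemma fstar_letter: "a \<in> pts (fib B 0) \<Longrightarrow> fstar (letter a) = letter (bstar B a)"
  by (simp add: letter_def free_star_single letter_star_def)

text \<open>The lower bound comes from testing left multiplication by \<open>a\<close> on the
  adjoint of \<open>a\<close>.\<close>

lemma mnorm_letter:
  assumes a: "a \<in> pts (fib B 0)"
  shows "mnorm (letter a) = nm 0 a"
proof (rule antisym)
  show "mnorm (letter a) \<le> nm 0 a"
    by (rule mnorm_le) (use a norm_mult[OF a, of _ 0] in \<open>simp_all add: act_letter\<close>)
  have "(nm 0 a)\<^sup>2 \<le> mnorm (letter a) * nm 0 a"
    using norm_act[OF unit_star_closed[OF a], of "letter a"] norm_star[OF a] norm_mult_star[OF a] a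
    by (simp add: act_letter unit_star_closed)
  then show "nm 0 a \<le> mnorm (letter a)"
    using fib.norm_nonneg[OF a] mnorm_nonneg[of "letter a"] by (cases "nm 0 a = 0") (simp_all add: power2_eq_square)
qed

text \<open>The working notion of positivity. Unlike \<open>unit_fibre_positive\<close>, which asks
  for the form \<open>c^* c\<close>, it is at once stable under sums and limits; the Kelley-Vaught
  theorem leads from the one to the other.\<close>

definition positive :: "'b \<Rightarrow> bool" where
  "positive a \<longleftrightarrow> a \<in> pts (fib B 0) \<and> free.pos (letter a)"

text \<open>Different polynomials can act alike, for instance \<open>letter a + letter b\<close> and
  the letter of the sum. Their \<open>mnorm\<close> distance is then zero, and positivity is
  closed.\<close>

lemma pos_cong:
  assumes "free.pos p" "fstar q = q" "\<And>u. u \<in> pts (fib B 0) \<Longrightarrow> act 0 p u = act 0 q u"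
  shows "free.pos q"
  by (rule free.pos_limit) (use assms mnorm_eq_zero[of p q] in auto)

lemma positive_star: "positive a \<Longrightarrow> bstar B a = a"
proof -
  assume a: "positive a"
  then have "letter (bstar B a) = letter a"
    using free.pos_sa[of "letter a"] fstar_letter[of a] by (simp add: positive_def)
  \<comment> \<open>Both sides are monomials with coefficient 1, so comparing the coefficients at
    one word forces the two letters to be equal.\<close>
  then have "Poly_Mapping.lookup (letter (bstar B a)) (Word [a]) = Poly_Mapping.lookup (letter a) (Word [a])"
    by (simp only:)
  then show ?thesis by (simp add: letter_def lookup_single when_def split: if_splits)
qed

lemma positiveI:
  assumes "a \<in> pts (fib B 0)" "bstar B a = a" "free.pos p" "\<And>u. u \<in> pts (fib B 0) \<Longrightarrow> act 0 p u = bmult B a u"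
  shows "positive a"
  unfolding positive_def using assms
  by (auto intro!: pos_cong[of p "letter a"] simp: fstar_letter act_letter)

lemma positive_closed: "positive a \<Longrightarrow> a \<in> pts (fib B 0)"
  by (simp add: positive_def)

lemma positive_add: "positive a \<Longrightarrow> positive b \<Longrightarrow> positive (vadd (fib B 0) a b)"
  by (rule positiveI[of _ "letter a + letter b"])
    (auto simp: positive_closed star_add[where t = 0 and r = 0] positive_star act_plus act_letter
      mult_add_left[where s = 0] positive_def free.pos_add)

lemma positive_scale: "positive a \<Longrightarrow> 0 \<le> r \<Longrightarrow> positive (vscale (fib B 0) (of_real r) a)"
  by (rule positiveI[of _ "r *\<^sub>R letter a"])
    (auto simp: positive_closed star_scale[where t = 0 and r = 0] positive_star act_scaleR act_letter
      mult_scale_left[where s = 0] positive_def free.pos_scaleR)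

lemma positive_zero: "positive (vzero (fib B 0))"
  by (rule positiveI[of _ 0])
    (auto simp: star_zero mult_zero_left[where s = 0] free.pos_zero act_def)

lemma positive_vsum:
  assumes "\<And>i. i \<in> I \<Longrightarrow> positive (f i)"
  shows "positive (vsum (fib B 0) f I)"
  using assms
proof (induction I rule: infinite_finite_induct)
  case (insert i I)
  have "vsum (fib B 0) f (insert i I) = vadd (fib B 0) (f i) (vsum (fib B 0) f I)"
    using insert by (intro fib.add.finprod_insert) (auto simp: positive_closed)
  then show ?case using insert by (simp add: positive_add)
qed (simp_all add: positive_zero)

lemma star_mult_self: "a \<in> pts (fib B t) \<Longrightarrow> bstar B (bmult B (bstar B a) a) = bmult B (bstar B a) a"
  using star_mult[OF star_closed] by simp

text \<open>The Fell bundle axiom replaces \<open>a\<close>, of any degree, by some \<open>c\<close>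
  in the unit fibre with the same \<open>c^* c\<close>; for \<open>c\<close> the Kelley-Vaught
  theorem applies in the free algebra.\<close>

lemma positive_star_mult:
  assumes "a \<in> pts (fib B t)"
  shows "positive (bmult B (bstar B a) a)"
proof -
  obtain c where c: "c \<in> pts (fib B 0)" "bmult B (bstar B a) a = bmult B (bstar B c) c"
    using star_mult_positive[OF assms] by (auto simp: unit_fibre_positive_def)
  have "positive (bmult B (bstar B c) c)"
  proof (rule positiveI[of _ "fstar (letter c) * letter c"])
    fix u assume "u \<in> pts (fib B 0)"
    then show "act 0 (fstar (letter c) * letter c) u = bmult B (bmult B (bstar B c) c) u"
      using c by (simp add: act_times fstar_letter act_letter unit_star_closed unit_mult_closed mult_assoc[where s = 0 and t = 0 and r = 0])
  qed (use c in \<open>simp_all add: star_mult_closed star_mult_self free.pos_star_mult\<close>)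
  then show ?thesis by (simp add: c)
qed

text \<open>The letter of a difference and the difference of letters act alike, which transfers
  \<open>pos_mono\<close> from the free algebra.\<close>

lemma positive_norm_mono:
  assumes "positive a" "b \<in> pts (fib B 0)" "positive (vdiff (fib B 0) b a)"
  shows "nm 0 a \<le> nm 0 b"
proof -
  have "b = vadd (fib B 0) (vdiff (fib B 0) b a) a"
    using assms by (simp add: fib.add_diff positive_closed)
  then have b: "bstar B b = b" using positive_add[OF assms(3,1)] positive_star by simp
  have "free.pos (letter b - letter a)"
  proof (rule pos_cong[of "letter (vdiff (fib B 0) b a)"])
    show "fstar (letter b - letter a) = letter b - letter a"
      using assms b by (simp add: free.st_diff fstar_letter positive_closed positive_star)
    fix u assume u: "u \<in> pts (fib B 0)"
    show "act 0 (letter (vdiff (fib B 0) b a)) u = act 0 (letter b - letter a) u"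
      using assms u linear_on_diff[OF fib.vspace_axioms mult_left_linear[OF u, of 0], of b a]
      by (simp add: act_diff act_letter positive_closed)
  qed (use assms in \<open>simp add: positive_def\<close>)
  then have "mnorm (letter a) \<le> mnorm (letter b)"
    using assms(1) by (intro free.pos_mono) (simp_all add: positive_def)
  then show ?thesis using assms by (simp add: mnorm_letter positive_closed)
qed

lemma positive_limit:
  assumes a: "a \<in> pts (fib B 0)" "bstar B a = a"
    and lim: "\<And>e. 0 < e \<Longrightarrow> \<exists>k. positive k \<and> nm 0 (vdiff (fib B 0) k a) \<le> e"
  shows "positive a"
proof -
  have "free.pos (letter a)"
  proof (rule free.pos_limit)
    fix e :: real assume "0 < e"
    then obtain k where k: "positive k" "nm 0 (vdiff (fib B 0) k a) \<le> e" using lim by blast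
    have "mnorm (letter k - letter a) \<le> nm 0 (vdiff (fib B 0) k a)"
    proof (rule mnorm_le)
      fix u assume u: "u \<in> pts (fib B 0)"
      have "act 0 (letter k - letter a) u = bmult B (vdiff (fib B 0) k a) u"
        using u k a linear_on_diff[OF fib.vspace_axioms mult_left_linear[OF u, of 0], of k a]
        by (simp add: act_diff act_letter positive_closed)
      then show "nm 0 (act 0 (letter k - letter a) u) \<le> nm 0 (vdiff (fib B 0) k a) * nm 0 u"
        using norm_mult[of "vdiff (fib B 0) k a" 0 u 0] u k a by (simp add: positive_closed)
    qed (use k a in \<open>simp add: positive_closed\<close>)
    then show "\<exists>p. free.pos p \<and> mnorm (p - letter a) \<le> e"
      using k by (intro exI[of _ "letter k"]) (simp add: positive_def)
  qed (simp add: fstar_letter a)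
  then show ?thesis using a by (simp add: positive_def)
qed

text \<open>With \<open>y = p x\<close>, the element \<open>y y^*\<close> lies in the unit fibre and
  equals \<open>p (x y^* )\<close>; bounding \<open>p\<close> there, passing to the adjoint
  \<open>y x^* = p (x x^* )\<close> and bounding once more gives the square of the claim.\<close>

lemma norm_act_fibre:
  assumes x: "x \<in> pts (fib B t)"
  shows "nm t (act t p x) \<le> mnorm p * nm t x"
proof -
  let ?y = "act t p x"
  have y: "?y \<in> pts (fib B t)" using x by simp
  have xx: "bmult B x (bstar B x) \<in> pts (fib B 0)" using mult_closed[OF x star_closed[OF x]] by simp
  have xy: "bmult B x (bstar B ?y) \<in> pts (fib B 0)" using mult_closed[OF x star_closed[OF y]] by simp
  have "bmult B ?y (bstar B ?y) = act 0 p (bmult B x (bstar B ?y))"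
    using act_mult[OF x star_closed[OF y], of 0 p] by simp
  then have "(nm t ?y)\<^sup>2 \<le> mnorm p * nm 0 (bmult B x (bstar B ?y))"
    using norm_mult_star[OF y] norm_act[OF xy, of p] by simp
  also have "nm 0 (bmult B x (bstar B ?y)) = nm 0 (bmult B ?y (bstar B x))"
    using star_mult[OF y star_closed[OF x]] norm_star[of "bmult B ?y (bstar B x)" 0]
      mult_closed[OF y star_closed[OF x]] x by simp
  also have "bmult B ?y (bstar B x) = act 0 p (bmult B x (bstar B x))"
    using act_mult[OF x star_closed[OF x], of 0 p] by simp
  also have "mnorm p * nm 0 (act 0 p (bmult B x (bstar B x))) \<le> mnorm p * (mnorm p * nm 0 (bmult B x (bstar B x)))"
    by (intro mult_left_mono norm_act xx mnorm_nonneg)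
  also have "\<dots> = (mnorm p * nm t x)\<^sup>2"
    using norm_mult_star[OF x] by (simp add: power_mult_distrib power2_eq_square)
  finally show ?thesis by (rule power2_le_imp_le) (use x mnorm_nonneg in simp)
qed

text \<open>This is proved by approximating a square root of \<open>\<parallel>p\<parallel> - p\<close>.\<close>

lemma positive_compression:
  assumes p: "p \<in> pts (fib B 0)" "bstar B p = p" and x: "x \<in> pts (fib B t)"
  shows "positive (vdiff (fib B 0) (vscale (fib B 0) (of_real (nm 0 p)) (bmult B (bstar B x) x))
     (bmult B (bstar B x) (bmult B p x)))"
proof -
  let ?h = "nm 0 p *\<^sub>R 1 - letter p"
  have h: "free.pos ?h"
    using free.pos_norm_minus[of "letter p"] p by (simp add: fstar_letter mnorm_letter)
  have eq: "vdiff (fib B 0) (vscale (fib B 0) (of_real (nm 0 p)) (bmult B (bstar B x) x))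
     (bmult B (bstar B x) (bmult B p x)) = bmult B (bstar B x) (act t ?h x)"
    using p x
    by (simp add: act_diff act_scaleR act_one act_letter unit_mult_closed star_closed
        mult_diff_right[where s = "- t" and t = t and r = 0] mult_scale_right[where s = "- t" and t = t and r = 0])
  have hx: "act t ?h x \<in> pts (fib B t)" using x by simp
  show ?thesis unfolding eq
  proof (rule positive_limit)
    show "bmult B (bstar B x) (act t ?h x) \<in> pts (fib B 0)" by (rule star_mult_closed[OF x hx])
    have "bstar B (bmult B (bstar B x) (act t ?h x)) = bmult B (bstar B (act t ?h x)) x"
      using star_mult[OF star_closed[OF x] hx] x by simp
    also have "\<dots> = bmult B (bstar B x) (act t ?h x)"
      using act_star[OF x x, of ?h] free.pos_sa[OF h] by simp
    finally show "bstar B (bmult B (bstar B x) (act t ?h x)) = bmult B (bstar B x) (act t ?h x)" .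
    fix e :: real assume e: "0 < e"
    define d where "d = e / ((nm t x)\<^sup>2 + 1)"
    have d: "0 < d" "d * (nm t x)\<^sup>2 \<le> e"
    proof -
      have s: "0 < (nm t x)\<^sup>2 + 1" by (smt (verit) zero_le_power2)
      then show "0 < d" using e by (simp add: d_def)
      then have "d * (nm t x)\<^sup>2 \<le> d * ((nm t x)\<^sup>2 + 1)" by (intro mult_left_mono) simp_all
      also have "\<dots> = e" using s by (simp add: d_def)
      finally show "d * (nm t x)\<^sup>2 \<le> e" .
    qed
    obtain k where k: "free.pos k" "mnorm (k * k - ?h) \<le> d"
      by (rule free.pos_approx_sqrt[OF h d(1)]) blast
    \<comment> \<open>Self-adjointness of \<open>k\<close> gives
      \<open>x^* (k k x) = (k x)^* (k x)\<close>, and \<open>k x\<close> lies again in the fibre at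
      \<open>t\<close>.\<close>
    have kk: "bmult B (bstar B x) (act t (k * k) x) = bmult B (bstar B (act t k x)) (act t k x)"
      using act_star[OF x, of "act t k x" t k] x free.pos_sa[OF k(1)] by (simp add: act_times)
    have pos: "positive (bmult B (bstar B x) (act t (k * k) x))"
      unfolding kk using x by (intro positive_star_mult[of _ t]) simp
    have "vdiff (fib B 0) (bmult B (bstar B x) (act t (k * k) x)) (bmult B (bstar B x) (act t ?h x))
        = bmult B (bstar B x) (act t (k * k - ?h) x)"
      unfolding act_diff[OF x, of "k * k" ?h]
      by (rule mult_diff_right[symmetric, OF star_closed[OF x]]) (simp_all add: x)
    then have "nm 0 (vdiff (fib B 0) (bmult B (bstar B x) (act t (k * k) x)) (bmult B (bstar B x) (act t ?h x)))
        \<le> nm t x * nm t (act t (k * k - ?h) x)"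
      using norm_mult[OF star_closed[OF x], of "act t (k * k - ?h) x" t] x by simp
    also have "\<dots> \<le> nm t x * (d * nm t x)"
      using norm_act_fibre[OF x, of "k * k - ?h"] mult_right_mono[OF k(2), of "nm t x"] x
      by (intro mult_left_mono) auto
    also have "\<dots> \<le> e" using d(2) by (simp add: power2_eq_square mult_ac)
    finally show "\<exists>k. positive k \<and> nm 0 (vdiff (fib B 0) k (bmult B (bstar B x) (act t ?h x))) \<le> e"
      using pos by blast
  qed
qed

end

section \<open>The star algebra of finitely supported sections\<close>

context vmonoid
begin

lemma vsum_eqI: "(\<And>i. i \<in> I \<Longrightarrow> f i = g i) \<Longrightarrow> (\<And>i. i \<in> I \<Longrightarrow> g i \<in> pts V) \<Longrightarrow> vsum V f I = vsum V g I"
  by (intro add.finprod_cong') auto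

lemma vsum_insert:
  "finite I \<Longrightarrow> i \<notin> I \<Longrightarrow> (\<And>j. j \<in> insert i I \<Longrightarrow> f j \<in> pts V) \<Longrightarrow> vsum V f (insert i I) = vadd V (f i) (vsum V f I)"
  by (intro add.finprod_insert) auto

lemma vsum_closed: "(\<And>j. j \<in> I \<Longrightarrow> f j \<in> pts V) \<Longrightarrow> vsum V f I \<in> pts V"
  by (intro add.finprod_closed) auto

lemma fsum_reindex:
  assumes "bij \<pi>" "\<And>i. f i \<in> pts V"
  shows "fsum V (\<lambda>i. f (\<pi> i)) = fsum V f"
proof -
  have im: "\<pi> ` {i. f (\<pi> i) \<noteq> vzero V} = {i. f i \<noteq> vzero V}"
  proof
    show "{i. f i \<noteq> vzero V} \<subseteq> \<pi> ` {i. f (\<pi> i) \<noteq> vzero V}"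
    proof
      fix j assume j: "j \<in> {i. f i \<noteq> vzero V}"
      obtain i where "j = \<pi> i" using assms(1) by (meson bij_pointE)
      then show "j \<in> \<pi> ` {i. f (\<pi> i) \<noteq> vzero V}" using j by blast
    qed
  qed auto
  have "inj_on \<pi> {i. f (\<pi> i) \<noteq> vzero V}" using assms(1) by (meson bij_is_inj inj_on_subset subset_UNIV)
  then have "vsum V f (\<pi> ` {i. f (\<pi> i) \<noteq> vzero V}) = vsum V (\<lambda>i. f (\<pi> i)) {i. f (\<pi> i) \<noteq> vzero V}"
    using assms(2) by (intro add.finprod_reindex) auto
  then show ?thesis by (simp add: fsum_def im)
qed

end

context vspace
begin

lemma fsum_scale:
  assumes "finite {i. f i \<noteq> vzero V}" "\<And>i. f i \<in> pts V"
  shows "fsum V (\<lambda>i. vscale V c (f i)) = vscale V c (fsum V f)"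
  using assms by (intro fsum_hom[symmetric] vmonoid_axioms) (auto simp: scale_add)

lemma add_diff_cancel: "x \<in> pts V \<Longrightarrow> y \<in> pts V \<Longrightarrow> vdiff V (vadd V x y) x = y"
  using diff_add_add[of x y x "vzero V"] by simp

text \<open>The cancellation in Cauchy-Schwarz. There \<open>P = z^* p z\<close>,
  \<open>U = m z^* z\<close> and \<open>Q = m^2 q\<close>; the left side is the sum of two positive
  elements.\<close>

lemma diff_diff_add:
  assumes "P \<in> pts V" "U \<in> pts V" "Q \<in> pts V"
  shows "vadd V (vdiff V (vdiff V P U) (vdiff V U Q)) (vdiff V U P) = vdiff V Q U"
proof -
  have "vdiff V (vdiff V P U) (vdiff V U Q) = vadd V (vdiff V P U) (vdiff V Q U)"
    using diff_commute[of U Q] assms by (subst vdiff_def) simp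
  moreover have "vadd V (vadd V (vdiff V P U) (vdiff V Q U)) (vdiff V U P)
      = vadd V (vdiff V Q U) (vadd V (vdiff V P U) (vdiff V U P))"
    using assms by (simp add: add.m_ac)
  ultimately show ?thesis using assms by (simp add: diff_add_diff)
qed

end

lemma section_alg_simps [simp]:
  "pts (section_alg B) = finite_sections B"
  "vzero (section_alg B) = (\<lambda>t. vzero (fib B t))"
  by (simp_all add: section_alg_def)

lemma section_alg_ops:
  "vadd (section_alg B) = (\<lambda>x y t. vadd (fib B t) (x t) (y t))"
  "vscale (section_alg B) = (\<lambda>c x t. vscale (fib B t) c (x t))"
  "amult (section_alg B) = (\<lambda>x y s. fsum (fib B s) (\<lambda>t. bmult B (x t) (y (- t + s))))"
  "astar (section_alg B) = (\<lambda>x s. bstar B (x (- s)))"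
  by (simp_all add: section_alg_def)

lemma section_module_simps [simp]:
  "pts (section_module B) = finite_sections B"
  "vzero (section_module B) = (\<lambda>t. vzero (fib B t))"
  by (simp_all add: section_module_def)

lemma section_module_ops:
  "vadd (section_module B) = (\<lambda>x y t. vadd (fib B t) (x t) (y t))"
  "vscale (section_module B) = (\<lambda>c x t. vscale (fib B t) c (x t))"
  "vnorm (section_module B) = (\<lambda>\<xi>. sqrt (vnorm (fib B 0) (section_inner B \<xi> \<xi>)))"
  by (simp_all add: section_module_def)

context fell
begin

abbreviation sections :: "('g \<Rightarrow> 'b) set" where "sections \<equiv> finite_sections B"

definition supp :: "('g \<Rightarrow> 'b) \<Rightarrow> 'g set" where "supp x = {t. x t \<noteq> vzero (fib B t)}"

definition delta :: "'g \<Rightarrow> 'b \<Rightarrow> 'g \<Rightarrow> 'b" where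
  "delta t b s = (if s = t then b else vzero (fib B s))"

text \<open>The algebra of sections and the module on which it acts have the same elements and the
  same linear operations, which are therefore named once for both.\<close>

definition sadd :: "('g \<Rightarrow> 'b) \<Rightarrow> ('g \<Rightarrow> 'b) \<Rightarrow> 'g \<Rightarrow> 'b" where
  "sadd x y t = vadd (fib B t) (x t) (y t)"

definition sscale :: "complex \<Rightarrow> ('g \<Rightarrow> 'b) \<Rightarrow> 'g \<Rightarrow> 'b" where
  "sscale c x t = vscale (fib B t) c (x t)"

definition conv :: "('g \<Rightarrow> 'b) \<Rightarrow> ('g \<Rightarrow> 'b) \<Rightarrow> 'g \<Rightarrow> 'b" where
  "conv x y s = fsum (fib B s) (\<lambda>t. bmult B (x t) (y (- t + s)))"

definition sstar :: "('g \<Rightarrow> 'b) \<Rightarrow> 'g \<Rightarrow> 'b" where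
  "sstar x s = bstar B (x (- s))"

lemma section_ops:
  "vadd (section_alg B) = sadd" "vscale (section_alg B) = sscale"
  "amult (section_alg B) = conv" "astar (section_alg B) = sstar"
  "vadd (section_module B) = sadd" "vscale (section_module B) = sscale"
  by (auto simp: section_alg_ops section_module_ops sadd_def sscale_def conv_def sstar_def fun_eq_iff)

lemma sectionsI: "(\<And>t. x t \<in> pts (fib B t)) \<Longrightarrow> finite (supp x) \<Longrightarrow> x \<in> sections"
  by (simp add: finite_sections_def supp_def)

lemma sectionsI': "(\<And>t. x t \<in> pts (fib B t)) \<Longrightarrow> finite K \<Longrightarrow> (\<And>t. t \<notin> K \<Longrightarrow> x t = vzero (fib B t)) \<Longrightarrow> x \<in> sections"
  by (rule sectionsI, assumption, rule finite_subset[of _ K]) (auto simp: supp_def)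

lemma finite_supp [simp]: "x \<in> sections \<Longrightarrow> finite (supp x)"
  by (simp add: finite_sections_def supp_def)

lemma section_value [simp]: "x \<in> sections \<Longrightarrow> x t \<in> pts (fib B t)"
  by (simp add: finite_sections_def)

lemma not_in_supp: "t \<notin> supp x \<Longrightarrow> x t = vzero (fib B t)"
  by (simp add: supp_def)

lemma delta_closed [simp]: "b \<in> pts (fib B t) \<Longrightarrow> delta t b \<in> sections"
  by (rule sectionsI'[of _ "{t}"]) (simp_all add: delta_def)

lemma delta_zero: "delta t (vzero (fib B t)) = (\<lambda>t. vzero (fib B t))"
  by (auto simp: delta_def)

lemma sadd_closed [simp]: "x \<in> sections \<Longrightarrow> y \<in> sections \<Longrightarrow> sadd x y \<in> sections"
  by (rule sectionsI'[of _ "supp x \<union> supp y"]) (simp_all add: sadd_def not_in_supp)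

lemma sscale_closed [simp]: "x \<in> sections \<Longrightarrow> sscale c x \<in> sections"
  by (rule sectionsI'[of _ "supp x"]) (simp_all add: sscale_def not_in_supp)

lemma zero_section_closed [simp]: "(\<lambda>t. vzero (fib B t)) \<in> sections"
  by (rule sectionsI'[of _ "{}"]) simp_all

lemma section_vector_space: "vector_space_on (section_alg B)" "vector_space_on (section_module B)"
proof -
  have "comm_group (additive_monoid (section_alg B))"
  proof (rule comm_groupI, unfold additive_monoid_simps section_ops)
    fix x assume x: "x \<in> pts (section_alg B)"
    show "\<exists>y\<in>pts (section_alg B). sadd y x = vzero (section_alg B)"
    proof
      show "sscale (-1) x \<in> pts (section_alg B)" using x by simp
      show "sadd (sscale (-1) x) x = vzero (section_alg B)"
        using x by (auto simp: sadd_def sscale_def fib.add.m_comm)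
    qed
  qed (auto simp: sadd_def fib.add.m_ac)
  moreover have "additive_monoid (section_module B) = additive_monoid (section_alg B)"
    by (simp add: additive_monoid_def section_ops)
  ultimately show "vector_space_on (section_alg B)" "vector_space_on (section_module B)"
    unfolding vector_space_on_def section_ops
    by (simp_all, simp_all add: sadd_def sscale_def fun_eq_iff fib.scale_add fib.add_scale fib.scale_mult)
qed

sublocale sec: vspace "section_alg B"
  by unfold_locales (rule section_vector_space)

text \<open>Sections are finite sums of point sections, so identities that are additive in each
  argument reduce to identities in the bundle.\<close>

lemma section_induct [consumes 1, case_names delta add]:
  assumes "x \<in> sections" "\<And>t b. b \<in> pts (fib B t) \<Longrightarrow> P (delta t b)"
    "\<And>x y. x \<in> sections \<Longrightarrow> y \<in> sections \<Longrightarrow> P x \<Longrightarrow> P y \<Longrightarrow> P (sadd x y)"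
  shows "P x"
proof -
  have "P x" if "finite K" "x \<in> sections" "supp x \<subseteq> K" for K x
    using that
  proof (induction K arbitrary: x rule: finite_induct)
    case empty
    then have "x = delta 0 (vzero (fib B 0))" by (auto simp: delta_zero supp_def)
    then show ?case using assms(2)[of "vzero (fib B 0)" 0] by simp
  next
    case (insert t K)
    let ?y = "x(t := vzero (fib B t))"
    have y: "?y \<in> sections"
      using insert.prems by (intro sectionsI'[of _ "supp x"]) (simp_all add: not_in_supp)
    have "supp ?y \<subseteq> K" using insert.prems by (auto simp: supp_def)
    then have "P ?y" using insert.IH y by blast
    moreover have "x = sadd (delta t (x t)) ?y"
      using insert.prems by (auto simp: sadd_def delta_def fun_eq_iff)
    ultimately show ?case using assms(2,3) y insert.prems by (metis delta_closed section_value)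
  qed
  from this[OF finite_supp[OF assms(1)] assms(1)] show ?thesis by simp
qed

lemma conv_term_closed [simp]: "x \<in> sections \<Longrightarrow> y \<in> sections \<Longrightarrow> bmult B (x t) (y (- t + s)) \<in> pts (fib B s)"
  by (rule mult_closed'[of _ t _ "- t + s"]) simp_all

lemma conv_term_zero: "t \<notin> supp x \<Longrightarrow> y \<in> sections \<Longrightarrow> bmult B (x t) (y (- t + s)) = vzero (fib B s)"
  using mult_zero_left[of "y (- t + s)" "- t + s" t s] by (simp add: not_in_supp)

lemma conv_term_finite: "x \<in> sections \<Longrightarrow> y \<in> sections \<Longrightarrow> finite {t. bmult B (x t) (y (- t + s)) \<noteq> vzero (fib B s)}"
  by (rule finite_subset[of _ "supp x"]) (auto intro: ccontr simp: conv_term_zero)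

lemma conv_eq_vsum:
  assumes "x \<in> sections" "y \<in> sections" "finite K" "supp x \<subseteq> K"
  shows "conv x y s = vsum (fib B s) (\<lambda>t. bmult B (x t) (y (- t + s))) K"
  unfolding conv_def using assms
  by (intro fib.fsum_eq_vsum) (auto intro: conv_term_zero)

lemma conv_delta:
  assumes "a \<in> pts (fib B t)" "y \<in> sections"
  shows "conv (delta t a) y s = bmult B a (y (- t + s))"
proof -
  have "conv (delta t a) y s = vsum (fib B s) (\<lambda>r. bmult B (delta t a r) (y (- r + s))) {t}"
    using assms by (intro conv_eq_vsum) (auto simp: supp_def delta_def)
  also have "\<dots> = bmult B a (y (- t + s))"
    using assms conv_term_closed[OF delta_closed[OF assms(1)] assms(2), of t s] by (simp add: delta_def)
  finally show ?thesis .
qed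

lemma conv_delta_delta:
  assumes "a \<in> pts (fib B s)" "b \<in> pts (fib B t)"
  shows "conv (delta s a) (delta t b) = delta (s + t) (bmult B a b)"
proof
  fix r
  have "- s + r = t \<longleftrightarrow> r = s + t" by (metis add.assoc add.left_neutral left_minus right_minus)
  then show "conv (delta s a) (delta t b) r = delta (s + t) (bmult B a b) r"
    using assms mult_zero_right[OF assms(1), of "- s + r" r]
    by (simp add: conv_delta) (simp add: delta_def)
qed

lemma conv_closed [simp]:
  assumes "x \<in> sections" "y \<in> sections"
  shows "conv x y \<in> sections"
proof (rule sectionsI)
  fix s show "conv x y s \<in> pts (fib B s)" unfolding conv_def using assms by (intro fib.fsum_closed) simp
next
  have "supp (conv x y) \<subseteq> (\<lambda>(t, r). t + r) ` (supp x \<times> supp y)"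
  proof
    fix s assume s: "s \<in> supp (conv x y)"
    show "s \<in> (\<lambda>(t, r). t + r) ` (supp x \<times> supp y)"
    proof (rule ccontr)
      assume n: "s \<notin> (\<lambda>(t, r). t + r) ` (supp x \<times> supp y)"
      have "bmult B (x t) (y (- t + s)) = vzero (fib B s)" for t
      proof (cases "t \<in> supp x")
        case True
        have "- t + s \<notin> supp y"
        proof
          assume "- t + s \<in> supp y"
          then have "(\<lambda>(t, r). t + r) (t, - t + s) \<in> (\<lambda>(t, r). t + r) ` (supp x \<times> supp y)" using True by blast
          then show False using n by simp
        qed
        then show ?thesis using assms mult_zero_right[of "x t" t "- t + s" s]
          by (simp add: not_in_supp)
      next
        case False
        then show ?thesis using assms by (intro conv_term_zero)
      qed
      then have "conv x y s = vzero (fib B s)" unfolding conv_def by (rule fib.fsum_zero)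
      then show False using s by (simp add: supp_def)
    qed
  qed
  then show "finite (supp (conv x y))" by (rule finite_subset) (simp add: assms)
qed

lemma conv_add_left:
  assumes "x \<in> sections" "x' \<in> sections" "y \<in> sections"
  shows "conv (sadd x x') y = sadd (conv x y) (conv x' y)"
proof
  fix s
  have "bmult B (sadd x x' t) (y (- t + s)) = vadd (fib B s) (bmult B (x t) (y (- t + s))) (bmult B (x' t) (y (- t + s)))" for t
    unfolding sadd_def using assms by (intro mult_add_left[of _ t _ _ "- t + s"]) simp_all
  then show "conv (sadd x x') y s = sadd (conv x y) (conv x' y) s"
    using assms by (simp add: conv_def fib.fsum_add conv_term_finite) (simp add: sadd_def conv_def)
qed

lemma conv_add_right:
  assumes "x \<in> sections" "y \<in> sections" "y' \<in> sections"
  shows "conv x (sadd y y') = sadd (conv x y) (conv x y')"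
proof
  fix s
  have "bmult B (x t) (sadd y y' (- t + s)) = vadd (fib B s) (bmult B (x t) (y (- t + s))) (bmult B (x t) (y' (- t + s)))" for t
    unfolding sadd_def using assms by (intro mult_add_right[of _ t _ "- t + s"]) simp_all
  then show "conv x (sadd y y') s = sadd (conv x y) (conv x y') s"
    using assms by (simp add: conv_def fib.fsum_add conv_term_finite) (simp add: sadd_def conv_def)
qed

lemma conv_scale_left:
  assumes "x \<in> sections" "y \<in> sections"
  shows "conv (sscale c x) y = sscale c (conv x y)"
proof
  fix s
  have "bmult B (sscale c x t) (y (- t + s)) = vscale (fib B s) c (bmult B (x t) (y (- t + s)))" for t
    unfolding sscale_def using assms by (intro mult_scale_left[of _ t _ "- t + s"]) simp_all
  then show "conv (sscale c x) y s = sscale c (conv x y) s"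
    using assms by (simp add: conv_def fib.fsum_scale conv_term_finite) (simp add: sscale_def conv_def)
qed

lemma conv_scale_right:
  assumes "x \<in> sections" "y \<in> sections"
  shows "conv x (sscale c y) = sscale c (conv x y)"
proof
  fix s
  have "bmult B (x t) (sscale c y (- t + s)) = vscale (fib B s) c (bmult B (x t) (y (- t + s)))" for t
    unfolding sscale_def using assms by (intro mult_scale_right[of _ t _ "- t + s"]) simp_all
  then show "conv x (sscale c y) s = sscale c (conv x y) s"
    using assms by (simp add: conv_def fib.fsum_scale conv_term_finite) (simp add: sscale_def conv_def)
qed

lemma sstar_closed [simp]:
  assumes "x \<in> sections"
  shows "sstar x \<in> sections"
proof (rule sectionsI)
  show "sstar x t \<in> pts (fib B t)" for t
    unfolding sstar_def using assms by (intro star_closed'[of _ "- t"]) simp_all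
  have "supp (sstar x) \<subseteq> uminus ` supp x"
    by (auto simp: supp_def sstar_def star_zero image_iff) (metis add.inverse_inverse star_zero)
  then show "finite (supp (sstar x))" by (rule finite_subset) (simp add: assms)
qed

lemma sstar_delta: "b \<in> pts (fib B t) \<Longrightarrow> sstar (delta t b) = delta (- t) (bstar B b)"
  by (auto simp: sstar_def delta_def star_zero fun_eq_iff)

lemma sstar_add: "x \<in> sections \<Longrightarrow> y \<in> sections \<Longrightarrow> sstar (sadd x y) = sadd (sstar x) (sstar y)"
  by (auto simp: sstar_def sadd_def fun_eq_iff intro!: star_add)

lemma sstar_scale: "x \<in> sections \<Longrightarrow> sstar (sscale c x) = sscale (cnj c) (sstar x)"
  by (auto simp: sstar_def sscale_def fun_eq_iff intro!: star_scale)

lemma sstar_sstar [simp]: "x \<in> sections \<Longrightarrow> sstar (sstar x) = x"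
  using star_star[OF section_value] by (simp add: sstar_def fun_eq_iff)

text \<open>After reduction of all three arguments to point sections this is associativity in the
  bundle, and no double sum has to be rearranged.\<close>

lemma conv_assoc:
  assumes x: "x \<in> sections" and y: "y \<in> sections" and z: "z \<in> sections"
  shows "conv (conv x y) z = conv x (conv y z)"
  using x
proof (induction x rule: section_induct)
  case (delta s a)
  show ?case using y
  proof (induction y rule: section_induct)
    case (delta t b)
    show ?case using z
    proof (induction z rule: section_induct)
      case (delta r c)
      then show ?case using \<open>a \<in> _\<close> \<open>b \<in> _\<close>
        by (simp add: conv_delta_delta mult_closed mult_assoc add.assoc)
    next
      case (add x y)
      then show ?case using \<open>a \<in> _\<close> \<open>b \<in> _\<close> by (simp add: conv_add_right)
    qed
  next
    case (add x y)
    then show ?case using \<open>a \<in> _\<close> z by (simp add: conv_add_right conv_add_left)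
  qed
next
  case (add x x')
  then show ?case using y z by (simp add: conv_add_left)
qed

lemma sstar_conv:
  assumes x: "x \<in> sections" and y: "y \<in> sections"
  shows "sstar (conv x y) = conv (sstar y) (sstar x)"
  using x
proof (induction x rule: section_induct)
  case (delta s a)
  show ?case using y
  proof (induction y rule: section_induct)
    case (delta t b)
    then show ?case using \<open>a \<in> _\<close>
      by (simp add: conv_delta_delta sstar_delta mult_closed star_closed star_mult minus_add)
  next
    case (add x y)
    then show ?case using \<open>a \<in> _\<close> by (simp add: conv_add_right conv_add_left sstar_add)
  qed
next
  case (add x x')
  then show ?case using y by (simp add: conv_add_right conv_add_left sstar_add)
qed

text \<open>The inner product of the module, written as the unit fibre value of the product
  \<open>x^* y\<close>. In this form the adjointness of left convolutions is associativity of the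
  product.\<close>

definition inner :: "('g \<Rightarrow> 'b) \<Rightarrow> ('g \<Rightarrow> 'b) \<Rightarrow> 'b" where
  "inner x y = conv (sstar x) y 0"

lemma inner_eq_section_inner:
  assumes "x \<in> sections" "y \<in> sections"
  shows "inner x y = section_inner B x y"
proof -
  have "bij (uminus :: 'g \<Rightarrow> 'g)" by (rule bij_uminus)
  from fib.fsum_reindex[OF this, of "\<lambda>t. bmult B (bstar B (x t)) (y t)" 0]
  have "fsum (fib B 0) (\<lambda>t. bmult B (bstar B (x (- t))) (y (- t))) = fsum (fib B 0) (\<lambda>t. bmult B (bstar B (x t)) (y t))"
    using assms star_mult_closed[OF section_value section_value] by blast
  then show ?thesis by (simp add: inner_def section_inner_def conv_def sstar_def)
qed

lemma inner_closed [simp]: "x \<in> sections \<Longrightarrow> y \<in> sections \<Longrightarrow> inner x y \<in> pts (fib B 0)"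
  by (simp add: inner_def)

lemma inner_eq_vsum:
  assumes "x \<in> sections" "y \<in> sections"
  shows "inner x y = vsum (fib B 0) (\<lambda>t. bmult B (bstar B (x t)) (y t)) (supp x)"
proof -
  have "bmult B (bstar B (x t)) (y t) = vzero (fib B 0)" if "t \<notin> supp x" for t
    using that assms by (simp add: not_in_supp star_zero[of t "- t"] mult_zero_left[of "y t" t "- t" 0])
  then show ?thesis unfolding inner_eq_section_inner[OF assms] section_inner_def
    using assms star_mult_closed[OF section_value[OF assms(1)] section_value[OF assms(2)]]
    by (intro fib.fsum_eq_vsum) auto
qed

lemma inner_add_right: "x \<in> sections \<Longrightarrow> y \<in> sections \<Longrightarrow> y' \<in> sections \<Longrightarrow> inner x (sadd y y') = vadd (fib B 0) (inner x y) (inner x y')"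
  by (simp add: inner_def conv_add_right) (simp add: sadd_def)

lemma inner_scale_right: "x \<in> sections \<Longrightarrow> y \<in> sections \<Longrightarrow> inner x (sscale c y) = vscale (fib B 0) c (inner x y)"
  by (simp add: inner_def conv_scale_right) (simp add: sscale_def)

lemma inner_add_left: "x \<in> sections \<Longrightarrow> x' \<in> sections \<Longrightarrow> y \<in> sections \<Longrightarrow> inner (sadd x x') y = vadd (fib B 0) (inner x y) (inner x' y)"
  by (simp add: inner_def sstar_add conv_add_left) (simp add: sadd_def)

lemma inner_scale_left: "x \<in> sections \<Longrightarrow> y \<in> sections \<Longrightarrow> inner (sscale c x) y = vscale (fib B 0) (cnj c) (inner x y)"
  by (simp add: inner_def sstar_scale conv_scale_left) (simp add: sscale_def)

lemma inner_star: "x \<in> sections \<Longrightarrow> y \<in> sections \<Longrightarrow> bstar B (inner x y) = inner y x"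
  using sstar_conv[of "sstar x" y] by (simp add: inner_def) (metis add.inverse_neutral sstar_def)

lemma inner_conv: "x \<in> sections \<Longrightarrow> y \<in> sections \<Longrightarrow> z \<in> sections \<Longrightarrow> inner (conv z x) y = inner x (conv (sstar z) y)"
  by (simp add: inner_def sstar_conv conv_assoc)

lemma inner_self_positive: "x \<in> sections \<Longrightarrow> positive (inner x x)"
  using positive_star_mult[OF section_value] by (simp add: inner_eq_vsum positive_vsum)

text \<open>Convolution on the right by a point section at \<open>0\<close> is the right action of
  the unit fibre on the module.\<close>

lemma conv_delta_right_zero:
  assumes "x \<in> sections" "b \<in> pts (fib B 0)"
  shows "conv x (delta 0 b) 0 = bmult B (x 0) b"
  using assms(1)
proof (induction x rule: section_induct)
  case (delta t a)
  then show ?case using assms(2) mult_zero_left[OF assms(2), of 0 0]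
    by (auto simp: conv_delta_delta) (auto simp: delta_def)
next
  case (add x y)
  then show ?case using assms(2) by (simp add: conv_add_left) (simp add: sadd_def mult_add_left[where s = 0])
qed

lemma inner_right_mult:
  assumes "x \<in> sections" "y \<in> sections" "b \<in> pts (fib B 0)"
  shows "inner x (conv y (delta 0 b)) = bmult B (inner x y) b"
  using assms by (simp add: inner_def conv_delta_right_zero flip: conv_assoc)

lemma inner_left_mult:
  assumes "x \<in> sections" "y \<in> sections" "b \<in> pts (fib B 0)"
  shows "inner (conv x (delta 0 b)) y = bmult B (bstar B b) (inner x y)"
proof -
  have "inner (conv x (delta 0 b)) y = bstar B (inner y (conv x (delta 0 b)))" using assms by (simp add: inner_star)
  also have "\<dots> = bstar B (bmult B (inner y x) b)" using assms by (simp add: inner_right_mult)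
  also have "\<dots> = bmult B (bstar B b) (inner x y)" using assms by (simp add: star_mult[where s = 0 and t = 0] inner_star)
  finally show ?thesis .
qed

text \<open>This is the operator inequality \<open>p \<le> norm p\<close> in the module; it holds
  fibre by fibre by \<open>positive_compression\<close>, and the positive terms are added
  up.\<close>

lemma positive_inner_diff:
  assumes x: "x \<in> sections" and p: "p \<in> pts (fib B 0)" "bstar B p = p"
  shows "positive (vdiff (fib B 0) (vscale (fib B 0) (of_real (nm 0 p)) (inner x x)) (inner x (conv (delta 0 p) x)))"
proof -
  let ?f = "\<lambda>t. bmult B (bstar B (x t)) (x t)" and ?g = "\<lambda>t. bmult B (bstar B (x t)) (bmult B p (x t))"
    and ?n = "of_real (nm 0 p)"
  have cl: "?f t \<in> pts (fib B 0)" "?g t \<in> pts (fib B 0)" for t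
    using x p by (auto simp: unit_mult_closed intro!: star_mult_closed[of _ t])
  have g: "inner x (conv (delta 0 p) x) = vsum (fib B 0) ?g (supp x)"
    using x p by (simp add: inner_eq_vsum conv_delta)
  have "vsum (fib B 0) (\<lambda>t. vdiff (fib B 0) (vscale (fib B 0) ?n (?f t)) (?g t)) K
      = vdiff (fib B 0) (vscale (fib B 0) ?n (vsum (fib B 0) ?f K)) (vsum (fib B 0) ?g K)" if "finite K" for K
    using that
  proof (induction K rule: finite_induct)
    case (insert t K)
    have "vsum (fib B 0) ?f (insert t K) = vadd (fib B 0) (?f t) (vsum (fib B 0) ?f K)"
      "vsum (fib B 0) ?g (insert t K) = vadd (fib B 0) (?g t) (vsum (fib B 0) ?g K)"
      "vsum (fib B 0) (\<lambda>t. vdiff (fib B 0) (vscale (fib B 0) ?n (?f t)) (?g t)) (insert t K)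
        = vadd (fib B 0) (vdiff (fib B 0) (vscale (fib B 0) ?n (?f t)) (?g t))
          (vsum (fib B 0) (\<lambda>t. vdiff (fib B 0) (vscale (fib B 0) ?n (?f t)) (?g t)) K)"
      using insert cl by (auto intro!: fib.vsum_insert)
    then show ?case using insert cl by (simp add: fib.vsum_closed fib.scale_add fib.diff_add_add)
  qed simp
  from this[OF finite_supp[OF x]]
  have "vdiff (fib B 0) (vscale (fib B 0) ?n (inner x x)) (inner x (conv (delta 0 p) x))
    = vsum (fib B 0) (\<lambda>t. vdiff (fib B 0) (vscale (fib B 0) ?n (?f t)) (?g t)) (supp x)"
    unfolding g using x by (simp add: inner_eq_vsum)
  also have "positive \<dots>" using p by (intro positive_vsum positive_compression[OF _ _ section_value[OF x]]) simp_all
  finally show ?thesis .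
qed

text \<open>The usual argument for Hilbert modules: expand \<open><w, w> \<ge> 0\<close> for
  \<open>w = x z - m y\<close> with \<open>z = <x, y>\<close>, and use
  \<open>z^* <x, x> z \<le> m z^* z\<close>. This leaves \<open>z^* z \<le> m <y, y>\<close>, and
  norms are monotone on positive elements.\<close>

lemma inner_cauchy_schwarz:
  assumes x: "x \<in> sections" and y: "y \<in> sections"
  shows "(nm 0 (inner x y))\<^sup>2 \<le> nm 0 (inner x x) * nm 0 (inner y y)"
proof (rule field_le_epsilon)
  define z p q where "z = inner x y" and "p = inner x x" and "q = inner y y"
  have cl [simp]: "z \<in> pts (fib B 0)" "p \<in> pts (fib B 0)" "q \<in> pts (fib B 0)"
    using x y by (simp_all add: z_def p_def q_def)
  have ps: "bstar B p = p" and zs: "inner y x = bstar B z"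
    using x y by (simp_all add: p_def z_def inner_star)
  let ?Z = "bmult B (bstar B z) z" and ?P = "bmult B (bstar B z) (bmult B p z)"
  have cl2 [simp]: "?Z \<in> pts (fib B 0)" "?P \<in> pts (fib B 0)"
    by (simp_all add: unit_mult_closed unit_star_closed)
  \<comment> \<open>A number \<open>m\<close> strictly above \<open>norm p\<close> is positive and
    may be divided by; afterwards \<open>m\<close> tends to \<open>norm p\<close>.\<close>
  have main: "(nm 0 z)\<^sup>2 \<le> m * nm 0 q" if m: "nm 0 p < m" for m :: real
  proof -
    have m0: "0 < m" using m fib.norm_nonneg[OF cl(2)] by linarith
    let ?m = "vscale (fib B 0) (of_real m)"
    define w where "w = sadd (conv x (delta 0 z)) (sscale (- of_real m) y)"
    have w: "w \<in> sections" using x y by (simp add: w_def)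
    let ?n = "vscale (fib B 0) (- of_real m)"
    have "inner w w = vadd (fib B 0) (vadd (fib B 0) ?P (?n ?Z)) (vadd (fib B 0) (?n ?Z) (?n (?n q)))"
      using x y
      by (simp add: w_def inner_add_left inner_add_right inner_scale_left inner_scale_right inner_left_mult
          inner_right_mult zs unit_mult_closed unit_star_closed mult_add_left[where s = 0 and t = 0 and r = 0]
          mult_scale_left[where s = 0 and t = 0 and r = 0] mult_assoc[where s = 0 and t = 0 and r = 0]
          fib.scale_add flip: z_def p_def q_def)
    then have ww: "inner w w = vdiff (fib B 0) (vdiff (fib B 0) ?P (?m ?Z)) (vdiff (fib B 0) (?m ?Z) (?m (?m q)))"
      by (simp add: vdiff_def fib.scale_add flip: fib.scale_mult)
    have "positive (vadd (fib B 0) (vdiff (fib B 0) (vscale (fib B 0) (of_real (nm 0 p)) ?Z) ?P)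
        (vscale (fib B 0) (of_real (m - nm 0 p)) ?Z))"
      using m ps by (intro positive_add positive_compression[where t = 0] positive_scale positive_star_mult[of z 0]) simp_all
    also have "vadd (fib B 0) (vdiff (fib B 0) (vscale (fib B 0) (of_real (nm 0 p)) ?Z) ?P)
        (vscale (fib B 0) (of_real (m - nm 0 p)) ?Z) = vdiff (fib B 0) (?m ?Z) ?P"
    proof -
      have "?m ?Z = vadd (fib B 0) (vscale (fib B 0) (of_real (nm 0 p)) ?Z) (vscale (fib B 0) (of_real (m - nm 0 p)) ?Z)"
        by (simp flip: fib.add_scale)
      then show ?thesis by (simp add: vdiff_def fib.add.m_ac)
    qed
    finally have "positive (vadd (fib B 0) (inner w w) (vdiff (fib B 0) (?m ?Z) ?P))"
      using w by (intro positive_add inner_self_positive)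
    then have "positive (vdiff (fib B 0) (?m (?m q)) (?m ?Z))"
      unfolding ww by (subst (asm) fib.diff_diff_add) simp_all
    then have "positive (vscale (fib B 0) (of_real (1 / m)) (vdiff (fib B 0) (?m (?m q)) (?m ?Z)))"
      using m0 by (intro positive_scale) simp_all
    also have "vscale (fib B 0) (of_real (1 / m)) (vdiff (fib B 0) (?m (?m q)) (?m ?Z)) = vdiff (fib B 0) (?m q) ?Z"
      using m0 by (simp flip: fib.diff_scale fib.scale_mult)
    finally have "nm 0 ?Z \<le> nm 0 (?m q)"
      by (intro positive_norm_mono positive_star_mult[of z 0]) simp_all
    then show ?thesis using m0 norm_star_mult[OF cl(1)] by (simp add: fib.norm_scale)
  qed
  fix e :: real assume e: "0 < e"
  let ?d = "e / (nm 0 q + 1)"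
  have q: "0 < nm 0 q + 1" using fib.norm_nonneg[OF cl(3)] by linarith
  have "(nm 0 z)\<^sup>2 \<le> (nm 0 p + ?d) * nm 0 q" using e q by (intro main) simp
  also have "\<dots> \<le> nm 0 p * nm 0 q + ?d * (nm 0 q + 1)"
  proof -
    have "?d * nm 0 q \<le> ?d * (nm 0 q + 1)" using e q by (intro mult_left_mono) simp_all
    then show ?thesis unfolding distrib_right by linarith
  qed
  also have "?d * (nm 0 q + 1) = e" using q by simp
  finally show "(nm 0 (inner x y))\<^sup>2 \<le> nm 0 (inner x x) * nm 0 (inner y y) + e"
    by (simp add: z_def p_def q_def)
qed

section \<open>The pre-Hilbert norm on sections\<close>

definition hnorm :: "('g \<Rightarrow> 'b) \<Rightarrow> real" where
  "hnorm x = sqrt (nm 0 (inner x x))"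

lemma hnorm_eq: "x \<in> sections \<Longrightarrow> vnorm (section_module B) x = hnorm x"
  by (simp add: hnorm_def inner_eq_section_inner section_module_ops)

lemma hnorm_nonneg [simp]: "x \<in> sections \<Longrightarrow> 0 \<le> hnorm x"
  by (simp add: hnorm_def)

lemma hnorm_square: "x \<in> sections \<Longrightarrow> (hnorm x)\<^sup>2 = nm 0 (inner x x)"
  by (simp add: hnorm_def)

lemma norm_inner_le:
  assumes "x \<in> sections" "y \<in> sections"
  shows "nm 0 (inner x y) \<le> hnorm x * hnorm y"
  unfolding hnorm_def real_sqrt_mult[symmetric] by (rule real_le_rsqrt) (rule inner_cauchy_schwarz[OF assms])

lemma hnorm_scale: "x \<in> sections \<Longrightarrow> hnorm (sscale c x) = cmod c * hnorm x"
  by (simp add: hnorm_def inner_scale_left inner_scale_right fib.norm_scale real_sqrt_mult flip: mult.assoc)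

lemma hnorm_triangle:
  assumes x: "x \<in> sections" and y: "y \<in> sections"
  shows "hnorm (sadd x y) \<le> hnorm x + hnorm y"
proof (rule power2_le_imp_le)
  have "(hnorm (sadd x y))\<^sup>2 = nm 0 (vadd (fib B 0) (vadd (fib B 0) (inner x x) (inner y x)) (vadd (fib B 0) (inner x y) (inner y y)))"
    using x y by (simp add: hnorm_square inner_add_left inner_add_right)
  also have "\<dots> \<le> (nm 0 (inner x x) + nm 0 (inner y x)) + (nm 0 (inner x y) + nm 0 (inner y y))"
    using x y by (intro order_trans[OF fib.norm_triangle] add_mono fib.norm_triangle) simp_all
  also have "\<dots> \<le> (hnorm x)\<^sup>2 + hnorm y * hnorm x + (hnorm x * hnorm y + (hnorm y)\<^sup>2)"
    using norm_inner_le[OF x y] norm_inner_le[OF y x] hnorm_square[OF x] hnorm_square[OF y] by linarith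
  also have "\<dots> = (hnorm x + hnorm y)\<^sup>2" by (simp add: power2_sum)
  finally show "(hnorm (sadd x y))\<^sup>2 \<le> (hnorm x + hnorm y)\<^sup>2" .
qed (use x y in simp)

lemma section_module_seminormed: "seminormed (section_module B)"
proof
  show "vector_space_on (section_module B)" by (rule section_vector_space)
  fix x y c assume x: "x \<in> pts (section_module B)"
  then show "0 \<le> vnorm (section_module B) x" by (simp add: hnorm_eq)
  show "vnorm (section_module B) (vscale (section_module B) c x) = cmod c * vnorm (section_module B) x"
    using x by (simp only: section_ops section_module_simps(1) hnorm_eq sscale_closed hnorm_scale)
  assume "y \<in> pts (section_module B)"
  then show "vnorm (section_module B) (vadd (section_module B) x y) \<le> vnorm (section_module B) x + vnorm (section_module B) y"
    using x by (simp only: section_ops section_module_simps(1) hnorm_eq sadd_closed hnorm_triangle)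
qed

text \<open>The element \<open>x(t)^* x(t)\<close> is one of the positive summands of
  \<open><x, x>\<close>.\<close>

lemma norm_value_le_hnorm:
  assumes x: "x \<in> sections"
  shows "nm t (x t) \<le> hnorm x"
proof (cases "t \<in> supp x")
  case True
  let ?f = "\<lambda>t. bmult B (bstar B (x t)) (x t)"
  have f: "?f s \<in> pts (fib B 0)" for s using star_mult_closed[OF section_value[OF x] section_value[OF x]] by blast
  have "inner x x = vadd (fib B 0) (?f t) (vsum (fib B 0) ?f (supp x - {t}))"
    using x True f fib.vsum_insert[of "supp x - {t}" t ?f] by (simp add: inner_eq_vsum insert_absorb)
  moreover have "positive (vsum (fib B 0) ?f (supp x - {t}))"
    using positive_star_mult[OF section_value[OF x]] by (intro positive_vsum)
  ultimately have "positive (vdiff (fib B 0) (inner x x) (?f t))"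
    using f by (simp add: positive_closed fib.add_diff_cancel)
  then have "nm 0 (?f t) \<le> nm 0 (inner x x)"
    using x by (intro positive_norm_mono positive_star_mult[of _ t]) simp_all
  then have "(nm t (x t))\<^sup>2 \<le> (hnorm x)\<^sup>2" using x norm_star_mult[of "x t" t] by (simp add: hnorm_square)
  then show ?thesis by (rule power2_le_imp_le) (use x in simp)
next
  case False
  then show ?thesis using x by (simp add: not_in_supp[OF False])
qed

lemma hnorm_delta:
  assumes b: "b \<in> pts (fib B t)"
  shows "hnorm (delta t b) = nm t b"
proof -
  have "inner (delta t b) (delta t b) = delta (- t + t) (bmult B (bstar B b) b) 0"
    by (simp only: inner_def sstar_delta[OF b] conv_delta_delta[OF star_closed[OF b] b])
  also have "\<dots> = bmult B (bstar B b) b" by (simp add: delta_def)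
  finally show ?thesis using norm_star_mult[OF b] b by (simp add: hnorm_def)
qed

text \<open>Boundedness of the left regular operators: \<open><b x, b x> = <x, (b^* b) x>\<close> is
  at most \<open>norm (b^* b)\<close> times \<open><x, x>\<close>.\<close>

lemma hnorm_conv_delta:
  assumes x: "x \<in> sections" and b: "b \<in> pts (fib B t)"
  shows "hnorm (conv (delta t b) x) \<le> nm t b * hnorm x"
proof (rule power2_le_imp_le)
  let ?p = "bmult B (bstar B b) b"
  have p: "?p \<in> pts (fib B 0)" "bstar B ?p = ?p" "nm 0 ?p = (nm t b)\<^sup>2"
    using b by (simp_all add: star_mult_closed[of _ t] star_mult_self[of _ t] norm_star_mult)
  have eq: "inner (conv (delta t b) x) (conv (delta t b) x) = inner x (conv (delta 0 ?p) x)"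
    using x b by (simp add: inner_conv sstar_delta conv_delta_delta star_closed flip: conv_assoc)
  have "nm 0 (inner x (conv (delta 0 ?p) x)) \<le> nm 0 (vscale (fib B 0) (of_real (nm 0 ?p)) (inner x x))"
  proof (rule positive_norm_mono)
    show "positive (inner x (conv (delta 0 ?p) x))"
      unfolding eq[symmetric] using x b by (intro inner_self_positive) simp
  qed (use x p positive_inner_diff[OF x p(1,2)] in simp_all)
  then show "(hnorm (conv (delta t b) x))\<^sup>2 \<le> (nm t b * hnorm x)\<^sup>2"
    using x b p(3) by (simp add: hnorm_square eq fib.norm_scale power_mult_distrib norm_power)
qed (use x b in simp)

end

section \<open>Normed star algebras and their completions\<close>

text \<open>Some bound \<open>C\<close> must be at hand, since a supremum of reals means nothing for
  an unbounded set.\<close>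

lemma opnorm_upper:
  assumes "x \<in> pts V" "vnorm V x \<le> 1" "\<And>y. y \<in> pts V \<Longrightarrow> vnorm V y \<le> 1 \<Longrightarrow> vnorm V (T y) \<le> C"
  shows "vnorm V (T x) \<le> opnorm V T"
  unfolding opnorm_def
proof (rule cSup_upper)
  show "vnorm V (T x) \<in> {vnorm V (T x) |x. x \<in> pts V \<and> vnorm V x \<le> 1}" using assms by blast
  show "bdd_above {vnorm V (T x) |x. x \<in> pts V \<and> vnorm V x \<le> 1}"
    using assms(3) by (intro bdd_aboveI[of _ C]) blast
qed

lemma opnorm_least:
  assumes "x \<in> pts V" "vnorm V x \<le> 1" "\<And>y. y \<in> pts V \<Longrightarrow> vnorm V y \<le> 1 \<Longrightarrow> vnorm V (T y) \<le> C"
  shows "opnorm V T \<le> C"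
  unfolding opnorm_def
proof (rule cSup_least)
  show "{vnorm V (T x) |x. x \<in> pts V \<and> vnorm V x \<le> 1} \<noteq> {}" using assms(1,2) by blast
qed (use assms(3) in blast)

lemma opnorm_cong:
  assumes "\<And>x. x \<in> pts V \<Longrightarrow> T x = T' x"
  shows "opnorm V T = opnorm V T'"
proof -
  have "{vnorm V (T x) |x. x \<in> pts V \<and> vnorm V x \<le> 1} = {vnorm V (T' x) |x. x \<in> pts V \<and> vnorm V x \<le> 1}"
    using assms by (intro Collect_cong ex_cong1) auto
  then show ?thesis by (simp only: opnorm_def)
qed

context seminormed
begin

lemma opnorm_bound:
  assumes T: "\<And>x. x \<in> pts V \<Longrightarrow> T x \<in> pts V" "\<And>c x. x \<in> pts V \<Longrightarrow> T (vscale V c x) = vscale V c (T x)"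
    and C: "\<And>x. x \<in> pts V \<Longrightarrow> vnorm V (T x) \<le> C * vnorm V x"
    and O: "\<And>x. x \<in> pts V \<Longrightarrow> vnorm V x = 1 \<Longrightarrow> vnorm V (T x) \<le> K" and x: "x \<in> pts V"
  shows "vnorm V (T x) \<le> K * vnorm V x"
proof (cases "vnorm V x = 0")
  case True
  then show ?thesis using C[OF x] by simp
next
  case False
  then have p: "0 < vnorm V x" using x by (simp add: less_le)
  let ?y = "vscale V (of_real (1 / vnorm V x)) x"
  have "vnorm V ?y = 1" using x p by (simp add: norm_scale norm_divide)
  then have "vnorm V (T ?y) \<le> K" using x by (intro O) simp_all
  moreover have "vnorm V (T ?y) = vnorm V (T x) / vnorm V x"
    using x p T(1)[OF x] by (simp add: T(2)[OF x] norm_scale norm_divide)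
  ultimately show ?thesis using p by (simp add: pos_divide_le_eq)
qed

text \<open>Removes the completed module from the norm: the operator norm on the completion is the
  least constant that works on the dense subspace. The operator acts termwise on representatives, as
  \<open>left_regular\<close> does.\<close>

lemma completion_opnorm:
  assumes T: "\<And>x. x \<in> pts V \<Longrightarrow> T x \<in> pts V" "\<And>c x. x \<in> pts V \<Longrightarrow> T (vscale V c x) = vscale V c (T x)"
    "\<And>x y. x \<in> pts V \<Longrightarrow> y \<in> pts V \<Longrightarrow> vdiff V (T x) (T y) = T (vdiff V x y)"
    and C: "0 \<le> C" "\<And>x. x \<in> pts V \<Longrightarrow> vnorm V (T x) \<le> C * vnorm V x"
  defines "K \<equiv> opnorm (completion V) (\<lambda>P. cauchy_class V (\<lambda>n. T (cauchy_rep P n)))"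
  shows "x \<in> pts V \<Longrightarrow> vnorm V (T x) \<le> K * vnorm V x"
    and "0 \<le> D \<Longrightarrow> (\<And>x. x \<in> pts V \<Longrightarrow> vnorm V (T x) \<le> D * vnorm V x) \<Longrightarrow> K \<le> D"
    and "0 \<le> K"
proof -
  let ?T = "\<lambda>P. cauchy_class V (\<lambda>n. T (cauchy_rep P n))"
  have d: "vnorm V (vdiff V (T x) (T y)) \<le> C * vnorm V (vdiff V x y)" if "x \<in> pts V" "y \<in> pts V" for x y
    using that by (simp add: T(3) C(2))
  note cauchy_T = bounded_map_cauchy[OF seminormed_axioms seminormed_axioms, of T C]
  have bound: "vnorm (completion V) (?T P) \<le> D"
    if D: "0 \<le> D" "\<And>x. x \<in> pts V \<Longrightarrow> vnorm V (T x) \<le> D * vnorm V x"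
      and P: "P \<in> pts (completion V)" "vnorm (completion V) P \<le> 1" for D P
  proof -
    have r: "cauchy_rep P \<in> cauchy_seqs V" by (rule cauchy_rep_seq[OF P(1)])
    have Tr: "(\<lambda>n. T (cauchy_rep P n)) \<in> cauchy_seqs V" using T d r by (intro cauchy_T(1))
    have "vnorm (completion V) (?T P) = lim (\<lambda>n. vnorm V (T (cauchy_rep P n)))"
      by (rule completion_norm[OF Tr])
    also have "\<dots> \<le> D * lim (\<lambda>n. vnorm V (cauchy_rep P n))"
      by (rule LIMSEQ_le[OF cauchy_norm_tendsto[OF Tr] tendsto_mult_left[OF cauchy_norm_tendsto[OF r]]])
        (use D(2) cauchy_seqsD[OF r] in blast)
    also have "lim (\<lambda>n. vnorm V (cauchy_rep P n)) = vnorm (completion V) P" by (simp add: completion_def)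
    finally show ?thesis using mult_left_le[OF P(2) D(1)] by linarith
  qed
  have z: "cauchy_class V (\<lambda>n. vzero V) \<in> pts (completion V)" "vnorm (completion V) (cauchy_class V (\<lambda>n. vzero V)) \<le> 1"
    by simp_all
  have up: "vnorm V (T x) \<le> K" if x: "x \<in> pts V" "vnorm V x \<le> 1" for x
  proof -
    let ?P = "cauchy_class V (\<lambda>n. x)"
    have P: "?P \<in> pts (completion V)" "vnorm (completion V) ?P \<le> 1" using x by simp_all
    have rel: "((\<lambda>n. T x), (\<lambda>n. T (cauchy_rep ?P n))) \<in> cauchy_rel V"
      using T d cauchy_rep_class[of "\<lambda>n. x"] x by (intro cauchy_T(2)) simp_all
    have "vnorm (completion V) (?T ?P) \<le> K"
      unfolding K_def using bound[OF C] by (intro opnorm_upper[OF P, of _ C])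
    moreover have "?T ?P = cauchy_class V (\<lambda>n. T x)"
      using rel cauchy_class_eq_iff[of "\<lambda>n. T x" "\<lambda>n. T (cauchy_rep ?P n)"] by (simp add: cauchy_rel_iff)
    ultimately show ?thesis using T(1)[OF x(1)] by simp
  qed
  show "0 \<le> K" using up[of "vzero V"] norm_nonneg[OF T(1)[OF zero_closed]] by simp
  show "x \<in> pts V \<Longrightarrow> vnorm V (T x) \<le> K * vnorm V x"
    by (rule opnorm_bound[of T C]) (use T C up in auto)
  show "K \<le> D" if "0 \<le> D" "\<And>x. x \<in> pts V \<Longrightarrow> vnorm V (T x) \<le> D * vnorm V x"
    unfolding K_def by (rule opnorm_least[OF z bound[OF that]])
qed

end

section \<open>Star algebras on carrier sets and their completions\<close>

locale star_alg = vspace A for A :: "('a, 'm) staralg_scheme" +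
  assumes mult_closed [simp]: "x \<in> pts A \<Longrightarrow> y \<in> pts A \<Longrightarrow> amult A x y \<in> pts A"
    and mult_add_left: "x \<in> pts A \<Longrightarrow> x' \<in> pts A \<Longrightarrow> y \<in> pts A \<Longrightarrow> amult A (vadd A x x') y = vadd A (amult A x y) (amult A x' y)"
    and mult_add_right: "x \<in> pts A \<Longrightarrow> y \<in> pts A \<Longrightarrow> y' \<in> pts A \<Longrightarrow> amult A x (vadd A y y') = vadd A (amult A x y) (amult A x y')"
    and mult_scale_left: "x \<in> pts A \<Longrightarrow> y \<in> pts A \<Longrightarrow> amult A (vscale A c x) y = vscale A c (amult A x y)"
    and mult_scale_right: "x \<in> pts A \<Longrightarrow> y \<in> pts A \<Longrightarrow> amult A x (vscale A c y) = vscale A c (amult A x y)"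
    and mult_assoc: "x \<in> pts A \<Longrightarrow> y \<in> pts A \<Longrightarrow> z \<in> pts A \<Longrightarrow> amult A (amult A x y) z = amult A x (amult A y z)"
    and star_closed [simp]: "x \<in> pts A \<Longrightarrow> astar A x \<in> pts A"
    and star_add: "x \<in> pts A \<Longrightarrow> y \<in> pts A \<Longrightarrow> astar A (vadd A x y) = vadd A (astar A x) (astar A y)"
    and star_scale: "x \<in> pts A \<Longrightarrow> astar A (vscale A c x) = vscale A (cnj c) (astar A x)"
    and star_mult: "x \<in> pts A \<Longrightarrow> y \<in> pts A \<Longrightarrow> astar A (amult A x y) = amult A (astar A y) (astar A x)"
    and star_star [simp]: "x \<in> pts A \<Longrightarrow> astar A (astar A x) = x"
begin

lemma mult_diff_left: "x \<in> pts A \<Longrightarrow> x' \<in> pts A \<Longrightarrow> y \<in> pts A \<Longrightarrow> amult A (vdiff A x x') y = vdiff A (amult A x y) (amult A x' y)"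
  by (simp add: vdiff_def mult_add_left mult_scale_left)

lemma mult_diff_right: "x \<in> pts A \<Longrightarrow> y \<in> pts A \<Longrightarrow> y' \<in> pts A \<Longrightarrow> amult A x (vdiff A y y') = vdiff A (amult A x y) (amult A x y')"
  by (simp add: vdiff_def mult_add_right mult_scale_right)

lemma star_diff: "x \<in> pts A \<Longrightarrow> y \<in> pts A \<Longrightarrow> astar A (vdiff A x y) = vdiff A (astar A x) (astar A y)"
  by (simp add: vdiff_def star_add star_scale)

primrec apow :: "'a \<Rightarrow> nat \<Rightarrow> 'a" where
  "apow x 0 = x"
| "apow x (Suc n) = amult A x (apow x n)"

text \<open>Powers are shifted: \<open>apow x n\<close> is \<open>x\<^sup>n\<^sup>+\<^sup>1\<close>, since the algebra has no unit.\<close>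

lemma apow_closed [simp]: "x \<in> pts A \<Longrightarrow> apow x n \<in> pts A"
  by (induction n) simp_all

lemma apow_add: "x \<in> pts A \<Longrightarrow> amult A (apow x m) (apow x n) = apow x (Suc (m + n))"
  by (induction m) (simp_all add: mult_assoc)

lemma apow_star:
  assumes "x \<in> pts A" "astar A x = x"
  shows "astar A (apow x n) = apow x n"
proof (induction n)
  case (Suc n)
  have "astar A (apow x (Suc n)) = amult A (apow x n) (apow x 0)" using assms Suc by (simp add: star_mult)
  also have "\<dots> = apow x (Suc n)" using assms by (subst apow_add) simp_all
  finally show ?case .
qed (simp add: assms)

end

locale normed_star_alg = star_alg A + seminormed A for A :: "('a, 'm) staralg_scheme" +
  assumes norm_mult: "x \<in> pts A \<Longrightarrow> y \<in> pts A \<Longrightarrow> vnorm A (amult A x y) \<le> vnorm A x * vnorm A y"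
    and norm_star [simp]: "x \<in> pts A \<Longrightarrow> vnorm A (astar A x) = vnorm A x"
begin

abbreviation const_class :: "'a \<Rightarrow> (nat \<Rightarrow> 'a) set" where
  "const_class x \<equiv> cauchy_class A (\<lambda>n. x)"

lemma alg_completion_simps [simp]:
  "pts (alg_completion A) = pts (completion A)" "vadd (alg_completion A) = vadd (completion A)"
  "vscale (alg_completion A) = vscale (completion A)" "vnorm (alg_completion A) = vnorm (completion A)"
  "vzero (alg_completion A) = vzero (completion A)"
  by (simp_all add: alg_completion_def)

lemma norm_mult_diff:
  assumes "x \<in> pts A" "y \<in> pts A" "x' \<in> pts A" "y' \<in> pts A"
  shows "vnorm A (vdiff A (amult A x y) (amult A x' y'))
    \<le> vnorm A (vdiff A x x') * vnorm A y + vnorm A x' * vnorm A (vdiff A y y')"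
proof -
  have "vdiff A (amult A x y) (amult A x' y') = vadd A (amult A (vdiff A x x') y) (amult A x' (vdiff A y y'))"
    using assms diff_add_diff[of "amult A x y" "amult A x' y" "amult A x' y'"]
    by (simp add: mult_diff_left mult_diff_right)
  then show ?thesis
    using norm_triangle[of "amult A (vdiff A x x') y" "amult A x' (vdiff A y y')"]
      norm_mult[of "vdiff A x x'" y] norm_mult[of x' "vdiff A y y'"] assms by simp
qed

lemma cauchy_mult:
  assumes X: "X \<in> cauchy_seqs A" and Y: "Y \<in> cauchy_seqs A"
  shows "(\<lambda>n. amult A (X n) (Y n)) \<in> cauchy_seqs A"
proof (rule cauchy_seqsI)
  have XY [simp]: "\<And>n. X n \<in> pts A" "\<And>n. Y n \<in> pts A" using cauchy_seqsD[OF X] cauchy_seqsD[OF Y] by auto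
  show "amult A (X n) (Y n) \<in> pts A" for n by simp
  obtain C where C: "0 < C" "\<And>n. vnorm A (X n) \<le> C" by (rule cauchy_norm_bounded[OF X]) blast
  obtain D where D: "0 < D" "\<And>n. vnorm A (Y n) \<le> D" by (rule cauchy_norm_bounded[OF Y]) blast
  fix e :: real assume e: "0 < e"
  then have e2: "0 < e / (2 * D)" "0 < e / (2 * C)" using C(1) D(1) by simp_all
  obtain M where M: "\<forall>m\<ge>M. \<forall>n\<ge>M. vnorm A (vdiff A (X m) (X n)) < e / (2 * D)"
    using X e2(1) unfolding cauchy_seqs_def by blast
  obtain N where N: "\<forall>m\<ge>N. \<forall>n\<ge>N. vnorm A (vdiff A (Y m) (Y n)) < e / (2 * C)"
    using Y e2(2) unfolding cauchy_seqs_def by blast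
  have "vnorm A (vdiff A (amult A (X m) (Y m)) (amult A (X n) (Y n))) < e" if "m \<ge> max M N" "n \<ge> max M N" for m n
  proof -
    have "vnorm A (vdiff A (X m) (X n)) < e / (2 * D)" "vnorm A (vdiff A (Y m) (Y n)) < e / (2 * C)"
      using M N that by (meson max.boundedE)+
    then have "vnorm A (vdiff A (X m) (X n)) * vnorm A (Y m) < (e / (2 * D)) * D"
      "vnorm A (X n) * vnorm A (vdiff A (Y m) (Y n)) \<le> C * (e / (2 * C))"
    proof -
      have "vnorm A (vdiff A (X m) (X n)) * vnorm A (Y m) \<le> vnorm A (vdiff A (X m) (X n)) * D"
        by (rule mult_left_mono[OF D(2)]) simp
      also have "\<dots> < (e / (2 * D)) * D"
        using \<open>vnorm A (vdiff A (X m) (X n)) < e / (2 * D)\<close> D(1) by (rule mult_strict_right_mono)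
      finally show "vnorm A (vdiff A (X m) (X n)) * vnorm A (Y m) < (e / (2 * D)) * D" .
      show "vnorm A (X n) * vnorm A (vdiff A (Y m) (Y n)) \<le> C * (e / (2 * C))"
        using \<open>vnorm A (vdiff A (Y m) (Y n)) < e / (2 * C)\<close> C(1) by (intro mult_mono C(2)) simp_all
    qed
    moreover have "(e / (2 * D)) * D = e / 2" "C * (e / (2 * C)) = e / 2" using C(1) D(1) by simp_all
    ultimately show ?thesis
      using norm_mult_diff[of "X m" "Y m" "X n" "Y n", OF XY(1) XY(2) XY(1) XY(2)] by linarith
  qed
  then show "\<exists>N. \<forall>m\<ge>N. \<forall>n\<ge>N. vnorm A (vdiff A (amult A (X m) (Y m)) (amult A (X n) (Y n))) < e" by blast
qed

lemma cauchy_rel_mult: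
  assumes X: "(X, X') \<in> cauchy_rel A" and Y: "(Y, Y') \<in> cauchy_rel A"
  shows "((\<lambda>n. amult A (X n) (Y n)), (\<lambda>n. amult A (X' n) (Y' n))) \<in> cauchy_rel A"
proof -
  have seqs: "X \<in> cauchy_seqs A" "X' \<in> cauchy_seqs A" "Y \<in> cauchy_seqs A" "Y' \<in> cauchy_seqs A"
    using assms by (auto simp: cauchy_rel_iff)
  note [simp] = seqs[THEN cauchy_seqsD]
  have "(\<lambda>n. vnorm A (vdiff A (X n) (X' n)) * vnorm A (Y n) + vnorm A (X' n) * vnorm A (vdiff A (Y n) (Y' n)))
      \<longlonglongrightarrow> 0 * lim (\<lambda>n. vnorm A (Y n)) + lim (\<lambda>n. vnorm A (X' n)) * 0"
    using assms by (intro tendsto_add tendsto_mult cauchy_norm_tendsto seqs) (auto simp: cauchy_rel_iff)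
  then have "(\<lambda>n. vnorm A (vdiff A (X n) (X' n)) * vnorm A (Y n) + vnorm A (X' n) * vnorm A (vdiff A (Y n) (Y' n))) \<longlonglongrightarrow> 0"
    by simp
  then have "(\<lambda>n. vnorm A (vdiff A (amult A (X n) (Y n)) (amult A (X' n) (Y' n)))) \<longlonglongrightarrow> 0"
    by (rule tendsto_zero_le) (simp_all add: norm_mult_diff)
  then show ?thesis using cauchy_mult seqs by (simp add: cauchy_rel_iff)
qed

lemma cauchy_star:
  "X \<in> cauchy_seqs A \<Longrightarrow> (\<lambda>n. astar A (X n)) \<in> cauchy_seqs A"
  "(X, Y) \<in> cauchy_rel A \<Longrightarrow> ((\<lambda>n. astar A (X n)), (\<lambda>n. astar A (Y n))) \<in> cauchy_rel A"
  by (rule bounded_map_cauchy[OF seminormed_axioms seminormed_axioms, of _ 1]; simp flip: star_diff)+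

lemma alg_completion_mult:
  assumes "X \<in> cauchy_seqs A" "Y \<in> cauchy_seqs A"
  shows "amult (alg_completion A) (cauchy_class A X) (cauchy_class A Y) = cauchy_class A (\<lambda>n. amult A (X n) (Y n))"
proof -
  have "((\<lambda>n. amult A (X n) (Y n)), (\<lambda>n. amult A (cauchy_rep (cauchy_class A X) n) (cauchy_rep (cauchy_class A Y) n))) \<in> cauchy_rel A"
    by (intro cauchy_rel_mult cauchy_rep_class assms)
  then show ?thesis
    by (subst cauchy_class_eq_iff[THEN iffD2, of "\<lambda>n. amult A (X n) (Y n)"]) (auto simp: cauchy_rel_iff alg_completion_def)
qed

lemma alg_completion_star:
  assumes "X \<in> cauchy_seqs A"
  shows "astar (alg_completion A) (cauchy_class A X) = cauchy_class A (\<lambda>n. astar A (X n))"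
proof -
  have "((\<lambda>n. astar A (X n)), (\<lambda>n. astar A (cauchy_rep (cauchy_class A X) n))) \<in> cauchy_rel A"
    by (intro cauchy_star cauchy_rep_class assms)
  then show ?thesis
    by (subst cauchy_class_eq_iff[THEN iffD2, of "\<lambda>n. astar A (X n)"]) (auto simp: cauchy_rel_iff alg_completion_def)
qed

text \<open>Restriction to the dense image of \<open>A\<close>; in part (1) the point sections are
  then inserted.\<close>

lemma star_hom_const_class:
  assumes "star_hom (alg_completion A) C \<phi>"
  shows "star_hom A C (\<lambda>x. \<phi> (const_class x))"
proof -
  have \<phi>: "\<And>P. P \<in> pts (completion A) \<Longrightarrow> \<phi> P \<in> pts C"
    "\<And>P Q. P \<in> pts (completion A) \<Longrightarrow> Q \<in> pts (completion A) \<Longrightarrow> \<phi> (vadd (completion A) P Q) = vadd C (\<phi> P) (\<phi> Q)"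
    "\<And>P c. P \<in> pts (completion A) \<Longrightarrow> \<phi> (vscale (completion A) c P) = vscale C c (\<phi> P)"
    "\<And>P Q. P \<in> pts (completion A) \<Longrightarrow> Q \<in> pts (completion A) \<Longrightarrow> \<phi> (amult (alg_completion A) P Q) = amult C (\<phi> P) (\<phi> Q)"
    "\<And>P. P \<in> pts (completion A) \<Longrightarrow> \<phi> (astar (alg_completion A) P) = astar C (\<phi> P)"
    using assms by (auto simp: star_hom_def linear_on_def)
  show ?thesis unfolding star_hom_def linear_on_def
  proof (intro conjI ballI allI)
    fix x y c assume x: "x \<in> pts A"
    show "\<phi> (const_class x) \<in> pts C" using x by (simp add: \<phi>)
    show "\<phi> (const_class (vscale A c x)) = vscale C c (\<phi> (const_class x))"
      using x \<phi>(3)[of "const_class x"] by (simp add: completion_scale)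
    show "\<phi> (const_class (astar A x)) = astar C (\<phi> (const_class x))"
      using x \<phi>(5)[of "const_class x"] by (simp add: alg_completion_star)
    assume y: "y \<in> pts A"
    show "\<phi> (const_class (vadd A x y)) = vadd C (\<phi> (const_class x)) (\<phi> (const_class y))"
      using x y \<phi>(2)[of "const_class x" "const_class y"] by (simp add: completion_add)
    show "\<phi> (const_class (amult A x y)) = amult C (\<phi> (const_class x)) (\<phi> (const_class y))"
      using x y \<phi>(4)[of "const_class x" "const_class y"] by (simp add: alg_completion_mult)
  qed
qed

end

text \<open>
  Here \<open>h\<close> is a pre-Hilbert norm. No inner product is recorded: the inequality
  \<open>\<parallel>x\<xi>\<parallel>\<^sup>2 \<le> \<parallel>\<xi>\<parallel> \<parallel>x\<^sup>*x\<xi>\<parallel>\<close> suffices for the C*-identity.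
\<close>

locale regular_alg = star_alg A for A :: "('a, 'm) staralg_scheme" +
  fixes h :: "'a \<Rightarrow> real"
  assumes h_nonneg [simp]: "x \<in> pts A \<Longrightarrow> 0 \<le> h x"
    and h_scale: "x \<in> pts A \<Longrightarrow> h (vscale A c x) = cmod c * h x"
    and h_triangle: "x \<in> pts A \<Longrightarrow> y \<in> pts A \<Longrightarrow> h (vadd A x y) \<le> h x + h y"
    and h_star_mult: "x \<in> pts A \<Longrightarrow> y \<in> pts A \<Longrightarrow> (h (amult A x y))\<^sup>2 \<le> h y * h (amult A (astar A x) (amult A x y))"
    and vnorm_nonneg: "x \<in> pts A \<Longrightarrow> 0 \<le> vnorm A x"
    and vnorm_bound: "x \<in> pts A \<Longrightarrow> y \<in> pts A \<Longrightarrow> h (amult A x y) \<le> vnorm A x * h y"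
    and vnorm_least: "x \<in> pts A \<Longrightarrow> 0 \<le> C \<Longrightarrow> (\<And>y. y \<in> pts A \<Longrightarrow> h (amult A x y) \<le> C * h y) \<Longrightarrow> vnorm A x \<le> C"
begin

lemma vnorm_scale_le: "x \<in> pts A \<Longrightarrow> vnorm A (vscale A c x) \<le> cmod c * vnorm A x"
  using mult_left_mono[OF vnorm_bound]
  by (intro vnorm_least) (simp_all add: mult_scale_left h_scale vnorm_nonneg mult.assoc)

text \<open>Apply \<open>h_star_mult\<close> to \<open>x^*\<close>: for \<open>z = x^* y\<close> it
  gives \<open>(h z)^2 \<le> h y * h (x z)\<close>, and one factor \<open>h z\<close>
  cancels.\<close>

lemma vnorm_star_le:
  assumes x: "x \<in> pts A"
  shows "vnorm A (astar A x) \<le> vnorm A x"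
proof (rule vnorm_least)
  fix y assume y: "y \<in> pts A"
  let ?z = "amult A (astar A x) y"
  have z: "?z \<in> pts A" using x y by simp
  have "h ?z * h ?z \<le> h y * (vnorm A x * h ?z)"
  proof -
    have "h ?z * h ?z \<le> h y * h (amult A x ?z)"
      using h_star_mult[of "astar A x" y] x y by (simp add: power2_eq_square)
    also have "\<dots> \<le> h y * (vnorm A x * h ?z)"
      by (rule mult_left_mono[OF vnorm_bound[OF x z] h_nonneg[OF y]])
    finally show ?thesis .
  qed
  then have "h ?z * h ?z \<le> (vnorm A x * h y) * h ?z" by (simp add: mult_ac)
  then show "h ?z \<le> vnorm A x * h y"
    using h_nonneg[OF z] h_nonneg[OF y] vnorm_nonneg[OF x]
    by (cases "h ?z = 0") (auto simp: mult_le_cancel_right)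
qed (use x vnorm_nonneg in simp_all)

sublocale normed_star_alg A
proof
  fix x y c assume x: "x \<in> pts A"
  show "0 \<le> vnorm A x" by (rule vnorm_nonneg[OF x])
  show "vnorm A (vscale A c x) = cmod c * vnorm A x"
  proof (cases "c = 0")
    case True
    then show ?thesis using vnorm_scale_le[OF x, of 0] vnorm_nonneg[of "vzero A"] x by simp
  next
    case False
    have "cmod c * vnorm A x = cmod c * vnorm A (vscale A (1 / c) (vscale A c x))"
      using x False by (simp flip: scale_mult)
    also have "\<dots> \<le> cmod c * (cmod (1 / c) * vnorm A (vscale A c x))"
      using x by (intro mult_left_mono vnorm_scale_le) simp_all
    also have "\<dots> = vnorm A (vscale A c x)" using False by (simp add: norm_divide)
    finally show ?thesis using vnorm_scale_le[OF x, of c] by linarith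
  qed
  show "vnorm A (astar A x) = vnorm A x"
    using vnorm_star_le[OF x] vnorm_star_le[of "astar A x"] x by simp
  assume y: "y \<in> pts A"
  show "vnorm A (vadd A x y) \<le> vnorm A x + vnorm A y"
  proof (rule vnorm_least)
    fix z assume z: "z \<in> pts A"
    show "h (amult A (vadd A x y) z) \<le> (vnorm A x + vnorm A y) * h z"
      using h_triangle[of "amult A x z" "amult A y z"] vnorm_bound[OF x z] vnorm_bound[OF y z] x y z
      by (simp add: mult_add_left distrib_right)
  qed (use x y vnorm_nonneg in simp_all)
  show "vnorm A (amult A x y) \<le> vnorm A x * vnorm A y"
  proof (rule vnorm_least)
    fix z assume z: "z \<in> pts A"
    have "h (amult A (amult A x y) z) \<le> vnorm A x * h (amult A y z)"
      using vnorm_bound[of x "amult A y z"] x y z by (simp add: mult_assoc)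
    also have "\<dots> \<le> vnorm A x * (vnorm A y * h z)"
      using vnorm_bound[OF y z] vnorm_nonneg[OF x] by (rule mult_left_mono)
    finally show "h (amult A (amult A x y) z) \<le> vnorm A x * vnorm A y * h z" by (simp add: mult.assoc)
  qed (use x y vnorm_nonneg in simp_all)
qed

text \<open>By \<open>h_star_mult\<close> the square root of \<open>norm (x^* x)\<close> bounds left
  multiplication by \<open>x\<close>, and \<open>vnorm\<close> is the least bound.\<close>

lemma vnorm_cstar:
  assumes x: "x \<in> pts A"
  shows "vnorm A (amult A (astar A x) x) = (vnorm A x)\<^sup>2"
proof (rule antisym)
  show "vnorm A (amult A (astar A x) x) \<le> (vnorm A x)\<^sup>2"
    using norm_mult[of "astar A x" x] x by (simp add: power2_eq_square)
  let ?c = "sqrt (vnorm A (amult A (astar A x) x))"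
  have "vnorm A x \<le> ?c"
  proof (rule vnorm_least[OF x])
    fix y assume y: "y \<in> pts A"
    have "(h (amult A x y))\<^sup>2 \<le> h y * (vnorm A (amult A (astar A x) x) * h y)"
      using h_star_mult[OF x y] mult_left_mono[OF vnorm_bound[of "amult A (astar A x) x" y], of "h y"] x y
      by (simp add: mult_assoc)
    also have "\<dots> = (?c * h y)\<^sup>2" using x by (simp add: power_mult_distrib power2_eq_square[of "h y"])
    finally show "h (amult A x y) \<le> ?c * h y"
      by (rule power2_le_imp_le) (use x y in simp)
  qed (use x in simp)
  then have "(vnorm A x)\<^sup>2 \<le> ?c\<^sup>2" using x by (intro power_mono) simp_all
  then show "(vnorm A x)\<^sup>2 \<le> vnorm A (amult A (astar A x) x)" using x by simp
qed

end

section \<open>The reduced norm on sections\<close>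

context fell
begin

interpretation M: seminormed "section_module B"
  by (rule section_module_seminormed)

lemma conv_bounded:
  assumes "x \<in> sections"
  shows "\<exists>C\<ge>0. \<forall>y\<in>sections. hnorm (conv x y) \<le> C * hnorm y"
  using assms
proof (induction x rule: section_induct)
  case (delta t b)
  then show ?case using hnorm_conv_delta by (intro exI[of _ "nm t b"]) simp
next
  case (add x x')
  then obtain C D where C: "0 \<le> C" "\<And>y. y \<in> sections \<Longrightarrow> hnorm (conv x y) \<le> C * hnorm y"
    and D: "0 \<le> D" "\<And>y. y \<in> sections \<Longrightarrow> hnorm (conv x' y) \<le> D * hnorm y" by blast
  have "hnorm (conv (sadd x x') y) \<le> (C + D) * hnorm y" if y: "y \<in> sections" for y
    using hnorm_triangle[of "conv x y" "conv x' y"] C(2)[OF y] D(2)[OF y] add y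
    by (simp add: conv_add_left distrib_right)
  then show ?case using C(1) D(1) by (intro exI[of _ "C + D"]) simp
qed

lemma left_regular_eq:
  assumes "b \<in> pts (fib B t)" "P \<in> pts (completion (section_module B))"
  shows "left_regular B t b P = cauchy_class (section_module B) (\<lambda>n. conv (delta t b) (cauchy_rep P n))"
proof -
  have "(\<lambda>n s. bmult B b (cauchy_rep P n (- t + s))) = (\<lambda>n. conv (delta t b) (cauchy_rep P n))"
    using assms M.cauchy_seqsD[OF M.cauchy_rep_seq[OF assms(2)]] by (auto simp: conv_delta fun_eq_iff)
  then show ?thesis by (simp add: left_regular_def)
qed

lemma vsum_conv_delta:
  assumes x: "x \<in> sections" and y: "y \<in> sections"
  shows "vsum (section_module B) (\<lambda>t. conv (delta t (x t)) y) (supp x) = conv x y"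
proof
  fix s
  have "vsum (section_module B) (\<lambda>t. conv (delta t (x t)) y) (supp x) s
      = vsum (fib B s) (\<lambda>t. conv (delta t (x t)) y s) (supp x)"
    using x y
    by (intro vsum_hom[where h = "\<lambda>x. x s"] M.vmonoid_axioms fib.vmonoid_axioms)
      (auto simp: section_ops sadd_def)
  also have "\<dots> = vsum (fib B s) (\<lambda>t. bmult B (x t) (y (- t + s))) (supp x)"
    using x y conv_delta[OF section_value[OF x] y] by (intro fib.vsum_eqI) auto
  also have "\<dots> = conv x y s" using x y by (intro conv_eq_vsum[symmetric]) auto
  finally show "vsum (section_module B) (\<lambda>t. conv (delta t (x t)) y) (supp x) s = conv x y s" .
qed

lemma conv_delta_cauchy:
  assumes "b \<in> pts (fib B t)" "X \<in> cauchy_seqs (section_module B)"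
  shows "(\<lambda>n. conv (delta t b) (X n)) \<in> cauchy_seqs (section_module B)"
proof (rule bounded_map_cauchy(1)[OF section_module_seminormed section_module_seminormed _ _ assms(2)])
  fix x y assume xy: "x \<in> pts (section_module B)" "y \<in> pts (section_module B)"
  have "vdiff (section_module B) (conv (delta t b) x) (conv (delta t b) y) = conv (delta t b) (vdiff (section_module B) x y)"
    using xy assms by (simp add: vdiff_def section_ops conv_add_right conv_scale_right)
  then show "vnorm (section_module B) (vdiff (section_module B) (conv (delta t b) x) (conv (delta t b) y))
      \<le> nm t b * vnorm (section_module B) (vdiff (section_module B) x y)"
    using M.diff_closed[OF xy] assms hnorm_conv_delta by (simp add: hnorm_eq)
qed (use assms in simp)

text \<open>The sum of left regular operators that defines the reduced norm is termwise left
  convolution by \<open>x\<close>, the form to which \<open>completion_opnorm\<close>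
  applies.\<close>

lemma regular_operator_eq:
  assumes x: "x \<in> sections" and P: "P \<in> pts (completion (section_module B))"
  shows "fsum (bundle_ell2 B) (\<lambda>t. left_regular B t (x t) P)
    = cauchy_class (section_module B) (\<lambda>n. conv x (cauchy_rep P n))"
proof -
  interpret C: vmonoid "completion (section_module B)" by (rule M.completion_vmonoid)
  have r: "cauchy_rep P \<in> cauchy_seqs (section_module B)" by (rule M.cauchy_rep_seq[OF P])
  have rn: "cauchy_rep P n \<in> sections" for n using M.cauchy_seqsD[OF r] by simp
  let ?Y = "\<lambda>t n. conv (delta t (x t)) (cauchy_rep P n)"
  have Y: "?Y t \<in> cauchy_seqs (section_module B)" for t
    using conv_delta_cauchy[OF section_value[OF x] r] .
  have lr: "left_regular B t (x t) P = cauchy_class (section_module B) (?Y t)" for t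
    by (rule left_regular_eq[OF section_value[OF x] P])
  have "fsum (bundle_ell2 B) (\<lambda>t. left_regular B t (x t) P)
      = vsum (completion (section_module B)) (\<lambda>t. cauchy_class (section_module B) (?Y t)) (supp x)"
    unfolding bundle_ell2_def lr
  proof (rule C.fsum_eq_vsum)
    fix t assume t: "t \<notin> supp x"
    have "?Y t n s = vzero (fib B s)" for n s
      using conv_delta[OF section_value[OF x] rn, of t n s] conv_term_zero[OF t rn, of n s] by (rule trans)
    then have "?Y t = (\<lambda>n. vzero (section_module B))" by (simp add: fun_eq_iff)
    then show "cauchy_class (section_module B) (?Y t) = vzero (completion (section_module B))"
      by (simp add: M.completion_zero)
  qed (use x Y in simp_all)
  also have "\<dots> = cauchy_class (section_module B) (\<lambda>n. vsum (section_module B) (\<lambda>t. ?Y t n) (supp x))"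
    using M.cauchy_vsum[of "supp x" ?Y] Y by blast
  finally show ?thesis using x rn by (simp add: vsum_conv_delta)
qed

text \<open>The reduced norm is from here on known through these three properties, which speak of
  finitely supported sections only.\<close>

lemma section_vnorm:
  assumes x: "x \<in> sections"
  shows "y \<in> sections \<Longrightarrow> hnorm (conv x y) \<le> vnorm (section_alg B) x * hnorm y"
    and "0 \<le> D \<Longrightarrow> (\<And>y. y \<in> sections \<Longrightarrow> hnorm (conv x y) \<le> D * hnorm y) \<Longrightarrow> vnorm (section_alg B) x \<le> D"
    and "0 \<le> vnorm (section_alg B) x"
proof -
  obtain C where C: "0 \<le> C" "\<And>y. y \<in> sections \<Longrightarrow> hnorm (conv x y) \<le> C * hnorm y"
    using conv_bounded[OF x] by blast
  let ?S = "section_module B"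
  let ?T = "\<lambda>P. cauchy_class ?S (\<lambda>n. conv x (cauchy_rep P n))"
  have "vnorm (section_alg B) x = opnorm (bundle_ell2 B) (\<lambda>P. fsum (bundle_ell2 B) (\<lambda>t. left_regular B t (x t) P))"
    by (simp add: section_alg_def)
  also have "\<dots> = opnorm (bundle_ell2 B) ?T"
    using regular_operator_eq[OF x] by (intro opnorm_cong) (simp only: bundle_ell2_def)
  finally have v: "vnorm (section_alg B) x = opnorm (completion ?S) ?T"
    by (simp only: bundle_ell2_def)
  have lin: "conv x y \<in> pts ?S" "conv x (vscale ?S c y) = vscale ?S c (conv x y)"
    "vnorm ?S (conv x y) \<le> C * vnorm ?S y" if "y \<in> pts ?S" for y c
    using that x C(2)[of y] by (simp_all add: section_ops conv_scale_right hnorm_eq)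
  have diff: "vdiff ?S (conv x y) (conv x z) = conv x (vdiff ?S y z)" if "y \<in> pts ?S" "z \<in> pts ?S" for y z
    using that x by (simp add: vdiff_def section_ops conv_add_right conv_scale_right)
  note op = M.completion_opnorm[OF lin(1,2) diff C(1) lin(3)]
  show "0 \<le> vnorm (section_alg B) x" unfolding v by (rule op(3))
  show "hnorm (conv x y) \<le> vnorm (section_alg B) x * hnorm y" if "y \<in> sections" for y
    unfolding v using op(1)[of y] that x by (simp add: hnorm_eq)
  show "vnorm (section_alg B) x \<le> D" if "0 \<le> D" "\<And>y. y \<in> sections \<Longrightarrow> hnorm (conv x y) \<le> D * hnorm y"
    unfolding v using that x by (intro op(2)) (simp_all add: hnorm_eq)
qed

sublocale sec: regular_alg "section_alg B" hnorm
proof (unfold_locales, unfold section_ops section_alg_simps)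
  fix x y assume x: "x \<in> sections" and y: "y \<in> sections"
  show "(hnorm (conv x y))\<^sup>2 \<le> hnorm y * hnorm (conv (sstar x) (conv x y))"
    using norm_inner_le[of y "conv (sstar x) (conv x y)"] x y
    by (simp add: hnorm_square inner_conv)
qed (simp_all add: conv_add_left conv_add_right conv_scale_left conv_scale_right conv_assoc sstar_add sstar_scale
    sstar_conv hnorm_scale hnorm_triangle section_vnorm)

text \<open>The unit fibre may lack a unit, so the operator is tested on the point section of the
  adjoint of \<open>b\<close>, where the C*-identity gives the norm of the result.\<close>

lemma vnorm_delta_ge:
  assumes b: "b \<in> pts (fib B t)"
  shows "nm t b \<le> vnorm (section_alg B) (delta t b)"
proof -
  have s: "bstar B b \<in> pts (fib B (- t))" by (rule star_closed[OF b])
  have bb: "bmult B b (bstar B b) \<in> pts (fib B 0)" using mult_closed[OF b s] by simp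
  have "hnorm (conv (delta t b) (delta (- t) (bstar B b))) = (nm t b)\<^sup>2"
    using hnorm_delta[OF bb] norm_mult_star[OF b] by (simp add: conv_delta_delta[OF b s])
  then have "nm t b * nm t b \<le> vnorm (section_alg B) (delta t b) * nm t b"
    using section_vnorm(1)[OF delta_closed[OF b] delta_closed[OF s]] hnorm_delta[OF s] b
    by (simp add: power2_eq_square)
  then show ?thesis using fib.norm_nonneg[OF b] section_vnorm(3)[OF delta_closed[OF b]]
    by (cases "nm t b = 0") (auto simp: mult_le_cancel_right)
qed

lemma representation_of_star_hom:
  assumes "star_hom (section_alg B) C \<psi>"
  shows "representation B C (\<lambda>t b. \<psi> (delta t b))"
proof -
  have \<psi>: "\<And>x. x \<in> sections \<Longrightarrow> \<psi> x \<in> pts C"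
    "\<And>x y. x \<in> sections \<Longrightarrow> y \<in> sections \<Longrightarrow> \<psi> (sadd x y) = vadd C (\<psi> x) (\<psi> y)"
    "\<And>x c. x \<in> sections \<Longrightarrow> \<psi> (sscale c x) = vscale C c (\<psi> x)"
    "\<And>x y. x \<in> sections \<Longrightarrow> y \<in> sections \<Longrightarrow> \<psi> (conv x y) = amult C (\<psi> x) (\<psi> y)"
    "\<And>x. x \<in> sections \<Longrightarrow> \<psi> (sstar x) = astar C (\<psi> x)"
    using assms by (auto simp: star_hom_def linear_on_def section_ops)
  have "delta t (vadd (fib B t) a b) = sadd (delta t a) (delta t b)"
    "delta t (vscale (fib B t) c a) = sscale c (delta t a)" for t a b c
    by (auto simp: delta_def sadd_def sscale_def fun_eq_iff)
  then show ?thesis unfolding representation_def linear_on_def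
    using \<psi>(1-3) \<psi>(4)[symmetric] \<psi>(5)[symmetric] by (auto simp: conv_delta_delta sstar_delta)
qed

theorem rfd_bundle_of_rfd_reduced:
  assumes "rfd (reduced_cstar B)"
  shows "rfd_bundle B"
  unfolding rfd_bundle_def
proof (intro allI impI)
  fix e :: real and \<Omega> assume e: "0 < e" and \<Omega>: "finite \<Omega> \<and> \<Omega> \<subseteq> total B"
  then have "\<forall>b\<in>\<Omega>. \<exists>t. b \<in> pts (fib B t)" by (auto simp: total_def)
  \<comment> \<open>The degree of an element of the total space, unique because the fibres are
    disjoint.\<close>
  then obtain dg where dg: "\<And>b. b \<in> \<Omega> \<Longrightarrow> b \<in> pts (fib B (dg b))" by metis
  let ?\<Omega> = "(\<lambda>b. sec.const_class (delta (dg b) b)) ` \<Omega>"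
  have "finite ?\<Omega>" "?\<Omega> \<subseteq> pts (reduced_cstar B)"
    using \<Omega> dg by (auto simp: reduced_cstar_def)
  then obtain d \<phi> where \<phi>: "star_hom (reduced_cstar B) (mat_alg d) \<phi>"
    "\<And>a. a \<in> ?\<Omega> \<Longrightarrow> vnorm (mat_alg d) (\<phi> a) \<ge> vnorm (reduced_cstar B) a - e"
    using assms e unfolding rfd_def by meson
  let ?\<psi> = "\<lambda>x. \<phi> (sec.const_class x)"
  have "representation B (mat_alg d) (\<lambda>t b. ?\<psi> (delta t b))"
    using \<phi>(1) unfolding reduced_cstar_def by (intro representation_of_star_hom sec.star_hom_const_class)
  moreover have "vnorm (mat_alg d) (?\<psi> (delta t b)) \<ge> nm t b - e" if "b \<in> \<Omega>" "b \<in> pts (fib B t)" for t b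
  proof -
    have "\<forall>s t. s \<noteq> t \<longrightarrow> pts (fib B s) \<inter> pts (fib B t) = {}"
      using fell_bundle by (simp add: fell_bundle_def)
    then have "dg b = t" using dg[OF that(1)] that(2) by blast
    then have "sec.const_class (delta t b) \<in> ?\<Omega>" using that(1) by blast
    from \<phi>(2)[OF this] show ?thesis using vnorm_delta_ge[OF that(2)] that(2) by (simp add: reduced_cstar_def)
  qed
  ultimately show "\<exists>d \<pi>. representation B (mat_alg d) \<pi> \<and>
      (\<forall>t. \<forall>b\<in>\<Omega> \<inter> pts (fib B t). nm t b - e \<le> vnorm (mat_alg d) (\<pi> t b))"
    by blast
qed

end

section \<open>The norm as a growth rate\<close>

text \<open>Iterating the second hypothesis gives \<open>(a 0 / c)^(2^k) \<le> a k / c\<close>. If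
  \<open>a 0\<close> exceeded \<open>c L\<close>, the powers of \<open>r = a 0 / (c L) > 1\<close>
  would stay below \<open>K / c\<close>. The conclusion is free of \<open>K\<close>: every crude
  constant can be absorbed there.\<close>

lemma growth_bound:
  fixes a :: "nat \<Rightarrow> real"
  assumes a: "\<And>k. 0 \<le> a k" "\<And>k. (a k)\<^sup>2 \<le> c * a (Suc k)" "\<And>k. a k \<le> K * L ^ (2 ^ k)"
    and c: "0 \<le> c" and L: "0 \<le> L"
  shows "a 0 \<le> c * L"
proof (rule ccontr)
  assume "\<not> a 0 \<le> c * L"
  then have gt: "c * L < a 0" by simp
  have cL: "0 \<le> c * L" using c L by simp
  have c0: "0 < c"
  proof (rule ccontr)
    assume "\<not> 0 < c"
    then have "(a 0)\<^sup>2 \<le> 0" using a(2)[of 0] c by simp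
    then show False using gt cL by simp
  qed
  \<comment> \<open>Stated without quotients; for \<open>c > 0\<close> it is the iterated inequality
    multiplied by a power of \<open>c\<close>.\<close>
  have iter: "c * a 0 ^ (2 ^ k) \<le> c ^ (2 ^ k) * a k" for k
  proof (induction k)
    case (Suc k)
    have "c * (c * a 0 ^ (2 ^ Suc k)) = (c * a 0 ^ (2 ^ k))\<^sup>2"
      by (simp add: power_mult_distrib power2_eq_square power_add mult_2 mult_ac)
    also have "\<dots> \<le> (c ^ (2 ^ k) * a k)\<^sup>2"
      using Suc c a(1) by (intro power_mono) simp_all
    also have "\<dots> = c ^ (2 ^ Suc k) * (a k)\<^sup>2"
      by (simp add: power_mult_distrib power2_eq_square power_add mult_2 mult_ac)
    also have "\<dots> \<le> c ^ (2 ^ Suc k) * (c * a (Suc k))" using a(2) c by (intro mult_left_mono) simp_all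
    finally show ?case using c0 by (simp add: mult_ac)
  qed simp
  have bound: "c * a 0 ^ (2 ^ k) \<le> K * (c * L) ^ (2 ^ k)" for k
  proof -
    have "c ^ (2 ^ k) * a k \<le> c ^ (2 ^ k) * (K * L ^ (2 ^ k))" using a(3) c by (intro mult_left_mono) simp_all
    then show ?thesis using iter[of k] by (simp add: power_mult_distrib mult_ac)
  qed
  have a0: "0 < a 0" using gt cL by linarith
  have cL0: "0 < c * L"
  proof (rule ccontr)
    assume "\<not> 0 < c * L"
    then have z: "c * L = 0" using cL by linarith
    have "c * a 0 \<le> 0" using bound[of 0] by (simp only: z power_0 power_one_right mult_zero_right)
    then show False using c0 a0 by (simp add: mult_le_0_iff)
  qed
  define r where "r = a 0 / (c * L)"
  have r: "1 < r" using gt cL0 by (simp add: r_def)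
  have rk: "r ^ (2 ^ k) \<le> K / c" for k
    using bound[of k] c0 cL0 by (simp add: r_def power_divide pos_divide_le_eq pos_le_divide_eq mult.commute)
  obtain n where "K / c < r ^ n" using real_arch_pow[OF r] by blast
  moreover have "r ^ n \<le> r ^ (2 ^ n)" using r by (intro power_increasing) (simp_all add: less_imp_le)
  ultimately show False using rk[of n] by linarith
qed

context star_alg
begin

text \<open>The power \<open>x^(2^k)\<close>; subtracting 1 undoes the shift of
  \<open>apow\<close>.\<close>

definition dyadic :: "'a \<Rightarrow> nat \<Rightarrow> 'a" where
  "dyadic x k = apow x (2 ^ k - 1)"

lemma dyadic_closed [simp]: "x \<in> pts A \<Longrightarrow> dyadic x k \<in> pts A"
  by (simp add: dyadic_def)

lemma dyadic_0 [simp]: "dyadic x 0 = x"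
  by (simp add: dyadic_def)

lemma dyadic_Suc: "x \<in> pts A \<Longrightarrow> dyadic x (Suc k) = amult A (dyadic x k) (dyadic x k)"
proof -
  have "Suc ((2 ^ k - 1) + (2 ^ k - 1)) = (2 ^ Suc k - 1 :: nat)"
  proof -
    obtain q where "(2 :: nat) ^ k = Suc q" using gr0_implies_Suc[of "(2 :: nat) ^ k"] by auto
    then show ?thesis by simp
  qed
  then show "x \<in> pts A \<Longrightarrow> ?thesis" unfolding dyadic_def by (subst apow_add) simp_all
qed

lemma dyadic_star: "x \<in> pts A \<Longrightarrow> astar A x = x \<Longrightarrow> astar A (dyadic x k) = dyadic x k"
  by (simp add: dyadic_def apow_star)

lemma dyadic_hom:
  assumes "star_hom A C \<phi>" "x \<in> pts A"
  shows "\<phi> (dyadic x (Suc k)) = amult C (\<phi> (dyadic x k)) (\<phi> (dyadic x k))"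
  using assms by (simp add: dyadic_Suc star_hom_def)

end

context normed_star_alg
begin

lemma norm_dyadic_le: "x \<in> pts A \<Longrightarrow> vnorm A (dyadic x k) \<le> vnorm A x ^ (2 ^ k)"
proof (induction k)
  case (Suc k)
  have "vnorm A (dyadic x (Suc k)) \<le> vnorm A (dyadic x k) * vnorm A (dyadic x k)"
    using Suc.prems by (simp add: dyadic_Suc norm_mult)
  also have "\<dots> \<le> vnorm A x ^ (2 ^ k) * vnorm A x ^ (2 ^ k)"
    using Suc by (intro mult_mono) simp_all
  finally show ?case by (simp add: power_add mult_2)
qed simp

end

context fell
begin

text \<open>For a point section this follows from \<open><u a, u a> = a^* <u, u> a\<close>. The
  constant depends on \<open>y\<close> alone, so it disappears in the growth argument.\<close>

lemma hnorm_conv_right: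
  assumes "y \<in> sections"
  shows "\<exists>C\<ge>0. \<forall>u\<in>sections. hnorm (conv u y) \<le> C * hnorm u"
  using assms
proof (induction y rule: section_induct)
  case (delta t a)
  have "hnorm (conv u (delta t a)) \<le> nm t a * hnorm u" if u: "u \<in> sections" for u
  proof (rule power2_le_imp_le)
    let ?z = "conv (sstar u) u"
    have z: "?z \<in> sections" using u by simp
    have "inner (conv u (delta t a)) (conv u (delta t a)) = conv (delta (- t) (bstar B a)) (conv ?z (delta t a)) 0"
      using u delta by (simp add: inner_def sstar_conv sstar_delta conv_assoc star_closed)
    also have "\<dots> = bmult B (bstar B a) (conv ?z (delta t a) t)"
      using conv_delta[OF star_closed[OF delta], of "conv ?z (delta t a)" 0] z delta by simp
    also have "conv ?z (delta t a) t = bmult B (?z 0) a"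
    proof -
      have "conv w (delta t a) t = bmult B (w 0) a" if "w \<in> sections" for w
        using that
      proof (induction w rule: section_induct)
        case (delta s b)
        have "t = s + t \<longleftrightarrow> s = 0" using add_right_cancel[of 0 t s] by auto
        then show ?case using delta \<open>a \<in> _\<close> mult_zero_left[OF \<open>a \<in> _\<close>, of 0 t]
          by (auto simp: conv_delta_delta) (auto simp: delta_def)
      next
        case (add x y)
        then show ?case using \<open>a \<in> _\<close>
          by (simp add: conv_add_left) (simp add: sadd_def mult_add_left[where s = 0 and t = t and r = t])
      qed
      then show ?thesis using z by blast
    qed
    finally have e: "inner (conv u (delta t a)) (conv u (delta t a)) = bmult B (bstar B a) (bmult B (inner u u) a)"
      by (simp add: inner_def)
    have "nm 0 (bmult B (bstar B a) (bmult B (inner u u) a)) \<le> nm t a * nm t (bmult B (inner u u) a)"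
      using norm_mult[OF star_closed[OF delta], of "bmult B (inner u u) a" t] unit_mult_closed(1)[of "inner u u" a t]
        u delta by simp
    also have "\<dots> \<le> nm t a * (nm 0 (inner u u) * nm t a)"
      using norm_mult[of "inner u u" 0 a t] u delta by (intro mult_left_mono) simp_all
    finally show "(hnorm (conv u (delta t a)))\<^sup>2 \<le> (nm t a * hnorm u)\<^sup>2"
      using u delta by (simp add: hnorm_square e power_mult_distrib) (simp add: power2_eq_square mult_ac)
  qed (use u delta in simp)
  then show ?case using delta by (intro exI[of _ "nm t a"]) simp
next
  case (add x y)
  then obtain C D where C: "0 \<le> C" "\<And>u. u \<in> sections \<Longrightarrow> hnorm (conv u x) \<le> C * hnorm u"
    and D: "0 \<le> D" "\<And>u. u \<in> sections \<Longrightarrow> hnorm (conv u y) \<le> D * hnorm u" by blast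
  have "hnorm (conv u (sadd x y)) \<le> (C + D) * hnorm u" if u: "u \<in> sections" for u
    using hnorm_triangle[of "conv u x" "conv u y"] C(2)[OF u] D(2)[OF u] add u
    by (simp add: conv_add_right distrib_right)
  then show ?case using C(1) D(1) by (intro exI[of _ "C + D"]) simp
qed

text \<open>Apply \<open>growth_bound\<close> to \<open>a k = hnorm (x^(2^k) y)\<close> with
  \<open>c = hnorm y\<close>: the square of \<open>a k\<close> is the norm of
  \<open><y, x^(2^(k+1)) y>\<close>, bounded by Cauchy-Schwarz, and right convolution by
  \<open>y\<close> turns the hypothesis on \<open>x^(2^k)\<close> into the upper bound.\<close>

theorem vnorm_le_growth:
  assumes x: "x \<in> sections" "sstar x = x" and K: "0 \<le> K" and L: "0 \<le> L"
    and bound: "\<And>k. hnorm (sec.dyadic x k) \<le> K * L ^ (2 ^ k)"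
  shows "vnorm (section_alg B) x \<le> L"
proof (rule section_vnorm(2)[OF x(1) L])
  fix y assume y: "y \<in> sections"
  have d [simp]: "sec.dyadic x k \<in> sections" for k using sec.dyadic_closed[of x k] x by simp
  have ds: "sstar (sec.dyadic x k) = sec.dyadic x k" for k
    using sec.dyadic_star[of x k] x by (simp add: section_ops)
  have dS: "sec.dyadic x (Suc k) = conv (sec.dyadic x k) (sec.dyadic x k)" for k
    using sec.dyadic_Suc[of x k] x by (simp add: section_ops)
  obtain C where C: "0 \<le> C" "\<And>u. u \<in> sections \<Longrightarrow> hnorm (conv u y) \<le> C * hnorm u"
    using hnorm_conv_right[OF y] by blast
  have "hnorm (conv (sec.dyadic x 0) y) \<le> hnorm y * L"
  proof (rule growth_bound[of "\<lambda>k. hnorm (conv (sec.dyadic x k) y)"])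
    show "0 \<le> hnorm (conv (sec.dyadic x k) y)" for k using y by simp
    show "(hnorm (conv (sec.dyadic x k) y))\<^sup>2 \<le> hnorm y * hnorm (conv (sec.dyadic x (Suc k)) y)" for k
      using norm_inner_le[of y "conv (sec.dyadic x (Suc k)) y"] y ds[of k]
      by (simp add: hnorm_square inner_conv dS conv_assoc)
    show "hnorm (conv (sec.dyadic x k) y) \<le> (C * K) * L ^ (2 ^ k)" for k
      using C(2)[OF d, of k] mult_left_mono[OF bound[of k] C(1)] by (simp add: mult.assoc)
  qed (use y L in simp_all)
  then show "hnorm (conv x y) \<le> L * hnorm y" by (simp add: mult.commute)
qed

text \<open>In place of a unit vector the test vector is the point section at \<open>0\<close> of
  the adjoint of \<open>x 0\<close>.\<close>

lemma norm_unit_value_le_vnorm: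
  assumes x: "x \<in> sections"
  shows "nm 0 (x 0) \<le> vnorm (section_alg B) x"
proof -
  let ?a = "bstar B (x 0)"
  have a: "?a \<in> pts (fib B 0)" using x by (simp add: unit_star_closed)
  have "nm 0 (bmult B (x 0) ?a) \<le> hnorm (conv x (delta 0 ?a))"
    using norm_value_le_hnorm[of "conv x (delta 0 ?a)" 0] conv_delta_right_zero[OF x a] x a by simp
  also have "\<dots> \<le> vnorm (section_alg B) x * nm 0 ?a"
    using section_vnorm(1)[OF x delta_closed[OF a]] hnorm_delta[OF a] by simp
  finally have "nm 0 (x 0) * nm 0 (x 0) \<le> vnorm (section_alg B) x * nm 0 (x 0)"
    using norm_mult_star[OF section_value[OF x, of 0]] norm_star[OF section_value[OF x, of 0]]
    by (simp add: power2_eq_square)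
  then show ?thesis using fib.norm_nonneg[OF section_value[OF x, of 0]] section_vnorm(3)[OF x]
    by (cases "nm 0 (x 0) = 0") (auto simp: mult_le_cancel_right)
qed

lemma hnorm_le_vnorm:
  assumes x: "x \<in> sections"
  shows "hnorm x \<le> vnorm (section_alg B) x"
proof (rule power2_le_imp_le)
  have "(hnorm x)\<^sup>2 \<le> vnorm (section_alg B) (conv (sstar x) x)"
    using norm_unit_value_le_vnorm[of "conv (sstar x) x"] x by (simp add: hnorm_square inner_def)
  also have "\<dots> = (vnorm (section_alg B) x)\<^sup>2"
    using sec.vnorm_cstar[of x] x by (simp add: section_ops)
  finally show "(hnorm x)\<^sup>2 \<le> (vnorm (section_alg B) x)\<^sup>2" .
qed (rule section_vnorm(3)[OF x])

end

section \<open>Matrices\<close>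

abbreviation l2 :: "'i set \<Rightarrow> ('i \<Rightarrow> complex) \<Rightarrow> real" where
  "l2 I u \<equiv> L2_set (\<lambda>i. cmod (u i)) I"

definition mv :: "'i set \<Rightarrow> ('i \<Rightarrow> 'i \<Rightarrow> complex) \<Rightarrow> ('i \<Rightarrow> complex) \<Rightarrow> 'i \<Rightarrow> complex" where
  "mv I M u i = (\<Sum>j\<in>I. M i j * u j)"

text \<open>Index sets such as products and disjoint unions occur below, so matrices are functions
  on an index set; a bound as a relation can be carried along injections without speaking of
  suprema.\<close>

definition op_bound :: "'i set \<Rightarrow> ('i \<Rightarrow> 'i \<Rightarrow> complex) \<Rightarrow> real \<Rightarrow> bool" where
  "op_bound I M C \<longleftrightarrow> (\<forall>u. l2 I (mv I M u) \<le> C * l2 I u)"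

lemma op_boundD: "op_bound I M C \<Longrightarrow> l2 I (mv I M u) \<le> C * l2 I u"
  by (simp add: op_bound_def)

lemma op_bound_cong: "(\<And>i j. i \<in> I \<Longrightarrow> j \<in> I \<Longrightarrow> M i j = M' i j) \<Longrightarrow> op_bound I M C \<longleftrightarrow> op_bound I M' C"
  unfolding op_bound_def mv_def by (intro all_cong1) (simp cong: L2_set_cong sum.cong)

lemma l2_square: "(l2 I u)\<^sup>2 = (\<Sum>i\<in>I. (cmod (u i))\<^sup>2)"
  by (simp add: L2_set_def sum_nonneg)

lemma l2_unit: "finite I \<Longrightarrow> j \<in> I \<Longrightarrow> l2 I (\<lambda>i. if i = j then c else 0) = cmod c"
  by (simp add: L2_set_def if_distrib[of cmod] if_distrib[of "\<lambda>x. x\<^sup>2"] cong: if_cong)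

lemma mv_unit: "finite I \<Longrightarrow> j \<in> I \<Longrightarrow> mv I M (\<lambda>i. if i = j then c else 0) i = M i j * c"
  by (simp add: mv_def if_distrib cong: if_cong)

lemma l2_scale: "l2 I (\<lambda>i. c * u i) = cmod c * l2 I u"
  by (simp add: norm_mult L2_set_right_distrib)

lemma op_bound_entry:
  assumes "finite I" "op_bound I M C" "i \<in> I" "j \<in> I"
  shows "cmod (M i j) \<le> C"
proof -
  have "cmod (M i j) \<le> l2 I (mv I M (\<lambda>i. if i = j then 1 else 0))"
    using member_le_L2_set[OF assms(1,3), of "\<lambda>i. cmod (mv I M (\<lambda>i. if i = j then 1 else 0) i)"] mv_unit[OF assms(1,4)] by simp
  also have "\<dots> \<le> C * l2 I (\<lambda>i. if i = j then 1 else 0)" by (rule op_boundD[OF assms(2)])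
  finally show ?thesis using l2_unit[OF assms(1,4), of 1] by simp
qed

lemma op_bound_mult:
  assumes "op_bound I M C" "op_bound I M' D" "0 \<le> C" "finite I"
  shows "op_bound I (\<lambda>i j. \<Sum>k\<in>I. M i k * M' k j) (C * D)"
  unfolding op_bound_def
proof
  fix u
  have "mv I (\<lambda>i j. \<Sum>k\<in>I. M i k * M' k j) u = mv I M (mv I M' u)"
    by (rule ext) (simp add: mv_def sum_distrib_left sum_distrib_right mult.assoc, rule sum.swap)
  moreover have "l2 I (mv I M (mv I M' u)) \<le> C * (D * l2 I u)"
    using op_boundD[OF assms(1), of "mv I M' u"] mult_left_mono[OF op_boundD[OF assms(2), of u] assms(3)] by linarith
  ultimately show "l2 I (mv I (\<lambda>i j. \<Sum>k\<in>I. M i k * M' k j) u) \<le> C * D * l2 I u" by (simp add: mult.assoc)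
qed

text \<open>The dependence on the size is harmless: wherever this is used for a norm estimate on
  representations, passing to powers removes it.\<close>

lemma op_bound_crude:
  assumes "finite I"
  shows "op_bound I M (\<Sum>i\<in>I. \<Sum>j\<in>I. cmod (M i j))"
  unfolding op_bound_def
proof
  fix u
  have "l2 I (mv I M u) \<le> (\<Sum>i\<in>I. cmod (mv I M u i))" by (rule L2_set_le_sum) simp
  also have "\<dots> \<le> (\<Sum>i\<in>I. \<Sum>j\<in>I. cmod (M i j) * l2 I u)"
  proof (rule sum_mono)
    fix i
    have "cmod (mv I M u i) \<le> (\<Sum>j\<in>I. cmod (M i j * u j))" unfolding mv_def by (rule norm_sum)
    also have "\<dots> \<le> (\<Sum>j\<in>I. cmod (M i j) * l2 I u)"
      using member_le_L2_set[OF assms, of _ "\<lambda>i. cmod (u i)"] by (intro sum_mono) (simp add: norm_mult mult_left_mono)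
    finally show "cmod (mv I M u i) \<le> (\<Sum>j\<in>I. cmod (M i j) * l2 I u)" .
  qed
  finally show "l2 I (mv I M u) \<le> (\<Sum>i\<in>I. \<Sum>j\<in>I. cmod (M i j)) * l2 I u" by (simp add: sum_distrib_right)
qed

lemma l2_mv_square:
  assumes "finite I"
  shows "complex_of_real ((l2 I (mv I M u))\<^sup>2) = (\<Sum>i\<in>I. \<Sum>j\<in>I. (\<Sum>k\<in>I. cnj (M k i) * M k j) * (cnj (u i) * u j))"
proof -
  have "complex_of_real ((l2 I (mv I M u))\<^sup>2) = (\<Sum>k\<in>I. cnj (mv I M u k) * mv I M u k)"
    unfolding l2_square of_real_sum complex_norm_square by (simp add: mult.commute)
  also have "\<dots> = (\<Sum>k\<in>I. \<Sum>i\<in>I. \<Sum>j\<in>I. cnj (M k i) * M k j * (cnj (u i) * u j))"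
    unfolding mv_def cnj_sum sum_product by (simp add: mult_ac)
  also have "\<dots> = (\<Sum>i\<in>I. \<Sum>j\<in>I. \<Sum>k\<in>I. cnj (M k i) * M k j * (cnj (u i) * u j))"
    by (subst sum.swap, rule sum.cong[OF refl], rule sum.swap)
  finally show ?thesis by (simp add: sum_distrib_right)
qed

text \<open>The square of \<open>norm (M u)\<close> is \<open><u, M^* M u>\<close>, to which
  Cauchy-Schwarz applies.\<close>

lemma op_bound_of_square:
  assumes I: "finite I" and b: "op_bound I (\<lambda>i j. \<Sum>k\<in>I. cnj (M k i) * M k j) (C\<^sup>2)" and C: "0 \<le> C"
  shows "op_bound I M C"
  unfolding op_bound_def
proof
  fix u
  let ?P = "\<lambda>i j. \<Sum>k\<in>I. cnj (M k i) * M k j"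
  have "complex_of_real ((l2 I (mv I M u))\<^sup>2) = (\<Sum>i\<in>I. \<Sum>j\<in>I. ?P i j * (cnj (u i) * u j))"
    by (rule l2_mv_square[OF I])
  also have "\<dots> = (\<Sum>i\<in>I. cnj (u i) * mv I ?P u i)"
    unfolding mv_def sum_distrib_left[of "cnj _"] by (simp add: mult_ac)
  finally have "complex_of_real ((l2 I (mv I M u))\<^sup>2) = (\<Sum>i\<in>I. cnj (u i) * mv I ?P u i)" .
  moreover have "(l2 I (mv I M u))\<^sup>2 = cmod (complex_of_real ((l2 I (mv I M u))\<^sup>2))"
    unfolding norm_of_real by simp
  ultimately have "(l2 I (mv I M u))\<^sup>2 = cmod (\<Sum>i\<in>I. cnj (u i) * mv I ?P u i)"
    by (simp only:)
  also have "\<dots> \<le> (\<Sum>i\<in>I. \<bar>cmod (u i)\<bar> * \<bar>cmod (mv I ?P u i)\<bar>)"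
    by (rule order_trans[OF norm_sum]) (simp add: norm_mult)
  also have "\<dots> \<le> l2 I u * l2 I (mv I ?P u)" by (rule L2_set_mult_ineq)
  also have "\<dots> \<le> l2 I u * (C\<^sup>2 * l2 I u)" by (intro mult_left_mono op_boundD b) simp
  also have "\<dots> = (C * l2 I u)\<^sup>2" by (simp add: power2_eq_square mult_ac)
  finally show "l2 I (mv I M u) \<le> C * l2 I u" by (rule power2_le_imp_le) (simp add: C)
qed

section \<open>The C*-algebra of d by d matrices\<close>

lemma mat_alg_simps [simp]:
  "pts (mat_alg d) = carrier_mat d d" "vzero (mat_alg d) = 0\<^sub>m d d" "vadd (mat_alg d) = (+)"
  "vscale (mat_alg d) = (\<cdot>\<^sub>m)" "amult (mat_alg d) = (*)" "astar (mat_alg d) = mat_adjoint"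
  by (simp_all add: mat_alg_def fun_eq_iff)

lemma mat_adjoint_square:
  assumes "M \<in> carrier_mat d d"
  shows "mat_adjoint M \<in> carrier_mat d d"
    and "i < d \<Longrightarrow> j < d \<Longrightarrow> mat_adjoint M $$ (i, j) = cnj (M $$ (j, i))"
  using assms by (auto simp: mat_adjoint_def mat_of_rows_def)

lemma mat_mult_index:
  assumes "M \<in> carrier_mat d d" "M' \<in> carrier_mat d d" "i < d" "j < d"
  shows "(M * M') $$ (i, j) = (\<Sum>k<d. M $$ (i, k) * M' $$ (k, j))"
  using assms by (auto simp: scalar_prod_def atLeast0LessThan)

lemma hilbert_vec_norm:
  assumes "v \<in> carrier_vec d"
  shows "vnorm (hilbert_vec d) v = l2 {..<d} (\<lambda>i. v $ i)"
proof -
  have "v \<bullet>c v = (\<Sum>i<d. v $ i * cnj (v $ i))"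
    using assms by (simp add: scalar_prod_def atLeast0LessThan)
  then have "v \<bullet>c v = (\<Sum>i<d. complex_of_real ((cmod (v $ i))\<^sup>2))"
    unfolding complex_norm_square .
  then have "Re (v \<bullet>c v) = (\<Sum>i<d. (cmod (v $ i))\<^sup>2)" by simp
  then show ?thesis by (simp add: hilbert_vec_def L2_set_def)
qed

lemma mat_vec_norm:
  assumes "M \<in> carrier_mat d d" "v \<in> carrier_vec d"
  shows "vnorm (hilbert_vec d) (M *\<^sub>v v) = l2 {..<d} (mv {..<d} (\<lambda>i j. M $$ (i, j)) (\<lambda>i. v $ i))"
proof -
  have "(M *\<^sub>v v) $ i = mv {..<d} (\<lambda>i j. M $$ (i, j)) (\<lambda>i. v $ i) i" if "i < d" for i
    using that assms by (auto simp: mv_def scalar_prod_def atLeast0LessThan)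
  then show ?thesis using assms by (subst hilbert_vec_norm[of _ d]) (auto intro!: L2_set_cong)
qed

lemma mat_norm_eq: "vnorm (mat_alg d) M = opnorm (hilbert_vec d) (\<lambda>v. M *\<^sub>v v)"
  by (simp add: mat_alg_def)

lemma mat_norm_least:
  assumes M: "M \<in> carrier_mat d d" and C: "0 \<le> C" "op_bound {..<d} (\<lambda>i j. M $$ (i, j)) C"
  shows "vnorm (mat_alg d) M \<le> C"
  unfolding mat_norm_eq
\<comment> \<open>The zero vector shows that the unit ball is nonempty in every dimension, including
  dimension 0.\<close>
proof (rule opnorm_least[of "0\<^sub>v d"])
  show "0\<^sub>v d \<in> pts (hilbert_vec d)" "vnorm (hilbert_vec d) (0\<^sub>v d) \<le> 1"
    by (simp_all add: hilbert_vec_def)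
  fix v assume v: "v \<in> pts (hilbert_vec d)" "vnorm (hilbert_vec d) v \<le> 1"
  then have v': "v \<in> carrier_vec d" by (simp add: hilbert_vec_def)
  have "vnorm (hilbert_vec d) (M *\<^sub>v v) \<le> C * vnorm (hilbert_vec d) v"
    using op_boundD[OF C(2)] by (simp add: mat_vec_norm[OF M v'] hilbert_vec_norm[OF v'])
  then show "vnorm (hilbert_vec d) (M *\<^sub>v v) \<le> C" using mult_left_le[OF v(2) C(1)] by linarith
qed

lemma mat_norm_bound:
  assumes M: "M \<in> carrier_mat d d"
  shows "op_bound {..<d} (\<lambda>i j. M $$ (i, j)) (vnorm (mat_alg d) M)"
  unfolding op_bound_def
proof
  fix u :: "nat \<Rightarrow> complex"
  let ?M = "\<lambda>i j. M $$ (i, j)"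
  define C where "C = (\<Sum>i<d. \<Sum>j<d. cmod (M $$ (i, j)))"
  have C: "op_bound {..<d} ?M C" "0 \<le> C" unfolding C_def by (rule op_bound_crude, simp) (simp add: sum_nonneg)
  show "l2 {..<d} (mv {..<d} ?M u) \<le> vnorm (mat_alg d) M * l2 {..<d} u"
  proof (cases "l2 {..<d} u = 0")
    case True
    then show ?thesis using op_boundD[OF C(1), of u] by simp
  next
    case False
    then have p: "0 < l2 {..<d} u" by (simp add: less_le)
    define c where "c = complex_of_real (1 / l2 {..<d} u)"
    have cc: "cmod c = 1 / l2 {..<d} u" using p by (simp add: c_def norm_divide)
    define v where "v = vec d (\<lambda>i. c * u i)"
    have v: "v \<in> carrier_vec d" by (simp add: v_def)
    have vi: "l2 {..<d} (\<lambda>i. v $ i) = l2 {..<d} (\<lambda>i. c * u i)"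
      by (intro L2_set_cong) (simp_all add: v_def)
    have v1: "vnorm (hilbert_vec d) v = 1" unfolding hilbert_vec_norm[OF v] vi l2_scale using p cc by simp
    have "mv {..<d} ?M (\<lambda>i. v $ i) = (\<lambda>i. c * mv {..<d} ?M u i)"
      by (rule ext) (simp add: mv_def v_def sum_distrib_left mult_ac)
    then have "vnorm (hilbert_vec d) (M *\<^sub>v v) = cmod c * l2 {..<d} (mv {..<d} ?M u)"
      unfolding mat_vec_norm[OF M v] by (simp add: l2_scale)
    moreover have "vnorm (hilbert_vec d) (M *\<^sub>v v) \<le> vnorm (mat_alg d) M"
      unfolding mat_norm_eq
    proof (rule opnorm_upper)
      show "v \<in> pts (hilbert_vec d)" "vnorm (hilbert_vec d) v \<le> 1" using v v1 by (simp_all add: hilbert_vec_def)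
      fix w assume w: "w \<in> pts (hilbert_vec d)" "vnorm (hilbert_vec d) w \<le> 1"
      then have w': "w \<in> carrier_vec d" by (simp add: hilbert_vec_def)
      have "vnorm (hilbert_vec d) (M *\<^sub>v w) \<le> C * vnorm (hilbert_vec d) w"
        using op_boundD[OF C(1)] by (simp add: mat_vec_norm[OF M w'] hilbert_vec_norm[OF w'])
      then show "vnorm (hilbert_vec d) (M *\<^sub>v w) \<le> C" using mult_left_le[OF w(2) C(2)] by linarith
    qed
    ultimately show ?thesis using p cc by (simp add: pos_divide_le_eq)
  qed
qed

lemma mat_norm_nonneg: "M \<in> carrier_mat d d \<Longrightarrow> 0 \<le> vnorm (mat_alg d) M"
  unfolding mat_norm_eq
proof -
  assume M: "M \<in> carrier_mat d d"
  define C where "C = (\<Sum>i<d. \<Sum>j<d. cmod (M $$ (i, j)))"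
  have C: "op_bound {..<d} (\<lambda>i j. M $$ (i, j)) C" "0 \<le> C" unfolding C_def by (rule op_bound_crude, simp) (simp add: sum_nonneg)
  have "vnorm (hilbert_vec d) (M *\<^sub>v 0\<^sub>v d) \<le> opnorm (hilbert_vec d) (\<lambda>v. M *\<^sub>v v)"
  proof (rule opnorm_upper)
    show "0\<^sub>v d \<in> pts (hilbert_vec d)" "vnorm (hilbert_vec d) (0\<^sub>v d) \<le> 1"
      by (simp_all add: hilbert_vec_def)
    fix w assume w: "w \<in> pts (hilbert_vec d)" "vnorm (hilbert_vec d) w \<le> 1"
    then have w': "w \<in> carrier_vec d" by (simp add: hilbert_vec_def)
    have "vnorm (hilbert_vec d) (M *\<^sub>v w) \<le> C * vnorm (hilbert_vec d) w"
      using op_boundD[OF C(1)] by (simp add: mat_vec_norm[OF M w'] hilbert_vec_norm[OF w'])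
    then show "vnorm (hilbert_vec d) (M *\<^sub>v w) \<le> C" using mult_left_le[OF w(2) C(2)] by linarith
  qed
  moreover have "0 \<le> vnorm (hilbert_vec d) (M *\<^sub>v 0\<^sub>v d)"
    using M by (subst mat_vec_norm[OF M]) simp_all
  ultimately show "0 \<le> opnorm (hilbert_vec d) (\<lambda>v. M *\<^sub>v v)" by linarith
qed

lemma mat_entry_le_norm: "M \<in> carrier_mat d d \<Longrightarrow> i < d \<Longrightarrow> j < d \<Longrightarrow> cmod (M $$ (i, j)) \<le> vnorm (mat_alg d) M"
  using op_bound_entry[OF _ mat_norm_bound] by auto

lemma mat_norm_le_entries: "M \<in> carrier_mat d d \<Longrightarrow> vnorm (mat_alg d) M \<le> (\<Sum>i<d. \<Sum>j<d. cmod (M $$ (i, j)))"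
  by (intro mat_norm_least op_bound_crude sum_nonneg) simp_all

lemma mat_norm_mult:
  assumes "M \<in> carrier_mat d d" "M' \<in> carrier_mat d d"
  shows "vnorm (mat_alg d) (M * M') \<le> vnorm (mat_alg d) M * vnorm (mat_alg d) M'"
proof (rule mat_norm_least)
  have "op_bound {..<d} (\<lambda>i j. \<Sum>k<d. M $$ (i, k) * M' $$ (k, j)) (vnorm (mat_alg d) M * vnorm (mat_alg d) M')"
    by (intro op_bound_mult mat_norm_bound mat_norm_nonneg assms) simp
  then show "op_bound {..<d} (\<lambda>i j. (M * M') $$ (i, j)) (vnorm (mat_alg d) M * vnorm (mat_alg d) M')"
    using assms by (subst op_bound_cong[of _ _ "\<lambda>i j. \<Sum>k<d. M $$ (i, k) * M' $$ (k, j)"]) (simp_all add: mat_mult_index del: index_mult_mat)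
qed (use assms mat_norm_nonneg in auto)

lemma mat_norm_cstar_le:
  assumes M: "M \<in> carrier_mat d d"
  shows "(vnorm (mat_alg d) M)\<^sup>2 \<le> vnorm (mat_alg d) (mat_adjoint M * M)"
proof -
  let ?P = "mat_adjoint M * M"
  have P: "?P \<in> carrier_mat d d" using mat_adjoint_square(1)[OF M] M by simp
  have entry: "?P $$ (i, j) = (\<Sum>k<d. cnj (M $$ (k, i)) * M $$ (k, j))" if "i < d" "j < d" for i j
    using that mat_mult_index[OF mat_adjoint_square(1)[OF M] M that] mat_adjoint_square(2)[OF M] by simp
  have "op_bound {..<d} (\<lambda>i j. \<Sum>k<d. cnj (M $$ (k, i)) * M $$ (k, j)) (vnorm (mat_alg d) ?P)"
    using mat_norm_bound[OF P] by (subst (asm) op_bound_cong[of _ _ "\<lambda>i j. \<Sum>k<d. cnj (M $$ (k, i)) * M $$ (k, j)"]) (simp_all add: entry)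
  then have "op_bound {..<d} (\<lambda>i j. \<Sum>k<d. cnj (M $$ (k, i)) * M $$ (k, j)) ((sqrt (vnorm (mat_alg d) ?P))\<^sup>2)"
    using mat_norm_nonneg[OF P] by simp
  from op_bound_of_square[OF _ this] have "op_bound {..<d} (\<lambda>i j. M $$ (i, j)) (sqrt (vnorm (mat_alg d) ?P))"
    using mat_norm_nonneg[OF P] by simp
  from mat_norm_least[OF M _ this] have "vnorm (mat_alg d) M \<le> sqrt (vnorm (mat_alg d) ?P)"
    using mat_norm_nonneg[OF P] by simp
  then have "(vnorm (mat_alg d) M)\<^sup>2 \<le> (sqrt (vnorm (mat_alg d) ?P))\<^sup>2"
    by (intro power_mono mat_norm_nonneg M)
  then show ?thesis using mat_norm_nonneg[OF P] by simp
qed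

lemma op_bound_add:
  assumes "finite I" "op_bound I M C" "op_bound I M' D"
  shows "op_bound I (\<lambda>i j. M i j + M' i j) (C + D)"
  unfolding op_bound_def
proof
  fix u
  have "l2 I (mv I (\<lambda>i j. M i j + M' i j) u) \<le> L2_set (\<lambda>i. cmod (mv I M u i) + cmod (mv I M' u i)) I"
    by (intro L2_set_mono) (simp_all add: mv_def distrib_right sum.distrib norm_triangle_ineq)
  also have "\<dots> \<le> l2 I (mv I M u) + l2 I (mv I M' u)" by (rule L2_set_triangle_ineq)
  finally show "l2 I (mv I (\<lambda>i j. M i j + M' i j) u) \<le> (C + D) * l2 I u"
    using op_boundD[OF assms(2), of u] op_boundD[OF assms(3), of u] by (simp add: distrib_right)
qed

lemma op_bound_scale: "op_bound I M C \<Longrightarrow> op_bound I (\<lambda>i j. c * M i j) (cmod c * C)"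
  unfolding op_bound_def
proof
  fix u assume b: "\<forall>u. l2 I (mv I M u) \<le> C * l2 I u"
  have "mv I (\<lambda>i j. c * M i j) u = (\<lambda>i. c * mv I M u i)" by (rule ext) (simp add: mv_def sum_distrib_left mult.assoc)
  then show "l2 I (mv I (\<lambda>i j. c * M i j) u) \<le> cmod c * C * l2 I u"
    using mult_left_mono[OF spec[OF b, of u] norm_ge_zero[of c]] by (simp add: l2_scale mult.assoc)
qed

interpretation mat: normed_star_alg "mat_alg d" for d
proof
  show "vector_space_on (mat_alg d)"
    unfolding vector_space_on_def
  proof (intro conjI)
    show "comm_group (additive_monoid (mat_alg d))"
    proof (rule comm_groupI, unfold additive_monoid_simps mat_alg_simps)
      fix x :: "complex mat" assume x: "x \<in> carrier_mat d d"
      show "\<exists>y\<in>carrier_mat d d. y + x = 0\<^sub>m d d" using x by (intro bexI[of _ "- x"]) (auto simp: uminus_l_inv_mat)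
    qed (auto simp: comm_add_mat)
  qed (auto intro!: eq_matI simp: algebra_simps)
  fix x y z :: "complex mat" and c :: complex
  assume x: "x \<in> pts (mat_alg d)"
  then have xc: "x \<in> carrier_mat d d" by simp
  show "astar (mat_alg d) x \<in> pts (mat_alg d)" using mat_adjoint_square[OF xc] by simp
  show "astar (mat_alg d) (vscale (mat_alg d) c x) = vscale (mat_alg d) (cnj c) (astar (mat_alg d) x)"
    using mat_adjoint_square[OF xc] mat_adjoint_square[OF smult_carrier_mat[OF xc]] xc by (intro eq_matI) auto
  show star2: "astar (mat_alg d) (astar (mat_alg d) x) = x"
    using mat_adjoint_square[OF xc] mat_adjoint_square[OF mat_adjoint_square(1)[OF xc]] xc by (intro eq_matI) auto
  show "0 \<le> vnorm (mat_alg d) x" by (rule mat_norm_nonneg[OF xc])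
  \<comment> \<open>The C*-inequality and submultiplicativity give
    \<open>(norm w)^2 \<le> norm (w^* ) * norm w\<close>; equality for \<open>x\<close> follows by
    using this for \<open>x\<close> and for its adjoint.\<close>
  have le: "vnorm (mat_alg d) w \<le> vnorm (mat_alg d) (mat_adjoint w)" if w: "w \<in> carrier_mat d d" for w
  proof (cases "vnorm (mat_alg d) w = 0")
    case False
    have "vnorm (mat_alg d) w * vnorm (mat_alg d) w \<le> vnorm (mat_alg d) (mat_adjoint w) * vnorm (mat_alg d) w"
      using mat_norm_cstar_le[OF w] mat_norm_mult[OF mat_adjoint_square(1)[OF w] w] by (simp add: power2_eq_square)
    then show ?thesis using False mat_norm_nonneg[OF w] by (simp add: mult_le_cancel_right)
  qed (simp add: mat_norm_nonneg mat_adjoint_square w)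
  show "vnorm (mat_alg d) (astar (mat_alg d) x) = vnorm (mat_alg d) x"
    using le[OF xc] le[OF mat_adjoint_square(1)[OF xc]] star2 by simp
  show "vnorm (mat_alg d) (vscale (mat_alg d) c x) = cmod c * vnorm (mat_alg d) x"
  proof -
    have sc: "vnorm (mat_alg d) (c \<cdot>\<^sub>m w) \<le> cmod c * vnorm (mat_alg d) w" if w: "w \<in> carrier_mat d d" for w c
    proof (rule mat_norm_least)
      show "op_bound {..<d} (\<lambda>i j. (c \<cdot>\<^sub>m w) $$ (i, j)) (cmod c * vnorm (mat_alg d) w)"
        using op_bound_scale[OF mat_norm_bound[OF w], of c] w
        by (subst op_bound_cong[of _ _ "\<lambda>i j. c * w $$ (i, j)"]) auto
    qed (use w mat_norm_nonneg in auto)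
    show ?thesis
    proof (cases "c = 0")
      case True
      then show ?thesis using sc[OF xc, of 0] mat_norm_nonneg[of "c \<cdot>\<^sub>m x" d] xc by simp
    next
      case False
      then have "x = (1 / c) \<cdot>\<^sub>m (c \<cdot>\<^sub>m x)" using xc by (intro eq_matI) auto
      then have "vnorm (mat_alg d) x \<le> cmod (1 / c) * vnorm (mat_alg d) (c \<cdot>\<^sub>m x)"
        using sc[of "c \<cdot>\<^sub>m x" "1 / c"] xc by simp
      then show ?thesis using sc[OF xc, of c] False by (simp add: norm_divide field_simps)
    qed
  qed
  assume y: "y \<in> pts (mat_alg d)"
  then have yc: "y \<in> carrier_mat d d" by simp
  show "amult (mat_alg d) x y \<in> pts (mat_alg d)" using xc yc by simp
  show "amult (mat_alg d) (vscale (mat_alg d) c x) y = vscale (mat_alg d) c (amult (mat_alg d) x y)"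
    using mult_smult_assoc_mat[OF xc yc] by simp
  show "amult (mat_alg d) x (vscale (mat_alg d) c y) = vscale (mat_alg d) c (amult (mat_alg d) x y)"
    using mult_smult_distrib[OF xc yc] by simp
  show "astar (mat_alg d) (vadd (mat_alg d) x y) = vadd (mat_alg d) (astar (mat_alg d) x) (astar (mat_alg d) y)"
  proof -
    have xy: "x + y \<in> carrier_mat d d" using xc yc by simp
    show ?thesis
      using mat_adjoint_square[OF xc] mat_adjoint_square[OF yc] mat_adjoint_square[OF xy] xc yc
      by (intro eq_matI) auto
  qed
  show "astar (mat_alg d) (amult (mat_alg d) x y) = amult (mat_alg d) (astar (mat_alg d) y) (astar (mat_alg d) x)"
  proof (rule eq_matI)
    note a = mat_adjoint_square[OF xc] mat_adjoint_square[OF yc] mat_adjoint_square[OF mult_carrier_mat[OF xc yc]]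
    fix i j assume "i < dim_row (amult (mat_alg d) (astar (mat_alg d) y) (astar (mat_alg d) x))"
      "j < dim_col (amult (mat_alg d) (astar (mat_alg d) y) (astar (mat_alg d) x))"
    then have ij: "i < d" "j < d" using a by auto
    show "astar (mat_alg d) (amult (mat_alg d) x y) $$ (i, j)
        = amult (mat_alg d) (astar (mat_alg d) y) (astar (mat_alg d) x) $$ (i, j)"
      using ij a by (simp add: mat_mult_index[OF xc yc] mat_mult_index[OF a(3) a(1)] cnj_sum mult.commute del: index_mult_mat)
  qed (use mat_adjoint_square[OF xc] mat_adjoint_square[OF yc] mat_adjoint_square[OF mult_carrier_mat[OF xc yc]] in auto)
  show "vnorm (mat_alg d) (vadd (mat_alg d) x y) \<le> vnorm (mat_alg d) x + vnorm (mat_alg d) y"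
  proof (rule mat_norm_least)
    show "op_bound {..<d} (\<lambda>i j. vadd (mat_alg d) x y $$ (i, j)) (vnorm (mat_alg d) x + vnorm (mat_alg d) y)"
      using op_bound_add[OF _ mat_norm_bound[OF xc] mat_norm_bound[OF yc]] xc yc
      by (subst op_bound_cong[of _ _ "\<lambda>i j. x $$ (i, j) + y $$ (i, j)"]) auto
  qed (use xc yc mat_norm_nonneg in auto)
  show "vnorm (mat_alg d) (amult (mat_alg d) x y) \<le> vnorm (mat_alg d) x * vnorm (mat_alg d) y"
    using mat_norm_mult[OF xc yc] by simp
  assume z: "z \<in> pts (mat_alg d)"
  show "amult (mat_alg d) (vadd (mat_alg d) x z) y = vadd (mat_alg d) (amult (mat_alg d) x y) (amult (mat_alg d) z y)"
    using xc yc z by (simp add: add_mult_distrib_mat)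
  show "amult (mat_alg d) x (vadd (mat_alg d) y z) = vadd (mat_alg d) (amult (mat_alg d) x y) (amult (mat_alg d) x z)"
    using xc yc z by (simp add: mult_add_distrib_mat)
  show "amult (mat_alg d) (amult (mat_alg d) x y) z = amult (mat_alg d) x (amult (mat_alg d) y z)"
    using xc yc z by simp
qed

lemma mat_norm_cstar:
  assumes M: "M \<in> carrier_mat d d"
  shows "vnorm (mat_alg d) (mat_adjoint M * M) = (vnorm (mat_alg d) M)\<^sup>2"
  using mat_norm_cstar_le[OF M] mat_norm_mult[OF mat_adjoint_square(1)[OF M] M] mat.norm_star[of M d] M
  by (simp add: power2_eq_square)

lemma mat_norm_zero_iff:
  assumes M: "M \<in> carrier_mat d d"
  shows "vnorm (mat_alg d) M = 0 \<longleftrightarrow> M = 0\<^sub>m d d"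
proof
  assume "vnorm (mat_alg d) M = 0"
  then have "M $$ (i, j) = 0" if "i < d" "j < d" for i j using mat_entry_le_norm[OF M that] by simp
  then show "M = 0\<^sub>m d d" using M by (intro eq_matI) auto
next
  assume "M = 0\<^sub>m d d"
  then show "vnorm (mat_alg d) M = 0" using mat.norm_zero[of d] by simp
qed

lemma mat_diff_index:
  assumes "M \<in> carrier_mat d d" "M' \<in> carrier_mat d d" "i < d" "j < d"
  shows "vdiff (mat_alg d) M M' $$ (i, j) = M $$ (i, j) - M' $$ (i, j)"
  using assms by (auto simp: vdiff_def)

lemma mat_cauchy_converges:
  assumes X: "X \<in> cauchy_seqs (mat_alg d)"
  obtains L where "L \<in> carrier_mat d d" "\<And>i j. i < d \<Longrightarrow> j < d \<Longrightarrow> (\<lambda>n. X n $$ (i, j)) \<longlonglongrightarrow> L $$ (i, j)"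
    "(\<lambda>n. vnorm (mat_alg d) (vdiff (mat_alg d) (X n) L)) \<longlonglongrightarrow> 0"
proof -
  have Xc: "X n \<in> carrier_mat d d" for n using mat.cauchy_seqsD[OF X] by simp
  have "convergent (\<lambda>n. X n $$ (i, j))" if ij: "i < d" "j < d" for i j
  proof (rule Cauchy_convergent, rule CauchyI)
    fix e :: real assume "0 < e"
    then obtain N where N: "\<forall>m\<ge>N. \<forall>n\<ge>N. vnorm (mat_alg d) (vdiff (mat_alg d) (X m) (X n)) < e"
      using X unfolding cauchy_seqs_def by blast
    show "\<exists>M. \<forall>m\<ge>M. \<forall>n\<ge>M. norm (X m $$ (i, j) - X n $$ (i, j)) < e"
    proof (intro exI[of _ N] allI impI)
      fix m n assume mn: "N \<le> m" "N \<le> n"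
      have "vnorm (mat_alg d) (vdiff (mat_alg d) (X m) (X n)) < e" using N mn by blast
      moreover have "vdiff (mat_alg d) (X m) (X n) \<in> carrier_mat d d" using mat.diff_closed[of "X m" d "X n"] Xc by simp
      ultimately show "norm (X m $$ (i, j) - X n $$ (i, j)) < e"
        using mat_entry_le_norm[of "vdiff (mat_alg d) (X m) (X n)" d i j] mat_diff_index[OF Xc Xc ij, of m n] ij by simp
    qed
  qed
  then have lim: "(\<lambda>n. X n $$ (i, j)) \<longlonglongrightarrow> lim (\<lambda>n. X n $$ (i, j))" if "i < d" "j < d" for i j
    using that by (simp add: convergent_LIMSEQ_iff)
  define L where "L = mat d d (\<lambda>(i, j). lim (\<lambda>n. X n $$ (i, j)))"
  have L: "L \<in> carrier_mat d d" by (simp add: L_def)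
  have ent: "(\<lambda>n. X n $$ (i, j)) \<longlonglongrightarrow> L $$ (i, j)" if "i < d" "j < d" for i j
    using lim that by (simp add: L_def)
  have "(\<lambda>n. \<Sum>i<d. \<Sum>j<d. cmod (X n $$ (i, j) - L $$ (i, j))) \<longlonglongrightarrow> (\<Sum>i<d. \<Sum>j<d. 0)"
    using ent by (intro tendsto_sum) (auto intro!: tendsto_norm_zero simp: LIM_zero_iff)
  then have "(\<lambda>n. \<Sum>i<d. \<Sum>j<d. cmod (X n $$ (i, j) - L $$ (i, j))) \<longlonglongrightarrow> 0" by simp
  then have "(\<lambda>n. vnorm (mat_alg d) (vdiff (mat_alg d) (X n) L)) \<longlonglongrightarrow> 0"
  proof (rule tendsto_zero_le)
    fix n
    have D: "vdiff (mat_alg d) (X n) L \<in> carrier_mat d d" using mat.diff_closed[of "X n" d L] Xc L by simp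
    show "0 \<le> vnorm (mat_alg d) (vdiff (mat_alg d) (X n) L)" by (rule mat_norm_nonneg[OF D])
    show "vnorm (mat_alg d) (vdiff (mat_alg d) (X n) L) \<le> (\<Sum>i<d. \<Sum>j<d. cmod (X n $$ (i, j) - L $$ (i, j)))"
      using mat_norm_le_entries[OF D] mat_diff_index[OF Xc L] by simp
  qed
  with L ent show ?thesis using that by blast
qed

lemma mat_banach: "banach_on (mat_alg d)"
  unfolding banach_on_def
proof (intro conjI ballI)
  fix X assume X: "X \<in> cauchy_seqs (mat_alg d)"
  obtain L where "L \<in> carrier_mat d d" "(\<lambda>n. vnorm (mat_alg d) (vdiff (mat_alg d) (X n) L)) \<longlonglongrightarrow> 0"
    by (rule mat_cauchy_converges[OF X]) blast
  then show "\<exists>x\<in>pts (mat_alg d). (\<lambda>n. vnorm (mat_alg d) (vdiff (mat_alg d) (X n) x)) \<longlonglongrightarrow> 0"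
    by (intro bexI[of _ L]) simp_all
next
  show "vector_space_on (mat_alg d)" by (rule mat.vector_space)
next
  fix x assume x: "x \<in> pts (mat_alg d)"
  show "0 \<le> vnorm (mat_alg d) x" by (rule mat.norm_nonneg[OF x])
  show "vnorm (mat_alg d) x = 0 \<longleftrightarrow> x = vzero (mat_alg d)" using mat_norm_zero_iff[of x d] x by simp
next
  show "\<forall>c. \<forall>x\<in>pts (mat_alg d). vnorm (mat_alg d) (vscale (mat_alg d) c x) = cmod c * vnorm (mat_alg d) x"
    using mat.norm_scale by blast
next
  fix x y assume x: "x \<in> pts (mat_alg d)" and y: "y \<in> pts (mat_alg d)"
  show "vnorm (mat_alg d) (vadd (mat_alg d) x y) \<le> vnorm (mat_alg d) x + vnorm (mat_alg d) y"
    by (rule mat.norm_triangle[OF x y])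
qed

section \<open>Constant bundles and the group algebra\<close>

locale cstar_alg = normed_star_alg C for C :: "('c, 'm) staralg_scheme" +
  assumes banach: "banach_on C"
    and norm_cstar: "x \<in> pts C \<Longrightarrow> vnorm C (amult C (astar C x) x) = (vnorm C x)\<^sup>2"

text \<open>The trivial bundle with fibre \<open>C\<close>; the tag keeps the fibres disjoint. For
  the complex numbers its sections form the group algebra, for matrices they form matrices over the
  group algebra, so everything proved for Fell bundles covers both.\<close>

definition const_bundle :: "('c, 'm) staralg_scheme \<Rightarrow> ('g::group_add, 'g \<times> 'c) bundle_data" where
  "const_bundle C = \<lparr>
     fib = (\<lambda>t. \<lparr>pts = {t} \<times> pts C, vzero = (t, vzero C), vadd = (\<lambda>p q. (t, vadd C (snd p) (snd q))),
        vscale = (\<lambda>c p. (t, vscale C c (snd p))), vnorm = (\<lambda>p. vnorm C (snd p))\<rparr>),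
     bmult = (\<lambda>p q. (fst p + fst q, amult C (snd p) (snd q))),
     bstar = (\<lambda>p. (- fst p, astar C (snd p)))\<rparr>"

lemma const_bundle_simps [simp]:
  "pts (fib (const_bundle C) t) = {t} \<times> pts C" "vzero (fib (const_bundle C) t) = (t, vzero C)"
  "vadd (fib (const_bundle C) t) p q = (t, vadd C (snd p) (snd q))"
  "vscale (fib (const_bundle C) t) c p = (t, vscale C c (snd p))"
  "vnorm (fib (const_bundle C) t) p = vnorm C (snd p)"
  "bmult (const_bundle C) p q = (fst p + fst q, amult C (snd p) (snd q))"
  "bstar (const_bundle C) p = (- fst p, astar C (snd p))"
  by (simp_all add: const_bundle_def)

lemma const_bundle_diff [simp]: "vdiff (fib (const_bundle C) t) p q = (t, vdiff C (snd p) (snd q))"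
  by (simp add: vdiff_def)

context cstar_alg
begin

lemma const_bundle_banach: "banach_on (fib (const_bundle C :: ('g::group_add, 'g \<times> 'c) bundle_data) t)"
  unfolding banach_on_def
proof (intro conjI ballI)
  let ?F = "fib (const_bundle C :: ('g, 'g \<times> 'c) bundle_data) t"
  show "vector_space_on ?F" unfolding vector_space_on_def
  proof (intro conjI)
    show "comm_group (additive_monoid ?F)"
    proof (rule comm_groupI, unfold additive_monoid_simps)
      fix x assume x: "x \<in> pts ?F"
      show "\<exists>y\<in>pts ?F. vadd ?F y x = vzero ?F"
        using x by (intro bexI[of _ "vscale ?F (-1) x"]) (auto simp: add.m_comm)
    qed (auto simp: add.m_ac)
  qed (auto simp: scale_add add_scale scale_mult)
  fix x assume x: "x \<in> pts ?F"
  show "0 \<le> vnorm ?F x" using x by auto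
  show "vnorm ?F x = 0 \<longleftrightarrow> x = vzero ?F" using x banach by (auto simp: banach_on_def)
next
  let ?F = "fib (const_bundle C :: ('g, 'g \<times> 'c) bundle_data) t"
  show "\<forall>c. \<forall>x\<in>pts ?F. vnorm ?F (vscale ?F c x) = cmod c * vnorm ?F x" by (auto simp: norm_scale)
next
  let ?F = "fib (const_bundle C :: ('g, 'g \<times> 'c) bundle_data) t"
  fix x y assume "x \<in> pts ?F" "y \<in> pts ?F"
  then show "vnorm ?F (vadd ?F x y) \<le> vnorm ?F x + vnorm ?F y" by (auto simp: norm_triangle)
next
  let ?F = "fib (const_bundle C :: ('g, 'g \<times> 'c) bundle_data) t"
  fix X assume X: "X \<in> cauchy_seqs ?F"
  then have cs: "(\<lambda>n. snd (X n)) \<in> cauchy_seqs C" unfolding cauchy_seqs_def by (simp add: mem_Times_iff)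
  have "\<And>X. X \<in> cauchy_seqs C \<Longrightarrow> \<exists>x\<in>pts C. (\<lambda>n. vnorm C (vdiff C (X n) x)) \<longlonglongrightarrow> 0"
    using banach by (simp add: banach_on_def)
  from this[OF cs] obtain x where "x \<in> pts C" "(\<lambda>n. vnorm C (vdiff C (snd (X n)) x)) \<longlonglongrightarrow> 0" by (rule bexE)
  then show "\<exists>x\<in>pts ?F. (\<lambda>n. vnorm ?F (vdiff ?F (X n) x)) \<longlonglongrightarrow> 0"
    by (intro bexI[of _ "(t, x)"]) simp_all
qed

lemma const_bundle_fell: "fell_bundle (const_bundle C :: ('g::group_add, 'g \<times> 'c) bundle_data)"
  unfolding fell_bundle_def
proof (intro conjI allI ballI)
  let ?B = "const_bundle C :: ('g, 'g \<times> 'c) bundle_data"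
  fix a assume "a \<in> total ?B"
  then have "snd a \<in> pts C" by (auto simp: total_def)
  then show "unit_fibre_positive ?B (bmult ?B (bstar ?B a) a)"
    \<comment> \<open>Only the tag depends on the degree, so the second component of
      \<open>a\<close> may be moved to the unit fibre.\<close>
    unfolding unit_fibre_positive_def by (intro bexI[of _ "(0, snd a)"]) auto
qed (auto simp: const_bundle_banach linear_on_def conj_linear_on_def total_def mult_add_left mult_add_right
    mult_scale_left mult_scale_right mult_assoc star_add star_scale star_mult add.assoc minus_add norm_mult norm_cstar)

lemma const_bundle_fsum:
  assumes "finite {i. f i \<noteq> vzero C}" "\<And>i. f i \<in> pts C"
  shows "fsum (fib (const_bundle C) t) (\<lambda>i. (t, f i)) = (t, fsum C f)"
proof -
  interpret D: fell "const_bundle C" by (rule fell.intro[OF const_bundle_fell])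
  show ?thesis
    by (rule fsum_hom[symmetric]) (use assms vmonoid_axioms D.fib.vmonoid_axioms in auto)
qed

end

text \<open>The hypothesis on unit fibres applied to \<open>u^* u\<close> shows that \<theta> does
  not increase \<open>hnorm\<close>. Hence the powers of \<theta> of \<open>z^* z\<close> grow no
  faster than those of \<open>z^* z\<close>, and \<open>vnorm_le_growth\<close> turns this into the
  inequality of operator norms.\<close>

lemma reduced_norm_contractive:
  assumes B: "fell (B :: ('g::group_add, 'b) bundle_data)" and D: "fell (D :: ('g, 'd) bundle_data)"
    and hom: "star_hom (section_alg B) (section_alg D) \<theta>"
    and unit: "\<And>z. z \<in> finite_sections B \<Longrightarrow> vnorm (fib D 0) (\<theta> z 0) \<le> vnorm (fib B 0) (z 0)"
    and z: "z \<in> finite_sections B"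
  shows "vnorm (section_alg D) (\<theta> z) \<le> vnorm (section_alg B) z"
proof -
  interpret B: fell B by fact
  interpret D: fell D by fact
  have \<theta>: "\<theta> x \<in> finite_sections D" "\<theta> (B.conv x y) = D.conv (\<theta> x) (\<theta> y)" "\<theta> (B.sstar x) = D.sstar (\<theta> x)"
    if "x \<in> finite_sections B" "y \<in> finite_sections B" for x y
    using hom that by (auto simp: star_hom_def linear_on_def B.section_ops D.section_ops)
  have hn: "D.hnorm (\<theta> u) \<le> B.hnorm u" if u: "u \<in> finite_sections B" for u
    unfolding D.hnorm_def B.hnorm_def D.inner_def B.inner_def
    using unit[of "B.conv (B.sstar u) u"] u \<theta> by simp
  let ?w = "B.conv (B.sstar z) z"
  have w: "?w \<in> finite_sections B" "B.sstar ?w = ?w" using z by (simp_all add: B.sstar_conv)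
  have tw: "\<theta> ?w \<in> finite_sections D" "D.sstar (\<theta> ?w) = \<theta> ?w"
    using \<theta>(1)[OF w(1) w(1)] \<theta>(3)[OF w(1) w(1)] w(2) by simp_all
  have dy: "\<theta> (B.sec.dyadic ?w k) = D.sec.dyadic (\<theta> ?w) k" for k
  proof (induction k)
    case (Suc k)
    then show ?case using B.sec.dyadic_Suc[of ?w k] D.sec.dyadic_Suc[of "\<theta> ?w" k] w tw
        \<theta>(2)[of "B.sec.dyadic ?w k" "B.sec.dyadic ?w k"] B.sec.dyadic_closed[of ?w k]
      by (simp add: B.section_ops D.section_ops)
  qed simp
  have "vnorm (section_alg D) (\<theta> ?w) \<le> vnorm (section_alg B) ?w"
  proof (rule D.vnorm_le_growth[OF tw, of 1])
    show "D.hnorm (D.sec.dyadic (\<theta> ?w) k) \<le> 1 * vnorm (section_alg B) ?w ^ (2 ^ k)" for k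
      using hn[of "B.sec.dyadic ?w k"] B.hnorm_le_vnorm[of "B.sec.dyadic ?w k"] B.sec.norm_dyadic_le[of ?w k]
        B.sec.dyadic_closed[of ?w k] w unfolding dy by simp
  qed (use B.section_vnorm(3)[OF w(1)] in simp_all)
  then have "(vnorm (section_alg D) (\<theta> z))\<^sup>2 \<le> (vnorm (section_alg B) z)\<^sup>2"
    using B.sec.vnorm_cstar[of z] D.sec.vnorm_cstar[of "\<theta> z"] z \<theta>[OF z z] \<theta>(2)[of "B.sstar z" z]
    by (simp add: B.section_ops D.section_ops)
  then show ?thesis by (rule power2_le_imp_le) (rule B.section_vnorm(3)[OF z])
qed

section \<open>The line bundle and the group algebra\<close>

definition complex_alg :: "complex staralg" where
  "complex_alg = \<lparr>pts = UNIV, vzero = 0, vadd = (+), vscale = (*), vnorm = cmod, amult = (*), astar = cnj\<rparr>"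

lemma complex_alg_simps [simp]:
  "pts complex_alg = UNIV" "vzero complex_alg = 0" "vadd complex_alg = (+)" "vscale complex_alg = (*)"
  "vnorm complex_alg = cmod" "amult complex_alg = (*)" "astar complex_alg = cnj"
  by (simp_all add: complex_alg_def)

lemma complex_vdiff [simp]: "vdiff complex_alg x y = x - y"
  by (simp add: vdiff_def)

interpretation cpx: cstar_alg complex_alg
proof
  show "vector_space_on complex_alg"
    unfolding vector_space_on_def
  proof (intro conjI)
    show "comm_group (additive_monoid complex_alg)"
    proof (rule comm_groupI, unfold additive_monoid_simps complex_alg_simps)
      fix x :: complex show "\<exists>y\<in>UNIV. y + x = 0" by (intro bexI[of _ "- x"]) simp_all
    qed auto
  qed (auto simp: algebra_simps)
  then show "banach_on complex_alg"
    unfolding banach_on_def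
  proof (intro conjI ballI)
    fix X assume X: "X \<in> cauchy_seqs complex_alg"
    have "Cauchy X"
    proof (rule CauchyI)
      fix e :: real assume "0 < e"
      then show "\<exists>M. \<forall>m\<ge>M. \<forall>n\<ge>M. norm (X m - X n) < e" using X by (simp add: cauchy_seqs_def)
    qed
    then obtain x where "X \<longlonglongrightarrow> x" using Cauchy_convergent convergent_def by blast
    then have "(\<lambda>n. cmod (X n - x)) \<longlonglongrightarrow> 0" using LIM_zero tendsto_norm_zero by blast
    then show "\<exists>x\<in>pts complex_alg. (\<lambda>n. vnorm complex_alg (vdiff complex_alg (X n) x)) \<longlonglongrightarrow> 0" by auto
  qed (auto simp: norm_mult norm_triangle_ineq)
qed (auto simp: algebra_simps norm_mult norm_triangle_ineq power2_eq_square)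

lemma vsum_complex: "finite I \<Longrightarrow> vsum complex_alg f I = sum f I"
proof (induction I rule: finite_induct)
  case (insert i I)
  then show ?case using cpx.vsum_insert[of I i f] by simp
qed simp

lemma fsum_complex: "finite {i. f i \<noteq> 0} \<Longrightarrow> fsum complex_alg f = (\<Sum>i | f i \<noteq> 0. f i)"
  by (simp add: fsum_def vsum_complex)

lemma group_alg_simps [simp]:
  "pts group_alg = {x. finite {t. x t \<noteq> 0}}"
  "vzero group_alg = (\<lambda>t. 0)"
  "vadd group_alg = (\<lambda>x y t. x t + y t)"
  "vscale group_alg = (\<lambda>c x t. c * x t)"
  by (simp_all add: group_alg_def)

lemma group_alg_mult: "amult group_alg x y s = (\<Sum>t | x t \<noteq> 0. x t * y (- t + s))"
  by (simp add: group_alg_def)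

lemma group_alg_star: "astar group_alg x s = cnj (x (- s))"
  by (simp add: group_alg_def)

interpretation line: fell "const_bundle complex_alg :: ('g::group_add, 'g \<times> complex) bundle_data"
  by (rule fell.intro[OF cpx.const_bundle_fell])

definition line_section :: "('g::group_add \<Rightarrow> complex) \<Rightarrow> 'g \<Rightarrow> 'g \<times> complex" where
  "line_section x = (\<lambda>t. (t, x t))"

lemma line_section_closed [simp]:
  "line_section x \<in> finite_sections (const_bundle complex_alg) \<longleftrightarrow> x \<in> pts group_alg"
  by (simp add: finite_sections_def line_section_def)

lemma line_section_inj: "line_section x = line_section y \<Longrightarrow> x = y"
  by (auto simp: line_section_def fun_eq_iff)

lemma line_section_add: "line_section (vadd group_alg x y) = line.sadd (line_section x) (line_section y)"
  by (auto simp: line_section_def line.sadd_def)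

lemma line_section_scale: "line_section (vscale group_alg c x) = line.sscale c (line_section x)"
  by (auto simp: line_section_def line.sscale_def)

lemma line_section_star: "line_section (astar group_alg x) = line.sstar (line_section x)"
  by (auto simp: line_section_def line.sstar_def group_alg_star)

lemma line_section_mult:
  assumes "x \<in> pts group_alg"
  shows "line_section (amult group_alg x y) = line.conv (line_section x) (line_section y)"
proof
  fix s
  have fin: "finite {t. x t * y (- t + s) \<noteq> 0}" using assms by (auto elim: rev_finite_subset)
  have "line.conv (line_section x) (line_section y) s
      = fsum (fib (const_bundle complex_alg) s) (\<lambda>t. (s, x t * y (- t + s)))"
    by (simp add: line.conv_def line_section_def)
  also have "\<dots> = (s, fsum complex_alg (\<lambda>t. x t * y (- t + s)))"
    using fin by (intro cpx.const_bundle_fsum) simp_all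
  also have "fsum complex_alg (\<lambda>t. x t * y (- t + s)) = (\<Sum>t | x t \<noteq> 0. x t * y (- t + s))"
    unfolding fsum_complex[OF fin] using assms by (intro sum.mono_neutral_left) auto
  finally show "line_section (amult group_alg x y) s = line.conv (line_section x) (line_section y) s"
    by (simp add: line_section_def group_alg_mult)
qed

text \<open>The algebra laws are pulled back along the injection \<open>line_section\<close> from
  the sections of the line bundle.\<close>

interpretation grp: star_alg "group_alg :: ('g::group_add \<Rightarrow> complex) staralg"
proof -
  have vs: "vector_space_on (group_alg :: ('g \<Rightarrow> complex) staralg)"
    unfolding vector_space_on_def
  proof (intro conjI)
    show "comm_group (additive_monoid (group_alg :: ('g \<Rightarrow> complex) staralg))"
    proof (rule comm_groupI, unfold additive_monoid_simps group_alg_simps)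
      fix x y :: "'g \<Rightarrow> complex" assume x: "x \<in> {x. finite {t. x t \<noteq> 0}}"
      then show "\<exists>y\<in>{x. finite {t. x t \<noteq> 0}}. (\<lambda>t. y t + x t) = (\<lambda>t. 0)"
        by (intro bexI[of _ "\<lambda>t. - x t"]) simp_all
      assume y: "y \<in> {x. finite {t. x t \<noteq> 0}}"
      have "{t. x t + y t \<noteq> 0} \<subseteq> {t. x t \<noteq> 0} \<union> {t. y t \<noteq> 0}" by auto
      then show "(\<lambda>t. x t + y t) \<in> {x. finite {t. x t \<noteq> 0}}" using x y finite_subset by auto
    qed (auto simp: algebra_simps)
  qed (auto simp: algebra_simps fun_eq_iff elim: rev_finite_subset)
  interpret vspace "group_alg :: ('g \<Rightarrow> complex) staralg" by unfold_locales (rule vs)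
  note eqI = line_section_inj
  note ls = line_section_mult line_section_add line_section_scale line_section_star
  have mc: "amult group_alg x y \<in> pts group_alg" if "x \<in> pts group_alg" "y \<in> pts group_alg" for x y :: "'g \<Rightarrow> complex"
    using that line_section_closed[of "amult group_alg x y"] line_section_closed[of x] line_section_closed[of y]
      line_section_mult[of x y] line.conv_closed by metis
  have sc: "astar group_alg x \<in> pts group_alg" if "x \<in> pts group_alg" for x :: "'g \<Rightarrow> complex"
    using that line_section_closed[of "astar group_alg x"] line_section_closed[of x]
      line_section_star[of x] line.sstar_closed by metis
  show "star_alg (group_alg :: ('g \<Rightarrow> complex) staralg)"
  proof
    fix x y z :: "'g \<Rightarrow> complex" and c
    assume x: "x \<in> pts group_alg"
    then have lx: "line_section x \<in> finite_sections (const_bundle complex_alg)" by simp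
    show "astar group_alg x \<in> pts group_alg" by (rule sc[OF x])
    show "astar group_alg (vscale group_alg c x) = vscale group_alg (cnj c) (astar group_alg x)"
      by (rule eqI) (simp only: ls line.sstar_scale[OF lx])
    show "astar group_alg (astar group_alg x) = x"
      by (rule eqI) (simp only: ls line.sstar_sstar[OF lx])
    assume y: "y \<in> pts group_alg"
    then have ly: "line_section y \<in> finite_sections (const_bundle complex_alg)" by simp
    show "amult group_alg x y \<in> pts group_alg" by (rule mc[OF x y])
    show "amult group_alg (vscale group_alg c x) y = vscale group_alg c (amult group_alg x y)"
      by (rule eqI) (simp only: ls x y scale_closed line.conv_scale_left[OF lx ly])
    show "amult group_alg x (vscale group_alg c y) = vscale group_alg c (amult group_alg x y)"
      by (rule eqI) (simp only: ls x y scale_closed line.conv_scale_right[OF lx ly])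
    show "astar group_alg (vadd group_alg x y) = vadd group_alg (astar group_alg x) (astar group_alg y)"
      by (rule eqI) (simp only: ls line.sstar_add[OF lx ly])
    show "astar group_alg (amult group_alg x y) = amult group_alg (astar group_alg y) (astar group_alg x)"
      by (rule eqI) (simp only: ls x y sc line.sstar_conv[OF lx ly])
    assume z: "z \<in> pts group_alg"
    then have lz: "line_section z \<in> finite_sections (const_bundle complex_alg)" by simp
    show "amult group_alg (vadd group_alg x z) y = vadd group_alg (amult group_alg x y) (amult group_alg z y)"
      by (rule eqI) (simp only: ls x y z add_closed line.conv_add_left[OF lx lz ly])
    show "amult group_alg x (vadd group_alg y z) = vadd group_alg (amult group_alg x y) (amult group_alg x z)"
      by (rule eqI) (simp only: ls x y z add_closed line.conv_add_right[OF lx ly lz])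
    show "amult group_alg (amult group_alg x y) z = amult group_alg x (amult group_alg y z)"
      by (rule eqI) (simp only: ls x y z mc line.conv_assoc[OF lx ly lz])
  qed
qed

definition group_hnorm :: "('g::group_add \<Rightarrow> complex) \<Rightarrow> real" where
  "group_hnorm x = L2_set (\<lambda>t. cmod (x t)) {t. x t \<noteq> 0}"

lemma group_star_mult_value:
  assumes "x \<in> pts group_alg"
  shows "amult group_alg (astar group_alg x) x 0 = complex_of_real ((group_hnorm x)\<^sup>2)"
proof -
  have "amult group_alg (astar group_alg x) x 0 = (\<Sum>t | x (- t) \<noteq> 0. cnj (x (- t)) * x (- t))"
    by (simp add: group_alg_mult group_alg_star)
  also have "\<dots> = (\<Sum>t\<in>uminus ` {t. x (- t) \<noteq> 0}. cnj (x t) * x t)"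
    by (simp add: sum.reindex inj_on_def)
  also have "uminus ` {t. x (- t) \<noteq> 0} = {t. x t \<noteq> 0}"
    by (auto simp: image_iff) (metis add.inverse_inverse)
  also have "(\<Sum>t | x t \<noteq> 0. cnj (x t) * x t) = complex_of_real ((group_hnorm x)\<^sup>2)"
    unfolding group_hnorm_def l2_square of_real_sum complex_norm_square by (simp add: mult.commute)
  finally show ?thesis .
qed

lemma line_hnorm:
  assumes x: "x \<in> pts group_alg"
  shows "line.hnorm (line_section x) = group_hnorm x"
proof -
  have "line.inner (line_section x) (line_section x) = (0, complex_of_real ((group_hnorm x)\<^sup>2))"
    unfolding line.inner_def line_section_star[symmetric] line_section_mult[OF grp.star_closed[OF x], symmetric]
    using group_star_mult_value[OF x] by (simp add: line_section_def)
  then show ?thesis by (simp add: line.hnorm_def norm_power group_hnorm_def)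
qed

lemma group_hnorm_eq_L2_set:
  assumes "finite K" "{t. x t \<noteq> 0} \<subseteq> K"
  shows "group_hnorm x = L2_set (\<lambda>t. cmod (x t)) K"
  unfolding group_hnorm_def L2_set_def using assms
  by (intro arg_cong[of _ _ sqrt] sum.mono_neutral_left) auto

lemma ell2_norm_finite:
  assumes "x \<in> pts group_alg"
  shows "x \<in> pts ell2" "vnorm ell2 x = group_hnorm x"
proof -
  have fin: "finite {t. x t \<noteq> 0}" using assms by simp
  have s: "((\<lambda>t. (cmod (x t))\<^sup>2) has_sum (\<Sum>t | x t \<noteq> 0. (cmod (x t))\<^sup>2)) UNIV"
    by (rule has_sum_finite_neutralI[OF fin]) auto
  show "x \<in> pts ell2" using s by (auto simp: ell2_def summable_on_def)
  show "vnorm ell2 x = group_hnorm x"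
    using infsumI[OF s] by (simp add: ell2_def group_hnorm_def L2_set_def)
qed

text \<open>Here the Hilbert space consists of functions and is not built as a completion. On a
  finite set \<open>R\<close> the image of \<xi> involves only finitely many values of \<xi>, so
  \<xi> may be truncated, the bound used, and \<open>R\<close> enlarged.\<close>

lemma ell2_operator_bound:
  assumes x: "x \<in> pts group_alg" and D: "0 \<le> D"
    and b: "\<And>y. y \<in> pts group_alg \<Longrightarrow> group_hnorm (amult group_alg x y) \<le> D * group_hnorm y"
    and xi: "\<xi> \<in> pts ell2"
  shows "vnorm ell2 (\<lambda>r. \<Sum>t | x t \<noteq> 0. x t * group_regular t \<xi> r) \<le> D * vnorm ell2 \<xi>"
proof -
  let ?T = "\<lambda>r. \<Sum>t | x t \<noteq> 0. x t * group_regular t \<xi> r" and ?s = "\<Sum>\<^sub>\<infinity>t. (cmod (\<xi> t))\<^sup>2"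
  have sm: "(\<lambda>t. (cmod (\<xi> t))\<^sup>2) summable_on UNIV" using xi by (simp add: ell2_def)
  have fin: "finite {t. x t \<noteq> 0}" using x by simp
  have part: "(\<Sum>r\<in>R. (cmod (?T r))\<^sup>2) \<le> D\<^sup>2 * ?s" if R: "finite R" for R
  proof -
    \<comment> \<open>The points at which \<xi> is evaluated when its image is computed on
      \<open>R\<close>.\<close>
    define F where "F = (\<lambda>(t, r). - t + r) ` ({t. x t \<noteq> 0} \<times> R)"
    have F: "finite F" using fin R by (simp add: F_def)
    define y where "y = (\<lambda>t. if t \<in> F then \<xi> t else 0)"
    have yF: "{t. y t \<noteq> 0} \<subseteq> F" by (auto simp: y_def)
    then have y: "y \<in> pts group_alg" using F by (simp add: finite_subset)
    have eq: "amult group_alg x y r = ?T r" if "r \<in> R" for r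
      unfolding group_alg_mult group_regular_def
    proof (rule sum.cong[OF refl])
      fix t assume "t \<in> {t. x t \<noteq> 0}"
      then have "- t + r \<in> F" using that by (force simp: F_def)
      then show "x t * y (- t + r) = x t * \<xi> (- t + r)" by (simp add: y_def)
    qed
    let ?K = "R \<union> {t. amult group_alg x y t \<noteq> 0}"
    have K: "finite ?K" using R grp.mult_closed[OF x y] by simp
    have "(\<Sum>r\<in>R. (cmod (?T r))\<^sup>2) = (\<Sum>r\<in>R. (cmod (amult group_alg x y r))\<^sup>2)" using eq by simp
    also have "\<dots> \<le> (\<Sum>r\<in>?K. (cmod (amult group_alg x y r))\<^sup>2)" using K by (intro sum_mono2) auto
    also have "\<dots> = (group_hnorm (amult group_alg x y))\<^sup>2"
      by (subst group_hnorm_eq_L2_set[OF K]) (auto simp: l2_square)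
    also have "\<dots> \<le> (D * group_hnorm y)\<^sup>2"
      using b[OF y] by (intro power_mono) (simp_all add: group_hnorm_def)
    also have "\<dots> = D\<^sup>2 * (\<Sum>t\<in>F. (cmod (\<xi> t))\<^sup>2)"
      by (simp add: power_mult_distrib group_hnorm_eq_L2_set[OF F yF] l2_square) (simp add: y_def)
    also have "\<dots> \<le> D\<^sup>2 * ?s"
      using sm F by (intro mult_left_mono finite_sum_le_infsum) simp_all
    finally show ?thesis .
  qed
  have "(\<Sum>\<^sub>\<infinity>r. (cmod (?T r))\<^sup>2) \<le> D\<^sup>2 * ?s"
  proof (rule infsum_le_finite_sums)
    show "(\<lambda>r. (cmod (?T r))\<^sup>2) summable_on UNIV"
      using part by (intro nonneg_bdd_above_summable_on bdd_aboveI[of _ "D\<^sup>2 * ?s"]) auto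
  qed (use part in blast)
  then have "sqrt (\<Sum>\<^sub>\<infinity>r. (cmod (?T r))\<^sup>2) \<le> sqrt (D\<^sup>2 * ?s)" by simp
  then show ?thesis using D by (simp add: ell2_def real_sqrt_mult)
qed

lemma group_vnorm_eq: "vnorm group_alg x = opnorm ell2 (\<lambda>\<xi> r. \<Sum>t | x t \<noteq> 0. x t * group_regular t \<xi> r)"
  by (simp add: group_alg_def)

text \<open>The norm is an operator norm on \<open>ell2\<close>, whereas \<open>regular_alg\<close>
  speaks of finitely supported vectors; \<open>ell2_operator_bound\<close> bridges the two, and a
  first bound comes from the line bundle.\<close>

interpretation grp: regular_alg "group_alg :: ('g::group_add \<Rightarrow> complex) staralg" group_hnorm
proof
  fix x y :: "'g \<Rightarrow> complex" and c
  assume x: "x \<in> pts group_alg"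
  have lx: "line_section x \<in> finite_sections (const_bundle complex_alg)" using x by simp
  show "0 \<le> group_hnorm x" by (simp add: group_hnorm_def)
  show "group_hnorm (vscale group_alg c x) = cmod c * group_hnorm x"
    using line.hnorm_scale[OF lx, of c] line_hnorm[OF x] line_hnorm[OF grp.scale_closed[OF x], of c]
    by (simp only: line_section_scale)
  have bounded: "\<exists>C\<ge>0. \<forall>y\<in>pts group_alg. group_hnorm (amult group_alg x y) \<le> C * group_hnorm y"
  proof -
    obtain C where C: "0 \<le> C" "\<And>z. z \<in> finite_sections (const_bundle complex_alg) \<Longrightarrow>
        line.hnorm (line.conv (line_section x) z) \<le> C * line.hnorm z"
      using line.conv_bounded[OF lx] by blast
    have "group_hnorm (amult group_alg x y) \<le> C * group_hnorm y" if y: "y \<in> pts group_alg" for y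
      using C(2)[of "line_section y"] line_hnorm[OF y] line_hnorm[OF grp.mult_closed[OF x y]] y
      by (simp only: line_section_closed line_section_mult[OF x])
    then show ?thesis using C(1) by blast
  qed
  then obtain C where C: "0 \<le> C" "\<And>y. y \<in> pts group_alg \<Longrightarrow> group_hnorm (amult group_alg x y) \<le> C * group_hnorm y"
    by blast
  let ?T = "\<lambda>\<xi> r. \<Sum>t | x t \<noteq> 0. x t * group_regular t \<xi> r"
  have T: "?T y = amult group_alg x y" for y
    by (simp add: group_alg_mult group_regular_def fun_eq_iff)
  have zero: "(\<lambda>t. 0) \<in> pts (group_alg :: ('g \<Rightarrow> complex) staralg)" by simp
  have up: "group_hnorm (amult group_alg x y) \<le> vnorm group_alg x" if y: "y \<in> pts group_alg" "group_hnorm y \<le> 1" for y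
  proof -
    have "vnorm ell2 (?T y) \<le> opnorm ell2 ?T"
    proof (rule opnorm_upper)
      show "y \<in> pts ell2" "vnorm ell2 y \<le> 1" using ell2_norm_finite[OF y(1)] y(2) by simp_all
      fix z assume z: "z \<in> pts (ell2 :: ('g \<Rightarrow> complex) nspace)" "vnorm ell2 z \<le> 1"
      show "vnorm ell2 (?T z) \<le> C"
        using ell2_operator_bound[OF x C z(1)] mult_left_le[OF z(2) C(1)] by linarith
    qed
    then show ?thesis unfolding T group_vnorm_eq using ell2_norm_finite(2)[OF grp.mult_closed[OF x y(1)]] by simp
  qed
  show nonneg: "0 \<le> vnorm group_alg x"
    using up[OF zero] by (simp add: group_hnorm_def order_trans[OF L2_set_nonneg])
  show "vnorm group_alg x \<le> D"
    if D: "0 \<le> D" "\<And>y. y \<in> pts group_alg \<Longrightarrow> group_hnorm (amult group_alg x y) \<le> D * group_hnorm y" for D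
    unfolding group_vnorm_eq
  proof (rule opnorm_least)
    show "(\<lambda>t. 0) \<in> pts (ell2 :: ('g \<Rightarrow> complex) nspace)" "vnorm ell2 (\<lambda>t :: 'g. 0) \<le> 1"
      using ell2_norm_finite[OF zero] by (simp_all add: group_hnorm_def)
    fix z assume z: "z \<in> pts (ell2 :: ('g \<Rightarrow> complex) nspace)" "vnorm ell2 z \<le> 1"
    show "vnorm ell2 (?T z) \<le> D"
      using ell2_operator_bound[OF x D z(1)] mult_left_le[OF z(2) D(1)] by linarith
  qed
  assume y: "y \<in> pts group_alg"
  have ly: "line_section y \<in> finite_sections (const_bundle complex_alg)" using y by simp
  show tri: "group_hnorm (vadd group_alg x y) \<le> group_hnorm x + group_hnorm y"
    using line.hnorm_triangle[OF lx ly] line_hnorm[OF x] line_hnorm[OF y] line_hnorm[OF grp.add_closed[OF x y]]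
    by (simp only: line_section_add)
  show "(group_hnorm (amult group_alg x y))\<^sup>2 \<le> group_hnorm y * group_hnorm (amult group_alg (astar group_alg x) (amult group_alg x y))"
    using line.sec.h_star_mult[of "line_section x" "line_section y"] lx ly line_hnorm[OF y]
      line_hnorm[OF grp.mult_closed[OF x y]] line_hnorm[OF grp.mult_closed[OF grp.star_closed[OF x] grp.mult_closed[OF x y]]]
    by (simp only: section_alg_simps line.section_ops line_section_mult[OF x] line_section_mult[OF grp.star_closed[OF x]] line_section_star)
  show "group_hnorm (amult group_alg x y) \<le> vnorm group_alg x * group_hnorm y"
  proof (cases "group_hnorm y = 0")
    case True
    then show ?thesis using C(2)[OF y] by simp
  next
    case False
    then have p: "0 < group_hnorm y" by (simp add: less_le group_hnorm_def)
    let ?c = "complex_of_real (1 / group_hnorm y)"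
    have sc: "group_hnorm (vscale group_alg ?c z) = group_hnorm z / group_hnorm y" if z: "z \<in> pts group_alg" for z
      using line.hnorm_scale[of "line_section z" ?c] z line_hnorm[OF z] line_hnorm[OF grp.scale_closed[OF z], of ?c] p
      by (simp only: line_section_scale line_section_closed) (simp add: norm_divide)
    have "group_hnorm (amult group_alg x (vscale group_alg ?c y)) \<le> vnorm group_alg x"
      using sc[OF y] p y by (intro up grp.scale_closed) simp_all
    then show ?thesis
      unfolding grp.mult_scale_right[OF x y] sc[OF grp.mult_closed[OF x y]] using p by (simp add: pos_divide_le_eq)
  qed
qed

text \<open>Here a unit vector is available: \<open>x\<close> is applied to the function supported
  at \<open>0\<close>.\<close>

lemma group_value_le_norm:
  fixes x :: "'g::group_add \<Rightarrow> complex"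
  assumes "x \<in> pts group_alg"
  shows "cmod (x 0) \<le> vnorm group_alg x"
proof -
  define e :: "'g \<Rightarrow> complex" where "e = (\<lambda>t. if t = 0 then 1 else 0)"
  have e: "e \<in> pts group_alg" by (simp add: e_def)
  have he: "group_hnorm e = 1" by (simp add: group_hnorm_def e_def L2_set_def)
  have "amult group_alg x e = x"
  proof
    fix s :: 'g
    have "- t + s = 0 \<longleftrightarrow> t = s" for t using add_left_cancel[of t "- t + s" 0] by auto
    then have "amult group_alg x e s = (\<Sum>t | x t \<noteq> 0. if t = s then x t else 0)"
      unfolding group_alg_mult e_def by (intro sum.cong) simp_all
    then show "amult group_alg x e s = x s" using assms by simp
  qed
  then have "group_hnorm x \<le> vnorm group_alg x"
    using grp.vnorm_bound[OF assms e] he by simp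
  moreover have "cmod (x 0) \<le> group_hnorm x"
  proof (cases "x 0 = 0")
    case False
    then show ?thesis unfolding group_hnorm_def using assms
      by (intro member_le_L2_set[of _ 0 "\<lambda>t. cmod (x t)"]) simp_all
  qed (simp add: group_hnorm_def)
  ultimately show ?thesis by linarith
qed

section \<open>Matrices over the group algebra\<close>

interpretation mat: cstar_alg "mat_alg d" for d
  by unfold_locales (simp_all add: mat_banach mat_norm_cstar)

interpretation mb: fell "const_bundle (mat_alg d) :: ('g::group_add, 'g \<times> complex mat) bundle_data" for d
  by (rule fell.intro[OF mat.const_bundle_fell])

lemma group_alg_mult_sum:
  assumes "finite K" "{t. x t \<noteq> 0} \<subseteq> K"
  shows "amult group_alg x y s = (\<Sum>t\<in>K. x t * y (- t + s))"
  unfolding group_alg_mult using assms by (intro sum.mono_neutral_left) auto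

definition entry :: "nat \<Rightarrow> nat \<Rightarrow> ('g \<Rightarrow> 'g \<times> complex mat) \<Rightarrow> 'g \<Rightarrow> complex" where
  "entry i j Z = (\<lambda>t. snd (Z t) $$ (i, j))"

lemma mat_section_value:
  assumes "Z \<in> finite_sections (const_bundle (mat_alg d))"
  shows "fst (Z t) = t" "snd (Z t) \<in> carrier_mat d d"
  using mb.section_value[OF assms, of t] by (auto simp: mem_Times_iff)

lemma mat_section_finite:
  assumes "Z \<in> finite_sections (const_bundle (mat_alg d))"
  shows "finite {t. snd (Z t) \<noteq> 0\<^sub>m d d}"
proof -
  have "{t. snd (Z t) \<noteq> 0\<^sub>m d d} \<subseteq> mb.supp d Z" by (auto simp: mb.supp_def)
  then show ?thesis using mb.finite_supp[OF assms] by (rule finite_subset)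
qed

lemma entry_support:
  "i < d \<Longrightarrow> j < d \<Longrightarrow> {t. entry i j Z t \<noteq> 0} \<subseteq> {t. snd (Z t) \<noteq> 0\<^sub>m d d}"
  by (auto simp: entry_def)

lemma entry_closed:
  assumes "Z \<in> finite_sections (const_bundle (mat_alg d))" "i < d" "j < d"
  shows "entry i j Z \<in> pts group_alg"
  using finite_subset[OF entry_support[OF assms(2,3)] mat_section_finite[OF assms(1)]] by simp

lemma entry_conv:
  assumes Z: "Z \<in> finite_sections (const_bundle (mat_alg d))" and W: "W \<in> finite_sections (const_bundle (mat_alg d))"
    and ij: "i < d" "j < d"
  shows "entry i j (mb.conv d Z W) s = (\<Sum>l<d. amult group_alg (entry i l Z) (entry l j W) s)"
proof -
  let ?K = "{t. snd (Z t) \<noteq> 0\<^sub>m d d}" and ?f = "\<lambda>t. snd (Z t) * snd (W (- t + s))"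
  have K: "finite ?K" by (rule mat_section_finite[OF Z])
  have f: "?f t \<in> carrier_mat d d" for t using mat_section_value[OF Z, of t] mat_section_value[OF W, of "- t + s"] by simp
  have f0: "?f t = 0\<^sub>m d d" if "t \<notin> ?K" for t using that mat_section_value(2)[OF W, of "- t + s"] by simp
  have fin: "finite {t. ?f t \<noteq> vzero (mat_alg d)}" by (rule finite_subset[OF _ K]) (use f0 in auto)
  have "mb.conv d Z W s = fsum (fib (const_bundle (mat_alg d)) s) (\<lambda>t. (s, ?f t))"
    unfolding mb.conv_def using mat_section_value(1)[OF Z] mat_section_value(1)[OF W] by simp
  also have "\<dots> = (s, fsum (mat_alg d) ?f)" using fin f by (intro mat.const_bundle_fsum) simp_all
  finally have "entry i j (mb.conv d Z W) s = fsum (mat_alg d) ?f $$ (i, j)" by (simp add: entry_def)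
  also have "\<dots> = fsum complex_alg (\<lambda>t. ?f t $$ (i, j))"
    using fin f ij by (intro fsum_hom mat.vmonoid_axioms cpx.vmonoid_axioms) simp_all
  also have "\<dots> = vsum complex_alg (\<lambda>t. ?f t $$ (i, j)) ?K"
    using K f0 ij by (intro cpx.fsum_eq_vsum) (auto simp del: index_mult_mat)
  also have "\<dots> = (\<Sum>t\<in>?K. ?f t $$ (i, j))" by (rule vsum_complex[OF K])
  also have "\<dots> = (\<Sum>t\<in>?K. \<Sum>l<d. entry i l Z t * entry l j W (- t + s))"
    using mat_mult_index[OF mat_section_value(2)[OF Z] mat_section_value(2)[OF W] ij]
    by (simp add: entry_def del: index_mult_mat)
  also have "\<dots> = (\<Sum>l<d. \<Sum>t\<in>?K. entry i l Z t * entry l j W (- t + s))" by (rule sum.swap)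
  also have "\<dots> = (\<Sum>l<d. amult group_alg (entry i l Z) (entry l j W) s)"
    using group_alg_mult_sum[OF K entry_support[OF ij(1)]] by simp
  finally show ?thesis .
qed

lemma entry_star:
  assumes "Z \<in> finite_sections (const_bundle (mat_alg d))" "i < d" "j < d"
  shows "entry i j (mb.sstar d Z) = astar group_alg (entry j i Z)"
  using assms mat_adjoint_square(2)[OF mat_section_value(2)[OF assms(1)]]
  by (auto simp: entry_def mb.sstar_def group_alg_star fun_eq_iff)

lemma entry_inner:
  assumes W: "W \<in> finite_sections (const_bundle (mat_alg d))" and ij: "i < d" "j < d"
  shows "snd (mb.inner d W W) $$ (i, j) = (\<Sum>k<d. amult group_alg (astar group_alg (entry k i W)) (entry k j W) 0)"
proof -
  have "snd (mb.inner d W W) $$ (i, j) = entry i j (mb.conv d (mb.sstar d W) W) 0"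
    by (simp add: mb.inner_def entry_def)
  also have "\<dots> = (\<Sum>k<d. amult group_alg (entry i k (mb.sstar d W)) (entry k j W) 0)"
    using W ij by (intro entry_conv mb.sstar_closed)
  also have "\<dots> = (\<Sum>k<d. amult group_alg (astar group_alg (entry k i W)) (entry k j W) 0)"
    using entry_star[OF W ij(1)] by simp
  finally show ?thesis .
qed

text \<open>The diagonal entry of \<open><W, W>\<close> at \<open>j\<close> is the sum of the
  squared norms of the entries of \<open>W\<close> in column \<open>j\<close>.\<close>

lemma group_hnorm_entry_le:
  assumes W: "W \<in> finite_sections (const_bundle (mat_alg d))" and ij: "i < d" "j < d"
  shows "group_hnorm (entry i j W) \<le> mb.hnorm d W"
proof (rule power2_le_imp_le)
  have "snd (mb.inner d W W) $$ (j, j) = complex_of_real (\<Sum>k<d. (group_hnorm (entry k j W))\<^sup>2)"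
    using entry_inner[OF W ij(2) ij(2)] group_star_mult_value[OF entry_closed[OF W _ ij(2)]] by simp
  then have "cmod (snd (mb.inner d W W) $$ (j, j)) = (\<Sum>k<d. (group_hnorm (entry k j W))\<^sup>2)"
    by (simp only: norm_of_real) (simp add: sum_nonneg)
  moreover have "snd (mb.inner d W W) \<in> carrier_mat d d" using mb.inner_closed[OF W W] by (auto simp: mem_Times_iff)
  ultimately have "(\<Sum>k<d. (group_hnorm (entry k j W))\<^sup>2) \<le> (mb.hnorm d W)\<^sup>2"
    using mat_entry_le_norm[of "snd (mb.inner d W W)" d j j] ij(2) mb.hnorm_square[OF W] by simp
  moreover have "(group_hnorm (entry i j W))\<^sup>2 \<le> (\<Sum>k<d. (group_hnorm (entry k j W))\<^sup>2)"
    using ij(1) by (intro member_le_sum[of i "{..<d}" "\<lambda>k. (group_hnorm (entry k j W))\<^sup>2"]) simp_all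
  ultimately show "(group_hnorm (entry i j W))\<^sup>2 \<le> (mb.hnorm d W)\<^sup>2" by linarith
qed (use W mb.hnorm_nonneg in blast)

text \<open>Place \<xi> at position \<open>(j, j)\<close> of an otherwise zero matrix section: its
  norm does not exceed that of \<xi>, and the product with \<open>Z\<close> has the convolution of
  \<open>entry i j Z\<close> with \<xi> as its entry at \<open>(i, j)\<close>.\<close>

lemma entry_vnorm_le:
  assumes Z: "Z \<in> finite_sections (const_bundle (mat_alg d))" and ij: "i < d" "j < d"
  shows "vnorm group_alg (entry i j Z) \<le> vnorm (section_alg (const_bundle (mat_alg d))) Z"
proof (rule grp.vnorm_least[OF entry_closed[OF Z ij] mb.section_vnorm(3)[OF Z]])
  fix \<xi> :: "'a \<Rightarrow> complex" assume xi: "\<xi> \<in> pts group_alg"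
  define \<Xi> where "\<Xi> = (\<lambda>t. (t, Matrix.mat d d (\<lambda>(a, b). if a = j \<and> b = j then \<xi> t else 0)))"
  have X: "\<Xi> \<in> finite_sections (const_bundle (mat_alg d))"
  proof (rule mb.sectionsI'[of _ _ "{t. \<xi> t \<noteq> 0}"])
    show "finite {t. \<xi> t \<noteq> 0}" using xi by simp
    show "\<Xi> t = vzero (fib (const_bundle (mat_alg d)) t)" if "t \<notin> {t. \<xi> t \<noteq> 0}" for t
      using that by (auto simp: \<Xi>_def intro!: eq_matI)
  qed (simp add: \<Xi>_def)
  have eX: "entry a b \<Xi> = (\<lambda>t. if a = j \<and> b = j then \<xi> t else 0)" if "a < d" "b < d" for a b
    using that by (auto simp: entry_def \<Xi>_def)
  have m0: "amult group_alg z (\<lambda>t. 0) = (\<lambda>t. 0)" "amult group_alg (astar group_alg (\<lambda>t. 0)) z = (\<lambda>t. 0)" for z :: "'a \<Rightarrow> complex"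
    by (simp_all add: group_alg_mult group_alg_star fun_eq_iff)
  have "entry i j (mb.conv d Z \<Xi>) s = amult group_alg (entry i j Z) \<xi> s" for s
  proof -
    have "entry i j (mb.conv d Z \<Xi>) s = (\<Sum>l<d. if l = j then amult group_alg (entry i j Z) \<xi> s else 0)"
      unfolding entry_conv[OF Z X ij] using ij by (intro sum.cong) (auto simp: eX m0)
    then show ?thesis using ij by simp
  qed
  then have prod: "entry i j (mb.conv d Z \<Xi>) = amult group_alg (entry i j Z) \<xi>" by (simp add: fun_eq_iff)
  have inner: "snd (mb.inner d \<Xi> \<Xi>) $$ (a, b) = (if a = j \<and> b = j then complex_of_real ((group_hnorm \<xi>)\<^sup>2) else 0)"
    if ab: "a < d" "b < d" for a b
  proof -
    have "snd (mb.inner d \<Xi> \<Xi>) $$ (a, b) = (\<Sum>k<d. if k = j then (if a = j \<and> b = j then complex_of_real ((group_hnorm \<xi>)\<^sup>2) else 0) else 0)"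
      unfolding entry_inner[OF X ab] using ab
      by (intro sum.cong) (auto simp: eX m0 group_star_mult_value[OF xi, simplified])
    then show ?thesis using ij by simp
  qed
  have "mb.hnorm d \<Xi> \<le> group_hnorm \<xi>"
  proof (rule power2_le_imp_le)
    have "snd (mb.inner d \<Xi> \<Xi>) \<in> carrier_mat d d" using mb.inner_closed[OF X X] by (auto simp: mem_Times_iff)
    then have "(mb.hnorm d \<Xi>)\<^sup>2 \<le> (\<Sum>a<d. \<Sum>b<d. cmod (snd (mb.inner d \<Xi> \<Xi>) $$ (a, b)))"
      using mat_norm_le_entries mb.hnorm_square[OF X] by simp
    also have "\<dots> = (\<Sum>a<d. \<Sum>b<d. if a = j then (if b = j then (group_hnorm \<xi>)\<^sup>2 else 0) else 0)"
      using inner by (intro sum.cong refl) (auto simp: norm_power group_hnorm_def)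
    also have "\<dots> = (group_hnorm \<xi>)\<^sup>2"
    proof -
      have "(\<Sum>b<d. if a = j then (if b = j then (group_hnorm \<xi>)\<^sup>2 else 0) else 0) = (if a = j then (group_hnorm \<xi>)\<^sup>2 else 0)" for a
        using ij by simp
      then show ?thesis using ij by simp
    qed
    finally show "(mb.hnorm d \<Xi>)\<^sup>2 \<le> (group_hnorm \<xi>)\<^sup>2" .
  qed (simp add: group_hnorm_def)
  have "group_hnorm (amult group_alg (entry i j Z) \<xi>) \<le> mb.hnorm d (mb.conv d Z \<Xi>)"
    using group_hnorm_entry_le[OF mb.conv_closed[OF Z X] ij] unfolding prod .
  also have "\<dots> \<le> vnorm (section_alg (const_bundle (mat_alg d))) Z * mb.hnorm d \<Xi>"
    by (rule mb.section_vnorm(1)[OF Z X])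
  also have "\<dots> \<le> vnorm (section_alg (const_bundle (mat_alg d))) Z * group_hnorm \<xi>"
    by (rule mult_left_mono[OF \<open>mb.hnorm d \<Xi> \<le> group_hnorm \<xi>\<close> mb.section_vnorm(3)[OF Z]])
  finally show "group_hnorm (amult group_alg (entry i j Z) \<xi>) \<le> vnorm (section_alg (const_bundle (mat_alg d))) Z * group_hnorm \<xi>" .
qed

section \<open>Automatic contractivity of finite-dimensional representations\<close>

context star_alg
begin

text \<open>The iteration of \<open>sqrt_iter\<close>, now on a carrier set and without a unit:
  \<open>1 - sqrt (1 - x)\<close> is a power series in \<open>x\<close> without constant term, so
  the limit lies in the completion.\<close>

primrec siter :: "'a \<Rightarrow> nat \<Rightarrow> 'a" where
  "siter x 0 = vzero A"
| "siter x (Suc n) = vscale A (1/2) (vadd A x (amult A (siter x n) (siter x n)))"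

lemma siter_closed [simp]: "x \<in> pts A \<Longrightarrow> siter x n \<in> pts A"
  by (induction n) simp_all

lemma star_zero: "astar A (vzero A) = vzero A"
  using star_scale[of "vzero A" 0] by simp

lemma siter_star: "x \<in> pts A \<Longrightarrow> astar A x = x \<Longrightarrow> astar A (siter x n) = siter x n"
  by (induction n) (simp_all add: star_zero star_scale star_add star_mult)

end

context normed_star_alg
begin

lemma siter_norm:
  assumes x: "x \<in> pts A" "vnorm A x \<le> 1"
  shows "vnorm A (siter x n) \<le> sqrt_majorant n"
proof (induction n)
  case (Suc n)
  have "vnorm A (vadd A x (amult A (siter x n) (siter x n))) \<le> 1 + vnorm A (siter x n) * vnorm A (siter x n)"
    using norm_triangle[of x "amult A (siter x n) (siter x n)"] norm_mult[of "siter x n" "siter x n"] x by simp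
  also have "\<dots> \<le> 1 + sqrt_majorant n * sqrt_majorant n"
    using mult_mono[OF Suc Suc] sqrt_majorant_bounds[of n] x by simp
  finally show ?case using x by (simp add: norm_scale power2_eq_square)
qed simp

lemma siter_step:
  assumes x: "x \<in> pts A" "vnorm A x \<le> 1"
  shows "vnorm A (vdiff A (siter x (Suc n)) (siter x n)) \<le> sqrt_majorant (Suc n) - sqrt_majorant n"
proof (induction n)
  case 0
  have "siter x (Suc 0) = vscale A (1/2) x" using mult_scale_left[of "vzero A" "vzero A" 0] x by simp
  then show ?case using x by (simp add: norm_scale del: siter.simps(2)) 
next
  case (Suc n)
  let ?y = "siter x" and ?t = sqrt_majorant
  note [simp del] = siter.simps(2) sqrt_majorant.simps(2)
  have "vdiff A (?y (Suc (Suc n))) (?y (Suc n))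
      = vdiff A (vscale A (1/2) (vadd A x (amult A (?y (Suc n)) (?y (Suc n))))) (vscale A (1/2) (vadd A x (amult A (?y n) (?y n))))"
    by (simp only: siter.simps(2)[of x "Suc n"] siter.simps(2)[of x n])
  also have "\<dots> = vscale A (1/2) (vdiff A (amult A (?y (Suc n)) (?y (Suc n))) (amult A (?y n) (?y n)))"
    using x by (simp add: diff_scale diff_add_add)
  finally have "vnorm A (vdiff A (?y (Suc (Suc n))) (?y (Suc n)))
      = 1/2 * vnorm A (vdiff A (amult A (?y (Suc n)) (?y (Suc n))) (amult A (?y n) (?y n)))"
    using x by (simp add: norm_scale)
  also have "\<dots> \<le> 1/2 * (vnorm A (vdiff A (?y (Suc n)) (?y n)) * vnorm A (?y (Suc n))
      + vnorm A (?y n) * vnorm A (vdiff A (?y (Suc n)) (?y n)))"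
    using norm_mult_diff[of "?y (Suc n)" "?y (Suc n)" "?y n" "?y n"] x by simp
  also have "\<dots> \<le> 1/2 * ((?t (Suc n) - ?t n) * ?t (Suc n) + ?t n * (?t (Suc n) - ?t n))"
    using Suc siter_norm[OF x] sqrt_majorant_bounds sqrt_majorant_mono[of n] x
    by (intro mult_left_mono add_mono mult_mono) simp_all
  also have "\<dots> = ?t (Suc (Suc n)) - ?t (Suc n)"
  proof -
    have "?t (Suc (Suc n)) - ?t (Suc n) = (1 + (?t (Suc n))\<^sup>2) / 2 - (1 + (?t n)\<^sup>2) / 2"
      by (simp only: sqrt_majorant.simps(2)[of "Suc n"] sqrt_majorant.simps(2)[of n])
    then show ?thesis by (simp add: field_simps power2_eq_square)
  qed
  finally show ?case .
qed

text \<open>Steps are majorised by those of the convergent scalar sequence, hence so are the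
  telescoped differences.\<close>

lemma siter_cauchy:
  assumes x: "x \<in> pts A" "vnorm A x \<le> 1"
  shows "siter x \<in> cauchy_seqs A"
proof (rule cauchy_seqsI)
  show "siter x n \<in> pts A" for n using x by simp
  have tele: "vnorm A (vdiff A (siter x (n + k)) (siter x n)) \<le> sqrt_majorant (n + k) - sqrt_majorant n" for n k
  proof (induction k)
    case 0
    show ?case using x by simp
  next
    case (Suc k)
    have "vnorm A (vdiff A (siter x (n + Suc k)) (siter x n))
        \<le> vnorm A (vdiff A (siter x (Suc (n + k))) (siter x (n + k))) + vnorm A (vdiff A (siter x (n + k)) (siter x n))"
      using norm_diff_triangle[of "siter x (Suc (n + k))" "siter x (n + k)" "siter x n"] siter_closed[OF x(1)]
      by (simp only: add_Suc_right)
    then show ?case using Suc siter_step[OF x, of "n + k"] by (simp only: add_Suc_right)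
  qed
  have le: "vnorm A (vdiff A (siter x m) (siter x n)) \<le> \<bar>sqrt_majorant m - sqrt_majorant n\<bar>" for m n
  proof (cases "n \<le> m")
    case True
    then show ?thesis using tele[of n "m - n"] by simp
  next
    case False
    then show ?thesis using tele[of m "n - m"] norm_diff_commute[of "siter x m" "siter x n"] x by simp
  qed
  fix e :: real assume "0 < e"
  moreover have "Cauchy sqrt_majorant" using sqrt_majorant_convergent by (rule convergent_Cauchy)
  ultimately obtain N where N: "\<And>m n. m \<ge> N \<Longrightarrow> n \<ge> N \<Longrightarrow> norm (sqrt_majorant m - sqrt_majorant n) < e"
    using CauchyD by metis
  show "\<exists>N. \<forall>m\<ge>N. \<forall>n\<ge>N. vnorm A (vdiff A (siter x m) (siter x n)) < e"
  proof (intro exI[of _ N] allI impI)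
    fix m n assume "N \<le> m" "N \<le> n"
    then have "\<bar>sqrt_majorant m - sqrt_majorant n\<bar> < e" using N[of m n] by simp
    then show "vnorm A (vdiff A (siter x m) (siter x n)) < e" by (rule le_less_trans[OF le])
  qed
qed

end

text \<open>With \<open>S = 1 - R\<close> the equation reads \<open>M^* M + S^* S = 1\<close>, so
  the squares of \<open>norm (M u)\<close> and \<open>norm (S u)\<close> add up to that of
  \<open>norm u\<close>. The unit is used only in the matrix algebra.\<close>

lemma mat_contraction_of_sqrt:
  assumes M: "M \<in> carrier_mat d d" and R: "R \<in> carrier_mat d d" "mat_adjoint R = R"
    and eq: "mat_adjoint M * M + R * R = R + R"
  shows "vnorm (mat_alg d) M \<le> 1"
proof (rule mat_norm_least[OF M])
  let ?M = "\<lambda>i j. M $$ (i, j)" and ?S = "\<lambda>i j. (if i = j then 1 else 0) - R $$ (i, j)"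
  let ?P = "\<lambda>M i j. \<Sum>k<d. cnj (M k i) * M k j"
  have rs: "cnj (R $$ (k, i)) = R $$ (i, k)" if "i < d" "k < d" for i k
    using mat_adjoint_square(2)[OF R(1) that] R(2) by simp
  have PS: "?P ?M i j + ?P ?S i j = (if i = j then 1 else 0)" if ij: "i < d" "j < d" for i j
  proof -
    have "?P ?S i j = (\<Sum>k<d. (if k = i then (if k = j then 1 else 0) - R $$ (k, j) else 0) - (if k = j then cnj (R $$ (k, i)) else 0)
        + cnj (R $$ (k, i)) * R $$ (k, j))"
      by (intro sum.cong refl) (auto simp: algebra_simps)
    also have "\<dots> = ((if i = j then 1 else 0) - R $$ (i, j)) - cnj (R $$ (j, i)) + (\<Sum>k<d. cnj (R $$ (k, i)) * R $$ (k, j))"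
      using ij by (simp add: sum.distrib sum_subtractf)
    also have "(\<Sum>k<d. cnj (R $$ (k, i)) * R $$ (k, j)) = (R * R) $$ (i, j)"
      unfolding mat_mult_index[OF R(1) R(1) ij] using rs ij by simp
    finally have S: "?P ?S i j = (if i = j then 1 else 0) - R $$ (i, j) - R $$ (i, j) + (R * R) $$ (i, j)"
      using rs[OF ij] by simp
    have "?P ?M i j = (mat_adjoint M * M) $$ (i, j)"
      unfolding mat_mult_index[OF mat_adjoint_square(1)[OF M] M ij] using mat_adjoint_square(2)[OF M] ij by simp
    moreover have "(mat_adjoint M * M) $$ (i, j) + (R * R) $$ (i, j) = R $$ (i, j) + R $$ (i, j)"
      using arg_cong[OF eq, of "\<lambda>X. X $$ (i, j)"] R M mat_adjoint_square(1)[OF M] ij by (simp del: index_mult_mat(1))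
    ultimately show ?thesis unfolding S by (simp add: algebra_simps)
  qed
  show "op_bound {..<d} ?M 1" unfolding op_bound_def
  proof
    fix u :: "nat \<Rightarrow> complex"
    have "complex_of_real ((l2 {..<d} (mv {..<d} ?M u))\<^sup>2 + (l2 {..<d} (mv {..<d} ?S u))\<^sup>2)
        = (\<Sum>i<d. \<Sum>j<d. (?P ?M i j + ?P ?S i j) * (cnj (u i) * u j))"
      unfolding of_real_add l2_mv_square[OF finite_lessThan] by (simp only: distrib_right sum.distrib)
    also have "\<dots> = (\<Sum>i<d. \<Sum>j<d. if i = j then cnj (u i) * u j else 0)"
      using PS by (intro sum.cong refl) auto
    also have "\<dots> = (\<Sum>i<d. u i * cnj (u i))" by (intro sum.cong refl) (simp add: mult.commute)
    also have "\<dots> = complex_of_real ((l2 {..<d} u)\<^sup>2)"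
      unfolding l2_square of_real_sum complex_norm_square ..
    finally have "(l2 {..<d} (mv {..<d} ?M u))\<^sup>2 + (l2 {..<d} (mv {..<d} ?S u))\<^sup>2 = (l2 {..<d} u)\<^sup>2"
      by (simp only: of_real_eq_iff)
    then have "(l2 {..<d} (mv {..<d} ?M u))\<^sup>2 \<le> (l2 {..<d} u)\<^sup>2" using zero_le_power2[of "l2 {..<d} (mv {..<d} ?S u)"] by linarith
    then show "l2 {..<d} (mv {..<d} ?M u) \<le> 1 * l2 {..<d} u"
      using power2_le_imp_le[OF _ L2_set_nonneg] by simp
  qed
qed simp

context normed_star_alg
begin

text \<open>For \<open>norm z \<le> 1\<close> and \<open>a = z^* z\<close>, the limit
  \<open>P\<close> of the iteration satisfies \<open>P = (a + P P) / 2\<close> in the completion. A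
  star homomorphism carries this to matrices, where \<open>mat_contraction_of_sqrt\<close> bounds
  the image of \<open>z\<close>; continuity comes out as a result.\<close>

lemma completion_star_hom_contractive:
  assumes \<phi>: "star_hom (alg_completion A) (mat_alg d) \<phi>" and x: "x \<in> pts A"
  shows "vnorm (mat_alg d) (\<phi> (const_class x)) \<le> vnorm A x"
proof -
  have sh: "star_hom A (mat_alg d) (\<lambda>x. \<phi> (const_class x))" by (rule star_hom_const_class[OF \<phi>])
  have unit: "vnorm (mat_alg d) (\<phi> (const_class z)) \<le> 1" if z: "z \<in> pts A" "vnorm A z \<le> 1" for z
  proof -
    define a where "a = amult A (astar A z) z"
    have a: "a \<in> pts A" "astar A a = a" using z by (simp_all add: a_def star_mult)
    have "vnorm A a \<le> vnorm A z * vnorm A z" using norm_mult[of "astar A z" z] z by (simp add: a_def)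
    also have "\<dots> \<le> 1" using z by (simp add: mult_le_one)
    finally have a1: "vnorm A a \<le> 1" .
    let ?P = "cauchy_class A (siter a)"
    have Y: "siter a \<in> cauchy_seqs A" by (rule siter_cauchy[OF a(1) a1])
    have S: "(\<lambda>n. vscale A (1/2) (vadd A a (amult A (siter a n) (siter a n)))) \<in> cauchy_seqs A"
      using Y a by (intro cauchy_scale cauchy_add cauchy_mult) simp_all
    have "(\<lambda>n. vnorm A (vdiff A (siter a (Suc n)) (siter a n))) \<longlonglongrightarrow> 0"
    proof (rule tendsto_zero_le)
      obtain L where L: "sqrt_majorant \<longlonglongrightarrow> L" using sqrt_majorant_convergent convergent_def by blast
      have "(\<lambda>n. sqrt_majorant (Suc n) - sqrt_majorant n) \<longlonglongrightarrow> L - L" by (intro tendsto_diff LIMSEQ_Suc L)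
      then show "(\<lambda>n. sqrt_majorant (Suc n) - sqrt_majorant n) \<longlonglongrightarrow> 0" by simp
      show "vnorm A (vdiff A (siter a (Suc n)) (siter a n)) \<le> sqrt_majorant (Suc n) - sqrt_majorant n" for n
        by (rule siter_step[OF a(1) a1])
      show "0 \<le> vnorm A (vdiff A (siter a (Suc n)) (siter a n))" for n
        using a by (intro norm_nonneg diff_closed siter_closed)
    qed
    \<comment> \<open>The sequence on the left is \<open>siter a\<close> shifted by one, hence
      equivalent to it: the class is a fixed point of the iteration.\<close>
    then have eqP: "cauchy_class A (\<lambda>n. vscale A (1/2) (vadd A a (amult A (siter a n) (siter a n)))) = ?P"
      using Y S by (simp add: cauchy_class_eq_iff cauchy_rel_iff)
    have aa: "cauchy_class A (\<lambda>n. amult A (siter a n) (siter a n)) \<in> pts (completion A)"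
      using Y by (simp add: cauchy_mult)
    have P: "?P = vscale (completion A) (1/2) (vadd (completion A) (const_class a) (amult (alg_completion A) ?P ?P))"
      using Y a by (subst eqP[symmetric]) (simp add: alg_completion_mult completion_add completion_scale cauchy_mult cauchy_add)
    have PP: "amult (alg_completion A) ?P ?P \<in> pts (completion A)" using Y by (simp add: alg_completion_mult cauchy_mult)
    have hom: "\<And>P. P \<in> pts (completion A) \<Longrightarrow> \<phi> P \<in> carrier_mat d d"
      "\<And>P Q. P \<in> pts (completion A) \<Longrightarrow> Q \<in> pts (completion A) \<Longrightarrow> \<phi> (vadd (completion A) P Q) = \<phi> P + \<phi> Q"
      "\<And>P c. P \<in> pts (completion A) \<Longrightarrow> \<phi> (vscale (completion A) c P) = c \<cdot>\<^sub>m \<phi> P"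
      "\<And>P Q. P \<in> pts (completion A) \<Longrightarrow> Q \<in> pts (completion A) \<Longrightarrow> \<phi> (amult (alg_completion A) P Q) = \<phi> P * \<phi> Q"
      "\<And>P. P \<in> pts (completion A) \<Longrightarrow> \<phi> (astar (alg_completion A) P) = mat_adjoint (\<phi> P)"
      using \<phi> by (auto simp: star_hom_def linear_on_def)
    let ?R = "\<phi> ?P"
    have Pc: "?P \<in> pts (completion A)" using Y by simp
    have Ac: "const_class a \<in> pts (completion A)" using a by simp
    have R: "?R \<in> carrier_mat d d" by (rule hom(1)[OF Pc])
    have "vadd (completion A) (const_class a) (amult (alg_completion A) ?P ?P) \<in> pts (completion A)"
      using Y a by (simp add: alg_completion_mult completion_add cauchy_mult cauchy_add)
    then have Req: "?R = (1/2) \<cdot>\<^sub>m (\<phi> (const_class a) + ?R * ?R)"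
      by (subst P) (simp only: hom(3) hom(2)[OF Ac PP] hom(4)[OF Pc Pc])
    have "astar (alg_completion A) ?P = ?P"
      using Y siter_star[OF a] by (simp add: alg_completion_star)
    then have Rs: "mat_adjoint ?R = ?R" using hom(5)[OF Pc] by simp
    have zc: "const_class z \<in> pts (completion A)" using z by simp
    have Mz: "\<phi> (const_class z) \<in> carrier_mat d d" by (rule hom(1)[OF zc])
    have "\<phi> (const_class a) = mat_adjoint (\<phi> (const_class z)) * \<phi> (const_class z)"
      using sh z by (simp add: a_def star_hom_def)
    moreover have "\<phi> (const_class a) + ?R * ?R = ?R + ?R"
    proof -
      have C: "\<phi> (const_class a) + ?R * ?R \<in> carrier_mat d d" using hom(1)[OF Ac] R by simp
      have one: "1 \<cdot>\<^sub>m M = M" for M :: "complex mat" by (rule eq_matI) auto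
      have "?R + ?R = (1/2) \<cdot>\<^sub>m (\<phi> (const_class a) + ?R * ?R) + (1/2) \<cdot>\<^sub>m (\<phi> (const_class a) + ?R * ?R)"
        using Req by (rule arg_cong2[of _ _ _ _ "(+)"]) (rule Req)
      also have "\<dots> = \<phi> (const_class a) + ?R * ?R"
        unfolding add_smult_distrib_right_mat[OF C, symmetric] by (simp add: one)
      finally show ?thesis ..
    qed
    ultimately show ?thesis using mat_contraction_of_sqrt[OF Mz R Rs] by simp
  qed
  show ?thesis
  proof (rule field_le_epsilon)
    fix e :: real assume e: "0 < e"
    \<comment> \<open>Adding \<open>e\<close> keeps the divisor positive when the norm of
      \<open>x\<close> is zero.\<close>
    let ?c = "vnorm A x + e"
    have c: "0 < ?c" using norm_nonneg[OF x] e by linarith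
    have "vnorm A (vscale A (of_real (1 / ?c)) x) \<le> 1"
      using x c e by (simp add: norm_scale norm_divide del: of_real_add)
    then have "vnorm (mat_alg d) (\<phi> (const_class (vscale A (of_real (1 / ?c)) x))) \<le> 1"
      using x by (intro unit) simp_all
    also have "\<phi> (const_class (vscale A (of_real (1 / ?c)) x)) = of_real (1 / ?c) \<cdot>\<^sub>m \<phi> (const_class x)"
      using sh x by (simp add: star_hom_def linear_on_def)
    finally have "cmod (of_real (1 / ?c)) * vnorm (mat_alg d) (\<phi> (const_class x)) \<le> 1"
      using mat.norm_scale[of "\<phi> (const_class x)" d] sh x by (simp add: star_hom_def linear_on_def)
    then show "vnorm (mat_alg d) (\<phi> (const_class x)) \<le> ?c"
      using c by (simp add: norm_divide field_simps del: of_real_add)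
  qed
qed

text \<open>A Banach algebra is its own completion: every class contains exactly one constant
  sequence, and \<psi> moves to the completion along this bijection.\<close>

lemma banach_star_hom_contractive:
  assumes banach: "banach_on A" and \<psi>: "star_hom A (mat_alg d) \<psi>" and x: "x \<in> pts A"
  shows "vnorm (mat_alg d) (\<psi> x) \<le> vnorm A x"
proof -
  have inj: "y = z" if "y \<in> pts A" "z \<in> pts A" "const_class y = const_class z" for y z
  proof -
    have "(\<lambda>n::nat. vnorm A (vdiff A y z)) \<longlonglongrightarrow> 0"
      using that by (simp only: cauchy_class_eq_iff[OF cauchy_const[OF that(1)] cauchy_const[OF that(2)]] cauchy_rel_iff)
    then have n: "vnorm A (vdiff A y z) = 0" by (rule LIMSEQ_unique[OF tendsto_const])
    have defi: "\<forall>x\<in>pts A. vnorm A x = 0 \<longleftrightarrow> x = vzero A" using banach by (simp add: banach_on_def)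
    have "vdiff A y z = vzero A" by (rule iffD1[OF bspec[OF defi diff_closed[OF that(1,2)]] n])
    then show ?thesis by (rule diff_eq_zeroD[OF that(1,2)])
  qed
  have surj: "\<exists>y\<in>pts A. P = const_class y" if "P \<in> pts (completion A)" for P
  proof -
    obtain X where X: "X \<in> cauchy_seqs A" "P = cauchy_class A X" using \<open>P \<in> _\<close> by (rule completion_cases)
    have "\<And>X. X \<in> cauchy_seqs A \<Longrightarrow> \<exists>x\<in>pts A. (\<lambda>n. vnorm A (vdiff A (X n) x)) \<longlonglongrightarrow> 0"
      using banach by (simp add: banach_on_def)
    from this[OF X(1)] obtain y where "y \<in> pts A" "(\<lambda>n. vnorm A (vdiff A (X n) y)) \<longlonglongrightarrow> 0" by (rule bexE)
    then show ?thesis using X by (intro bexI[of _ y]) (simp_all add: cauchy_class_eq_iff cauchy_rel_iff)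
  qed
  define \<phi> where "\<phi> P = \<psi> (THE y. y \<in> pts A \<and> P = const_class y)" for P
  have \<phi>: "\<phi> (const_class y) = \<psi> y" if "y \<in> pts A" for y
    unfolding \<phi>_def using that by (intro arg_cong[of _ _ \<psi>] the_equality) (auto dest: inj)
  have \<psi>': "\<And>x. x \<in> pts A \<Longrightarrow> \<psi> x \<in> carrier_mat d d"
    "\<And>x y. x \<in> pts A \<Longrightarrow> y \<in> pts A \<Longrightarrow> \<psi> (vadd A x y) = \<psi> x + \<psi> y"
    "\<And>x c. x \<in> pts A \<Longrightarrow> \<psi> (vscale A c x) = c \<cdot>\<^sub>m \<psi> x"
    "\<And>x y. x \<in> pts A \<Longrightarrow> y \<in> pts A \<Longrightarrow> \<psi> (amult A x y) = \<psi> x * \<psi> y"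
    "\<And>x. x \<in> pts A \<Longrightarrow> \<psi> (astar A x) = mat_adjoint (\<psi> x)"
    using \<psi> by (auto simp: star_hom_def linear_on_def)
  have "star_hom (alg_completion A) (mat_alg d) \<phi>"
    unfolding star_hom_def linear_on_def alg_completion_simps
  proof (intro conjI ballI allI)
    fix P Q c assume "P \<in> pts (completion A)"
    then obtain y where y: "y \<in> pts A" "P = const_class y" using surj by blast
    show "\<phi> P \<in> pts (mat_alg d)" using y by (simp add: \<phi> \<psi>')
    show "\<phi> (vscale (completion A) c P) = vscale (mat_alg d) c (\<phi> P)" using y by (simp add: \<phi> \<psi>' completion_scale)
    show "\<phi> (astar (alg_completion A) P) = astar (mat_alg d) (\<phi> P)" using y by (simp add: \<phi> \<psi>' alg_completion_star)
    assume "Q \<in> pts (completion A)"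
    then obtain z where z: "z \<in> pts A" "Q = const_class z" using surj by blast
    show "\<phi> (vadd (completion A) P Q) = vadd (mat_alg d) (\<phi> P) (\<phi> Q)" using y z by (simp add: \<phi> \<psi>' completion_add)
    show "\<phi> (amult (alg_completion A) P Q) = amult (mat_alg d) (\<phi> P) (\<phi> Q)" using y z by (simp add: \<phi> \<psi>' alg_completion_mult)
  qed
  from completion_star_hom_contractive[OF this x] show ?thesis using \<phi>[OF x] by simp
qed

end

section \<open>Matrix representations with arbitrary finite index sets\<close>

text \<open>Selecting rows and columns by injections cannot raise the bound: a vector is extended by
  zero along \<open>e2\<close>, and the image is restricted along \<open>e1\<close>. Both
  re-indexing and the choice of a block are instances.\<close>

lemma op_bound_embed:
  fixes e1 e2 :: "'j \<Rightarrow> 'i"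
  assumes I: "finite I" and b: "op_bound I M C" and C: "0 \<le> C"
    and e1: "inj_on e1 J" "e1 ` J \<subseteq> I" and e2: "inj_on e2 J" "e2 ` J \<subseteq> I"
  shows "op_bound J (\<lambda>a b. M (e1 a) (e2 b)) C"
  unfolding op_bound_def
proof
  fix u :: "'j \<Rightarrow> complex"
  define v where "v i = (if i \<in> e2 ` J then u (inv_into J e2 i) else 0)" for i
  have v: "v (e2 j) = u j" if "j \<in> J" for j using that e2(1) by (simp add: v_def)
  have "(\<Sum>i\<in>I. (cmod (v i))\<^sup>2) = (\<Sum>i\<in>e2 ` J. (cmod (v i))\<^sup>2)"
    using I e2(2) by (intro sum.mono_neutral_right) (auto simp: v_def)
  also have "\<dots> = (\<Sum>j\<in>J. (cmod (u j))\<^sup>2)" using v by (simp add: sum.reindex[OF e2(1)])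
  finally have lv: "l2 I v = l2 J u" by (simp add: L2_set_def)
  have mv: "mv J (\<lambda>a b. M (e1 a) (e2 b)) u a = mv I M v (e1 a)" for a
  proof -
    have "mv I M v (e1 a) = (\<Sum>i\<in>e2 ` J. M (e1 a) i * v i)"
      unfolding mv_def using I e2(2) by (intro sum.mono_neutral_right) (auto simp: v_def)
    also have "\<dots> = (\<Sum>j\<in>J. M (e1 a) (e2 j) * u j)" using v by (simp add: sum.reindex[OF e2(1)])
    finally show ?thesis by (simp add: mv_def)
  qed
  have "(\<Sum>a\<in>J. (cmod (mv I M v (e1 a)))\<^sup>2) = (\<Sum>i\<in>e1 ` J. (cmod (mv I M v i))\<^sup>2)"
    by (simp add: sum.reindex[OF e1(1)])
  also have "\<dots> \<le> (\<Sum>i\<in>I. (cmod (mv I M v i))\<^sup>2)" using I e1(2) by (intro sum_mono2) simp_all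
  finally have "l2 J (\<lambda>a. mv I M v (e1 a)) \<le> l2 I (mv I M v)" unfolding L2_set_def by (rule real_sqrt_le_mono)
  also have "\<dots> \<le> C * l2 J u" using op_boundD[OF b, of v] lv by simp
  finally show "l2 J (mv J (\<lambda>a b. M (e1 a) (e2 b)) u) \<le> C * l2 J u" by (simp add: mv)
qed

text \<open>Direct sums and tensor products are easiest to write with disjoint unions and products
  as index sets; the homomorphism laws are therefore stated entry by entry over such a set.\<close>

definition imat_hom :: "('a, 'm) staralg_scheme \<Rightarrow> 'i set \<Rightarrow> ('a \<Rightarrow> 'i \<Rightarrow> 'i \<Rightarrow> complex) \<Rightarrow> bool" where
  "imat_hom A I \<psi> \<longleftrightarrow> (\<forall>i\<in>I. \<forall>j\<in>I.
     (\<forall>x\<in>pts A. \<forall>y\<in>pts A. \<psi> (vadd A x y) i j = \<psi> x i j + \<psi> y i j) \<and>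
     (\<forall>c. \<forall>x\<in>pts A. \<psi> (vscale A c x) i j = c * \<psi> x i j) \<and>
     (\<forall>x\<in>pts A. \<forall>y\<in>pts A. \<psi> (amult A x y) i j = (\<Sum>k\<in>I. \<psi> x i k * \<psi> y k j)) \<and>
     (\<forall>x\<in>pts A. \<psi> (astar A x) i j = cnj (\<psi> x j i)))"

text \<open>An enumeration of the index set produces an honest matrix. The second clause transfers
  every norm estimate in both directions.\<close>

lemma imat_hom_star_hom:
  assumes I: "finite I" and \<psi>: "imat_hom A I \<psi>"
  shows "\<exists>n \<phi>. star_hom A (mat_alg n) \<phi> \<and>
    (\<forall>x C. 0 \<le> C \<longrightarrow> (op_bound {..<n} (\<lambda>a b. \<phi> x $$ (a, b)) C \<longleftrightarrow> op_bound I (\<psi> x) C))"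
proof -
  let ?n = "card I"
  obtain e where e: "bij_betw e {..<?n} I" using ex_bij_betw_nat_finite[OF I] unfolding atLeast0LessThan by blast
  have eI: "e a \<in> I" if "a < ?n" for a using bij_betw_apply[OF e] that by simp
  have h: "\<And>i j x y. i \<in> I \<Longrightarrow> j \<in> I \<Longrightarrow> x \<in> pts A \<Longrightarrow> y \<in> pts A \<Longrightarrow> \<psi> (vadd A x y) i j = \<psi> x i j + \<psi> y i j"
    "\<And>i j x c. i \<in> I \<Longrightarrow> j \<in> I \<Longrightarrow> x \<in> pts A \<Longrightarrow> \<psi> (vscale A c x) i j = c * \<psi> x i j"
    "\<And>i j x y. i \<in> I \<Longrightarrow> j \<in> I \<Longrightarrow> x \<in> pts A \<Longrightarrow> y \<in> pts A \<Longrightarrow> \<psi> (amult A x y) i j = (\<Sum>k\<in>I. \<psi> x i k * \<psi> y k j)"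
    "\<And>i j x. i \<in> I \<Longrightarrow> j \<in> I \<Longrightarrow> x \<in> pts A \<Longrightarrow> \<psi> (astar A x) i j = cnj (\<psi> x j i)"
    using \<psi> by (auto simp: imat_hom_def)
  define \<phi> where "\<phi> x = Matrix.mat ?n ?n (\<lambda>(a, b). \<psi> x (e a) (e b))" for x
  have \<phi>i: "\<phi> x $$ (a, b) = \<psi> x (e a) (e b)" if "a < ?n" "b < ?n" for x a b using that by (simp add: \<phi>_def)
  have \<phi>c: "\<phi> x \<in> carrier_mat ?n ?n" for x by (simp add: \<phi>_def)
  have eq: "M = M'" if "M \<in> carrier_mat ?n ?n" "M' \<in> carrier_mat ?n ?n"
    "\<And>a b. a < ?n \<Longrightarrow> b < ?n \<Longrightarrow> M $$ (a, b) = M' $$ (a, b)" for M M' :: "complex mat"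
    using that by (intro eq_matI) auto
  have "star_hom A (mat_alg ?n) \<phi>"
    unfolding star_hom_def linear_on_def mat_alg_simps
  proof (intro conjI ballI allI)
    fix x y c assume x: "x \<in> pts A"
    show "\<phi> x \<in> carrier_mat ?n ?n" by (rule \<phi>c)
    show "\<phi> (vscale A c x) = c \<cdot>\<^sub>m \<phi> x"
      using \<phi>c[of x] eI x by (intro eq \<phi>c) (auto simp: \<phi>i h(2))
    show "\<phi> (astar A x) = mat_adjoint (\<phi> x)"
      using mat_adjoint_square[OF \<phi>c[of x]] eI x by (intro eq \<phi>c) (auto simp: \<phi>i h(4))
    assume y: "y \<in> pts A"
    show "\<phi> (vadd A x y) = \<phi> x + \<phi> y"
      using \<phi>c[of x] \<phi>c[of y] eI x y by (intro eq \<phi>c) (auto simp: \<phi>i h(1))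
    show "\<phi> (amult A x y) = \<phi> x * \<phi> y"
    proof (intro eq \<phi>c)
      show "\<phi> x * \<phi> y \<in> carrier_mat ?n ?n" using \<phi>c[of x] \<phi>c[of y] by simp
      fix a b assume ab: "a < ?n" "b < ?n"
      have "(\<phi> x * \<phi> y) $$ (a, b) = (\<Sum>k<?n. \<psi> x (e a) (e k) * \<psi> y (e k) (e b))"
        unfolding mat_mult_index[OF \<phi>c \<phi>c ab] using ab by (intro sum.cong) (simp_all add: \<phi>i)
      also have "\<dots> = (\<Sum>k\<in>I. \<psi> x (e a) k * \<psi> y k (e b))"
        by (rule sum.reindex_bij_betw[OF e])
      finally show "\<phi> (amult A x y) $$ (a, b) = (\<phi> x * \<phi> y) $$ (a, b)"
        using \<phi>i[OF ab] h(3)[OF eI[OF ab(1)] eI[OF ab(2)] x y] by simp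
    qed
  qed
  moreover have "op_bound {..<?n} (\<lambda>a b. \<phi> x $$ (a, b)) C \<longleftrightarrow> op_bound I (\<psi> x) C" if C: "0 \<le> C" for x C
  proof -
    let ?f = "inv_into {..<?n} e"
    have f: "bij_betw ?f I {..<?n}" by (rule bij_betw_inv_into[OF e])
    have "op_bound {..<?n} (\<lambda>a b. \<phi> x $$ (a, b)) C \<longleftrightarrow> op_bound {..<?n} (\<lambda>a b. \<psi> x (e a) (e b)) C"
      by (intro op_bound_cong) (simp add: \<phi>i)
    moreover have "op_bound {..<?n} (\<lambda>a b. \<psi> x (e a) (e b)) C" if "op_bound I (\<psi> x) C"
      using e by (intro op_bound_embed[OF I that C]) (auto simp: bij_betw_def)
    moreover have "op_bound I (\<psi> x) C" if b: "op_bound {..<?n} (\<lambda>a b. \<psi> x (e a) (e b)) C"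
    proof -
      have "op_bound I (\<lambda>i j. (\<lambda>a b. \<psi> x (e a) (e b)) (?f i) (?f j)) C"
        using f by (intro op_bound_embed[OF finite_lessThan b C]) (auto simp: bij_betw_def)
      moreover have "e (?f i) = i" if "i \<in> I" for i using bij_betw_inv_into_right[OF e that] .
      ultimately show ?thesis by (subst op_bound_cong[of I "\<psi> x" "\<lambda>i j. \<psi> x (e (?f i)) (e (?f j))"]) simp_all
    qed
    ultimately show ?thesis by blast
  qed
  ultimately show ?thesis by blast
qed

section \<open>Residual finite-dimensionality of a completion\<close>

context normed_star_alg
begin

text \<open>The image of a self-adjoint element is a self-adjoint matrix, and squaring such a matrix
  squares its norm.\<close>

lemma mat_hom_dyadic_norm:
  assumes \<phi>: "star_hom A (mat_alg n) \<phi>" and x: "x \<in> pts A" "astar A x = x"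
  shows "vnorm (mat_alg n) (\<phi> (dyadic x k)) = vnorm (mat_alg n) (\<phi> x) ^ (2 ^ k)"
proof (induction k)
  case (Suc k)
  let ?M = "\<phi> (dyadic x k)"
  have "?M \<in> carrier_mat n n" using \<phi> x by (simp add: star_hom_def linear_on_def)
  moreover have "mat_adjoint ?M = ?M"
  proof -
    have "\<phi> (astar A (dyadic x k)) = astar (mat_alg n) ?M" using \<phi> x by (simp only: star_hom_def dyadic_closed)
    then show ?thesis using dyadic_star[OF x, of k] by simp
  qed
  ultimately have "vnorm (mat_alg n) (?M * ?M) = (vnorm (mat_alg n) ?M)\<^sup>2"
    using mat_norm_cstar[of ?M n] by simp
  moreover have "\<phi> (dyadic x (Suc k)) = ?M * ?M" using dyadic_hom[OF \<phi> x(1), of k] by simp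
  ultimately show ?case using Suc by (simp add: power_even_eq)
qed simp

text \<open>For \<open>x^* x\<close> the norms of the images of the dyadic powers are exact powers,
  so \<open>growth_bound\<close> with \<open>c = 1\<close> improves any bound \<open>K\<close> to
  \<open>1\<close>.\<close>

lemma mat_hom_contractive:
  assumes \<phi>: "star_hom A (mat_alg n) \<phi>" and K: "\<And>z. z \<in> pts A \<Longrightarrow> vnorm (mat_alg n) (\<phi> z) \<le> K * vnorm A z"
    and x: "x \<in> pts A"
  shows "vnorm (mat_alg n) (\<phi> x) \<le> vnorm A x"
proof -
  let ?w = "amult A (astar A x) x" and ?N = "vnorm (mat_alg n)"
  have w: "?w \<in> pts A" "astar A ?w = ?w" using x by (simp_all add: star_mult)
  have c: "\<phi> z \<in> carrier_mat n n" if "z \<in> pts A" for z using \<phi> that by (simp add: star_hom_def linear_on_def)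
  have K0: "0 \<le> K * vnorm A z" if "z \<in> pts A" for z using K[OF that] mat_norm_nonneg[OF c[OF that]] by linarith
  have "?N (\<phi> ?w) ^ (2 ^ 0) \<le> 1 * vnorm A ?w"
  proof (rule growth_bound[of "\<lambda>k. ?N (\<phi> ?w) ^ (2 ^ k)"])
    show "0 \<le> ?N (\<phi> ?w) ^ (2 ^ k)" for k using mat_norm_nonneg[OF c[OF w(1)]] by simp
    show "(?N (\<phi> ?w) ^ (2 ^ k))\<^sup>2 \<le> 1 * ?N (\<phi> ?w) ^ (2 ^ Suc k)" for k by (simp add: power_even_eq)
    show "?N (\<phi> ?w) ^ (2 ^ k) \<le> \<bar>K\<bar> * vnorm A ?w ^ (2 ^ k)" for k
    proof -
      have d: "dyadic ?w k \<in> pts A" using w by simp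
      have "?N (\<phi> ?w) ^ (2 ^ k) \<le> K * vnorm A (dyadic ?w k)"
        unfolding mat_hom_dyadic_norm[OF \<phi> w, symmetric] by (rule K[OF d])
      also have "\<dots> \<le> \<bar>K\<bar> * vnorm A (dyadic ?w k)" using d by (intro mult_right_mono) simp_all
      also have "\<dots> \<le> \<bar>K\<bar> * vnorm A ?w ^ (2 ^ k)" by (intro mult_left_mono norm_dyadic_le w) simp
      finally show ?thesis .
    qed
  qed (use w in simp_all)
  then have "?N (\<phi> ?w) \<le> vnorm A ?w" by simp
  also have "\<dots> \<le> (vnorm A x)\<^sup>2" using norm_mult[of "astar A x" x] x by (simp add: power2_eq_square)
  also have "?N (\<phi> ?w) = (?N (\<phi> x))\<^sup>2"
    using \<phi> x mat_norm_cstar[OF c[OF x]] by (simp add: star_hom_def)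
  finally show ?thesis by (rule power2_le_imp_le) (simp add: x)
qed

text \<open>The extension is characterised by a limit along every representing sequence. Each
  homomorphism law then holds entry by entry, by uniqueness of limits.\<close>

lemma contractive_hom_extends:
  assumes \<phi>: "star_hom A (mat_alg d) \<phi>" and con: "\<And>z. z \<in> pts A \<Longrightarrow> vnorm (mat_alg d) (\<phi> z) \<le> vnorm A z"
  shows "\<exists>\<Phi>. star_hom (alg_completion A) (mat_alg d) \<Phi> \<and> (\<forall>X\<in>cauchy_seqs A.
    (\<lambda>n. vnorm (mat_alg d) (vdiff (mat_alg d) (\<phi> (X n)) (\<Phi> (cauchy_class A X)))) \<longlonglongrightarrow> 0)"
proof -
  let ?N = "vnorm (mat_alg d)" and ?D = "vdiff (mat_alg d)"
  have h: "\<And>x. x \<in> pts A \<Longrightarrow> \<phi> x \<in> carrier_mat d d"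
    "\<And>x y. x \<in> pts A \<Longrightarrow> y \<in> pts A \<Longrightarrow> \<phi> (vadd A x y) = \<phi> x + \<phi> y"
    "\<And>x c. x \<in> pts A \<Longrightarrow> \<phi> (vscale A c x) = c \<cdot>\<^sub>m \<phi> x"
    "\<And>x y. x \<in> pts A \<Longrightarrow> y \<in> pts A \<Longrightarrow> \<phi> (amult A x y) = \<phi> x * \<phi> y"
    "\<And>x. x \<in> pts A \<Longrightarrow> \<phi> (astar A x) = mat_adjoint (\<phi> x)"
    using \<phi> by (auto simp: star_hom_def linear_on_def)
  have diff: "?D (\<phi> x) (\<phi> y) = \<phi> (vdiff A x y)" if "x \<in> pts A" "y \<in> pts A" for x y
    using that by (simp add: vdiff_def h)
  have lip: "?N (?D (\<phi> x) (\<phi> y)) \<le> 1 * vnorm A (vdiff A x y)" if "x \<in> pts A" "y \<in> pts A" for x y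
    using that con[of "vdiff A x y"] by (simp add: diff)
  note cau = bounded_map_cauchy[OF seminormed_axioms mat.seminormed_axioms, of \<phi> d 1]
  define \<Phi> where "\<Phi> P = (SOME L. L \<in> carrier_mat d d \<and> (\<lambda>n. ?N (?D (\<phi> (cauchy_rep P n)) L)) \<longlonglongrightarrow> 0)" for P
  have \<Phi>: "\<Phi> P \<in> carrier_mat d d \<and> (\<lambda>n. ?N (?D (\<phi> (cauchy_rep P n)) (\<Phi> P))) \<longlonglongrightarrow> 0" if "P \<in> pts (completion A)" for P
  proof -
    have "(\<lambda>n. \<phi> (cauchy_rep P n)) \<in> cauchy_seqs (mat_alg d)"
      using h(1) lip cauchy_rep_seq[OF that] by (intro cau(1)) simp_all
    then obtain L where "L \<in> carrier_mat d d" "(\<lambda>n. ?N (?D (\<phi> (cauchy_rep P n)) L)) \<longlonglongrightarrow> 0"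
      by (rule mat_cauchy_converges) blast
    then show ?thesis unfolding \<Phi>_def by (intro someI[of "\<lambda>L. L \<in> carrier_mat d d \<and> (\<lambda>n. ?N (?D (\<phi> (cauchy_rep P n)) L)) \<longlonglongrightarrow> 0"]) blast
  qed
  have \<Phi>c: "\<Phi> (cauchy_class A X) \<in> carrier_mat d d" if "X \<in> cauchy_seqs A" for X
    using \<Phi>[of "cauchy_class A X"] that by simp
  have lim: "(\<lambda>n. ?N (?D (\<phi> (X n)) (\<Phi> (cauchy_class A X)))) \<longlonglongrightarrow> 0" if X: "X \<in> cauchy_seqs A" for X
  proof -
    let ?Y = "cauchy_rep (cauchy_class A X)" and ?L = "\<Phi> (cauchy_class A X)"
    have Pc: "cauchy_class A X \<in> pts (completion A)" using X by simp
    have Y: "?Y \<in> cauchy_seqs A" by (rule cauchy_rep_seq[OF Pc])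
    have "(\<lambda>n. ?N (?D (\<phi> (X n)) (\<phi> (?Y n)))) \<longlonglongrightarrow> 0"
    proof (rule tendsto_zero_le)
      show "(\<lambda>n. vnorm A (vdiff A (X n) (?Y n))) \<longlonglongrightarrow> 0" using cauchy_rep_class[OF X] by (simp add: cauchy_rel_iff)
      fix n show "?N (?D (\<phi> (X n)) (\<phi> (?Y n))) \<le> vnorm A (vdiff A (X n) (?Y n))"
        using lip[OF cauchy_seqsD[OF X] cauchy_seqsD[OF Y], of n n] by simp
      show "0 \<le> ?N (?D (\<phi> (X n)) (\<phi> (?Y n)))"
        using h(1) cauchy_seqsD[OF X] cauchy_seqsD[OF Y] by (intro mat.norm_nonneg mat.diff_closed) simp_all
    qed
    from tendsto_add[OF this conjunct2[OF \<Phi>[OF Pc]]]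
    have "(\<lambda>n. ?N (?D (\<phi> (X n)) (\<phi> (?Y n))) + ?N (?D (\<phi> (?Y n)) ?L)) \<longlonglongrightarrow> 0" by simp
    then show ?thesis
    proof (rule tendsto_zero_le)
      fix n
      have m: "\<phi> (X n) \<in> pts (mat_alg d)" "\<phi> (?Y n) \<in> pts (mat_alg d)" "?L \<in> pts (mat_alg d)"
        using h(1) cauchy_seqsD[OF X] cauchy_seqsD[OF Y] \<Phi>c[OF X] by simp_all
      show "0 \<le> ?N (?D (\<phi> (X n)) ?L)" by (rule mat.norm_nonneg[OF mat.diff_closed[OF m(1,3)]])
      show "?N (?D (\<phi> (X n)) ?L) \<le> ?N (?D (\<phi> (X n)) (\<phi> (?Y n))) + ?N (?D (\<phi> (?Y n)) ?L)"
        by (rule mat.norm_diff_triangle[OF m])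
    qed
  qed
  have ent: "(\<lambda>n. \<phi> (X n) $$ (i, j)) \<longlonglongrightarrow> \<Phi> (cauchy_class A X) $$ (i, j)"
    if X: "X \<in> cauchy_seqs A" and ij: "i < d" "j < d" for X i j
  proof -
    have m: "\<phi> (X n) \<in> carrier_mat d d" for n using h(1) cauchy_seqsD[OF X] by simp
    have "(\<lambda>n. cmod (\<phi> (X n) $$ (i, j) - \<Phi> (cauchy_class A X) $$ (i, j))) \<longlonglongrightarrow> 0"
    proof (rule tendsto_zero_le[OF lim[OF X]])
      fix n
      have "?D (\<phi> (X n)) (\<Phi> (cauchy_class A X)) \<in> carrier_mat d d"
        using mat.diff_closed[of "\<phi> (X n)" d "\<Phi> (cauchy_class A X)"] m \<Phi>c[OF X] by simp
      from mat_entry_le_norm[OF this ij]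
      show "cmod (\<phi> (X n) $$ (i, j) - \<Phi> (cauchy_class A X) $$ (i, j)) \<le> ?N (?D (\<phi> (X n)) (\<Phi> (cauchy_class A X)))"
        by (simp only: mat_diff_index[OF m \<Phi>c[OF X] ij])
    qed simp
    then show ?thesis by (rule LIM_zero_cancel[OF tendsto_norm_zero_cancel])
  qed
  have eq: "M = M'" if "M \<in> carrier_mat d d" "M' \<in> carrier_mat d d"
    "\<And>a b. a < d \<Longrightarrow> b < d \<Longrightarrow> M $$ (a, b) = M' $$ (a, b)" for M M' :: "complex mat"
    using that by (intro eq_matI) auto
  have "star_hom (alg_completion A) (mat_alg d) \<Phi>"
    unfolding star_hom_def linear_on_def alg_completion_simps mat_alg_simps
  proof (intro conjI ballI allI)
    fix P Q c assume "P \<in> pts (completion A)"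
    then obtain X where X: "X \<in> cauchy_seqs A" "P = cauchy_class A X" by (rule completion_cases)
    note Xn = cauchy_seqsD[OF X(1)]
    have Xm: "\<phi> (X n) \<in> carrier_mat d d" for n using h(1) Xn by simp
    have Pc: "\<Phi> P \<in> carrier_mat d d" using \<Phi>c X by simp
    show "\<Phi> P \<in> carrier_mat d d" by (rule Pc)
    show "\<Phi> (vscale (completion A) c P) = c \<cdot>\<^sub>m \<Phi> P"
      unfolding X(2) completion_scale[OF X(1)]
    proof (rule eq[OF \<Phi>c[OF cauchy_scale(1)[OF X(1)]]])
      show "c \<cdot>\<^sub>m \<Phi> (cauchy_class A X) \<in> carrier_mat d d" using \<Phi>c[OF X(1)] by simp
      fix i j assume ij: "i < d" "j < d"
      have "\<phi> (vscale A c (X n)) $$ (i, j) = c * \<phi> (X n) $$ (i, j)" for n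
        using h(3)[OF Xn, of c n] Xm[of n] ij by simp
      then have "(\<lambda>n. \<phi> (vscale A c (X n)) $$ (i, j)) \<longlonglongrightarrow> c * \<Phi> (cauchy_class A X) $$ (i, j)"
        using tendsto_mult_left[OF ent[OF X(1) ij], of c] by simp
      from LIMSEQ_unique[OF ent[OF cauchy_scale(1)[OF X(1)] ij] this]
      show "\<Phi> (cauchy_class A (\<lambda>n. vscale A c (X n))) $$ (i, j) = (c \<cdot>\<^sub>m \<Phi> (cauchy_class A X)) $$ (i, j)"
        using \<Phi>c[OF X(1)] ij by simp
    qed
    show "\<Phi> (astar (alg_completion A) P) = mat_adjoint (\<Phi> P)"
      unfolding X(2) alg_completion_star[OF X(1)]
    proof (rule eq[OF \<Phi>c[OF cauchy_star(1)[OF X(1)]] mat_adjoint_square(1)[OF \<Phi>c[OF X(1)]]])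
      fix i j assume ij: "i < d" "j < d"
      have "(\<lambda>n. \<phi> (astar A (X n)) $$ (i, j)) \<longlonglongrightarrow> cnj (\<Phi> (cauchy_class A X) $$ (j, i))"
        using tendsto_cnj[OF ent[OF X(1) ij(2,1)]] h(5)[OF Xn] mat_adjoint_square(2)[OF Xm ij] by simp
      from LIMSEQ_unique[OF ent[OF cauchy_star(1)[OF X(1)] ij] this]
      show "\<Phi> (cauchy_class A (\<lambda>n. astar A (X n))) $$ (i, j) = mat_adjoint (\<Phi> (cauchy_class A X)) $$ (i, j)"
        using mat_adjoint_square(2)[OF \<Phi>c[OF X(1)] ij] by simp
    qed
    assume "Q \<in> pts (completion A)"
    then obtain Y where Y: "Y \<in> cauchy_seqs A" "Q = cauchy_class A Y" by (rule completion_cases)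
    note Yn = cauchy_seqsD[OF Y(1)]
    have Ym: "\<phi> (Y n) \<in> carrier_mat d d" for n using h(1) Yn by simp
    show "\<Phi> (vadd (completion A) P Q) = \<Phi> P + \<Phi> Q"
      unfolding X(2) Y(2) completion_add[OF X(1) Y(1)]
    proof (rule eq[OF \<Phi>c[OF cauchy_add[OF X(1) Y(1)]]])
      show "\<Phi> (cauchy_class A X) + \<Phi> (cauchy_class A Y) \<in> carrier_mat d d" using \<Phi>c[OF X(1)] \<Phi>c[OF Y(1)] by simp
      fix i j assume ij: "i < d" "j < d"
      have "(\<phi> (X n) + \<phi> (Y n)) $$ (i, j) = \<phi> (X n) $$ (i, j) + \<phi> (Y n) $$ (i, j)" for n
        using Xm[of n] Ym[of n] ij by simp
      then have "(\<lambda>n. \<phi> (vadd A (X n) (Y n)) $$ (i, j)) \<longlonglongrightarrow> \<Phi> (cauchy_class A X) $$ (i, j) + \<Phi> (cauchy_class A Y) $$ (i, j)"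
        using tendsto_add[OF ent[OF X(1) ij] ent[OF Y(1) ij]] h(2)[OF Xn Yn] by simp
      from LIMSEQ_unique[OF ent[OF cauchy_add[OF X(1) Y(1)] ij] this]
      show "\<Phi> (cauchy_class A (\<lambda>n. vadd A (X n) (Y n))) $$ (i, j) = (\<Phi> (cauchy_class A X) + \<Phi> (cauchy_class A Y)) $$ (i, j)"
        using \<Phi>c[OF X(1)] \<Phi>c[OF Y(1)] ij by simp
    qed
    show "\<Phi> (amult (alg_completion A) P Q) = \<Phi> P * \<Phi> Q"
      unfolding X(2) Y(2) alg_completion_mult[OF X(1) Y(1)]
    proof (rule eq[OF \<Phi>c[OF cauchy_mult[OF X(1) Y(1)]] mult_carrier_mat[OF \<Phi>c[OF X(1)] \<Phi>c[OF Y(1)]]])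
      fix i j assume ij: "i < d" "j < d"
      have "(\<lambda>n. \<Sum>k<d. \<phi> (X n) $$ (i, k) * \<phi> (Y n) $$ (k, j))
          \<longlonglongrightarrow> (\<Sum>k<d. \<Phi> (cauchy_class A X) $$ (i, k) * \<Phi> (cauchy_class A Y) $$ (k, j))"
        using ent[OF X(1) ij(1)] ent[OF Y(1) _ ij(2)] by (intro tendsto_sum tendsto_mult) simp_all
      then have "(\<lambda>n. \<phi> (amult A (X n) (Y n)) $$ (i, j)) \<longlonglongrightarrow> (\<Phi> (cauchy_class A X) * \<Phi> (cauchy_class A Y)) $$ (i, j)"
        by (simp only: mat_mult_index[OF Xm Ym ij] h(4)[OF Xn Yn] mat_mult_index[OF \<Phi>c[OF X(1)] \<Phi>c[OF Y(1)] ij])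
      from LIMSEQ_unique[OF ent[OF cauchy_mult[OF X(1) Y(1)] ij] this]
      show "\<Phi> (cauchy_class A (\<lambda>n. amult A (X n) (Y n))) $$ (i, j) = (\<Phi> (cauchy_class A X) * \<Phi> (cauchy_class A Y)) $$ (i, j)" .
    qed
  qed
  then show ?thesis using lim by blast
qed

lemma sum_Sigma_pairs: "finite F \<Longrightarrow> (\<Sum>p\<in>Sigma F (\<lambda>a. {..<n a}). g p) = (\<Sum>a\<in>F. \<Sum>i<(n a :: nat). g (a, i))"
  by (simp add: sum.Sigma)

text \<open>A direct sum of one representation for each element of \<open>F\<close>; the norm of the
  sum is bounded by the common bound of the blocks and dominates each block.\<close>

lemma finite_norm_approximation:
  assumes approx: "\<And>x. x \<in> pts A \<Longrightarrow> \<exists>d \<phi>. star_hom A (mat_alg d) \<phi> \<and>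
      (\<forall>z\<in>pts A. vnorm (mat_alg d) (\<phi> z) \<le> vnorm A z) \<and> vnorm A x - e \<le> vnorm (mat_alg d) (\<phi> x)"
    and F: "finite F" "F \<subseteq> pts A"
  shows "\<exists>d \<phi>. star_hom A (mat_alg d) \<phi> \<and> (\<forall>z\<in>pts A. vnorm (mat_alg d) (\<phi> z) \<le> vnorm A z) \<and>
    (\<forall>x\<in>F. vnorm A x - e \<le> vnorm (mat_alg d) (\<phi> x))"
proof -
  have "\<forall>x\<in>F. \<exists>d \<phi>. star_hom A (mat_alg d) \<phi> \<and>
      (\<forall>z\<in>pts A. vnorm (mat_alg d) (\<phi> z) \<le> vnorm A z) \<and> vnorm A x - e \<le> vnorm (mat_alg d) (\<phi> x)"
    using approx F(2) by blast
  then obtain n \<Phi> where ex: "\<And>a. a \<in> F \<Longrightarrow> star_hom A (mat_alg (n a)) (\<Phi> a)"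
    "\<And>a z. a \<in> F \<Longrightarrow> z \<in> pts A \<Longrightarrow> vnorm (mat_alg (n a)) (\<Phi> a z) \<le> vnorm A z"
    "\<And>a. a \<in> F \<Longrightarrow> vnorm A a - e \<le> vnorm (mat_alg (n a)) (\<Phi> a a)"
    by (metis (no_types, lifting))
  have h: "\<And>a x. a \<in> F \<Longrightarrow> x \<in> pts A \<Longrightarrow> \<Phi> a x \<in> carrier_mat (n a) (n a)"
    "\<And>a x y. a \<in> F \<Longrightarrow> x \<in> pts A \<Longrightarrow> y \<in> pts A \<Longrightarrow> \<Phi> a (vadd A x y) = \<Phi> a x + \<Phi> a y"
    "\<And>a x c. a \<in> F \<Longrightarrow> x \<in> pts A \<Longrightarrow> \<Phi> a (vscale A c x) = c \<cdot>\<^sub>m \<Phi> a x"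
    "\<And>a x y. a \<in> F \<Longrightarrow> x \<in> pts A \<Longrightarrow> y \<in> pts A \<Longrightarrow> \<Phi> a (amult A x y) = \<Phi> a x * \<Phi> a y"
    "\<And>a x. a \<in> F \<Longrightarrow> x \<in> pts A \<Longrightarrow> \<Phi> a (astar A x) = mat_adjoint (\<Phi> a x)"
    using ex(1) by (auto simp: star_hom_def linear_on_def)
  \<comment> \<open>Pairs consisting of a block and an index within it.\<close>
  define I where "I = Sigma F (\<lambda>a. {..<n a})"
  have I: "finite I" using F(1) by (simp add: I_def)
  define \<psi> where "\<psi> x p q = (if fst p = fst q then \<Phi> (fst p) x $$ (snd p, snd q) else 0)" for x p q
  note sumI = sum_Sigma_pairs[OF F(1), of _ n, folded I_def]
  have diag: "(\<Sum>q\<in>I. (if a = fst q then g (snd q) else 0)) = (\<Sum>i<n a. g i)" if "a \<in> F" for a and g :: "nat \<Rightarrow> complex"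
  proof -
    have "(\<Sum>q\<in>I. (if a = fst q then g (snd q) else 0)) = (\<Sum>b\<in>F. if b = a then (\<Sum>i<n a. g i) else 0)"
      unfolding sumI by (intro sum.cong) auto
    then show ?thesis using F(1) that by simp
  qed
  have "imat_hom A I \<psi>" unfolding imat_hom_def
  proof (intro ballI)
    fix p q assume "p \<in> I" "q \<in> I"
    then obtain a i b j where pq: "p = (a, i)" "q = (b, j)" "a \<in> F" "b \<in> F" "i < n a" "j < n b" by (auto simp: I_def)
    show "(\<forall>x\<in>pts A. \<forall>y\<in>pts A. \<psi> (vadd A x y) p q = \<psi> x p q + \<psi> y p q) \<and>
      (\<forall>c. \<forall>x\<in>pts A. \<psi> (vscale A c x) p q = c * \<psi> x p q) \<and>
      (\<forall>x\<in>pts A. \<forall>y\<in>pts A. \<psi> (amult A x y) p q = (\<Sum>k\<in>I. \<psi> x p k * \<psi> y k q)) \<and>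
      (\<forall>x\<in>pts A. \<psi> (astar A x) p q = cnj (\<psi> x q p))"
    proof (intro conjI ballI allI)
      fix x y c assume x: "x \<in> pts A"
      note xc = h(1)[OF pq(3) x]
      show "\<psi> (vscale A c x) p q = c * \<psi> x p q" using pq x carrier_matD[OF xc] by (auto simp: \<psi>_def h(3))
      show "\<psi> (astar A x) p q = cnj (\<psi> x q p)"
        using pq x mat_adjoint_square(2)[OF xc, of i j] by (auto simp: \<psi>_def h(5))
      assume y: "y \<in> pts A"
      note yc = h(1)[OF pq(3) y]
      show "\<psi> (vadd A x y) p q = \<psi> x p q + \<psi> y p q"
        using pq x y carrier_matD[OF xc] carrier_matD[OF yc] by (auto simp: \<psi>_def h(2))
      have "(\<Sum>k\<in>I. \<psi> x p k * \<psi> y k q)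
          = (\<Sum>k\<in>I. if a = fst k then (if a = b then \<Phi> a x $$ (i, snd k) * \<Phi> a y $$ (snd k, j) else 0) else 0)"
        using pq by (intro sum.cong) (auto simp: \<psi>_def)
      also have "\<dots> = (\<Sum>k<n a. if a = b then \<Phi> a x $$ (i, k) * \<Phi> a y $$ (k, j) else 0)"
        by (rule diag[OF pq(3)])
      finally show "\<psi> (amult A x y) p q = (\<Sum>k\<in>I. \<psi> x p k * \<psi> y k q)"
        using pq x y mat_mult_index[OF xc yc, of i j] by (auto simp: \<psi>_def h(4) simp del: index_mult_mat)
    qed
  qed
  from imat_hom_star_hom[OF I this] obtain d \<phi> where \<phi>: "star_hom A (mat_alg d) \<phi>"
    "\<And>x C. 0 \<le> C \<Longrightarrow> op_bound {..<d} (\<lambda>a b. \<phi> x $$ (a, b)) C \<longleftrightarrow> op_bound I (\<psi> x) C" by blast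
  have \<phi>c: "\<phi> x \<in> carrier_mat d d" if "x \<in> pts A" for x using \<phi>(1) that by (simp add: star_hom_def linear_on_def)
  have up: "vnorm (mat_alg d) (\<phi> x) \<le> vnorm A x" if x: "x \<in> pts A" for x
  proof (rule mat_norm_least[OF \<phi>c[OF x] norm_nonneg[OF x]], unfold \<phi>(2)[OF norm_nonneg[OF x]], unfold op_bound_def, rule allI)
    fix u
    have mvI: "mv I (\<psi> x) u (a, i) = mv {..<n a} (\<lambda>i j. \<Phi> a x $$ (i, j)) (\<lambda>j. u (a, j)) i" if "a \<in> F" for a i
    proof -
      have "mv I (\<psi> x) u (a, i) = (\<Sum>q\<in>I. if a = fst q then \<Phi> a x $$ (i, snd q) * u (a, snd q) else 0)"
        unfolding mv_def by (intro sum.cong) (auto simp: \<psi>_def)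
      also have "\<dots> = (\<Sum>j<n a. \<Phi> a x $$ (i, j) * u (a, j))" by (rule diag[OF that])
      finally show ?thesis by (simp add: mv_def)
    qed
    have "(l2 I (mv I (\<psi> x) u))\<^sup>2 = (\<Sum>a\<in>F. (l2 {..<n a} (mv {..<n a} (\<lambda>i j. \<Phi> a x $$ (i, j)) (\<lambda>j. u (a, j))))\<^sup>2)"
      unfolding l2_square sumI by (simp add: mvI)
    also have "\<dots> \<le> (\<Sum>a\<in>F. (vnorm A x * l2 {..<n a} (\<lambda>j. u (a, j)))\<^sup>2)"
    proof (intro sum_mono power_mono)
      fix a assume a: "a \<in> F"
      show "l2 {..<n a} (mv {..<n a} (\<lambda>i j. \<Phi> a x $$ (i, j)) (\<lambda>j. u (a, j))) \<le> vnorm A x * l2 {..<n a} (\<lambda>j. u (a, j))"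
        using op_boundD[OF mat_norm_bound[OF h(1)[OF a x]], of "\<lambda>j. u (a, j)"]
          mult_right_mono[OF ex(2)[OF a x] L2_set_nonneg, of "\<lambda>j. cmod (u (a, j))" "{..<n a}"] by linarith
    qed simp
    also have "\<dots> = (vnorm A x * l2 I u)\<^sup>2"
      unfolding power_mult_distrib l2_square sumI by (simp add: sum_distrib_left)
    finally show "l2 I (mv I (\<psi> x) u) \<le> vnorm A x * l2 I u" by (rule power2_le_imp_le) (simp add: x)
  qed
  have "vnorm A x - e \<le> vnorm (mat_alg d) (\<phi> x)" if x: "x \<in> F" for x
  proof -
    have xA: "x \<in> pts A" using x F(2) by blast
    have n0: "0 \<le> vnorm (mat_alg d) (\<phi> x)" by (rule mat_norm_nonneg[OF \<phi>c[OF xA]])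
    have "op_bound I (\<psi> x) (vnorm (mat_alg d) (\<phi> x))"
      using mat_norm_bound[OF \<phi>c[OF xA]] unfolding \<phi>(2)[OF n0] .
    \<comment> \<open>The diagonal block that was chosen for \<open>x\<close>.\<close>
    from op_bound_embed[OF I this n0, of "Pair x" "{..<n x}" "Pair x"]
    have "op_bound {..<n x} (\<lambda>i j. \<psi> x (x, i) (x, j)) (vnorm (mat_alg d) (\<phi> x))"
      using x by (simp add: I_def inj_on_def image_subset_iff)
    then have "vnorm (mat_alg (n x)) (\<Phi> x x) \<le> vnorm (mat_alg d) (\<phi> x)"
      by (intro mat_norm_least[OF h(1)[OF x xA] n0]) (simp add: \<psi>_def)
    then show ?thesis using ex(3)[OF x] by linarith
  qed
  then show ?thesis using \<phi>(1) up by blast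
qed

text \<open>It suffices to approximate the norm of one element of the dense subalgebra at a time,
  provided the representations are contractive and thus extend to the completion.\<close>

theorem rfd_completion:
  assumes approx: "\<And>x e. x \<in> pts A \<Longrightarrow> 0 < e \<Longrightarrow> \<exists>d \<phi>. star_hom A (mat_alg d) \<phi> \<and>
      (\<forall>z\<in>pts A. vnorm (mat_alg d) (\<phi> z) \<le> vnorm A z) \<and> vnorm A x - e \<le> vnorm (mat_alg d) (\<phi> x)"
  shows "rfd (alg_completion A)"
  unfolding rfd_def alg_completion_simps
proof (intro allI impI)
  fix e :: real and \<Omega> assume e: "0 < e" and \<Omega>: "finite \<Omega> \<and> \<Omega> \<subseteq> pts (completion A)"
  \<comment> \<open>The last clause says that \<open>x\<close> lies within \<open>e / 3\<close> of
    \<open>P\<close>. The three losses of \<open>e / 3\<close> are: from \<open>P\<close> to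
    \<open>x\<close>, from \<open>x\<close> to its image, and from that image to the image of
    \<open>P\<close>.\<close>
  have "\<exists>x. x \<in> pts A \<and> vnorm (completion A) P \<le> vnorm A x + e / 3 \<and>
      (\<forall>\<^sub>F m in sequentially. vnorm A (vdiff A x (cauchy_rep P m)) \<le> e / 3)" if P: "P \<in> \<Omega>" for P
  proof -
    have Pc: "P \<in> pts (completion A)" using P \<Omega> by blast
    have X: "cauchy_rep P \<in> cauchy_seqs A" by (rule cauchy_rep_seq[OF Pc])
    have nP: "vnorm (completion A) P = lim (\<lambda>n. vnorm A (cauchy_rep P n))" by (simp add: completion_def)
    have "(\<lambda>n. vnorm A (cauchy_rep P n)) \<longlonglongrightarrow> vnorm (completion A) P"
      unfolding nP by (rule cauchy_norm_tendsto[OF X])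
    then have "\<forall>\<^sub>F n in sequentially. vnorm (completion A) P - e / 3 < vnorm A (cauchy_rep P n)"
      by (rule order_tendstoD(1)) (use e in linarith)
    then obtain M where M: "\<And>n. n \<ge> M \<Longrightarrow> vnorm (completion A) P - e / 3 < vnorm A (cauchy_rep P n)"
      unfolding eventually_sequentially by blast
    have e3: "0 < e / 3" using e by simp
    obtain N where N: "\<forall>m\<ge>N. \<forall>n\<ge>N. vnorm A (vdiff A (cauchy_rep P m) (cauchy_rep P n)) < e / 3"
      using X e3 unfolding cauchy_seqs_def by blast
    let ?x = "cauchy_rep P (max M N)"
    have "?x \<in> pts A" by (rule cauchy_seqsD[OF X])
    moreover have "vnorm (completion A) P \<le> vnorm A ?x + e / 3" using M[of "max M N"] by simp
    moreover have "\<forall>\<^sub>F m in sequentially. vnorm A (vdiff A ?x (cauchy_rep P m)) \<le> e / 3"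
      unfolding eventually_sequentially using N by (intro exI[of _ N]) (simp add: less_imp_le)
    ultimately show ?thesis by blast
  qed
  then have "\<forall>P\<in>\<Omega>. \<exists>x. x \<in> pts A \<and> vnorm (completion A) P \<le> vnorm A x + e / 3 \<and>
      (\<forall>\<^sub>F m in sequentially. vnorm A (vdiff A x (cauchy_rep P m)) \<le> e / 3)" by (rule ballI)
  from bchoice[OF this] obtain x where x0: "\<forall>P\<in>\<Omega>. x P \<in> pts A \<and> vnorm (completion A) P \<le> vnorm A (x P) + e / 3 \<and>
      (\<forall>\<^sub>F m in sequentially. vnorm A (vdiff A (x P) (cauchy_rep P m)) \<le> e / 3)" by (rule exE)
  have x: "\<And>P. P \<in> \<Omega> \<Longrightarrow> x P \<in> pts A"
    "\<And>P. P \<in> \<Omega> \<Longrightarrow> vnorm (completion A) P \<le> vnorm A (x P) + e / 3"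
    "\<And>P. P \<in> \<Omega> \<Longrightarrow> \<forall>\<^sub>F m in sequentially. vnorm A (vdiff A (x P) (cauchy_rep P m)) \<le> e / 3"
    by (rule conjunct1[OF bspec[OF x0]] conjunct1[OF conjunct2[OF bspec[OF x0]]] conjunct2[OF conjunct2[OF bspec[OF x0]]], assumption)+
  have F: "finite (x ` \<Omega>)" "x ` \<Omega> \<subseteq> pts A" by (use \<Omega> in simp, rule image_subsetI[OF x(1)])
  have e3: "0 < e / 3" using e by simp
  from finite_norm_approximation[OF approx[OF _ e3] F] obtain d \<phi> where \<phi>: "star_hom A (mat_alg d) \<phi>"
    "\<And>z. z \<in> pts A \<Longrightarrow> vnorm (mat_alg d) (\<phi> z) \<le> vnorm A z"
    "\<And>P. P \<in> \<Omega> \<Longrightarrow> vnorm A (x P) - e / 3 \<le> vnorm (mat_alg d) (\<phi> (x P))" by blast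
  from contractive_hom_extends[OF \<phi>(1,2)] obtain \<Phi> where \<Phi>: "star_hom (alg_completion A) (mat_alg d) \<Phi>"
    "\<And>X. X \<in> cauchy_seqs A \<Longrightarrow>
      (\<lambda>n. vnorm (mat_alg d) (vdiff (mat_alg d) (\<phi> (X n)) (\<Phi> (cauchy_class A X)))) \<longlonglongrightarrow> 0" by blast
  have "vnorm (completion A) P - e \<le> vnorm (mat_alg d) (\<Phi> P)" if P: "P \<in> \<Omega>" for P
  proof -
    let ?N = "vnorm (mat_alg d)" and ?D = "vdiff (mat_alg d)"
    have Pc: "P \<in> pts (completion A)" using P \<Omega> by blast
    have X: "cauchy_rep P \<in> cauchy_seqs A" by (rule cauchy_rep_seq[OF Pc])
    note Xn = cauchy_seqsD[OF X]
    have lim: "(\<lambda>n. ?N (?D (\<phi> (cauchy_rep P n)) (\<Phi> P))) \<longlonglongrightarrow> 0"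
      using \<Phi>(2)[OF X] unfolding class_cauchy_rep[OF Pc] .
    have m: "\<phi> z \<in> pts (mat_alg d)" if "z \<in> pts A" for z using \<phi>(1) that by (simp add: star_hom_def linear_on_def)
    have PM: "\<Phi> P \<in> pts (mat_alg d)" using \<Phi>(1) Pc by (simp add: star_hom_def linear_on_def)
    have "\<forall>\<^sub>F n in sequentially. ?N (\<phi> (x P)) - e / 3 - ?N (\<Phi> P) \<le> ?N (?D (\<phi> (cauchy_rep P n)) (\<Phi> P))"
      using x(3)[OF P]
    proof (rule eventually_mono)
      fix n assume le: "vnorm A (vdiff A (x P) (cauchy_rep P n)) \<le> e / 3"
      have "?D (\<phi> (x P)) (\<phi> (cauchy_rep P n)) = \<phi> (vdiff A (x P) (cauchy_rep P n))"
        using \<phi>(1) x(1)[OF P] Xn[of n] by (simp add: vdiff_def star_hom_def linear_on_def)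
      then have "?N (?D (\<phi> (x P)) (\<phi> (cauchy_rep P n))) \<le> e / 3"
        using \<phi>(2)[OF diff_closed[OF x(1)[OF P] Xn], of n] le by simp
      then show "?N (\<phi> (x P)) - e / 3 - ?N (\<Phi> P) \<le> ?N (?D (\<phi> (cauchy_rep P n)) (\<Phi> P))"
        using mat.norm_le_add_diff[OF m[OF x(1)[OF P]] m[OF Xn], of n]
          mat.norm_le_add_diff[OF m[OF Xn] PM, of n] by linarith
    qed
    then have "?N (\<phi> (x P)) - e / 3 - ?N (\<Phi> P) \<le> 0"
      by (intro tendsto_lowerbound[OF lim]) simp_all
    then show ?thesis using x(2)[OF P] \<phi>(3)[OF P] by linarith
  qed
  then show "\<exists>d \<phi>. star_hom (alg_completion A) (mat_alg d) \<phi> \<and>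
      (\<forall>P\<in>\<Omega>. vnorm (completion A) P - e \<le> vnorm (mat_alg d) (\<phi> P))"
    using \<Phi>(1) by blast
qed

end

section \<open>Matrix coefficients of a representation of the bundle\<close>

lemma group_alg_sum:
  assumes "finite L" "\<And>l. l \<in> L \<Longrightarrow> g l \<in> pts group_alg"
  shows "(\<lambda>s. \<Sum>l\<in>L. g l s) \<in> pts group_alg"
    and "star_hom group_alg (mat_alg k) \<rho> \<Longrightarrow> a < k \<Longrightarrow> b < k \<Longrightarrow>
      \<rho> (\<lambda>s. \<Sum>l\<in>L. g l s) $$ (a, b) = (\<Sum>l\<in>L. \<rho> (g l) $$ (a, b))"
proof -
  have "(\<lambda>s. \<Sum>l\<in>L. g l s) \<in> pts group_alg \<and> (star_hom group_alg (mat_alg k) \<rho> \<longrightarrow> a < k \<longrightarrow> b < k \<longrightarrow>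
      \<rho> (\<lambda>s. \<Sum>l\<in>L. g l s) $$ (a, b) = (\<Sum>l\<in>L. \<rho> (g l) $$ (a, b)))"
    using assms
  proof (induction L rule: finite_induct)
    case empty
    show ?case
    proof (intro conjI impI)
      assume \<rho>: "star_hom group_alg (mat_alg k) \<rho>" and ab: "a < k" "b < k"
      have "linear_on group_alg (mat_alg k) \<rho>" using \<rho> by (simp only: star_hom_def)
      from linear_on_zero[OF grp.vspace_axioms mat.vspace_axioms this]
      show "\<rho> (\<lambda>s. \<Sum>l\<in>{}. g l s) $$ (a, b) = (\<Sum>l\<in>{}. \<rho> (g l) $$ (a, b))" using ab by simp
    qed simp
  next
    case (insert l L)
    let ?h = "\<lambda>s. \<Sum>l\<in>L. g l s"
    have gl: "g l \<in> pts group_alg" using insert.prems[of l] by simp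
    have IH: "?h \<in> pts group_alg" "star_hom group_alg (mat_alg k) \<rho> \<longrightarrow> a < k \<longrightarrow> b < k \<longrightarrow>
        \<rho> ?h $$ (a, b) = (\<Sum>l\<in>L. \<rho> (g l) $$ (a, b))"
      using insert.IH insert.prems by blast+
    have eq: "(\<lambda>s. \<Sum>l\<in>insert l L. g l s) = vadd group_alg (g l) ?h" using insert.hyps by simp
    show ?case unfolding eq
    proof (intro conjI impI)
      show "vadd group_alg (g l) ?h \<in> pts group_alg" by (rule grp.add_closed[OF gl IH(1)])
      assume \<rho>: "star_hom group_alg (mat_alg k) \<rho>" and ab: "a < k" "b < k"
      have "\<rho> (vadd group_alg (g l) ?h) = \<rho> (g l) + \<rho> ?h" "\<rho> ?h \<in> carrier_mat k k"
        using \<rho> gl IH(1) unfolding star_hom_def linear_on_def mat_alg_simps by blast+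
      then show "\<rho> (vadd group_alg (g l) ?h) $$ (a, b) = (\<Sum>l\<in>insert l L. \<rho> (g l) $$ (a, b))"
        using \<rho> ab IH(2) insert.hyps by simp
    qed
  qed
  then show "(\<lambda>s. \<Sum>l\<in>L. g l s) \<in> pts group_alg"
    and "star_hom group_alg (mat_alg k) \<rho> \<Longrightarrow> a < k \<Longrightarrow> b < k \<Longrightarrow>
      \<rho> (\<lambda>s. \<Sum>l\<in>L. g l s) $$ (a, b) = (\<Sum>l\<in>L. \<rho> (g l) $$ (a, b))" by blast+
qed

section \<open>From a bundle representation to sections of a matrix bundle\<close>

definition unit_alg :: "('g::group_add, 'b) bundle_data \<Rightarrow> 'b staralg" where
  "unit_alg B = \<lparr>pts = pts (fib B 0), vzero = vzero (fib B 0), vadd = vadd (fib B 0), vscale = vscale (fib B 0),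
     vnorm = vnorm (fib B 0), amult = bmult B, astar = bstar B\<rparr>"

lemma unit_alg_simps [simp]:
  "pts (unit_alg B) = pts (fib B 0)" "vzero (unit_alg B) = vzero (fib B 0)" "vadd (unit_alg B) = vadd (fib B 0)"
  "vscale (unit_alg B) = vscale (fib B 0)" "vnorm (unit_alg B) = vnorm (fib B 0)"
  "amult (unit_alg B) = bmult B" "astar (unit_alg B) = bstar B"
  by (simp_all add: unit_alg_def)

context fell
begin

lemma unit_alg_banach: "banach_on (unit_alg B)"
proof -
  have "banach_on (unit_alg B) = banach_on (fib B 0)"
    by (simp only: banach_on_def vector_space_on_def additive_monoid_def cauchy_seqs_def vdiff_def unit_alg_simps)
  then show ?thesis using banach by simp
qed

lemma unit_alg_normed: "normed_star_alg (unit_alg B)"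
proof
  have "vector_space_on (unit_alg B) = vector_space_on (fib B 0)"
    by (simp only: vector_space_on_def additive_monoid_def unit_alg_simps)
  then show "vector_space_on (unit_alg B)" using fib.vector_space by simp
  note mult' = norm_mult[of _ 0 _ 0, simplified]
  fix x y c assume x: "x \<in> pts (unit_alg B)"
  then show "0 \<le> vnorm (unit_alg B) x" "astar (unit_alg B) x \<in> pts (unit_alg B)"
    "vnorm (unit_alg B) (astar (unit_alg B) x) = vnorm (unit_alg B) x"
    using norm_star[of x 0] by (simp_all add: unit_star_closed)
  show "astar (unit_alg B) (astar (unit_alg B) x) = x" using x star_star[of x 0] by simp
  show "vnorm (unit_alg B) (vscale (unit_alg B) c x) = cmod c * vnorm (unit_alg B) x"
    using x by (simp add: fib.norm_scale)
  show "astar (unit_alg B) (vscale (unit_alg B) c x) = vscale (unit_alg B) (cnj c) (astar (unit_alg B) x)"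
    using x star_scale[of x 0 0] by simp
  assume y: "y \<in> pts (unit_alg B)"
  show "amult (unit_alg B) x y \<in> pts (unit_alg B)" using x y by (simp add: unit_mult_closed)
  show "amult (unit_alg B) (vscale (unit_alg B) c x) y = vscale (unit_alg B) c (amult (unit_alg B) x y)"
    using x y mult_scale_left[of x 0 y 0 0 c] by simp
  show "amult (unit_alg B) x (vscale (unit_alg B) c y) = vscale (unit_alg B) c (amult (unit_alg B) x y)"
    using x y mult_scale_right[of x 0 y 0 0 c] by simp
  show "astar (unit_alg B) (vadd (unit_alg B) x y) = vadd (unit_alg B) (astar (unit_alg B) x) (astar (unit_alg B) y)"
    using x y star_add[of x 0 y 0] by simp
  show "astar (unit_alg B) (amult (unit_alg B) x y) = amult (unit_alg B) (astar (unit_alg B) y) (astar (unit_alg B) x)"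
    using x y star_mult[of x 0 y 0] by simp
  show "vnorm (unit_alg B) (vadd (unit_alg B) x y) \<le> vnorm (unit_alg B) x + vnorm (unit_alg B) y"
    using x y by (simp add: fib.norm_triangle)
  show "vnorm (unit_alg B) (amult (unit_alg B) x y) \<le> vnorm (unit_alg B) x * vnorm (unit_alg B) y"
    using x y by (simp add: mult')
  fix z assume z: "z \<in> pts (unit_alg B)"
  show "amult (unit_alg B) (vadd (unit_alg B) x y) z = vadd (unit_alg B) (amult (unit_alg B) x z) (amult (unit_alg B) y z)"
    using x y z mult_add_left[of x 0 y z 0 0] by simp
  show "amult (unit_alg B) x (vadd (unit_alg B) y z) = vadd (unit_alg B) (amult (unit_alg B) x y) (amult (unit_alg B) x z)"
    using x y z mult_add_right[of x 0 y 0 z 0] by simp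
  show "amult (unit_alg B) (amult (unit_alg B) x y) z = amult (unit_alg B) x (amult (unit_alg B) y z)"
    using x y z mult_assoc[of x 0 y 0 z 0] by simp
qed

text \<open>The unit fibre is complete, so the automatic contractivity of star homomorphisms into
  matrices applies to the restriction of \<pi>.\<close>

lemma representation_unit_contractive:
  assumes \<pi>: "representation B (mat_alg d) \<pi>" and b: "b \<in> pts (fib B 0)"
  shows "vnorm (mat_alg d) (\<pi> 0 b) \<le> nm 0 b"
proof -
  interpret U: normed_star_alg "unit_alg B" by (rule unit_alg_normed)
  have lin: "linear_on (fib B 0) (mat_alg d) (\<pi> 0)" using \<pi> by (simp add: representation_def)
  have m: "amult (mat_alg d) (\<pi> s x) (\<pi> t y) = \<pi> (s + t) (bmult B x y)"
    if "x \<in> pts (fib B s)" "y \<in> pts (fib B t)" for s t x y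
    using \<pi> that unfolding representation_def by simp
  have st: "astar (mat_alg d) (\<pi> s x) = \<pi> (- s) (bstar B x)" if "x \<in> pts (fib B s)" for s x
    using \<pi> that unfolding representation_def by simp
  have "star_hom (unit_alg B) (mat_alg d) (\<pi> 0)"
    unfolding star_hom_def
  proof (intro conjI ballI)
    show "linear_on (unit_alg B) (mat_alg d) (\<pi> 0)" using lin by (simp add: linear_on_def)
    fix x assume x: "x \<in> pts (unit_alg B)"
    then show "\<pi> 0 (astar (unit_alg B) x) = astar (mat_alg d) (\<pi> 0 x)" using st[of x 0] by simp
    fix y assume "y \<in> pts (unit_alg B)"
    then show "\<pi> 0 (amult (unit_alg B) x y) = amult (mat_alg d) (\<pi> 0 x) (\<pi> 0 y)" using m[of x 0 y 0] x by simp
  qed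
  from U.banach_star_hom_contractive[OF unit_alg_banach this] show ?thesis using b by simp
qed

definition rep_section :: "('g \<Rightarrow> 'b \<Rightarrow> 'c) \<Rightarrow> ('g \<Rightarrow> 'b) \<Rightarrow> 'g \<Rightarrow> 'g \<times> 'c" where
  "rep_section \<pi> z = (\<lambda>t. (t, \<pi> t (z t)))"

text \<open>Applying \<pi> in each fibre is a morphism from \<open>B\<close> to the trivial bundle
  of matrices; the tag records the degree.\<close>

lemma rep_section_star_hom:
  assumes \<pi>: "representation B (mat_alg d) \<pi>"
  shows "star_hom (section_alg B) (section_alg (const_bundle (mat_alg d))) (rep_section \<pi>)"
proof -
  have lin: "linear_on (fib B t) (mat_alg d) (\<pi> t)" for t using \<pi> by (simp add: representation_def)
  have m: "amult (mat_alg d) (\<pi> s x) (\<pi> t y) = \<pi> (s + t) (bmult B x y)"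
    if "x \<in> pts (fib B s)" "y \<in> pts (fib B t)" for s t x y
    using \<pi> that unfolding representation_def by simp
  have st: "astar (mat_alg d) (\<pi> s x) = \<pi> (- s) (bstar B x)" if "x \<in> pts (fib B s)" for s x
    using \<pi> that unfolding representation_def by simp
  have c: "\<pi> t b \<in> pts (mat_alg d)" if "b \<in> pts (fib B t)" for t b
    using lin[of t] that unfolding linear_on_def by simp
  have ad: "\<pi> t (vadd (fib B t) a b) = vadd (mat_alg d) (\<pi> t a) (\<pi> t b)" if "a \<in> pts (fib B t)" "b \<in> pts (fib B t)" for t a b
    using lin[of t] that unfolding linear_on_def by simp
  have sc: "\<pi> t (vscale (fib B t) q a) = vscale (mat_alg d) q (\<pi> t a)" if "a \<in> pts (fib B t)" for t a q
    using lin[of t] that unfolding linear_on_def by simp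
  have zero: "\<pi> t (vzero (fib B t)) = vzero (mat_alg d)" for t
    by (rule linear_on_zero[OF fib.vspace_axioms mat.vspace_axioms lin])
  show ?thesis
    unfolding star_hom_def linear_on_def section_alg_simps section_ops mb.section_ops
  proof (intro conjI ballI allI)
    fix x y q assume x: "x \<in> sections"
    show "rep_section \<pi> x \<in> finite_sections (const_bundle (mat_alg d))"
    proof (rule mb.sectionsI'[OF _ finite_supp[OF x]])
      show "rep_section \<pi> x t \<in> pts (fib (const_bundle (mat_alg d)) t)" for t
        using c[OF section_value[OF x]] by (simp add: rep_section_def)
      show "rep_section \<pi> x t = vzero (fib (const_bundle (mat_alg d)) t)" if "t \<notin> supp x" for t
        using not_in_supp[OF that] zero by (simp add: rep_section_def)
    qed
    show "rep_section \<pi> (sscale q x) = mb.sscale d q (rep_section \<pi> x)"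
      using sc[OF section_value[OF x]] by (simp add: rep_section_def mb.sscale_def sscale_def fun_eq_iff)
    show "rep_section \<pi> (sstar x) = mb.sstar d (rep_section \<pi> x)"
      using st[OF section_value[OF x]] by (simp add: rep_section_def mb.sstar_def sstar_def fun_eq_iff)
    assume y: "y \<in> sections"
    show "rep_section \<pi> (sadd x y) = mb.sadd d (rep_section \<pi> x) (rep_section \<pi> y)"
      using ad[OF section_value[OF x] section_value[OF y]] by (simp add: rep_section_def mb.sadd_def sadd_def fun_eq_iff)
    show "rep_section \<pi> (conv x y) = mb.conv d (rep_section \<pi> x) (rep_section \<pi> y)"
    proof
      fix s
      let ?f = "\<lambda>t. bmult B (x t) (y (- t + s))"
      have fc: "?f t \<in> pts (fib B s)" for t using x y by simp
      have fin: "finite {t. ?f t \<noteq> vzero (fib B s)}" by (rule conv_term_finite[OF x y])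
      have fin': "finite {t. \<pi> s (?f t) \<noteq> vzero (mat_alg d)}"
        by (rule finite_subset[OF _ fin]) (use zero in auto)
      have "\<pi> s (conv x y s) = fsum (mat_alg d) (\<lambda>t. \<pi> s (?f t))"
        unfolding conv_def by (rule fsum_hom[OF fib.vmonoid_axioms mat.vmonoid_axioms fin fc zero c ad])
      then have "rep_section \<pi> (conv x y) s = fsum (fib (const_bundle (mat_alg d)) s) (\<lambda>t. (s, \<pi> s (?f t)))"
        unfolding rep_section_def using mat.const_bundle_fsum[OF fin' c[OF fc], of s] by simp
      also have "(\<lambda>t. (s, \<pi> s (?f t))) = (\<lambda>t. bmult (const_bundle (mat_alg d)) (rep_section \<pi> x t) (rep_section \<pi> y (- t + s)))"
        using m[OF section_value[OF x] section_value[OF y], of _ "- _ + s"] by (simp add: rep_section_def fun_eq_iff)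
      finally show "rep_section \<pi> (conv x y) s = mb.conv d (rep_section \<pi> x) (rep_section \<pi> y) s"
        unfolding mb.conv_def .
    qed
  qed
qed

text \<open>By \<open>reduced_norm_contractive\<close> only the unit fibre has to be
  examined.\<close>

lemma rep_section_contractive:
  assumes \<pi>: "representation B (mat_alg d) \<pi>" and z: "z \<in> sections"
  shows "vnorm (section_alg (const_bundle (mat_alg d))) (rep_section \<pi> z) \<le> vnorm (section_alg B) z"
proof (rule reduced_norm_contractive[OF fell_axioms mb.fell_axioms rep_section_star_hom[OF \<pi>] _ z])
  fix z assume "z \<in> sections"
  from representation_unit_contractive[OF \<pi> section_value[OF this]]
  show "vnorm (fib (const_bundle (mat_alg d)) 0) (rep_section \<pi> z 0) \<le> nm 0 (z 0)"
    by (simp add: rep_section_def)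
qed

text \<open>The matrix of the tensor product of \<pi> and \<rho>: apply \<pi> to get a matrix over
  the group algebra, then \<rho> to each of its entries.\<close>

definition coeff :: "('g \<Rightarrow> 'b \<Rightarrow> complex mat) \<Rightarrow> (('g \<Rightarrow> complex) \<Rightarrow> complex mat) \<Rightarrow> ('g \<Rightarrow> 'b) \<Rightarrow> nat \<times> nat \<Rightarrow> nat \<times> nat \<Rightarrow> complex" where
  "coeff \<pi> \<rho> z p q = \<rho> (entry (fst p) (fst q) (rep_section \<pi> z)) $$ (snd p, snd q)"

lemma coeff_imat_hom:
  assumes \<pi>: "representation B (mat_alg d) \<pi>" and \<rho>: "star_hom group_alg (mat_alg k) \<rho>"
  shows "imat_hom (section_alg B) ({..<d} \<times> {..<k}) (coeff \<pi> \<rho>)"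
  unfolding imat_hom_def section_alg_simps section_ops
proof (intro ballI)
  fix p q assume "p \<in> {..<d} \<times> {..<k}" "q \<in> {..<d} \<times> {..<k}"
  then obtain i a j b where pq: "p = (i, a)" "q = (j, b)" "i < d" "a < k" "j < d" "b < k" by auto
  let ?\<Theta> = "rep_section \<pi>"
  have T: "x \<in> sections \<Longrightarrow> ?\<Theta> x \<in> finite_sections (const_bundle (mat_alg d))"
    "x \<in> sections \<Longrightarrow> y \<in> sections \<Longrightarrow> ?\<Theta> (sadd x y) = mb.sadd d (?\<Theta> x) (?\<Theta> y)"
    "x \<in> sections \<Longrightarrow> ?\<Theta> (sscale c x) = mb.sscale d c (?\<Theta> x)"
    "x \<in> sections \<Longrightarrow> y \<in> sections \<Longrightarrow> ?\<Theta> (conv x y) = mb.conv d (?\<Theta> x) (?\<Theta> y)"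
    "x \<in> sections \<Longrightarrow> ?\<Theta> (sstar x) = mb.sstar d (?\<Theta> x)" for x y c
    using rep_section_star_hom[OF \<pi>] by (simp_all add: star_hom_def linear_on_def section_ops mb.section_ops)
  have R: "x \<in> pts group_alg \<Longrightarrow> \<rho> x \<in> carrier_mat k k"
    "x \<in> pts group_alg \<Longrightarrow> y \<in> pts group_alg \<Longrightarrow> \<rho> (vadd group_alg x y) = \<rho> x + \<rho> y"
    "x \<in> pts group_alg \<Longrightarrow> \<rho> (vscale group_alg c x) = c \<cdot>\<^sub>m \<rho> x"
    "x \<in> pts group_alg \<Longrightarrow> y \<in> pts group_alg \<Longrightarrow> \<rho> (amult group_alg x y) = \<rho> x * \<rho> y"
    "x \<in> pts group_alg \<Longrightarrow> \<rho> (astar group_alg x) = mat_adjoint (\<rho> x)" for x y c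
    using \<rho> unfolding star_hom_def linear_on_def mat_alg_simps by blast+
  have E: "entry i j (?\<Theta> x) \<in> pts group_alg" if "x \<in> sections" "i < d" "j < d" for x i j
    by (rule entry_closed[OF T(1)[OF that(1)] that(2,3)])
  show "(\<forall>x\<in>sections. \<forall>y\<in>sections. coeff \<pi> \<rho> (sadd x y) p q = coeff \<pi> \<rho> x p q + coeff \<pi> \<rho> y p q) \<and>
    (\<forall>c. \<forall>x\<in>sections. coeff \<pi> \<rho> (sscale c x) p q = c * coeff \<pi> \<rho> x p q) \<and>
    (\<forall>x\<in>sections. \<forall>y\<in>sections. coeff \<pi> \<rho> (conv x y) p q = (\<Sum>r\<in>{..<d} \<times> {..<k}. coeff \<pi> \<rho> x p r * coeff \<pi> \<rho> y r q)) \<and>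
    (\<forall>x\<in>sections. coeff \<pi> \<rho> (sstar x) p q = cnj (coeff \<pi> \<rho> x q p))"
  proof (intro conjI ballI allI)
    fix x y c assume x: "x \<in> sections"
    note Ex = E[OF x pq(3) pq(5)]
    note vx = mat_section_value(2)[OF T(1)[OF x]]
    show "coeff \<pi> \<rho> (sscale c x) p q = c * coeff \<pi> \<rho> x p q"
    proof -
      have "entry i j (mb.sscale d c (?\<Theta> x)) = vscale group_alg c (entry i j (?\<Theta> x))"
        using carrier_matD[OF vx] pq by (simp add: entry_def mb.sscale_def fun_eq_iff)
      then show ?thesis using T(3)[OF x, of c] R(3)[OF Ex, of c] carrier_matD[OF R(1)[OF Ex]] pq by (simp add: coeff_def)
    qed
    show "coeff \<pi> \<rho> (sstar x) p q = cnj (coeff \<pi> \<rho> x q p)"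
      using T(5)[OF x] entry_star[OF T(1)[OF x] pq(3,5)] R(5)[OF E[OF x pq(5,3)]]
        mat_adjoint_square(2)[OF R(1)[OF E[OF x pq(5,3)]] pq(4,6)] pq by (simp add: coeff_def)
    assume y: "y \<in> sections"
    note Ey = E[OF y pq(3) pq(5)]
    note vy = mat_section_value(2)[OF T(1)[OF y]]
    show "coeff \<pi> \<rho> (sadd x y) p q = coeff \<pi> \<rho> x p q + coeff \<pi> \<rho> y p q"
    proof -
      have "entry i j (mb.sadd d (?\<Theta> x) (?\<Theta> y)) = vadd group_alg (entry i j (?\<Theta> x)) (entry i j (?\<Theta> y))"
        using carrier_matD[OF vx] carrier_matD[OF vy] pq by (simp add: entry_def mb.sadd_def fun_eq_iff)
      then show ?thesis
        using T(2)[OF x y] R(2)[OF Ex Ey] carrier_matD[OF R(1)[OF Ex]] carrier_matD[OF R(1)[OF Ey]] pq by (simp add: coeff_def)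
    qed
    let ?g = "\<lambda>l. amult group_alg (entry i l (?\<Theta> x)) (entry l j (?\<Theta> y))"
    have gc: "?g l \<in> pts group_alg" if "l \<in> {..<d}" for l
      using that by (intro grp.mult_closed E x y pq) simp_all
    have "entry i j (?\<Theta> (conv x y)) = (\<lambda>s. \<Sum>l<d. ?g l s)"
      unfolding T(4)[OF x y] using entry_conv[OF T(1)[OF x] T(1)[OF y] pq(3,5)] by (rule ext)
    then have "coeff \<pi> \<rho> (conv x y) p q = (\<Sum>l<d. \<rho> (?g l) $$ (a, b))"
      using group_alg_sum(2)[OF finite_lessThan gc \<rho> pq(4,6)] pq by (simp add: coeff_def)
    also have "\<dots> = (\<Sum>l<d. \<Sum>c<k. coeff \<pi> \<rho> x p (l, c) * coeff \<pi> \<rho> y (l, c) q)"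
    proof (rule sum.cong[OF refl])
      fix l assume "l \<in> {..<d}"
      then have l: "l < d" by simp
      note e1 = E[OF x pq(3) l] and e2 = E[OF y l pq(5)]
      show "\<rho> (?g l) $$ (a, b) = (\<Sum>c<k. coeff \<pi> \<rho> x p (l, c) * coeff \<pi> \<rho> y (l, c) q)"
        unfolding R(4)[OF e1 e2] mat_mult_index[OF R(1)[OF e1] R(1)[OF e2] pq(4,6)] using pq by (simp add: coeff_def)
    qed
    also have "\<dots> = (\<Sum>r\<in>{..<d} \<times> {..<k}. coeff \<pi> \<rho> x p r * coeff \<pi> \<rho> y r q)"
      by (simp add: sum.cartesian_product)
    finally show "coeff \<pi> \<rho> (conv x y) p q = (\<Sum>r\<in>{..<d} \<times> {..<k}. coeff \<pi> \<rho> x p r * coeff \<pi> \<rho> y r q)" .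
  qed
qed

text \<open>Each coefficient is bounded by the reduced norm, through \<rho>, the entries and \<pi>
  in turn. Summing the coefficients loses a factor depending on the dimensions, which
  \<open>mat_hom_contractive\<close> removes. The last clause says that a block does not exceed the
  whole matrix.\<close>

lemma coeff_representation:
  assumes \<pi>: "representation B (mat_alg d) \<pi>" and \<rho>: "star_hom (reduced_group_cstar TYPE('g)) (mat_alg k) \<rho>"
  shows "\<exists>n \<phi>. star_hom (section_alg B) (mat_alg n) \<phi> \<and>
    (\<forall>z\<in>sections. vnorm (mat_alg n) (\<phi> z) \<le> vnorm (section_alg B) z) \<and>
    (\<forall>z\<in>sections. \<forall>i<d. \<forall>j<d.
      vnorm (mat_alg k) (\<rho> (grp.const_class (entry i j (rep_section \<pi> z)))) \<le> vnorm (mat_alg n) (\<phi> z))"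
proof -
  let ?\<rho> = "\<lambda>y. \<rho> (grp.const_class y)" and ?I = "{..<d} \<times> {..<k}"
  have \<rho>': "star_hom (alg_completion group_alg) (mat_alg k) \<rho>" using \<rho> by (simp only: reduced_group_cstar_def)
  have sh: "star_hom group_alg (mat_alg k) ?\<rho>" by (rule grp.star_hom_const_class[OF \<rho>'])
  have I: "finite ?I" by simp
  obtain n \<phi> where \<phi>: "star_hom (section_alg B) (mat_alg n) \<phi>"
    "\<And>z C. 0 \<le> C \<Longrightarrow> op_bound {..<n} (\<lambda>a b. \<phi> z $$ (a, b)) C \<longleftrightarrow> op_bound ?I (coeff \<pi> ?\<rho> z) C"
    using imat_hom_star_hom[OF I coeff_imat_hom[OF \<pi> sh]] by blast
  have Tc: "rep_section \<pi> z \<in> finite_sections (const_bundle (mat_alg d))" if "z \<in> sections" for z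
    using rep_section_star_hom[OF \<pi>] that by (simp add: star_hom_def linear_on_def)
  have Ec: "entry i j (rep_section \<pi> z) \<in> pts group_alg" if "z \<in> sections" "i < d" "j < d" for z i j
    by (rule entry_closed[OF Tc[OF that(1)] that(2,3)])
  have Rc: "?\<rho> y \<in> carrier_mat k k" if "y \<in> pts group_alg" for y
    using sh that unfolding star_hom_def linear_on_def mat_alg_simps by blast
  have \<phi>c: "\<phi> z \<in> carrier_mat n n" if "z \<in> sections" for z
    using \<phi>(1) that by (simp add: star_hom_def linear_on_def)
  have crude: "vnorm (mat_alg n) (\<phi> z) \<le> real (card ?I * card ?I) * vnorm (section_alg B) z" if z: "z \<in> sections" for z
  proof (rule mat_norm_least[OF \<phi>c[OF z]])
    let ?N = "vnorm (section_alg B) z"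
    show C: "0 \<le> real (card ?I * card ?I) * ?N" using section_vnorm(3)[OF z] by simp
    have le: "cmod (coeff \<pi> ?\<rho> z p q) \<le> ?N" if I2: "p \<in> ?I" "q \<in> ?I" for p q
    proof -
      obtain i a j b where pq: "p = (i, a)" "q = (j, b)" "i < d" "a < k" "j < d" "b < k" using I2 by auto
      have "cmod (coeff \<pi> ?\<rho> z p q) \<le> vnorm (mat_alg k) (?\<rho> (entry i j (rep_section \<pi> z)))"
        using mat_entry_le_norm[OF Rc[OF Ec[OF z pq(3,5)]] pq(4,6)] pq by (simp add: coeff_def)
      also have "\<dots> \<le> vnorm group_alg (entry i j (rep_section \<pi> z))"
        by (rule grp.completion_star_hom_contractive[OF \<rho>' Ec[OF z pq(3,5)]])
      also have "\<dots> \<le> vnorm (section_alg (const_bundle (mat_alg d))) (rep_section \<pi> z)"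
        by (rule entry_vnorm_le[OF Tc[OF z] pq(3,5)])
      also have "\<dots> \<le> ?N" by (rule rep_section_contractive[OF \<pi> z])
      finally show ?thesis .
    qed
    have S: "(\<Sum>p\<in>?I. \<Sum>q\<in>?I. cmod (coeff \<pi> ?\<rho> z p q)) \<le> (\<Sum>p\<in>?I. \<Sum>q\<in>?I. ?N)"
      by (intro sum_mono le)
    have "op_bound ?I (coeff \<pi> ?\<rho> z) (real (card ?I * card ?I) * ?N)"
      unfolding op_bound_def
    proof
      fix u
      have "l2 ?I (mv ?I (coeff \<pi> ?\<rho> z) u) \<le> (\<Sum>p\<in>?I. \<Sum>q\<in>?I. cmod (coeff \<pi> ?\<rho> z p q)) * l2 ?I u"
        by (rule op_boundD[OF op_bound_crude[OF I]])
      also have "\<dots> \<le> (\<Sum>p\<in>?I. \<Sum>q\<in>?I. ?N) * l2 ?I u" by (rule mult_right_mono[OF S L2_set_nonneg])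
      finally show "l2 ?I (mv ?I (coeff \<pi> ?\<rho> z) u) \<le> real (card ?I * card ?I) * ?N * l2 ?I u"
        by (simp only: sum_constant of_nat_mult mult.assoc)
    qed
    then show "op_bound {..<n} (\<lambda>a b. \<phi> z $$ (a, b)) (real (card ?I * card ?I) * ?N)" unfolding \<phi>(2)[OF C] .
  qed
  have "vnorm (mat_alg n) (\<phi> z) \<le> vnorm (section_alg B) z" if "z \<in> sections" for z
    using sec.mat_hom_contractive[OF \<phi>(1), of "real (card ?I * card ?I)" z] crude that by (simp only: section_alg_simps)
  moreover have "vnorm (mat_alg k) (?\<rho> (entry i j (rep_section \<pi> z))) \<le> vnorm (mat_alg n) (\<phi> z)"
    if z: "z \<in> sections" and ij: "i < d" "j < d" for z i j
  proof -
    have n0: "0 \<le> vnorm (mat_alg n) (\<phi> z)" by (rule mat_norm_nonneg[OF \<phi>c[OF z]])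
    have "op_bound ?I (coeff \<pi> ?\<rho> z) (vnorm (mat_alg n) (\<phi> z))"
      using mat_norm_bound[OF \<phi>c[OF z]] unfolding \<phi>(2)[OF n0] .
    \<comment> \<open>The block in block row \<open>i\<close> and block column \<open>j\<close> is
      \<rho> of the entry at \<open>(i, j)\<close>.\<close>
    from op_bound_embed[OF I this n0, of "Pair i" "{..<k}" "Pair j"]
    have "op_bound {..<k} (\<lambda>a b. coeff \<pi> ?\<rho> z (i, a) (j, b)) (vnorm (mat_alg n) (\<phi> z))"
      using ij by (simp add: inj_on_def image_subset_iff)
    then show ?thesis by (intro mat_norm_least[OF Rc[OF Ec[OF z ij]] n0]) (simp add: coeff_def)
  qed
  ultimately show ?thesis using \<phi>(1) by blast
qed

section \<open>Norm approximation\<close>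

text \<open>The unit fibre value of the square of a self-adjoint \<open>u\<close> is
  \<open><u, u>\<close>. After \<pi> its norm is the square of \<open>hnorm\<close>, which is at
  least the squared norm of the value of \<open>u\<close> at \<open>0\<close>; a lower bound at one
  dyadic power thus passes to all later ones.\<close>

lemma dyadic_value_growth:
  assumes \<pi>: "representation B (mat_alg d) \<pi>" and h: "h \<in> sections" "sstar h = h"
    and L: "0 \<le> L" "L ^ (2 ^ K) \<le> vnorm (mat_alg d) (\<pi> 0 (sec.dyadic h K 0))"
  shows "L ^ (2 ^ (K + j)) \<le> vnorm (mat_alg d) (\<pi> 0 (sec.dyadic h (K + j) 0))"
proof (induction j)
  case (Suc j)
  let ?u = "sec.dyadic h (K + j)" and ?\<Theta> = "rep_section \<pi>"
  have u: "?u \<in> sections" "sstar ?u = ?u"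
    using sec.dyadic_closed[of h "K + j"] sec.dyadic_star[of h "K + j"] h by (simp_all add: section_ops)
  have T: "?\<Theta> ?u \<in> finite_sections (const_bundle (mat_alg d))" "?\<Theta> (sstar ?u) = mb.sstar d (?\<Theta> ?u)"
    "?\<Theta> (conv ?u ?u) = mb.conv d (?\<Theta> ?u) (?\<Theta> ?u)"
    using rep_section_star_hom[OF \<pi>] u(1) by (simp_all add: star_hom_def linear_on_def section_ops mb.section_ops)
  have "sec.dyadic h (K + Suc j) = conv ?u ?u"
    using sec.dyadic_Suc[of h "K + j"] h by (simp add: section_ops)
  then have "\<pi> 0 (sec.dyadic h (K + Suc j) 0) = snd (?\<Theta> (conv ?u ?u) 0)" by (simp only: rep_section_def snd_conv)
  also have "\<dots> = snd (mb.inner d (?\<Theta> ?u) (?\<Theta> ?u))"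
    unfolding mb.inner_def T(3) T(2)[unfolded u(2), symmetric] ..
  finally have eq: "vnorm (mat_alg d) (\<pi> 0 (sec.dyadic h (K + Suc j) 0)) = (mb.hnorm d (?\<Theta> ?u))\<^sup>2"
    using mb.hnorm_square[OF T(1)] by simp
  have "(L ^ (2 ^ (K + j)))\<^sup>2 \<le> (vnorm (mat_alg d) (\<pi> 0 (?u 0)))\<^sup>2"
    using Suc L(1) by (intro power_mono) simp_all
  also have "vnorm (mat_alg d) (\<pi> 0 (?u 0)) \<le> mb.hnorm d (?\<Theta> ?u)"
    using mb.norm_value_le_hnorm[OF T(1), of 0] by (simp add: rep_section_def)
  then have "(vnorm (mat_alg d) (\<pi> 0 (?u 0)))\<^sup>2 \<le> (mb.hnorm d (?\<Theta> ?u))\<^sup>2"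
    using order_trans[OF zero_le_power[OF L(1)] Suc] by (intro power_mono)
  finally show ?case unfolding eq by (simp add: power_even_eq)
qed (use L in simp)

text \<open>The order of choices is decisive: the power \<open>K\<close> comes first, \<pi> and its
  dimension \<open>d\<close> depend on it, the larger power \<open>m\<close> depends on
  \<open>d\<close>, and \<rho> depends on the entries of that power. At the power \<open>m\<close>
  the loss of \<open>2 d^2\<close> is outweighed by the gap between \<open>L'\<close> and
  \<open>L\<close>.\<close>

lemma section_norm_approximation:
  assumes rB: "rfd_bundle B" and rG: "rfd (reduced_group_cstar TYPE('g))"
    and x: "x \<in> sections" and e: "0 < e" "e < vnorm (section_alg B) x"
  shows "\<exists>n \<phi>. star_hom (section_alg B) (mat_alg n) \<phi> \<and>
    (\<forall>z\<in>sections. vnorm (mat_alg n) (\<phi> z) \<le> vnorm (section_alg B) z) \<and>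
    vnorm (section_alg B) x - e \<le> vnorm (mat_alg n) (\<phi> x)"
proof -
  define N where "N = vnorm (section_alg B) x"
  \<comment> \<open>Two levels below the norm \<open>N^2\<close> of \<open>x^* x\<close>:
    \<open>L\<close> is the growth rate that can be detected, and \<open>L'\<close> the one to be
    reached, large enough that its square root is at least \<open>N - e\<close>.\<close>
  define L where "L = N\<^sup>2 - e\<^sup>2 / 2"
  define L' where "L' = N\<^sup>2 - e\<^sup>2"
  have "e\<^sup>2 < N\<^sup>2" using e by (intro power_strict_mono) (simp_all add: N_def)
  moreover have "0 < e\<^sup>2" using e by simp
  ultimately have LL: "0 < L'" "L' < L" "L < N\<^sup>2" by (simp_all add: L_def L'_def)
  then have L0: "0 < L" by linarith
  define h where "h = conv (sstar x) x"
  have h: "h \<in> sections" "sstar h = h" using x by (simp_all add: h_def sstar_conv)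
  have nh: "vnorm (section_alg B) h = N\<^sup>2" using sec.vnorm_cstar[of x] x by (simp add: h_def N_def section_ops)
  have dc: "sec.dyadic h k \<in> sections" "sstar (sec.dyadic h k) = sec.dyadic h k"
    "sec.dyadic h (Suc k) = conv (sec.dyadic h k) (sec.dyadic h k)" for k
    using sec.dyadic_closed[of h k] sec.dyadic_star[of h k] sec.dyadic_Suc[of h k] h by (simp_all add: section_ops)
  have "\<not> (\<forall>k. hnorm (sec.dyadic h k) \<le> 1 * L ^ (2 ^ k))"
  proof
    assume "\<forall>k. hnorm (sec.dyadic h k) \<le> 1 * L ^ (2 ^ k)"
    then have "vnorm (section_alg B) h \<le> L" using L0 by (intro vnorm_le_growth[OF h, of 1]) simp_all
    then show False using nh LL by simp
  qed
  \<comment> \<open>Otherwise the growth rate of the powers would bound the norm of \<open>h\<close>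
    by \<open>L\<close>, which is below \<open>N^2\<close>.\<close>
  then obtain k0 where k0: "L ^ (2 ^ k0) < hnorm (sec.dyadic h k0)" by (auto simp: not_le)
  \<comment> \<open>One more squaring turns \<open>hnorm\<close> of a power into the norm of a unit
    fibre value, which is what \<pi> can be tested on.\<close>
  define K where "K = Suc k0"
  let ?v = "sec.dyadic h K 0"
  have v: "?v \<in> pts (fib B 0)" by (rule section_value[OF dc(1)])
  have "?v = inner (sec.dyadic h k0) (sec.dyadic h k0)" unfolding K_def dc(3) inner_def dc(2) ..
  then have nv: "nm 0 ?v = (hnorm (sec.dyadic h k0))\<^sup>2" by (simp only: hnorm_square[OF dc(1)])
  have "(L ^ (2 ^ k0))\<^sup>2 < (hnorm (sec.dyadic h k0))\<^sup>2" using k0 L0 by (intro power_strict_mono) simp_all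
  moreover have "L ^ (2 ^ K) = (L ^ (2 ^ k0))\<^sup>2" by (simp add: K_def power_even_eq)
  ultimately have gt: "L ^ (2 ^ K) < nm 0 ?v" by (simp only: nv)
  have "finite {?v} \<and> {?v} \<subseteq> total B" using totalI[OF v] by simp
  moreover have "0 < nm 0 ?v - L ^ (2 ^ K)" using gt by simp
  ultimately obtain d \<pi> where \<pi>: "representation B (mat_alg d) \<pi>"
    "\<forall>t. \<forall>b\<in>{?v} \<inter> pts (fib B t). nm t b - (nm 0 ?v - L ^ (2 ^ K)) \<le> vnorm (mat_alg d) (\<pi> t b)"
    using rB unfolding rfd_bundle_def by meson
  have "nm 0 ?v - (nm 0 ?v - L ^ (2 ^ K)) \<le> vnorm (mat_alg d) (\<pi> 0 ?v)" using \<pi>(2) v by blast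
  then have start: "L ^ (2 ^ K) \<le> vnorm (mat_alg d) (\<pi> 0 ?v)" by simp
  have "1 < L / L'" using LL by simp
  \<comment> \<open>The factor 2 makes room for half of \<open>L ^ m\<close>, which is given up to
    the error \<delta>.\<close>
  then obtain j where j: "2 * real (d * d) < (L / L') ^ j" using real_arch_pow by blast
  define m where "m = (2 :: nat) ^ (K + j)"
  define u where "u = sec.dyadic h (K + j)"
  have "(2 :: nat) ^ j \<le> 2 ^ (K + j)" by (rule power_increasing) simp_all
  \<comment> \<open>The exponent \<open>m\<close> has to be a power of two not below
    \<open>2^K\<close>, so \<open>j\<close> is reached only with room to spare.\<close>
  then have "j \<le> m" unfolding m_def using less_exp[of j] by linarith
  then have "(L / L') ^ j \<le> (L / L') ^ m" by (rule power_increasing) (use \<open>1 < L / L'\<close> in linarith)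
  then have big: "2 * real (d * d) * L' ^ m < L ^ m"
    using j LL by (simp add: power_divide pos_less_divide_eq[symmetric])
  have u: "u \<in> sections" unfolding u_def by (rule dc(1))
  have Tu: "rep_section \<pi> u \<in> finite_sections (const_bundle (mat_alg d))"
    using rep_section_star_hom[OF \<pi>(1)] u by (simp add: star_hom_def linear_on_def)
  define y where "y i l = entry i l (rep_section \<pi> u)" for i l
  have yc: "y i l \<in> pts group_alg" if "i < d" "l < d" for i l
    unfolding y_def by (rule entry_closed[OF Tu that])
  define q where "q = real (d * d)"
  have q: "0 \<le> q" by (simp add: q_def)
  \<comment> \<open>Chosen so that the \<open>d^2\<close> errors of the entries add up to at most
    \<open>L ^ m / 2\<close>; the summand 1 avoids a zero divisor when \<open>d = 0\<close>.\<close>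
  define \<delta> where "\<delta> = L ^ m / (2 * (q + 1))"
  have \<delta>: "0 < \<delta>" "real (d * d) * \<delta> \<le> L ^ m / 2"
  proof -
    show "0 < \<delta>" unfolding \<delta>_def by (rule divide_pos_pos[OF zero_less_power[OF L0]]) (use q in simp)
    have "q / (q + 1) \<le> 1" using q by (simp add: divide_le_eq_1)
    have "real (d * d) * \<delta> = q / (q + 1) * (L ^ m / 2)" using q by (simp add: \<delta>_def q_def)
    also have "\<dots> \<le> 1 * (L ^ m / 2)"
      by (rule mult_right_mono[OF \<open>q / (q + 1) \<le> 1\<close>]) (use zero_less_power[OF L0, of m] in simp)
    finally show "real (d * d) * \<delta> \<le> L ^ m / 2" by (simp only: mult_1)
  qed
  let ?\<Omega> = "(\<lambda>(i, l). grp.const_class (y i l)) ` ({..<d} \<times> {..<d})"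
  have "?\<Omega> \<subseteq> pts (reduced_group_cstar TYPE('g))"
    using yc by (auto simp: reduced_group_cstar_def simp del: group_alg_simps)
  then have "finite ?\<Omega> \<and> ?\<Omega> \<subseteq> pts (reduced_group_cstar TYPE('g))" by simp
  then obtain k \<rho> where \<rho>: "star_hom (reduced_group_cstar TYPE('g)) (mat_alg k) \<rho>"
    "\<forall>a\<in>?\<Omega>. vnorm (reduced_group_cstar TYPE('g)) a - \<delta> \<le> vnorm (mat_alg k) (\<rho> a)"
    using rG \<delta>(1) unfolding rfd_def by meson
  have \<rho>y: "vnorm group_alg (y i l) \<le> vnorm (mat_alg k) (\<rho> (grp.const_class (y i l))) + \<delta>" if "i < d" "l < d" for i l
  proof -
    have "grp.const_class (y i l) \<in> ?\<Omega>" using that by (intro image_eqI[of _ _ "(i, l)"]) simp_all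
    from bspec[OF \<rho>(2) this] show ?thesis
      unfolding reduced_group_cstar_def grp.alg_completion_simps grp.completion_norm_const[OF yc[OF that]] by linarith
  qed
  from coeff_representation[OF \<pi>(1) \<rho>(1)] obtain n \<phi> where \<phi>: "star_hom (section_alg B) (mat_alg n) \<phi>"
    "\<forall>z\<in>sections. vnorm (mat_alg n) (\<phi> z) \<le> vnorm (section_alg B) z"
    "\<forall>z\<in>sections. \<forall>i<d. \<forall>j<d.
      vnorm (mat_alg k) (\<rho> (grp.const_class (entry i j (rep_section \<pi> z)))) \<le> vnorm (mat_alg n) (\<phi> z)" by blast
  let ?n = "vnorm (mat_alg n)"
  have \<phi>c: "\<phi> z \<in> carrier_mat n n" if "z \<in> sections" for z
    using \<phi>(1) that by (simp add: star_hom_def linear_on_def)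
  \<comment> \<open>A matrix entry of the unit fibre value is a value at \<open>0\<close> of a group
    algebra element, hence bounded by its norm, which \<rho> almost attains.\<close>
  have entry_le: "cmod (\<pi> 0 (u 0) $$ (i, l)) \<le> ?n (\<phi> u) + \<delta>" if "i < d" "l < d" for i l
  proof -
    have "cmod (\<pi> 0 (u 0) $$ (i, l)) = cmod (y i l 0)" by (simp add: y_def entry_def rep_section_def)
    also have "\<dots> \<le> vnorm group_alg (y i l)" by (rule group_value_le_norm[OF yc[OF that]])
    also have "\<dots> \<le> vnorm (mat_alg k) (\<rho> (grp.const_class (y i l))) + \<delta>" by (rule \<rho>y[OF that])
    also have "vnorm (mat_alg k) (\<rho> (grp.const_class (y i l))) \<le> ?n (\<phi> u)"
      unfolding y_def using \<phi>(3) u that by blast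
    finally show ?thesis by simp
  qed
  have "L ^ m \<le> vnorm (mat_alg d) (\<pi> 0 (u 0))"
    unfolding m_def u_def by (rule dyadic_value_growth[OF \<pi>(1) h less_imp_le[OF L0] start])
  also have "\<dots> \<le> (\<Sum>i<d. \<Sum>l<d. cmod (\<pi> 0 (u 0) $$ (i, l)))"
    using mat_section_value(2)[OF Tu, of 0] by (intro mat_norm_le_entries) (simp add: rep_section_def)
  also have "\<dots> \<le> (\<Sum>i<d. \<Sum>l<d. ?n (\<phi> u) + \<delta>)" by (intro sum_mono entry_le) simp_all
  also have "\<dots> = real (d * d) * ?n (\<phi> u) + real (d * d) * \<delta>" by (simp add: algebra_simps)
  finally have "L ^ m \<le> 2 * real (d * d) * ?n (\<phi> u)" using \<delta>(2) by linarith
  moreover have "?n (\<phi> u) = ?n (\<phi> h) ^ m"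
    unfolding u_def m_def using sec.mat_hom_dyadic_norm[OF \<phi>(1), of h "K + j"] h by (simp add: section_ops)
  ultimately have lower: "L ^ m \<le> 2 * real (d * d) * ?n (\<phi> h) ^ m" by simp
  have "L' \<le> ?n (\<phi> h)"
  proof (rule ccontr)
    assume "\<not> L' \<le> ?n (\<phi> h)"
    then have "?n (\<phi> h) ^ m \<le> L' ^ m" using mat_norm_nonneg[OF \<phi>c[OF h(1)]] by (intro power_mono) simp_all
    then have "2 * real (d * d) * ?n (\<phi> h) ^ m \<le> 2 * real (d * d) * L' ^ m" by (intro mult_left_mono) simp_all
    then show False using lower big by linarith
  qed
  moreover have "?n (\<phi> h) = (?n (\<phi> x))\<^sup>2"
    using \<phi>(1) x mat_norm_cstar[OF \<phi>c[OF x]] by (simp add: star_hom_def h_def section_ops)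
  \<comment> \<open>This amounts to \<open>e \<le> N\<close>.\<close>
  moreover have "(N - e)\<^sup>2 \<le> L'"
  proof -
    have "e * e \<le> N * e" using e by (intro mult_right_mono) (simp_all add: N_def)
    then show ?thesis by (simp add: L'_def power2_eq_square algebra_simps)
  qed
  ultimately have "(N - e)\<^sup>2 \<le> (?n (\<phi> x))\<^sup>2" by linarith
  then have "N - e \<le> ?n (\<phi> x)" by (rule power2_le_imp_le) (rule mat_norm_nonneg[OF \<phi>c[OF x]])
  then show ?thesis using \<phi>(1,2) unfolding N_def by blast
qed

theorem rfd_reduced_of_rfd_bundle:
  assumes "rfd_bundle B" "rfd (reduced_group_cstar TYPE('g))"
  shows "rfd (reduced_cstar B)"
  unfolding reduced_cstar_def
proof (rule sec.rfd_completion, unfold section_alg_simps)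
  fix x and e :: real assume x: "x \<in> sections" and e: "0 < e"
  show "\<exists>d \<phi>. star_hom (section_alg B) (mat_alg d) \<phi> \<and>
      (\<forall>z\<in>sections. vnorm (mat_alg d) (\<phi> z) \<le> vnorm (section_alg B) z) \<and>
      vnorm (section_alg B) x - e \<le> vnorm (mat_alg d) (\<phi> x)"
  proof (cases "e < vnorm (section_alg B) x")
    case True
    show ?thesis by (rule section_norm_approximation[OF assms x e True])
  next
    case False
    have eq: "M = M'" if "M \<in> carrier_mat 0 0" "M' \<in> carrier_mat 0 0" for M M' :: "complex mat"
      using that by (intro eq_matI) auto
    \<comment> \<open>When \<open>e\<close> is at least the norm, nothing has to be attained and the
      representation on the zero space serves.\<close>
    have "star_hom (section_alg B) (mat_alg 0) (\<lambda>z. 0\<^sub>m 0 0)"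
      unfolding star_hom_def linear_on_def mat_alg_simps
      by (intro conjI ballI allI eq) (simp_all add: mat_adjoint_square)
    moreover have "vnorm (mat_alg 0) (0\<^sub>m 0 0) = 0" using mat_norm_zero_iff[of "0\<^sub>m 0 0" 0] by simp
    ultimately show ?thesis using False section_vnorm(3)
      by (intro exI[of _ 0] exI[of _ "\<lambda>z. 0\<^sub>m 0 0"]) simp
  qed
qed

end

theorem proposition4p2:
  fixes B :: "('g::group_add, 'b) bundle_data"
  assumes "fell_bundle B"
  shows "(rfd (reduced_cstar B) \<longrightarrow> rfd_bundle B) \<and>
    (separable_bundle B \<longrightarrow>
      (rfd_bundle B \<and> rfd (reduced_group_cstar TYPE('g)) \<longrightarrow> rfd (reduced_cstar B)))"
proof -
  interpret fell B by (rule fell.intro[OF assms])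
  show ?thesis using rfd_bundle_of_rfd_reduced rfd_reduced_of_rfd_bundle by blast
qed

end
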